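(* Using the definition that accumulates $\mathcal{D}(nat)$, $\mathcal{D}_{list}(atm)$, $\mathcal{D}(intuit)$, $\mathcal{D}(\mathrm{PCF})$ and the clause $X\equiv X\triangleq\top$ (for $\equiv\,: i\to i\to o$), the following formulas are derivable in $FO\lambda^{\Delta\mathbb{N}}$ ($\supset$ associating to the right): Determinacy: $\forall m\forall m_1\forall m_2(\vdash\langle m\Downarrow m_1\rangle\supset\ \vdash\langle m\Downarrow m_2\rangle\supset m_1\equiv m_2)$; $\forall m\forall m_1\forall m_2(\vdash\langle m\leadsto m_1\rangle\supset\ \vdash\langle m\leadsto m_2\rangle\supset m_1\equiv m_2)$; $\forall m\forall v_1\forall v_2(\vdash\langle value\,v_1\rangle\supset\ \vdash\langle m\leadsto^* v_1\rangle\supset\ \vdash\langle value\,v_2\rangle\supset\ \vdash\langle m\leadsto^* v_2\rangle\supset v_1\equiv v_2)$. Equivalence: $\forall m\forall v(\vdash\langle m\Downarrow v\rangle\supset(\vdash\langle value\,v\rangle\land\ \vdash\langle m\leadsto^* v\rangle))$; $\forall m\forall v((\vdash\langle value\,v\rangle\land\ \vdash\langle m\leadsto^* v\rangle)\supset\ \vdash\langle m\Downarrow v\rangle)$. Subject reduction: for each $R\in\{\Downarrow,\leadsto,\leadsto^*\}$, $\forall m\forall n(\vdash\langle m\,R\,n\rangle\supset\forall t(\vdash\langle typeof\,m\,t\rangle\supset\ \vdash\langle typeof\,n\,t\rangle))$. Unicity of typing: $\forall m\forall t_1\forall t_2(\vdash\langle typeof\,m\,t_1\rangle\supset\ \vdash\langle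 typeof\,m\,t_2\rangle\supset t_1\equiv t_2)$.
   Context: $FO\lambda^{\Delta\mathbb{N}}$ is the following intuitionistic sequent calculus. Terms are simply typed $\lambda$-terms (up to $\alpha\beta\eta$-conversion) over a signature of typed constants; $o$ is the type of formulas, and quantifiers range only over types not containing $o$. Formulas are built from atomic formulas with $\bot,\top,\land,\lor,\supset,\forall,\exists$. There is a type $nt$ with constants $z:nt$, $s:nt\to nt$ and a predicate $nat: nt\to o$. Sequents are $\Gamma\longrightarrow B$, $\Gamma$ a finite multiset. Rules: $\bot,\Gamma\longrightarrow B$ and $\Gamma\longrightarrow\top$ are axioms; the usual intuitionistic left and right rules for $\land,\lor,\supset,\forall,\exists$ (with the usual eigenvariable conditions); initial sequents $A,\Gamma\longrightarrow A$ for atomic $A$; left contraction; cut. For $nat$: $\Gamma\longrightarrow nat\,z$; from $\Gamma\longrightarrow nat\,I$ infer $\Gamma\longrightarrow nat\,(s\,I)$; induction: for $B:nt\to o$ and eigenvariable $j$ not free in $B$, from $\longrightarrow B\,z$, $B\,j\longrightarrow B\,(s\,j)$, $B\,I,\Gamma\longrightarrow C$ infer $nat\,I,\Gamma\longrightarrow C$. Relative to a definition (set of clauses $\forall\bar x[p\,\bar t\triangleq B]$, free variables of $B$ occurring in $\bar t$, satisfying a level condition): right rule: from $\Gamma\longrightarrow B\theta$ infer $\Gamma\longrightarrow p\,\bar u$ when $p\,\bar u=(p\,\bar t)\theta$; left rule: infer $p\,\bar u,\Gamma\longrightarrow C$ from the premises $B\theta,\Gamma\theta\longrightarrow C\theta$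 for every clause (renamed apart) and every $\theta$ in a complete set of unifiers of $p\,\bar u$ and $p\,\bar t$. A formula is derivable using a definition if $\longrightarrow F$ has a derivation. $\mathcal{D}(nat)$: predicates $=,<,\le: nt\to nt\to o$, $sum: nt\to nt\to nt\to o$; clauses $I=I\triangleq\top$; $sum\,z\,J\,J\triangleq nat\,J$; $sum\,(s\,I)\,J\,(s\,K)\triangleq sum\,I\,J\,K$; $z<(s\,J)\triangleq nat\,J$; $(s\,I)<(s\,J)\triangleq I<J$; $I\le I\triangleq\top$; $I\le J\triangleq I<J$. Object logic: types $i$, $atm$, $prp$, constants $\langle\cdot\rangle: atm\to prp$, $tt: prp$, $\&: prp\to prp\to prp$ (right-associative), $\Rightarrow: atm\to prp\to prp$, $\bigwedge: (i\to prp)\to prp$. $atmlst$ is the list type over $atm$ with $nil$ and infix $::$. $\mathcal{D}_{list}(atm)$ has clauses $length\,nil\,z\triangleq\top$; $length\,(X::L)\,(s\,I)\triangleq length\,L\,I$; $list\,L\triangleq\exists i(nat\,i\land length\,L\,i)$; $element\,X\,(X::L)\triangleq\top$; $element\,X\,(Y::L)\triangleq element\,X\,L$; $split\,nil\,nil\,nil\triangleq\top$; $split\,(X::L_1)\,(X::L_2)\,L_3\triangleq split\,L_1\,L_2\,L_3$; $split\,(X::L_1)\,L_2\,(X::L_3)\triangleq split\,L_1\,L_2\,L_3$; $permute\,nil\,nil\triangleq\top$; $permute\,(X::L_1)\,L_2\triangleq\exists l_{22}(split\,L_2\,(X::nil)\,l_{22}\land permute\,L_1\,l_{22})$. With $prog: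 atm\to prp\to o$ and $seq: nt\to atmlst\to prp\to o$ (first argument as subscript), $\mathcal{D}(intuit)$ is: $seq_I\,(A'::L)\,\langle A\rangle\triangleq element\,A\,(A'::L)$; $seq_I\,L\,tt\triangleq\top$; $seq_{(s I)}\,L\,(B\,\&\,C)\triangleq seq_I\,L\,B\land seq_I\,L\,C$; $seq_{(s I)}\,L\,(A\Rightarrow B)\triangleq seq_I\,(A::L)\,B$; $seq_{(s I)}\,L\,(\bigwedge B)\triangleq\forall x\,seq_I\,L\,(B\,x)$; $seq_{(s I)}\,L\,\langle A\rangle\triangleq\exists b(prog\,A\,b\land seq_I\,L\,b)$. $\vdash B$ abbreviates $\exists i(nat\,i\land seq_i\,nil\,B)$. PCF: constants (all over type $i$) $num,bool: i$, $arr: i\to i\to i$ (types); $zero,true,false: i$, $succ,pred,is\_zero: i\to i$, $if: i\to i\to i\to i$, $abs: i\to(i\to i)\to i$, $app: i\to i\to i$, $rec: i\to(i\to i)\to i$; object predicates $typeof: i\to i\to atm$, infix $\Downarrow,\leadsto,\leadsto^*: i\to i\to atm$, $value: i\to atm$. $\mathcal{D}(\mathrm{PCF})$ consists of clauses $prog\,A\,G\triangleq\top$ (all variables universally quantified), written here as $A\leftarrow G$: Typing: $typeof\,zero\,num\leftarrow tt$; $typeof\,true\,bool\leftarrow tt$; $typeof\,false\,bool\leftarrow tt$; $typeof\,(succ\,M)\,num\leftarrow\langle typeof\,M\,num\rangle$; $typeof\,(pred\,M)\,num\leftarrow\langle typeof\,M\,num\rangle$; $typeof\,(is\_zero\,M)\,bool\leftarrow\langle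 typeof\,M\,num\rangle$; $typeof\,(if\,M\,N_1\,N_2)\,T\leftarrow\langle typeof\,M\,bool\rangle\,\&\,\langle typeof\,N_1\,T\rangle\,\&\,\langle typeof\,N_2\,T\rangle$; $typeof\,(abs\,T\,R)\,(arr\,T\,U)\leftarrow\bigwedge n(typeof\,n\,T\Rightarrow\langle typeof\,(R\,n)\,U\rangle)$; $typeof\,(app\,M\,N)\,T\leftarrow\langle typeof\,M\,(arr\,U\,T)\rangle\,\&\,\langle typeof\,N\,U\rangle$; $typeof\,(rec\,T\,R)\,T\leftarrow\bigwedge n(typeof\,n\,T\Rightarrow\langle typeof\,(R\,n)\,T\rangle)$. Natural semantics: $zero\Downarrow zero\leftarrow tt$; $true\Downarrow true\leftarrow tt$; $false\Downarrow false\leftarrow tt$; $(succ\,M)\Downarrow(succ\,V)\leftarrow\langle M\Downarrow V\rangle$; $(pred\,M)\Downarrow zero\leftarrow\langle M\Downarrow zero\rangle$; $(pred\,M)\Downarrow V\leftarrow\langle M\Downarrow(succ\,V)\rangle$; $(is\_zero\,M)\Downarrow true\leftarrow\langle M\Downarrow zero\rangle$; $(is\_zero\,M)\Downarrow false\leftarrow\langle M\Downarrow(succ\,V)\rangle$; $(if\,M\,N_1\,N_2)\Downarrow V\leftarrow\langle M\Downarrow true\rangle\,\&\,\langle N_1\Downarrow V\rangle$; $(if\,M\,N_1\,N_2)\Downarrow V\leftarrow\langle M\Downarrow false\rangle\,\&\,\langle N_2\Downarrow V\rangle$; $(abs\,T\,R)\Downarrow(abs\,T\,R)\leftarrow tt$;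 $(app\,M\,N)\Downarrow V\leftarrow\langle M\Downarrow(abs\,T\,R)\rangle\,\&\,\langle(R\,N)\Downarrow V\rangle$; $(rec\,T\,R)\Downarrow V\leftarrow\langle(R\,(rec\,T\,R))\Downarrow V\rangle$. Transition semantics: $(succ\,M)\leadsto(succ\,M')\leftarrow\langle M\leadsto M'\rangle$; $(pred\,zero)\leadsto zero\leftarrow tt$; $(pred\,(succ\,V))\leadsto V\leftarrow\langle value\,V\rangle$; $(pred\,M)\leadsto(pred\,M')\leftarrow\langle M\leadsto M'\rangle$; $(is\_zero\,zero)\leadsto true\leftarrow tt$; $(is\_zero\,(succ\,V))\leadsto false\leftarrow\langle value\,V\rangle$; $(is\_zero\,M)\leadsto(is\_zero\,M')\leftarrow\langle M\leadsto M'\rangle$; $(if\,true\,M\,N)\leadsto M\leftarrow tt$; $(if\,false\,M\,N)\leadsto N\leftarrow tt$; $(if\,M\,N_1\,N_2)\leadsto(if\,M'\,N_1\,N_2)\leftarrow\langle M\leadsto M'\rangle$; $(app\,(abs\,T\,R)\,N)\leadsto(R\,N)\leftarrow tt$; $(app\,M\,N)\leadsto(app\,M'\,N)\leftarrow\langle M\leadsto M'\rangle$; $(rec\,T\,R)\leadsto(R\,(rec\,T\,R))\leftarrow tt$; $M\leadsto^* M\leftarrow tt$; $M\leadsto^* N\leftarrow\langle M\leadsto M'\rangle\,\&\,\langle M'\leadsto^* N\rangle$; $value\,zero\leftarrow tt$; $value\,true\leftarrow tt$; $value\,false\leftarrow tt$; $value\,(succ\,V)\leftarrow\langle value\,V\rangle$;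 $value\,(abs\,T\,R)\leftarrow tt$. *)

theory Defs
  imports Main "HOL-Library.Multiset"
begin

section \<open>Simply typed terms\<close>

datatype ty = Ti | Tatm | Tprp | Tnt | Tatmlst | To | Fn ty ty (infixr "\<rightarrow>" 60)

primrec ofree :: "ty \<Rightarrow> bool" where
  "ofree Ti = True"
| "ofree Tatm = True"
| "ofree Tprp = True"
| "ofree Tnt = True"
| "ofree Tatmlst = True"
| "ofree To = False"
| "ofree (\<sigma> \<rightarrow> \<tau>) = (ofree \<sigma> \<and> ofree \<tau>)"

datatype pred =
    P_nat
  | P_eq | P_sum | P_less | P_le
  | P_length | P_list | P_element | P_split | P_permute
  | P_prog | P_seq
  | P_equiv

datatype con =
    C_Bot | C_Top | C_And | C_Or | C_Imp | C_All ty | C_Ex ty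
  | Pred pred
  | C_z | C_s
  | C_nil | C_cons
  | C_obj | C_tt | C_amp | C_arrow | C_bigand
  | C_typeof | C_eval | C_step | C_steps | C_value
  | C_num | C_bool | C_arr
  | C_zero | C_true | C_false | C_succ | C_pred | C_is_zero | C_if | C_abs | C_app | C_rec

primrec pty :: "pred \<Rightarrow> ty" where
  "pty P_nat = (Tnt \<rightarrow> To)"
| "pty P_eq = (Tnt \<rightarrow> Tnt \<rightarrow> To)"
| "pty P_sum = (Tnt \<rightarrow> Tnt \<rightarrow> Tnt \<rightarrow> To)"
| "pty P_less = (Tnt \<rightarrow> Tnt \<rightarrow> To)"
| "pty P_le = (Tnt \<rightarrow> Tnt \<rightarrow> To)"
| "pty P_length = (Tatmlst \<rightarrow> Tnt \<rightarrow> To)"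
| "pty P_list = (Tatmlst \<rightarrow> To)"
| "pty P_element = (Tatm \<rightarrow> Tatmlst \<rightarrow> To)"
| "pty P_split = (Tatmlst \<rightarrow> Tatmlst \<rightarrow> Tatmlst \<rightarrow> To)"
| "pty P_permute = (Tatmlst \<rightarrow> Tatmlst \<rightarrow> To)"
| "pty P_prog = (Tatm \<rightarrow> Tprp \<rightarrow> To)"
| "pty P_seq = (Tnt \<rightarrow> Tatmlst \<rightarrow> Tprp \<rightarrow> To)"
| "pty P_equiv = (Ti \<rightarrow> Ti \<rightarrow> To)"

primrec cty :: "con \<Rightarrow> ty" where
  "cty C_Bot = To"
| "cty C_Top = To"
| "cty C_And = (To \<rightarrow> To \<rightarrow> To)"
| "cty C_Or = (To \<rightarrow> To \<rightarrow> To)"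
| "cty C_Imp = (To \<rightarrow> To \<rightarrow> To)"
| "cty (C_All \<tau>) = ((\<tau> \<rightarrow> To) \<rightarrow> To)"
| "cty (C_Ex \<tau>) = ((\<tau> \<rightarrow> To) \<rightarrow> To)"
| "cty (Pred p) = pty p"
| "cty C_z = Tnt"
| "cty C_s = (Tnt \<rightarrow> Tnt)"
| "cty C_nil = Tatmlst"
| "cty C_cons = (Tatm \<rightarrow> Tatmlst \<rightarrow> Tatmlst)"
| "cty C_obj = (Tatm \<rightarrow> Tprp)"
| "cty C_tt = Tprp"
| "cty C_amp = (Tprp \<rightarrow> Tprp \<rightarrow> Tprp)"
| "cty C_arrow = (Tatm \<rightarrow> Tprp \<rightarrow> Tprp)"
| "cty C_bigand = ((Ti \<rightarrow> Tprp) \<rightarrow> Tprp)"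
| "cty C_typeof = (Ti \<rightarrow> Ti \<rightarrow> Tatm)"
| "cty C_eval = (Ti \<rightarrow> Ti \<rightarrow> Tatm)"
| "cty C_step = (Ti \<rightarrow> Ti \<rightarrow> Tatm)"
| "cty C_steps = (Ti \<rightarrow> Ti \<rightarrow> Tatm)"
| "cty C_value = (Ti \<rightarrow> Tatm)"
| "cty C_num = Ti"
| "cty C_bool = Ti"
| "cty C_arr = (Ti \<rightarrow> Ti \<rightarrow> Ti)"
| "cty C_zero = Ti"
| "cty C_true = Ti"
| "cty C_false = Ti"
| "cty C_succ = (Ti \<rightarrow> Ti)"
| "cty C_pred = (Ti \<rightarrow> Ti)"
| "cty C_is_zero = (Ti \<rightarrow> Ti)"
| "cty C_if = (Ti \<rightarrow> Ti \<rightarrow> Ti \<rightarrow> Ti)"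
| "cty C_abs = (Ti \<rightarrow> (Ti \<rightarrow> Ti) \<rightarrow> Ti)"
| "cty C_app = (Ti \<rightarrow> Ti \<rightarrow> Ti)"
| "cty C_rec = (Ti \<rightarrow> (Ti \<rightarrow> Ti) \<rightarrow> Ti)"

primrec con_ok :: "con \<Rightarrow> bool" where
  "con_ok C_Bot = True" | "con_ok C_Top = True" | "con_ok C_And = True"
| "con_ok C_Or = True" | "con_ok C_Imp = True"
| "con_ok (C_All \<tau>) = ofree \<tau>" | "con_ok (C_Ex \<tau>) = ofree \<tau>"
| "con_ok (Pred p) = True"
| "con_ok C_z = True" | "con_ok C_s = True" | "con_ok C_nil = True" | "con_ok C_cons = True"
| "con_ok C_obj = True" | "con_ok C_tt = True" | "con_ok C_amp = True"
| "con_ok C_arrow = True" | "con_ok C_bigand = True"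
| "con_ok C_typeof = True" | "con_ok C_eval = True" | "con_ok C_step = True"
| "con_ok C_steps = True" | "con_ok C_value = True"
| "con_ok C_num = True" | "con_ok C_bool = True" | "con_ok C_arr = True"
| "con_ok C_zero = True" | "con_ok C_true = True" | "con_ok C_false = True"
| "con_ok C_succ = True" | "con_ok C_pred = True" | "con_ok C_is_zero = True"
| "con_ok C_if = True" | "con_ok C_abs = True" | "con_ok C_app = True" | "con_ok C_rec = True"

text \<open>Terms are locally nameless, so that alpha-conversion is syntactic equality: a free variable
  is a name together with its type (a name at two types gives two different variables), a bound
  variable is a de Bruijn index.\<close>

datatype tm =
    Con con
  | Var string ty
  | Bnd nat
  | App tm tm (infixl "\<cdot>" 90)
  | Lam ty tm

text \<open>The list types the bound variables. Free variables stand for eigenvariables and for the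
  universally quantified variables of clauses, so they only have types over which the logic
  quantifies.\<close>

fun type_of :: "ty list \<Rightarrow> tm \<Rightarrow> ty option" where
  "type_of \<Delta> (Con c) = (if con_ok c then Some (cty c) else None)"
| "type_of \<Delta> (Var x \<tau>) = (if ofree \<tau> then Some \<tau> else None)"
| "type_of \<Delta> (Bnd n) = (if n < length \<Delta> then Some (\<Delta> ! n) else None)"
| "type_of \<Delta> (t \<cdot> u) =
     (case type_of \<Delta> t of
        Some (\<sigma> \<rightarrow> \<tau>) \<Rightarrow> if type_of \<Delta> u = Some \<sigma> then Some \<tau> else None
      | _ \<Rightarrow> None)"
| "type_of \<Delta> (Lam \<sigma> t) = map_option (\<lambda>\<tau>. \<sigma> \<rightarrow> \<tau>) (type_of (\<sigma> # \<Delta>) t)"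

abbreviation has_type :: "ty list \<Rightarrow> tm \<Rightarrow> ty \<Rightarrow> bool" where
  "has_type \<Delta> t \<tau> \<equiv> type_of \<Delta> t = Some \<tau>"

primrec fv :: "tm \<Rightarrow> (string \<times> ty) set" where
  "fv (Con c) = {}"
| "fv (Var x \<tau>) = {(x, \<tau>)}"
| "fv (Bnd n) = {}"
| "fv (t \<cdot> u) = fv t \<union> fv u"
| "fv (Lam \<sigma> t) = fv t"

primrec lift :: "nat \<Rightarrow> tm \<Rightarrow> tm" where
  "lift k (Con c) = Con c"
| "lift k (Var x \<tau>) = Var x \<tau>"
| "lift k (Bnd n) = Bnd (if n < k then n else Suc n)"
| "lift k (t \<cdot> u) = lift k t \<cdot> lift k u"
| "lift k (Lam \<sigma> t) = Lam \<sigma> (lift (Suc k) t)"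

primrec inst :: "nat \<Rightarrow> tm \<Rightarrow> tm \<Rightarrow> tm" where
  "inst k u (Con c) = Con c"
| "inst k u (Var x \<tau>) = Var x \<tau>"
| "inst k u (Bnd n) = (if n < k then Bnd n else if n = k then u else Bnd (n - 1))"
| "inst k u (t \<cdot> t') = inst k u t \<cdot> inst k u t'"
| "inst k u (Lam \<sigma> t) = Lam \<sigma> (inst (Suc k) (lift 0 u) t)"

primrec bind :: "nat \<Rightarrow> string \<Rightarrow> ty \<Rightarrow> tm \<Rightarrow> tm" where
  "bind k x \<tau> (Con c) = Con c"
| "bind k x \<tau> (Var y \<sigma>) = (if y = x \<and> \<sigma> = \<tau> then Bnd k else Var y \<sigma>)"
| "bind k x \<tau> (Bnd n) = Bnd (if n < k then n else Suc n)"
| "bind k x \<tau> (t \<cdot> u) = bind k x \<tau> t \<cdot> bind k x \<tau> u"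
| "bind k x \<tau> (Lam \<sigma> t) = Lam \<sigma> (bind (Suc k) x \<tau> t)"

abbreviation lam :: "string \<Rightarrow> ty \<Rightarrow> tm \<Rightarrow> tm" where
  "lam x \<tau> t \<equiv> Lam \<tau> (bind 0 x \<tau> t)"

inductive conv :: "ty list \<Rightarrow> tm \<Rightarrow> tm \<Rightarrow> ty \<Rightarrow> bool" where
  conv_refl: "has_type \<Delta> t \<tau> \<Longrightarrow> conv \<Delta> t t \<tau>"
| conv_sym: "conv \<Delta> t u \<tau> \<Longrightarrow> conv \<Delta> u t \<tau>"
| conv_trans: "conv \<Delta> t u \<tau> \<Longrightarrow> conv \<Delta> u v \<tau> \<Longrightarrow> conv \<Delta> t v \<tau>"
| conv_app: "conv \<Delta> t t' (\<sigma> \<rightarrow> \<tau>) \<Longrightarrow> conv \<Delta> u u' \<sigma> \<Longrightarrow> conv \<Delta> (t \<cdot> u) (t' \<cdot> u') \<tau>"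
| conv_lam: "conv (\<sigma> # \<Delta>) t t' \<tau> \<Longrightarrow> conv \<Delta> (Lam \<sigma> t) (Lam \<sigma> t') (\<sigma> \<rightarrow> \<tau>)"
| conv_beta: "has_type (\<sigma> # \<Delta>) t \<tau> \<Longrightarrow> has_type \<Delta> u \<sigma> \<Longrightarrow>
    conv \<Delta> (Lam \<sigma> t \<cdot> u) (inst 0 u t) \<tau>"
| conv_eta: "has_type \<Delta> t (\<sigma> \<rightarrow> \<tau>) \<Longrightarrow> conv \<Delta> (Lam \<sigma> (lift 0 t \<cdot> Bnd 0)) t (\<sigma> \<rightarrow> \<tau>)"

section \<open>Substitutions and unifiers\<close>

type_synonym subst = "string \<Rightarrow> ty \<Rightarrow> tm"

definition is_subst :: "subst \<Rightarrow> bool" where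
  "is_subst \<theta> \<longleftrightarrow> (\<forall>x \<tau>. ofree \<tau> \<longrightarrow> has_type [] (\<theta> x \<tau>) \<tau>)"

text \<open>No lifting under binders: the values of a substitution have no dangling indices.\<close>

primrec sub :: "subst \<Rightarrow> tm \<Rightarrow> tm" where
  "sub \<theta> (Con c) = Con c"
| "sub \<theta> (Var x \<tau>) = \<theta> x \<tau>"
| "sub \<theta> (Bnd n) = Bnd n"
| "sub \<theta> (t \<cdot> u) = sub \<theta> t \<cdot> sub \<theta> u"
| "sub \<theta> (Lam \<sigma> t) = Lam \<sigma> (sub \<theta> t)"

definition unifier :: "subst \<Rightarrow> tm \<Rightarrow> tm \<Rightarrow> bool" where
  "unifier \<theta> A B \<longleftrightarrow> is_subst \<theta> \<and> conv [] (sub \<theta> A) (sub \<theta> B) To"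

definition complete_unifiers :: "subst set \<Rightarrow> tm \<Rightarrow> tm \<Rightarrow> bool" where
  "complete_unifiers U A B \<longleftrightarrow>
     (\<forall>\<theta>\<in>U. unifier \<theta> A B) \<and>
     (\<forall>\<sigma>. unifier \<sigma> A B \<longrightarrow>
        (\<exists>\<theta>\<in>U. \<exists>\<rho>. is_subst \<rho> \<and>
           (\<forall>x \<tau>. ofree \<tau> \<longrightarrow> conv [] (\<sigma> x \<tau>) (sub \<rho> (\<theta> x \<tau>)) \<tau>)))"

section \<open>Formulas and definitions\<close>

definition formula :: "tm \<Rightarrow> bool" where
  "formula A \<longleftrightarrow> has_type [] A To"

definition atom :: "pred \<Rightarrow> tm list \<Rightarrow> tm" where
  "atom p ts = foldl App (Con (Pred p)) ts"

abbreviation Bot :: tm ("\<^bold>\<bottom>") where "\<^bold>\<bottom> \<equiv> Con C_Bot"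
abbreviation Top :: tm ("\<^bold>\<top>") where "\<^bold>\<top> \<equiv> Con C_Top"
abbreviation And :: "tm \<Rightarrow> tm \<Rightarrow> tm" (infixr "\<^bold>\<and>" 55) where "A \<^bold>\<and> B \<equiv> Con C_And \<cdot> A \<cdot> B"
abbreviation Or :: "tm \<Rightarrow> tm \<Rightarrow> tm" (infixr "\<^bold>\<or>" 54) where "A \<^bold>\<or> B \<equiv> Con C_Or \<cdot> A \<cdot> B"
abbreviation Imp :: "tm \<Rightarrow> tm \<Rightarrow> tm" (infixr "\<^bold>\<supset>" 53) where "A \<^bold>\<supset> B \<equiv> Con C_Imp \<cdot> A \<cdot> B"
abbreviation All :: "ty \<Rightarrow> tm \<Rightarrow> tm" where "All \<tau> B \<equiv> Con (C_All \<tau>) \<cdot> B"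
abbreviation Ex :: "ty \<Rightarrow> tm \<Rightarrow> tm" where "Ex \<tau> B \<equiv> Con (C_Ex \<tau>) \<cdot> B"

abbreviation all :: "string \<Rightarrow> ty \<Rightarrow> tm \<Rightarrow> tm" where "all x \<tau> A \<equiv> All \<tau> (lam x \<tau> A)"
abbreviation ex :: "string \<Rightarrow> ty \<Rightarrow> tm \<Rightarrow> tm" where "ex x \<tau> A \<equiv> Ex \<tau> (lam x \<tau> A)"

abbreviation z :: tm where "z \<equiv> Con C_z"
abbreviation s :: "tm \<Rightarrow> tm" where "s I \<equiv> Con C_s \<cdot> I"
abbreviation nat' :: "tm \<Rightarrow> tm" where "nat' I \<equiv> Con (Pred P_nat) \<cdot> I"

text \<open>The variables of a clause are its free variables, implicitly universally quantified.\<close>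

datatype clause = Clause (head: tm) (body: tm) (infix "\<triangleq>" 50)

text \<open>The formula has level at most \<open>n\<close>, for levels \<open>l\<close> of the predicates. The level of an
  implication is the maximum of the successor of the level of its antecedent and the level of its
  consequent; the other connectives take maxima.\<close>

inductive level_le :: "(pred \<Rightarrow> nat) \<Rightarrow> tm \<Rightarrow> nat \<Rightarrow> bool" for l where
  level_conv: "level_le l A n \<Longrightarrow> conv [] A B To \<Longrightarrow> level_le l B n"
| level_atom: "l p \<le> n \<Longrightarrow> level_le l (atom p ts) n"
| level_bot: "level_le l \<^bold>\<bottom> n"
| level_top: "level_le l \<^bold>\<top> n"
| level_and: "level_le l A n \<Longrightarrow> level_le l B n \<Longrightarrow> level_le l (A \<^bold>\<and> B) n"
| level_or: "level_le l A n \<Longrightarrow> level_le l B n \<Longrightarrow> level_le l (A \<^bold>\<or> B) n"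
| level_imp: "level_le l A m \<Longrightarrow> m < n \<Longrightarrow> level_le l B n \<Longrightarrow> level_le l (A \<^bold>\<supset> B) n"
| level_all: "level_le l A n \<Longrightarrow> level_le l (all x \<tau> A) n"
| level_ex: "level_le l A n \<Longrightarrow> level_le l (ex x \<tau> A) n"

definition is_definition :: "clause set \<Rightarrow> bool" where
  "is_definition D \<longleftrightarrow>
     (\<exists>l. \<forall>c\<in>D. formula (head c) \<and> formula (body c) \<and> fv (body c) \<subseteq> fv (head c) \<and>
        (\<exists>p ts. p \<noteq> P_nat \<and> head c = atom p ts \<and> level_le l (body c) (l p)))"

definition variant :: "clause \<Rightarrow> clause \<Rightarrow> bool" where
  "variant c' c \<longleftrightarrow>
     (\<exists>r :: string \<Rightarrow> ty \<Rightarrow> string. (\<forall>\<tau>. inj (\<lambda>x. r x \<tau>)) \<and>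
        c' = (sub (\<lambda>x \<tau>. Var (r x \<tau>) \<tau>) (head c) \<triangleq> sub (\<lambda>x \<tau>. Var (r x \<tau>) \<tau>) (body c)))"

section \<open>The sequent calculus\<close>

definition fvs :: "tm multiset \<Rightarrow> (string \<times> ty) set" where
  "fvs \<Gamma> = (\<Union>A\<in>set_mset \<Gamma>. fv A)"

definition formulas :: "tm multiset \<Rightarrow> bool" where
  "formulas \<Gamma> \<longleftrightarrow> (\<forall>A\<in>set_mset \<Gamma>. formula A)"

text \<open>Rule \<open>conv\<close> identifies formulas up to beta-eta-conversion. The side conditions
  \<open>formula\<close> and \<open>formulas\<close> make derivable sequents consist of formulas only. In \<open>defL\<close>, a
  variant and a complete set of unifiers (possibly infinite) may be chosen for each clause.\<close>

inductive derives :: "clause set \<Rightarrow> tm multiset \<Rightarrow> tm \<Rightarrow> bool" for D where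
  conv: "derives D \<Gamma> C \<Longrightarrow> rel_mset (\<lambda>A B. conv [] A B To) \<Gamma> \<Gamma>' \<Longrightarrow> conv [] C C' To \<Longrightarrow>
    derives D \<Gamma>' C'"
| init: "formula (atom p ts) \<Longrightarrow> formulas \<Gamma> \<Longrightarrow> derives D (add_mset (atom p ts) \<Gamma>) (atom p ts)"
| contract: "derives D (add_mset A (add_mset A \<Gamma>)) C \<Longrightarrow> derives D (add_mset A \<Gamma>) C"
| cut: "derives D \<Gamma> A \<Longrightarrow> derives D (add_mset A \<Gamma>') C \<Longrightarrow> derives D (\<Gamma> + \<Gamma>') C"
| botL: "formulas \<Gamma> \<Longrightarrow> formula C \<Longrightarrow> derives D (add_mset \<^bold>\<bottom> \<Gamma>) C"
| topR: "formulas \<Gamma> \<Longrightarrow> derives D \<Gamma> \<^bold>\<top>"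
| andL1: "derives D (add_mset A \<Gamma>) C \<Longrightarrow> formula B \<Longrightarrow> derives D (add_mset (A \<^bold>\<and> B) \<Gamma>) C"
| andL2: "derives D (add_mset B \<Gamma>) C \<Longrightarrow> formula A \<Longrightarrow> derives D (add_mset (A \<^bold>\<and> B) \<Gamma>) C"
| andR: "derives D \<Gamma> A \<Longrightarrow> derives D \<Gamma> B \<Longrightarrow> derives D \<Gamma> (A \<^bold>\<and> B)"
| orL: "derives D (add_mset A \<Gamma>) C \<Longrightarrow> derives D (add_mset B \<Gamma>) C \<Longrightarrow>
    derives D (add_mset (A \<^bold>\<or> B) \<Gamma>) C"
| orR1: "derives D \<Gamma> A \<Longrightarrow> formula B \<Longrightarrow> derives D \<Gamma> (A \<^bold>\<or> B)"
| orR2: "derives D \<Gamma> B \<Longrightarrow> formula A \<Longrightarrow> derives D \<Gamma> (A \<^bold>\<or> B)"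
| impL: "derives D \<Gamma> A \<Longrightarrow> derives D (add_mset B \<Gamma>) C \<Longrightarrow> derives D (add_mset (A \<^bold>\<supset> B) \<Gamma>) C"
| impR: "derives D (add_mset A \<Gamma>) B \<Longrightarrow> derives D \<Gamma> (A \<^bold>\<supset> B)"
| allL: "derives D (add_mset (B \<cdot> t) \<Gamma>) C \<Longrightarrow> formula (All \<tau> B) \<Longrightarrow> has_type [] t \<tau> \<Longrightarrow>
    derives D (add_mset (All \<tau> B) \<Gamma>) C"
| allR: "derives D \<Gamma> (B \<cdot> Var y \<tau>) \<Longrightarrow> (y, \<tau>) \<notin> fvs \<Gamma> \<union> fv B \<Longrightarrow> formula (All \<tau> B) \<Longrightarrow>
    derives D \<Gamma> (All \<tau> B)"
| exL: "derives D (add_mset (B \<cdot> Var y \<tau>) \<Gamma>) C \<Longrightarrow> (y, \<tau>) \<notin> fvs \<Gamma> \<union> fv B \<union> fv C \<Longrightarrow>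
    formula (Ex \<tau> B) \<Longrightarrow> derives D (add_mset (Ex \<tau> B) \<Gamma>) C"
| exR: "derives D \<Gamma> (B \<cdot> t) \<Longrightarrow> formula (Ex \<tau> B) \<Longrightarrow> has_type [] t \<tau> \<Longrightarrow> derives D \<Gamma> (Ex \<tau> B)"
| natR_z: "formulas \<Gamma> \<Longrightarrow> derives D \<Gamma> (nat' z)"
| natR_s: "derives D \<Gamma> (nat' I) \<Longrightarrow> derives D \<Gamma> (nat' (s I))"
| natL: "derives D {#} (B \<cdot> z) \<Longrightarrow>
    derives D {#B \<cdot> Var j Tnt#} (B \<cdot> s (Var j Tnt)) \<Longrightarrow> (j, Tnt) \<notin> fv B \<Longrightarrow>
    derives D (add_mset (B \<cdot> I) \<Gamma>) C \<Longrightarrow>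
    derives D (add_mset (nat' I) \<Gamma>) C"
| defR: "(H \<triangleq> B) \<in> D \<Longrightarrow> is_subst \<theta> \<Longrightarrow> derives D \<Gamma> (sub \<theta> B) \<Longrightarrow> derives D \<Gamma> (sub \<theta> H)"
| defL: "p \<noteq> P_nat \<Longrightarrow> formula (atom p us) \<Longrightarrow> formulas \<Gamma> \<Longrightarrow> formula C \<Longrightarrow>
    \<forall>c\<in>D. variant (v c) c \<and>
      (fv (head (v c)) \<union> fv (body (v c))) \<inter> (fv (atom p us) \<union> fvs \<Gamma> \<union> fv C) = {} \<and>
      complete_unifiers (U c) (atom p us) (head (v c)) \<Longrightarrow>
    \<forall>c\<in>D. \<forall>\<theta>\<in>U c.
      derives D (add_mset (sub \<theta> (body (v c))) (image_mset (sub \<theta>) \<Gamma>)) (sub \<theta> C) \<Longrightarrow>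
    derives D (add_mset (atom p us) \<Gamma>) C"

definition derivable :: "clause set \<Rightarrow> tm \<Rightarrow> bool" where
  "derivable D F \<longleftrightarrow> is_definition D \<and> formula F \<and> derives D {#} F"

section \<open>Natural numbers and lists\<close>

abbreviation eq' :: "tm \<Rightarrow> tm \<Rightarrow> tm" where "eq' I J \<equiv> Con (Pred P_eq) \<cdot> I \<cdot> J"
abbreviation sum' :: "tm \<Rightarrow> tm \<Rightarrow> tm \<Rightarrow> tm" where "sum' I J K \<equiv> Con (Pred P_sum) \<cdot> I \<cdot> J \<cdot> K"
abbreviation less' :: "tm \<Rightarrow> tm \<Rightarrow> tm" where "less' I J \<equiv> Con (Pred P_less) \<cdot> I \<cdot> J"
abbreviation le' :: "tm \<Rightarrow> tm \<Rightarrow> tm" where "le' I J \<equiv> Con (Pred P_le) \<cdot> I \<cdot> J"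

definition D_nat :: "clause set" where
  "D_nat =
    (let I = Var ''I'' Tnt; J = Var ''J'' Tnt; K = Var ''K'' Tnt in
     {eq' I I \<triangleq> \<^bold>\<top>,
      sum' z J J \<triangleq> nat' J,
      sum' (s I) J (s K) \<triangleq> sum' I J K,
      less' z (s J) \<triangleq> nat' J,
      less' (s I) (s J) \<triangleq> less' I J,
      le' I I \<triangleq> \<^bold>\<top>,
      le' I J \<triangleq> less' I J})"

abbreviation nil :: tm where "nil \<equiv> Con C_nil"
abbreviation cons :: "tm \<Rightarrow> tm \<Rightarrow> tm" (infixr "\<^bold>#" 65) where "X \<^bold># L \<equiv> Con C_cons \<cdot> X \<cdot> L"
abbreviation length' :: "tm \<Rightarrow> tm \<Rightarrow> tm" where "length' L I \<equiv> Con (Pred P_length) \<cdot> L \<cdot> I"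
abbreviation list' :: "tm \<Rightarrow> tm" where "list' L \<equiv> Con (Pred P_list) \<cdot> L"
abbreviation element :: "tm \<Rightarrow> tm \<Rightarrow> tm" where "element X L \<equiv> Con (Pred P_element) \<cdot> X \<cdot> L"
abbreviation split :: "tm \<Rightarrow> tm \<Rightarrow> tm \<Rightarrow> tm" where
  "split L1 L2 L3 \<equiv> Con (Pred P_split) \<cdot> L1 \<cdot> L2 \<cdot> L3"
abbreviation permute :: "tm \<Rightarrow> tm \<Rightarrow> tm" where "permute L1 L2 \<equiv> Con (Pred P_permute) \<cdot> L1 \<cdot> L2"

definition D_list :: "clause set" where
  "D_list =
    (let I = Var ''I'' Tnt; i = Var ''i'' Tnt; X = Var ''X'' Tatm; Y = Var ''Y'' Tatm;
         L = Var ''L'' Tatmlst; L1 = Var ''L1'' Tatmlst; L2 = Var ''L2'' Tatmlst;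
         L3 = Var ''L3'' Tatmlst; l22 = Var ''l22'' Tatmlst in
     {length' nil z \<triangleq> \<^bold>\<top>,
      length' (X \<^bold># L) (s I) \<triangleq> length' L I,
      list' L \<triangleq> ex ''i'' Tnt (nat' i \<^bold>\<and> length' L i),
      element X (X \<^bold># L) \<triangleq> \<^bold>\<top>,
      element X (Y \<^bold># L) \<triangleq> element X L,
      split nil nil nil \<triangleq> \<^bold>\<top>,
      split (X \<^bold># L1) (X \<^bold># L2) L3 \<triangleq> split L1 L2 L3,
      split (X \<^bold># L1) L2 (X \<^bold># L3) \<triangleq> split L1 L2 L3,
      permute nil nil \<triangleq> \<^bold>\<top>,
      permute (X \<^bold># L1) L2 \<triangleq>
        ex ''l22'' Tatmlst (split L2 (X \<^bold># nil) l22 \<^bold>\<and> permute L1 l22)})"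

section \<open>The object logic\<close>

abbreviation obj :: "tm \<Rightarrow> tm" ("\<langle>_\<rangle>") where "\<langle>A\<rangle> \<equiv> Con C_obj \<cdot> A"
abbreviation tt :: tm where "tt \<equiv> Con C_tt"
abbreviation amp :: "tm \<Rightarrow> tm \<Rightarrow> tm" (infixr "\<^bold>&" 60) where "B \<^bold>& C \<equiv> Con C_amp \<cdot> B \<cdot> C"
abbreviation arrow :: "tm \<Rightarrow> tm \<Rightarrow> tm" (infixr "\<^bold>\<Rightarrow>" 59) where
  "A \<^bold>\<Rightarrow> B \<equiv> Con C_arrow \<cdot> A \<cdot> B"
abbreviation Bigand :: "tm \<Rightarrow> tm" where "Bigand B \<equiv> Con C_bigand \<cdot> B"
abbreviation bigand :: "string \<Rightarrow> tm \<Rightarrow> tm" where "bigand x B \<equiv> Bigand (lam x Ti B)"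
abbreviation prog :: "tm \<Rightarrow> tm \<Rightarrow> tm" where "prog A B \<equiv> Con (Pred P_prog) \<cdot> A \<cdot> B"
abbreviation seq :: "tm \<Rightarrow> tm \<Rightarrow> tm \<Rightarrow> tm" where "seq I L B \<equiv> Con (Pred P_seq) \<cdot> I \<cdot> L \<cdot> B"

definition D_intuit :: "clause set" where
  "D_intuit =
    (let I = Var ''I'' Tnt; L = Var ''L'' Tatmlst; A = Var ''A'' Tatm; A' = Var ''A1'' Tatm;
         B = Var ''B'' Tprp; C = Var ''C'' Tprp; b = Var ''b'' Tprp;
         F = Var ''F'' (Ti \<rightarrow> Tprp); x = Var ''x'' Ti in
     {seq I (A' \<^bold># L) \<langle>A\<rangle> \<triangleq> element A (A' \<^bold># L),
      seq I L tt \<triangleq> \<^bold>\<top>,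
      seq (s I) L (B \<^bold>& C) \<triangleq> seq I L B \<^bold>\<and> seq I L C,
      seq (s I) L (A \<^bold>\<Rightarrow> B) \<triangleq> seq I (A \<^bold># L) B,
      seq (s I) L (Bigand F) \<triangleq> all ''x'' Ti (seq I L (F \<cdot> x)),
      seq (s I) L \<langle>A\<rangle> \<triangleq> ex ''b'' Tprp (prog A b \<^bold>\<and> seq I L b)})"

text \<open>Lifting avoids capture of dangling indices of \<open>B\<close> by the existential quantifier.\<close>

definition provable :: "tm \<Rightarrow> tm" ("\<turnstile> _" [80] 80) where
  "\<turnstile> B = Ex Tnt (Lam Tnt (nat' (Bnd 0) \<^bold>\<and> seq (Bnd 0) nil (lift 0 B)))"

section \<open>PCF\<close>

abbreviation num' :: tm where "num' \<equiv> Con C_num"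
abbreviation bool' :: tm where "bool' \<equiv> Con C_bool"
abbreviation arr' :: "tm \<Rightarrow> tm \<Rightarrow> tm" where "arr' T U \<equiv> Con C_arr \<cdot> T \<cdot> U"
abbreviation zero' :: tm where "zero' \<equiv> Con C_zero"
abbreviation true' :: tm where "true' \<equiv> Con C_true"
abbreviation false' :: tm where "false' \<equiv> Con C_false"
abbreviation succ' :: "tm \<Rightarrow> tm" where "succ' M \<equiv> Con C_succ \<cdot> M"
abbreviation pred' :: "tm \<Rightarrow> tm" where "pred' M \<equiv> Con C_pred \<cdot> M"
abbreviation is_zero' :: "tm \<Rightarrow> tm" where "is_zero' M \<equiv> Con C_is_zero \<cdot> M"
abbreviation if' :: "tm \<Rightarrow> tm \<Rightarrow> tm \<Rightarrow> tm" where "if' M N1 N2 \<equiv> Con C_if \<cdot> M \<cdot> N1 \<cdot> N2"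
abbreviation abs' :: "tm \<Rightarrow> tm \<Rightarrow> tm" where "abs' T R \<equiv> Con C_abs \<cdot> T \<cdot> R"
abbreviation app' :: "tm \<Rightarrow> tm \<Rightarrow> tm" where "app' M N \<equiv> Con C_app \<cdot> M \<cdot> N"
abbreviation rec' :: "tm \<Rightarrow> tm \<Rightarrow> tm" where "rec' T R \<equiv> Con C_rec \<cdot> T \<cdot> R"

abbreviation typeof :: "tm \<Rightarrow> tm \<Rightarrow> tm" where "typeof M T \<equiv> Con C_typeof \<cdot> M \<cdot> T"
abbreviation eval' :: "tm \<Rightarrow> tm \<Rightarrow> tm" (infix "\<Down>" 70) where "M \<Down> V \<equiv> Con C_eval \<cdot> M \<cdot> V"
abbreviation step :: "tm \<Rightarrow> tm \<Rightarrow> tm" (infix "\<leadsto>" 70) where "M \<leadsto> N \<equiv> Con C_step \<cdot> M \<cdot> N"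
abbreviation steps :: "tm \<Rightarrow> tm \<Rightarrow> tm" (infix "\<leadsto>\<^sup>*" 70) where
  "M \<leadsto>\<^sup>* N \<equiv> Con C_steps \<cdot> M \<cdot> N"
abbreviation value' :: "tm \<Rightarrow> tm" where "value' V \<equiv> Con C_value \<cdot> V"

abbreviation prog_clause :: "tm \<Rightarrow> tm \<Rightarrow> clause" (infix "\<^bold>\<leftarrow>" 50) where
  "A \<^bold>\<leftarrow> G \<equiv> (prog A G \<triangleq> \<^bold>\<top>)"

definition D_typing :: "clause set" where
  "D_typing =
    (let M = Var ''M'' Ti; N = Var ''N'' Ti; N1 = Var ''N1'' Ti; N2 = Var ''N2'' Ti;
         T = Var ''T'' Ti; U = Var ''U'' Ti; R = Var ''R'' (Ti \<rightarrow> Ti); n = Var ''n'' Ti in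
     {typeof zero' num' \<^bold>\<leftarrow> tt,
      typeof true' bool' \<^bold>\<leftarrow> tt,
      typeof false' bool' \<^bold>\<leftarrow> tt,
      typeof (succ' M) num' \<^bold>\<leftarrow> \<langle>typeof M num'\<rangle>,
      typeof (pred' M) num' \<^bold>\<leftarrow> \<langle>typeof M num'\<rangle>,
      typeof (is_zero' M) bool' \<^bold>\<leftarrow> \<langle>typeof M num'\<rangle>,
      typeof (if' M N1 N2) T \<^bold>\<leftarrow> \<langle>typeof M bool'\<rangle> \<^bold>& \<langle>typeof N1 T\<rangle> \<^bold>& \<langle>typeof N2 T\<rangle>,
      typeof (abs' T R) (arr' T U) \<^bold>\<leftarrow> bigand ''n'' (typeof n T \<^bold>\<Rightarrow> \<langle>typeof (R \<cdot> n) U\<rangle>),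
      typeof (app' M N) T \<^bold>\<leftarrow> \<langle>typeof M (arr' U T)\<rangle> \<^bold>& \<langle>typeof N U\<rangle>,
      typeof (rec' T R) T \<^bold>\<leftarrow> bigand ''n'' (typeof n T \<^bold>\<Rightarrow> \<langle>typeof (R \<cdot> n) T\<rangle>)})"

definition D_natural :: "clause set" where
  "D_natural =
    (let M = Var ''M'' Ti; N = Var ''N'' Ti; N1 = Var ''N1'' Ti; N2 = Var ''N2'' Ti;
         V = Var ''V'' Ti; T = Var ''T'' Ti; R = Var ''R'' (Ti \<rightarrow> Ti) in
     {zero' \<Down> zero' \<^bold>\<leftarrow> tt,
      true' \<Down> true' \<^bold>\<leftarrow> tt,
      false' \<Down> false' \<^bold>\<leftarrow> tt,
      succ' M \<Down> succ' V \<^bold>\<leftarrow> \<langle>M \<Down> V\<rangle>,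
      pred' M \<Down> zero' \<^bold>\<leftarrow> \<langle>M \<Down> zero'\<rangle>,
      pred' M \<Down> V \<^bold>\<leftarrow> \<langle>M \<Down> succ' V\<rangle>,
      is_zero' M \<Down> true' \<^bold>\<leftarrow> \<langle>M \<Down> zero'\<rangle>,
      is_zero' M \<Down> false' \<^bold>\<leftarrow> \<langle>M \<Down> succ' V\<rangle>,
      if' M N1 N2 \<Down> V \<^bold>\<leftarrow> \<langle>M \<Down> true'\<rangle> \<^bold>& \<langle>N1 \<Down> V\<rangle>,
      if' M N1 N2 \<Down> V \<^bold>\<leftarrow> \<langle>M \<Down> false'\<rangle> \<^bold>& \<langle>N2 \<Down> V\<rangle>,
      abs' T R \<Down> abs' T R \<^bold>\<leftarrow> tt,
      app' M N \<Down> V \<^bold>\<leftarrow> \<langle>M \<Down> abs' T R\<rangle> \<^bold>& \<langle>(R \<cdot> N) \<Down> V\<rangle>,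
      rec' T R \<Down> V \<^bold>\<leftarrow> \<langle>(R \<cdot> rec' T R) \<Down> V\<rangle>})"

definition D_transition :: "clause set" where
  "D_transition =
    (let M = Var ''M'' Ti; M' = Var ''M1'' Ti; N = Var ''N'' Ti;
         N1 = Var ''N1'' Ti; N2 = Var ''N2'' Ti;
         V = Var ''V'' Ti; T = Var ''T'' Ti; R = Var ''R'' (Ti \<rightarrow> Ti) in
     {succ' M \<leadsto> succ' M' \<^bold>\<leftarrow> \<langle>M \<leadsto> M'\<rangle>,
      pred' zero' \<leadsto> zero' \<^bold>\<leftarrow> tt,
      pred' (succ' V) \<leadsto> V \<^bold>\<leftarrow> \<langle>value' V\<rangle>,
      pred' M \<leadsto> pred' M' \<^bold>\<leftarrow> \<langle>M \<leadsto> M'\<rangle>,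
      is_zero' zero' \<leadsto> true' \<^bold>\<leftarrow> tt,
      is_zero' (succ' V) \<leadsto> false' \<^bold>\<leftarrow> \<langle>value' V\<rangle>,
      is_zero' M \<leadsto> is_zero' M' \<^bold>\<leftarrow> \<langle>M \<leadsto> M'\<rangle>,
      if' true' M N \<leadsto> M \<^bold>\<leftarrow> tt,
      if' false' M N \<leadsto> N \<^bold>\<leftarrow> tt,
      if' M N1 N2 \<leadsto> if' M' N1 N2 \<^bold>\<leftarrow> \<langle>M \<leadsto> M'\<rangle>,
      app' (abs' T R) N \<leadsto> (R \<cdot> N) \<^bold>\<leftarrow> tt,
      app' M N \<leadsto> app' M' N \<^bold>\<leftarrow> \<langle>M \<leadsto> M'\<rangle>,
      rec' T R \<leadsto> (R \<cdot> rec' T R) \<^bold>\<leftarrow> tt,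
      M \<leadsto>\<^sup>* M \<^bold>\<leftarrow> tt,
      M \<leadsto>\<^sup>* N \<^bold>\<leftarrow> \<langle>M \<leadsto> M'\<rangle> \<^bold>& \<langle>M' \<leadsto>\<^sup>* N\<rangle>,
      value' zero' \<^bold>\<leftarrow> tt,
      value' true' \<^bold>\<leftarrow> tt,
      value' false' \<^bold>\<leftarrow> tt,
      value' (succ' V) \<^bold>\<leftarrow> \<langle>value' V\<rangle>,
      value' (abs' T R) \<^bold>\<leftarrow> tt})"

definition D_PCF :: "clause set" where
  "D_PCF = D_typing \<union> D_natural \<union> D_transition"

abbreviation equiv' :: "tm \<Rightarrow> tm \<Rightarrow> tm" (infix "\<^bold>\<equiv>" 70) where
  "X \<^bold>\<equiv> Y \<equiv> Con (Pred P_equiv) \<cdot> X \<cdot> Y"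

definition D_equiv :: "clause set" where
  "D_equiv = (let X = Var ''X'' Ti in {X \<^bold>\<equiv> X \<triangleq> \<^bold>\<top>})"

definition D_all :: "clause set" where
  "D_all = D_nat \<union> D_list \<union> D_intuit \<union> D_PCF \<union> D_equiv"

lemma level_le_pred:
  "level_le (\<lambda>_. 0) (Con (Pred p) \<cdot> a) 0"
  "level_le (\<lambda>_. 0) (Con (Pred p) \<cdot> a \<cdot> b) 0"
  "level_le (\<lambda>_. 0) (Con (Pred p) \<cdot> a \<cdot> b \<cdot> c) 0"
  using level_atom[of "\<lambda>_. 0" p 0 "[a]"] level_atom[of "\<lambda>_. 0" p 0 "[a, b]"]
    level_atom[of "\<lambda>_. 0" p 0 "[a, b, c]"]
  by (simp_all add: atom_def)

lemma atom_pred: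
  "p \<noteq> P_nat \<Longrightarrow> \<exists>q ts. q \<noteq> P_nat \<and> Con (Pred p) \<cdot> a = atom q ts"
  "p \<noteq> P_nat \<Longrightarrow> \<exists>q ts. q \<noteq> P_nat \<and> Con (Pred p) \<cdot> a \<cdot> b = atom q ts"
  "p \<noteq> P_nat \<Longrightarrow> \<exists>q ts. q \<noteq> P_nat \<and> Con (Pred p) \<cdot> a \<cdot> b \<cdot> c = atom q ts"
  by (rule exI[of _ p], rule exI[of _ "[a]"], simp add: atom_def)
     (rule exI[of _ p], rule exI[of _ "[a, b]"], simp add: atom_def,
      rule exI[of _ p], rule exI[of _ "[a, b, c]"], simp add: atom_def)

definition legal_clause :: "clause \<Rightarrow> bool" where
  "legal_clause c \<longleftrightarrow> formula (head c) \<and> formula (body c) \<and> fv (body c) \<subseteq> fv (head c) \<and>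
     (\<exists>p ts. p \<noteq> P_nat \<and> head c = atom p ts \<and> level_le (\<lambda>_. 0) (body c) 0)"

lemma legal_clauseI:
  "formula H \<Longrightarrow> formula B \<Longrightarrow> fv B \<subseteq> fv H \<Longrightarrow> \<exists>p ts. p \<noteq> P_nat \<and> H = atom p ts \<Longrightarrow>
   level_le (\<lambda>_. 0) B 0 \<Longrightarrow> legal_clause (H \<triangleq> B)"
  by (auto simp: legal_clause_def)

lemma legal_D_all: "\<forall>c\<in>D_all. legal_clause c"
  unfolding D_all_def D_nat_def D_list_def D_intuit_def D_PCF_def D_typing_def D_natural_def
    D_transition_def D_equiv_def Let_def ball_Un
  apply (intro conjI ballI)
  apply ((elim insertE emptyE; hypsubst; rule legal_clauseI;
    ((rule atom_pred; simp; fail) | (intro level_le_pred level_le.intros(3-); fail) |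
     (simp add: formula_def; fail) | (simp; blast; fail))?)+)
  done

text \<open>No clause body contains an implication, so every predicate can be given level 0.\<close>

lemma is_definition_D_all: "is_definition D_all"
  unfolding is_definition_def
  by (rule exI[of _ "\<lambda>_. 0"]) (use legal_D_all in \<open>simp add: legal_clause_def\<close>)

end

theory Submission
  imports Defs "HOL-Library.Confluence" "HOL-Library.Countable_Set"
begin

text \<open>Derivability is reduced to truth in prime theories (sets of formulas closed under derivability,
  with the disjunction and existence properties): a formula that belongs to all of them is derivable,
  by a Henkin argument. In one prime theory, the terms of type \<open>i\<close> modulo provable equality
  form a set on which the constants of PCF are injective with disjoint ranges, because the left rule for \<open>\<equiv>\<close>
  unifies. There the object-level judgments become ordinary relations with the usual inversion
  principles, and induction on \<open>nat\<close> becomes induction on the height of object-level derivations, as long as the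
  induction predicate is expressed by a formula; the standard proofs of the properties of PCF then
  go through. Hypothetical typing judgments are handled by an internal proof of cut for
  the specification logic, and by instantiating bound variables with closed terms that have a unique type.\<close>

section \<open>Metatheory of terms\<close>

text \<open>Two features of the calculus shape the proof. The left rule for definitions applies a
  unifier to the whole sequent, so a case analysis begun in a prime theory \<open>T\<close>
  continues in other prime theories, which contain only substitution instances of chosen facts; its
  conclusion must therefore be a formula, and the facts to be kept must be listed in a finite set.
  The induction rule has no side formulas in base and step, so an induction formula quantifies over
  its parameters, and its step is argued in every prime theory at once. Likewise an implication or a
  universal formula cannot be put into \<open>T\<close> by inspecting \<open>T\<close> alone: one
  argues in all prime theories above a finite part of \<open>T\<close>. Which clauses match an atom
  depends on injectivity and disjointness of constants up to conversion, hence on confluence of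
  beta-eta-reduction; as abstractions carry type annotations, confluence needs typing. Heights of
  object-level derivations are compared by the cut formula with \<open>z\<close> as its middle
  argument, which serves as their ordering.\<close>

lemma lift_lift: "i \<le> k \<Longrightarrow> lift (Suc k) (lift i t) = lift i (lift k t)"
  by (induction t arbitrary: i k) auto

lemma inst_lift [simp]: "inst k u (lift k t) = t"
  by (induction t arbitrary: k u) auto

lemma lift_inst: "j \<le> k \<Longrightarrow> lift k (inst j u t) = inst j (lift k u) (lift (Suc k) t)"
  by (induction t arbitrary: j k u) (auto simp: lift_lift)

lemma lift_inst_le: "k \<le> j \<Longrightarrow> lift k (inst j u t) = inst (Suc j) (lift k u) (lift k t)"
  by (induction t arbitrary: j k u) (auto simp: lift_lift)

lemma inst_inst:
  "i \<le> j \<Longrightarrow> inst i (inst j v u) (inst (Suc j) (lift i v) t) = inst j v (inst i u t)"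
proof (induction t arbitrary: i j u v)
  case (Lam \<sigma> t)
  then show ?case
    using Lam.IH[of "Suc i" "Suc j" "lift 0 v" "lift 0 u"] by (simp add: lift_lift lift_inst_le)
qed auto

lemma lift_inj [simp]: "lift k t = lift k u \<longleftrightarrow> t = u"
  by (metis inst_lift)

text \<open>The equation behind the overlap of beta and eta: an eta-redex around an abstraction
  contains a beta-redex, whose contraction must give back the same body.\<close>

lemma inst_Bnd_lift: "inst k (Bnd k) (lift (Suc k) t) = t"
  by (induction t arbitrary: k) auto

lemma type_of_lift: "type_of (\<Delta>1 @ \<sigma> # \<Delta>2) (lift (length \<Delta>1) t) = type_of (\<Delta>1 @ \<Delta>2) t"
proof (induction t arbitrary: \<Delta>1)
  case (Lam \<tau> t)
  show ?case using Lam[of "\<tau> # \<Delta>1"] by simp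
qed (auto simp: nth_append Suc_diff_le split: ty.split option.split)

lemma type_of_lift_0 [simp]: "type_of (\<sigma> # \<Delta>) (lift 0 t) = type_of \<Delta> t"
  using type_of_lift[of "[]"] by simp

lemma type_of_inst:
  "has_type (\<Delta>1 @ \<Delta>2) u \<sigma> \<Longrightarrow>
   type_of (\<Delta>1 @ \<Delta>2) (inst (length \<Delta>1) u t) = type_of (\<Delta>1 @ \<sigma> # \<Delta>2) t"
proof (induction t arbitrary: \<Delta>1 u)
  case (Lam \<tau> t)
  show ?case using Lam.IH[of "\<tau> # \<Delta>1" "lift 0 u"] Lam.prems by simp
qed (auto simp: nth_append Suc_diff_le nth_Cons' not_less split: ty.split option.split)

lemma type_of_inst_0: "has_type \<Delta> u \<sigma> \<Longrightarrow> type_of \<Delta> (inst 0 u t) = type_of (\<sigma> # \<Delta>) t"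
  using type_of_inst[of "[]"] by simp

lemma has_type_App: "has_type \<Delta> (t \<cdot> u) \<tau> \<longleftrightarrow> (\<exists>\<sigma>. has_type \<Delta> t (\<sigma> \<rightarrow> \<tau>) \<and> has_type \<Delta> u \<sigma>)"
  by (auto split: option.splits ty.splits)

lemma has_type_Lam:
  "has_type \<Delta> (Lam \<sigma> t) \<tau> \<longleftrightarrow> (\<exists>\<tau>'. \<tau> = (\<sigma> \<rightarrow> \<tau>') \<and> has_type (\<sigma> # \<Delta>) t \<tau>')"
  by auto

lemma has_type_append: "has_type \<Delta> t \<tau> \<Longrightarrow> has_type (\<Delta> @ \<Delta>') t \<tau>"
proof (induction t arbitrary: \<Delta> \<tau>)
  case (App t u)
  then show ?case by (fastforce simp only: has_type_App)
next
  case (Lam \<sigma> t)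
  then show ?case by (force simp only: has_type_Lam append_Cons[symmetric])
qed (auto simp: nth_append split: if_splits)

lemma has_type_weaken: "has_type [] t \<tau> \<Longrightarrow> has_type \<Delta> t \<tau>"
  using has_type_append[of "[]" t \<tau> \<Delta>] by (simp only: append_Nil)

text \<open>A typable term has no index beyond its context, so shifting there changes nothing. In
  particular, values of substitutions, typed in the empty context, may pass under binders
  unlifted.\<close>

lemma lift_has_type: "has_type \<Delta> t \<tau> \<Longrightarrow> length \<Delta> \<le> k \<Longrightarrow> lift k t = t"
proof (induction t arbitrary: \<Delta> \<tau> k)
  case (App t u)
  then show ?case by (auto simp only: has_type_App lift.simps)
next
  case (Lam \<sigma> t)
  from Lam.prems obtain \<tau>' where "has_type (\<sigma> # \<Delta>) t \<tau>'" by (auto simp only: has_type_Lam)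
  with Lam.IH[of "\<sigma> # \<Delta>"] Lam.prems show ?case by simp
qed (auto split: if_splits)

lemma inst_has_type: "has_type \<Delta> t \<tau> \<Longrightarrow> length \<Delta> \<le> k \<Longrightarrow> inst k u t = t"
  by (metis inst_lift lift_has_type)

lemma conv_has_type: "conv \<Delta> t u \<tau> \<Longrightarrow> has_type \<Delta> t \<tau> \<and> has_type \<Delta> u \<tau>"
proof (induction rule: conv.induct)
  case (conv_app \<Delta> t t' \<sigma> \<tau> u u')
  then show ?case by (simp only: has_type_App) blast
next
  case (conv_beta \<sigma> \<Delta> t \<tau> u)
  then show ?case by (simp add: type_of_inst_0)
next
  case (conv_eta \<Delta> t \<sigma> \<tau>)
  then show ?case by simp
qed auto

section \<open>Parallel reduction and injectivity of constants\<close>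

inductive par :: "tm \<Rightarrow> tm \<Rightarrow> bool" (infix "\<Rrightarrow>" 50) where
  par_Con [intro!]: "Con c \<Rrightarrow> Con c"
| par_Var [intro!]: "Var x \<tau> \<Rrightarrow> Var x \<tau>"
| par_Bnd [intro!]: "Bnd n \<Rrightarrow> Bnd n"
| par_App: "t \<Rrightarrow> t' \<Longrightarrow> u \<Rrightarrow> u' \<Longrightarrow> t \<cdot> u \<Rrightarrow> t' \<cdot> u'"
| par_Lam: "t \<Rrightarrow> t' \<Longrightarrow> Lam \<sigma> t \<Rrightarrow> Lam \<sigma> t'"
| par_beta: "t \<Rrightarrow> t' \<Longrightarrow> u \<Rrightarrow> u' \<Longrightarrow> Lam \<sigma> t \<cdot> u \<Rrightarrow> inst 0 u' t'"
| par_eta: "t \<Rrightarrow> t' \<Longrightarrow> Lam \<sigma> (lift 0 t \<cdot> Bnd 0) \<Rrightarrow> t'"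

inductive_cases par_ConE [elim!]: "Con c \<Rrightarrow> v"
inductive_cases par_VarE [elim!]: "Var x \<tau> \<Rrightarrow> v"
inductive_cases par_BndE [elim!]: "Bnd n \<Rrightarrow> v"

lemma par_AppE [consumes 1, case_names App beta]:
  assumes "t \<cdot> u \<Rrightarrow> v"
  obtains t' u' where "v = t' \<cdot> u'" "t \<Rrightarrow> t'" "u \<Rrightarrow> u'"
  | \<sigma> a a' u' where "t = Lam \<sigma> a" "v = inst 0 u' a'" "a \<Rrightarrow> a'" "u \<Rrightarrow> u'"
  using assms by (cases rule: par.cases) auto

lemma par_LamE [consumes 1, case_names Lam eta]:
  assumes "Lam \<sigma> t \<Rrightarrow> v"
  obtains t' where "v = Lam \<sigma> t'" "t \<Rrightarrow> t'"
  | a where "t = lift 0 a \<cdot> Bnd 0" "a \<Rrightarrow> v"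
  using assms by (cases rule: par.cases) auto

lemma par_refl [simp, intro!]: "t \<Rrightarrow> t"
  by (induction t) (auto intro: par_App par_Lam)

lemma par_lift: "t \<Rrightarrow> t' \<Longrightarrow> lift k t \<Rrightarrow> lift k t'"
proof (induction arbitrary: k rule: par.induct)
  case (par_beta t t' u u' \<sigma>)
  then show ?case
    using par.par_beta[of "lift (Suc k) t" "lift (Suc k) t'"] by (simp add: lift_inst)
next
  case (par_eta t t' \<sigma>)
  then show ?case
    using par.par_eta[of "lift k t" "lift k t'"] by (simp add: lift_lift[of 0, symmetric])
qed (auto intro: par_App par_Lam)

lemma par_inst: "t \<Rrightarrow> t' \<Longrightarrow> u \<Rrightarrow> u' \<Longrightarrow> inst k u t \<Rrightarrow> inst k u' t'"
proof (induction arbitrary: k u u' rule: par.induct)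
  case (par_Lam t t' \<sigma>)
  then show ?case by (simp add: par.par_Lam par_lift)
next
  case (par_beta t t' v v' \<sigma>)
  have "Lam \<sigma> (inst (Suc k) (lift 0 u) t) \<cdot> inst k u v \<Rrightarrow>
      inst 0 (inst k u' v') (inst (Suc k) (lift 0 u') t')"
    by (intro par.par_beta par_beta par_lift)
  then show ?case by (simp add: inst_inst)
next
  case (par_eta t t' \<sigma>)
  have "Lam \<sigma> (lift 0 (inst k u t) \<cdot> Bnd 0) \<Rrightarrow> inst k u' t'"
    by (intro par.par_eta par_eta)
  then show ?case by (simp add: lift_inst_le)
qed (auto intro: par_App)

lemma lift_eq_App: "lift k t = a \<cdot> b \<longleftrightarrow> (\<exists>a' b'. t = a' \<cdot> b' \<and> a = lift k a' \<and> b = lift k b')"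
  by (cases t) auto

lemma lift_eq_Lam: "lift k t = Lam \<sigma> a \<longleftrightarrow> (\<exists>a'. t = Lam \<sigma> a' \<and> a = lift (Suc k) a')"
  by (cases t) auto

text \<open>The ranges of two liftings meet exactly in the terms lifted twice, a pullback property
  that is checked on indices. It recognises eta-redexes underneath a lift.\<close>

lemma lift_Suc_eq_lift:
  "i \<le> k \<Longrightarrow> lift (Suc k) t = lift i u \<Longrightarrow> \<exists>v. t = lift i v \<and> u = lift k v"
proof (induction t arbitrary: i k u)
  case (Bnd n)
  \<comment> \<open>The witness is the preimage of \<open>Bnd n\<close> under \<open>lift i\<close>;
    the assumption excludes \<open>n = i\<close>, the index that \<open>lift i\<close>
    skips.\<close>
  then show ?case
    by (cases u) (auto intro!: exI[of _ "Bnd (if n < i then n else n - 1)"] split: if_splits)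
next
  case (App t1 t2)
  from App.prems obtain u1 u2 where u: "u = u1 \<cdot> u2" "lift (Suc k) t1 = lift i u1"
    "lift (Suc k) t2 = lift i u2"
    by (metis lift_eq_App lift.simps(4))
  from App.IH(1)[OF App.prems(1) u(2)] App.IH(2)[OF App.prems(1) u(3)] u(1)
  show ?case by (metis lift.simps(4))
next
  case (Lam \<sigma> t)
  from Lam.prems obtain u1 where u: "u = Lam \<sigma> u1" "lift (Suc (Suc k)) t = lift (Suc i) u1"
    by (metis lift_eq_Lam lift.simps(5))
  from Lam.IH[OF _ u(2)] Lam.prems(1) u(1) show ?case by (metis Suc_le_mono lift.simps(5))
next
  case (Con c)
  then show ?case by (cases u) (auto intro!: exI[of _ "Con c"])
next
  case (Var x \<tau>)
  then show ?case by (cases u) (auto intro!: exI[of _ "Var x \<tau>"])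
qed

lemma lift_eq_eta_redex:
  "lift (Suc k) t = lift 0 u \<cdot> Bnd 0 \<longleftrightarrow> (\<exists>v. t = lift 0 v \<cdot> Bnd 0 \<and> u = lift k v)"
proof
  assume "lift (Suc k) t = lift 0 u \<cdot> Bnd 0"
  then obtain a b where t: "t = a \<cdot> b" "lift (Suc k) a = lift 0 u" "lift (Suc k) b = Bnd 0"
    by (metis lift_eq_App)
  moreover have "b = Bnd 0" using t(3) by (cases b) (auto split: if_splits)
  ultimately show "\<exists>v. t = lift 0 v \<cdot> Bnd 0 \<and> u = lift k v"
    using lift_Suc_eq_lift[of 0 k a u] by auto
qed (auto simp: lift_lift)

text \<open>Reduction creates no new indices, so an index missing from a term stays missing. Hence
  an eta-redex remains one when its function part reduces.\<close>

lemma par_lift_inv: "lift k t \<Rrightarrow> v \<Longrightarrow> \<exists>t'. v = lift k t' \<and> t \<Rrightarrow> t'"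
proof (induction "lift k t" v arbitrary: k t rule: par.induct)
  case (par_Con c)
  then show ?case by (auto intro!: exI[of _ "Con c"])
next
  case (par_Var x \<tau>)
  then show ?case by (auto intro!: exI[of _ "Var x \<tau>"])
next
  case (par_Bnd n)
  then show ?case by (metis par_refl)
next
  case (par_App a a' b b')
  then obtain a1 b1 where t: "t = a1 \<cdot> b1" "a = lift k a1" "b = lift k b1"
    by (metis lift_eq_App)
  with par_App.hyps(2)[OF t(2)] par_App.hyps(4)[OF t(3)] show ?case
    by (metis lift.simps(4) par.par_App)
next
  case (par_Lam a a' \<sigma>)
  then obtain a1 where t: "t = Lam \<sigma> a1" "a = lift (Suc k) a1" by (metis lift_eq_Lam)
  with par_Lam.hyps(2)[OF t(2)] show ?case by (metis lift.simps(5) par.par_Lam)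
next
  case (par_beta a a' b b' \<sigma>)
  then obtain a1 b1 where t: "t = Lam \<sigma> a1 \<cdot> b1" "a = lift (Suc k) a1" "b = lift k b1"
    by (metis lift_eq_App lift_eq_Lam)
  with par_beta.hyps(2)[OF t(2)] par_beta.hyps(4)[OF t(3)] show ?case
    by (metis lift_inst par.par_beta zero_le)
next
  case (par_eta a a' \<sigma>)
  then obtain t1 where t1: "t = Lam \<sigma> t1" "lift (Suc k) t1 = lift 0 a \<cdot> Bnd 0"
    by (metis lift_eq_Lam)
  then obtain w where w: "t1 = lift 0 w \<cdot> Bnd 0" "a = lift k w" by (metis lift_eq_eta_redex)
  with par_eta.hyps(2)[OF w(2)] t1 show ?case by (auto intro: par.par_eta)
qed

lemma size_lift [simp]: "size (lift k t) = size t"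
  by (induction t arbitrary: k) auto

text \<open>Complete development in the style of Takahashi: all beta-redexes of the term are contracted,
  and an abstraction that is an eta-redex is contracted instead of an inner beta-redex.\<close>

function dev :: "tm \<Rightarrow> tm" where
  "dev (Con c) = Con c"
| "dev (Var x \<tau>) = Var x \<tau>"
| "dev (Bnd n) = Bnd n"
| "dev (t \<cdot> u) = (case t of Lam \<sigma> a \<Rightarrow> inst 0 (dev u) (dev a) | _ \<Rightarrow> dev t \<cdot> dev u)"
| "dev (Lam \<sigma> t) = (if \<exists>a. t = lift 0 a \<cdot> Bnd 0 then dev (THE a. t = lift 0 a \<cdot> Bnd 0)
      else Lam \<sigma> (dev t))"
  by pat_completeness auto
termination
  by (relation "measure size") auto

lemma dev_App:
  "dev (Lam \<sigma> a \<cdot> u) = inst 0 (dev u) (dev a)"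
  "\<nexists>\<sigma> a. t = Lam \<sigma> a \<Longrightarrow> dev (t \<cdot> u) = dev t \<cdot> dev u"
  by (auto split: tm.split)

lemma dev_Lam:
  "dev (Lam \<sigma> (lift 0 a \<cdot> Bnd 0)) = dev a"
  "\<nexists>a. t = lift 0 a \<cdot> Bnd 0 \<Longrightarrow> dev (Lam \<sigma> t) = Lam \<sigma> (dev t)"
  by auto

declare dev.simps(4,5) [simp del]

lemma dev_lift: "dev (lift k t) = lift k (dev t)"
proof (induction t arbitrary: k rule: measure_induct_rule[of size])
  case (less t)
  show ?case
  proof (cases t)
    case (App a b)
    show ?thesis
    proof (cases "\<exists>\<sigma> c. a = Lam \<sigma> c")
      case True
      then obtain \<sigma> c where a: "a = Lam \<sigma> c" by blast
      show ?thesis using less[of c] less[of b] by (simp add: App a dev_App lift_inst)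
    next
      case False
      then have "\<nexists>\<sigma> c. lift k a = Lam \<sigma> c" by (simp add: lift_eq_Lam)
      with False less[of a] less[of b] show ?thesis by (simp add: App dev_App)
    qed
  next
    case (Lam \<sigma> a)
    show ?thesis
    proof (cases "\<exists>c. a = lift 0 c \<cdot> Bnd 0")
      case True
      then obtain c where a: "a = lift 0 c \<cdot> Bnd 0" by blast
      show ?thesis using less[of c] by (simp add: Lam a lift_lift dev_Lam)
    next
      case False
      then have "\<nexists>c. lift (Suc k) a = lift 0 c \<cdot> Bnd 0" by (simp add: lift_eq_eta_redex)
      with False less[of a] show ?thesis by (simp add: Lam dev_Lam)
    qed
  qed auto
qed

text \<open>Every parallel step can be completed to \<open>dev t\<close>, which gives the diamond
  property. Typing is essential: an eta-redex annotated with \<sigma> around an abstraction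
  annotated with \<rho> goes to an abstraction over \<rho> by eta and to one over \<sigma> by the
  inner beta-step, and only typing makes the annotations equal.\<close>

lemma par_dev: "has_type \<Delta> t \<tau> \<Longrightarrow> t \<Rrightarrow> v \<Longrightarrow> v \<Rrightarrow> dev t"
proof (induction t arbitrary: \<Delta> \<tau> v rule: measure_induct_rule[of size])
  case (less t)
  show ?case
  proof (cases t)
    case t: (App a b)
    from less.prems(1)[unfolded t has_type_App] obtain \<sigma>'
      where ty: "has_type \<Delta> a (\<sigma>' \<rightarrow> \<tau>)" "has_type \<Delta> b \<sigma>'" by blast
    have b: "b' \<Rrightarrow> dev b" if "b \<Rrightarrow> b'" for b' using less.IH[OF _ ty(2) that] t by simp
    show ?thesis
    proof (cases "\<exists>\<sigma> c. a = Lam \<sigma> c")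
      case True
      then obtain \<sigma> c where a: "a = Lam \<sigma> c" by blast
      with ty(1) have tc: "has_type (\<sigma> # \<Delta>) c \<tau>" by auto
      have c: "c' \<Rrightarrow> dev c" if "c \<Rrightarrow> c'" for c' using less.IH[OF _ tc that] t a by simp
      from less.prems(2)[unfolded t a] show ?thesis
      proof (cases rule: par_AppE)
        case (App f b')
        note v = App(1) and b' = App(3)
        from App(2) show ?thesis
        proof (cases rule: par_LamE)
          case (Lam c')
          then show ?thesis using v b' b c by (simp add: t a dev_App par_beta)
        next
          case (eta d)
          have td: "has_type \<Delta> d (\<sigma>' \<rightarrow> \<tau>)"
            using ty(1) a eta(1) by (auto split: option.splits ty.splits if_splits)
          show ?thesis
          proof (cases "\<exists>\<rho> e. d = Lam \<rho> e")
            case True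
            then obtain \<rho> e where d: "d = Lam \<rho> e" by blast
            \<comment> \<open>The eta-step exposes a new beta-redex \<open>d \<cdot> b\<close>. It
              is smaller than \<open>t\<close> and has the same complete development, by
              \<open>inst_Bnd_lift\<close>.\<close>
            have "f \<cdot> b' \<Rrightarrow> dev (d \<cdot> b)"
            proof (rule less.IH)
              show "size (d \<cdot> b) < size t" using t a eta by simp
              show "has_type \<Delta> (d \<cdot> b) \<tau>" using td ty(2) by simp
              show "d \<cdot> b \<Rrightarrow> f \<cdot> b'" using eta b' by (intro par_App)
            qed
            then show ?thesis
              by (simp add: t a eta(1) d dev_App dev_lift inst_Bnd_lift v)
          next
            case False
            then have *: "\<nexists>\<rho> e. lift 0 d = Lam \<rho> e" by (simp add: lift_eq_Lam)
            have "f \<Rrightarrow> dev d" using less.IH[OF _ td eta(2)] t a eta(1) by simp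
            then show ?thesis using b[OF b']
              by (simp add: t a eta(1) dev_App * dev_lift v par_App)
          qed
        qed
      next
        case (beta \<rho> e c' b')
        then show ?thesis using b c by (simp add: t a dev_App par_inst)
      qed
    next
      case False
      have a: "a' \<Rrightarrow> dev a" if "a \<Rrightarrow> a'" for a' using less.IH[OF _ ty(1) that] t by simp
      from less.prems(2)[unfolded t] show ?thesis
        by (cases rule: par_AppE) (use False a b in \<open>auto simp: t dev_App intro: par_App\<close>)
    qed
  next
    case t: (Lam \<sigma> a)
    from less.prems(1)[unfolded t has_type_Lam] obtain \<tau>'
      where ty: "\<tau> = (\<sigma> \<rightarrow> \<tau>')" "has_type (\<sigma> # \<Delta>) a \<tau>'" by blast
    show ?thesis
    proof (cases "\<exists>c. a = lift 0 c \<cdot> Bnd 0")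
      case True
      then obtain c where a: "a = lift 0 c \<cdot> Bnd 0" by blast
      have tc: "has_type \<Delta> c (\<sigma> \<rightarrow> \<tau>')" using ty(2) a by (auto split: option.splits ty.splits if_splits)
      have c: "c' \<Rrightarrow> dev c" if "c \<Rrightarrow> c'" for c' using less.IH[OF _ tc that] t a by simp
      from less.prems(2)[unfolded t] show ?thesis
      proof (cases rule: par_LamE)
        case (Lam a')
        note v = Lam(1)
        from Lam(2)[unfolded a] show ?thesis
        proof (cases rule: par_AppE)
          case (App g u)
          then have "u = Bnd 0" by auto
          moreover from par_lift_inv[OF App(2)] obtain c' where "g = lift 0 c'" "c \<Rrightarrow> c'" by blast
          ultimately show ?thesis using c by (simp add: t a dev_Lam v App(1) par_eta)
        next
          case (beta \<rho> d d' u)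
          then obtain e where c': "c = Lam \<rho> e" "d = lift (Suc 0) e"
            by (auto simp: lift_eq_Lam)
          have u: "u = Bnd 0" using beta by auto
          from par_lift_inv[OF beta(3)[unfolded c'(2)]] obtain e'
            where e': "d' = lift (Suc 0) e'" "e \<Rrightarrow> e'" by blast
          have "\<rho> = \<sigma>" using tc c' by auto
          moreover have "dev t = dev c" by (simp add: t a dev_Lam)
          ultimately show ?thesis using c[of "Lam \<sigma> e'"] e' u c' beta(2)
            by (simp add: v inst_Bnd_lift par_Lam)
        qed
      next
        case (eta c')
        then show ?thesis using a c by (simp add: t dev_Lam)
      qed
    next
      case False
      have "a' \<Rrightarrow> dev a" if "a \<Rrightarrow> a'" for a' using less.IH[OF _ ty(2) that] t by simp
      with less.prems(2) False show ?thesis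
        by (auto simp: t dev_Lam elim!: par_LamE intro: par_Lam)
    qed
  qed (use less.prems in auto)
qed

section \<open>Church-Rosser property of typed conversion\<close>

lemma par_has_type: "t \<Rrightarrow> u \<Longrightarrow> has_type \<Delta> t \<tau> \<Longrightarrow> has_type \<Delta> u \<tau>"
proof (induction arbitrary: \<Delta> \<tau> rule: par.induct)
  case (par_App t t' u u')
  then show ?case by (simp only: has_type_App) blast
next
  case (par_beta t t' u u' \<sigma>)
  then have "has_type (\<sigma> # \<Delta>) t \<tau>" "has_type \<Delta> u \<sigma>"
    by (auto split: option.splits ty.splits if_splits)
  with par_beta.IH have "has_type (\<sigma> # \<Delta>) t' \<tau>" "has_type \<Delta> u' \<sigma>" by blast+
  then show ?case by (simp add: type_of_inst_0)
next
  case (par_eta t t' \<sigma>)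
  then have "has_type \<Delta> t \<tau>" by (auto split: option.splits ty.splits if_splits)
  then show ?case by (rule par_eta.IH)
qed auto

lemma par_conv: "t \<Rrightarrow> u \<Longrightarrow> has_type \<Delta> t \<tau> \<Longrightarrow> conv \<Delta> t u \<tau>"
proof (induction arbitrary: \<Delta> \<tau> rule: par.induct)
  case (par_App t t' u u')
  then show ?case unfolding has_type_App by (blast intro: conv_app)
next
  case (par_Lam t t' \<sigma>)
  then show ?case unfolding has_type_Lam by (blast intro: conv_lam)
next
  case (par_beta t t' u u' \<sigma>)
  then have ty: "has_type (\<sigma> # \<Delta>) t \<tau>" "has_type \<Delta> u \<sigma>"
    by (auto split: option.splits ty.splits if_splits)
  then have "conv \<Delta> (Lam \<sigma> t \<cdot> u) (Lam \<sigma> t' \<cdot> u') \<tau>"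
    by (intro conv_app[of _ _ _ \<sigma>] conv_lam par_beta.IH)
  moreover have "conv \<Delta> (Lam \<sigma> t' \<cdot> u') (inst 0 u' t') \<tau>"
    using par_has_type[OF par_beta.hyps(1) ty(1)] par_has_type[OF par_beta.hyps(2) ty(2)]
    by (rule conv_beta)
  ultimately show ?case by (rule conv_trans)
next
  case (par_eta t t' \<sigma>)
  then have ty: "has_type \<Delta> t \<tau>" "\<exists>\<tau>'. \<tau> = (\<sigma> \<rightarrow> \<tau>')"
    by (auto split: option.splits ty.splits if_splits)
  then show ?case using par_eta.IH[OF ty(1)] by (blast intro: conv_trans conv_eta)
qed (auto intro: conv_refl)

text \<open>Typing is part of the relation because the diamond property is available only for
  typable terms.\<close>

definition tpar :: "ty list \<Rightarrow> ty \<Rightarrow> tm \<Rightarrow> tm \<Rightarrow> bool" where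
  "tpar \<Delta> \<tau> t u \<longleftrightarrow> has_type \<Delta> t \<tau> \<and> t \<Rrightarrow> u"

lemma confluentp_tpar: "confluentp (tpar \<Delta> \<tau>)"
proof (rule strong_confluentp_imp_confluentp, rule strong_confluentpI)
  fix t u v assume *: "tpar \<Delta> \<tau> t u" "tpar \<Delta> \<tau> t v"
  then have "tpar \<Delta> \<tau> u (dev t)" "tpar \<Delta> \<tau> v (dev t)"
    by (auto simp: tpar_def par_has_type intro: par_dev)
  then show "\<exists>w. (tpar \<Delta> \<tau>)\<^sup>*\<^sup>* u w \<and> (tpar \<Delta> \<tau>)\<^sup>=\<^sup>= v w" by blast
qed

lemma tpars_has_type: "(tpar \<Delta> \<tau>)\<^sup>*\<^sup>* t u \<Longrightarrow> has_type \<Delta> t \<tau> \<Longrightarrow> has_type \<Delta> u \<tau>"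
  by (induction rule: rtranclp_induct) (auto simp: tpar_def par_has_type)

lemma tpars_conv: "(tpar \<Delta> \<tau>)\<^sup>*\<^sup>* t u \<Longrightarrow> has_type \<Delta> t \<tau> \<Longrightarrow> conv \<Delta> t u \<tau>"
  by (induction rule: rtranclp_induct) (auto simp: tpar_def intro: conv_refl conv_trans par_conv)

lemma tpars_map:
  assumes "(tpar \<Delta> \<tau>)\<^sup>*\<^sup>* t u" "\<And>a b. tpar \<Delta> \<tau> a b \<Longrightarrow> tpar \<Delta>' \<tau>' (f a) (f b)"
  shows "(tpar \<Delta>' \<tau>')\<^sup>*\<^sup>* (f t) (f u)"
  using assms(1) by (induction rule: rtranclp_induct) (auto intro: rtranclp.rtrancl_into_rtrancl assms(2))

text \<open>Only transitivity calls on confluence; for the congruence rules the reductions of the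
  parts are run one after the other.\<close>

lemma conv_joinable: "conv \<Delta> t u \<tau> \<Longrightarrow> \<exists>w. (tpar \<Delta> \<tau>)\<^sup>*\<^sup>* t w \<and> (tpar \<Delta> \<tau>)\<^sup>*\<^sup>* u w"
proof (induction rule: conv.induct)
  case (conv_trans \<Delta> t u \<tau> v)
  then show ?case by (meson confluentp_tpar confluentpD rtranclp_trans)
next
  case (conv_app \<Delta> t t' \<sigma> \<tau> u u')
  then obtain v w where v: "(tpar \<Delta> (\<sigma> \<rightarrow> \<tau>))\<^sup>*\<^sup>* t v" "(tpar \<Delta> (\<sigma> \<rightarrow> \<tau>))\<^sup>*\<^sup>* t' v"
    and w: "(tpar \<Delta> \<sigma>)\<^sup>*\<^sup>* u w" "(tpar \<Delta> \<sigma>)\<^sup>*\<^sup>* u' w" by blast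
  have ty: "has_type \<Delta> t (\<sigma> \<rightarrow> \<tau>)" "has_type \<Delta> t' (\<sigma> \<rightarrow> \<tau>)" "has_type \<Delta> u \<sigma>" "has_type \<Delta> u' \<sigma>"
    using conv_app conv_has_type by blast+
  have tv: "has_type \<Delta> v (\<sigma> \<rightarrow> \<tau>)" using ty v tpars_has_type by blast
  have 1: "(tpar \<Delta> \<tau>)\<^sup>*\<^sup>* (a \<cdot> b) (v \<cdot> b)" if "(tpar \<Delta> (\<sigma> \<rightarrow> \<tau>))\<^sup>*\<^sup>* a v" "has_type \<Delta> b \<sigma>" for a b
    using that(1) by (rule tpars_map[where f = "\<lambda>x. x \<cdot> b"]) (use that in \<open>auto simp: tpar_def intro: par_App\<close>)
  have 2: "(tpar \<Delta> \<tau>)\<^sup>*\<^sup>* (v \<cdot> a) (v \<cdot> b)" if "(tpar \<Delta> \<sigma>)\<^sup>*\<^sup>* a b" for a b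
    using that(1) by (rule tpars_map[where f = "\<lambda>x. v \<cdot> x"]) (use tv in \<open>auto simp: tpar_def intro: par_App\<close>)
  show ?case using 1[OF v(1) ty(3)] 1[OF v(2) ty(4)] 2[OF w(1)] 2[OF w(2)]
    by (meson rtranclp_trans)
next
  case (conv_lam \<sigma> \<Delta> t t' \<tau>)
  then obtain v where "(tpar (\<sigma> # \<Delta>) \<tau>)\<^sup>*\<^sup>* t v" "(tpar (\<sigma> # \<Delta>) \<tau>)\<^sup>*\<^sup>* t' v" by blast
  then have "(tpar \<Delta> (\<sigma> \<rightarrow> \<tau>))\<^sup>*\<^sup>* (Lam \<sigma> t) (Lam \<sigma> v)" "(tpar \<Delta> (\<sigma> \<rightarrow> \<tau>))\<^sup>*\<^sup>* (Lam \<sigma> t') (Lam \<sigma> v)"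
    by - (erule tpars_map[where f = "Lam \<sigma>"], simp add: tpar_def par_Lam)+
  then show ?case by (intro exI conjI)
next
  case (conv_beta \<sigma> \<Delta> t \<tau> u)
  then have "tpar \<Delta> \<tau> (Lam \<sigma> t \<cdot> u) (inst 0 u t)" by (auto simp: tpar_def intro: par_beta)
  then show ?case by (intro exI conjI) (erule r_into_rtranclp, rule rtranclp.rtrancl_refl)
next
  case (conv_eta \<Delta> t \<sigma> \<tau>)
  then have "tpar \<Delta> (\<sigma> \<rightarrow> \<tau>) (Lam \<sigma> (lift 0 t \<cdot> Bnd 0)) t" by (auto simp: tpar_def intro: par_eta)
  then show ?case by (intro exI conjI) (erule r_into_rtranclp, rule rtranclp.rtrancl_refl)
next
  case (conv_sym \<Delta> t u \<tau>)
  then show ?case by (elim exE conjE) (intro exI conjI)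
next
  case (conv_refl \<Delta> t \<tau>)
  show ?case by (rule exI[of _ t]) simp
qed

text \<open>A constant at the head blocks contraction at the root forever, so the head and the
  number of arguments are invariants of conversion.\<close>

primrec rigid :: "tm \<Rightarrow> bool" where
  "rigid (Con c) = True"
| "rigid (Var x \<tau>) = False"
| "rigid (Bnd n) = False"
| "rigid (t \<cdot> u) = rigid t"
| "rigid (Lam \<sigma> t) = False"

lemma par_rigid_App:
  "t \<cdot> u \<Rrightarrow> w \<Longrightarrow> rigid t \<Longrightarrow> \<exists>t' u'. w = t' \<cdot> u' \<and> t \<Rrightarrow> t' \<and> u \<Rrightarrow> u'"
  by (erule par_AppE) auto

lemma par_rigid: "t \<Rrightarrow> w \<Longrightarrow> rigid t \<Longrightarrow> rigid w"
proof (induction t arbitrary: w)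
  case (App t u)
  then show ?case using par_rigid_App[OF App.prems(1)] by auto
qed auto

lemma tpars_rigid_App:
  assumes "(tpar \<Delta> \<tau>)\<^sup>*\<^sup>* (t \<cdot> u) w" "rigid t" "has_type \<Delta> t (\<sigma> \<rightarrow> \<tau>)" "has_type \<Delta> u \<sigma>"
  shows "\<exists>t' u'. w = t' \<cdot> u' \<and> rigid t' \<and> (tpar \<Delta> (\<sigma> \<rightarrow> \<tau>))\<^sup>*\<^sup>* t t' \<and> (tpar \<Delta> \<sigma>)\<^sup>*\<^sup>* u u'"
  using assms(1)
proof (induction rule: rtranclp_induct)
  case base
  then show ?case using assms by blast
next
  case (step v w)
  then obtain t' u' where v: "v = t' \<cdot> u'" "rigid t'" "(tpar \<Delta> (\<sigma> \<rightarrow> \<tau>))\<^sup>*\<^sup>* t t'"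
    "(tpar \<Delta> \<sigma>)\<^sup>*\<^sup>* u u'" by blast
  with step.hyps(2) obtain t'' u'' where w: "w = t'' \<cdot> u''" "t' \<Rrightarrow> t''" "u' \<Rrightarrow> u''"
    by (auto simp: tpar_def dest: par_rigid_App)
  moreover have "rigid t''" using w(2) v(2) par_rigid by blast
  moreover have "tpar \<Delta> (\<sigma> \<rightarrow> \<tau>) t' t''" "tpar \<Delta> \<sigma> u' u''"
    using tpars_has_type[OF v(3) assms(3)] tpars_has_type[OF v(4) assms(4)] w
    by (auto simp: tpar_def)
  ultimately show ?case using v by (blast intro: rtranclp.rtrancl_into_rtrancl)
qed

lemma tpars_Con: "(tpar \<Delta> \<tau>)\<^sup>*\<^sup>* (Con c) w \<Longrightarrow> w = Con c"
  by (induction rule: rtranclp_induct) (auto simp: tpar_def)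

text \<open>A common reduct of two rigid applications is reached argument by argument. Repeated use
  turns a conversion between constructor terms into conversions of their arguments, or refutes it;
  matching an atom against the clauses thus becomes simplification with
  \<open>conv_rigid\<close>.\<close>

lemma conv_rigid_App:
  assumes "rigid t" "rigid t'"
  shows "conv \<Delta> (t \<cdot> u) (t' \<cdot> u') \<tau> \<longleftrightarrow> (\<exists>\<sigma>. conv \<Delta> t t' (\<sigma> \<rightarrow> \<tau>) \<and> conv \<Delta> u u' \<sigma>)"
proof
  assume *: "conv \<Delta> (t \<cdot> u) (t' \<cdot> u') \<tau>"
  from conv_has_type[OF *] obtain \<sigma> \<sigma>' where
    ty: "has_type \<Delta> t (\<sigma> \<rightarrow> \<tau>)" "has_type \<Delta> u \<sigma>" "has_type \<Delta> t' (\<sigma>' \<rightarrow> \<tau>)" "has_type \<Delta> u' \<sigma>'"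
    unfolding has_type_App by blast
  from conv_joinable[OF *] obtain w where w: "(tpar \<Delta> \<tau>)\<^sup>*\<^sup>* (t \<cdot> u) w" "(tpar \<Delta> \<tau>)\<^sup>*\<^sup>* (t' \<cdot> u') w"
    by blast
  from tpars_rigid_App[OF w(1) assms(1) ty(1,2)] tpars_rigid_App[OF w(2) assms(2) ty(3,4)]
  obtain a b where ab: "(tpar \<Delta> (\<sigma> \<rightarrow> \<tau>))\<^sup>*\<^sup>* t a" "(tpar \<Delta> \<sigma>)\<^sup>*\<^sup>* u b"
      "(tpar \<Delta> (\<sigma>' \<rightarrow> \<tau>))\<^sup>*\<^sup>* t' a" "(tpar \<Delta> \<sigma>')\<^sup>*\<^sup>* u' b" by auto
  have "\<sigma> = \<sigma>'"
    using tpars_has_type[OF ab(1) ty(1)] tpars_has_type[OF ab(3) ty(3)] by simp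
  with tpars_conv[OF ab(1) ty(1)] tpars_conv[OF ab(2) ty(2)]
    tpars_conv[OF ab(3) ty(3)] tpars_conv[OF ab(4) ty(4)]
  show "\<exists>\<sigma>. conv \<Delta> t t' (\<sigma> \<rightarrow> \<tau>) \<and> conv \<Delta> u u' \<sigma>" by (metis conv_trans conv_sym)
qed (blast intro: conv_app)

lemma conv_Con: "conv \<Delta> (Con c) (Con c') \<tau> \<longleftrightarrow> c = c' \<and> con_ok c \<and> \<tau> = cty c"
proof
  assume *: "conv \<Delta> (Con c) (Con c') \<tau>"
  from conv_joinable[OF *] have "c = c'" by (auto dest!: tpars_Con)
  with conv_has_type[OF *] show "c = c' \<and> con_ok c \<and> \<tau> = cty c" by (auto split: if_splits)
qed (auto intro: conv_refl)

lemma not_conv_Con_App: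
  assumes "rigid t"
  shows "\<not> conv \<Delta> (Con c) (t \<cdot> u) \<tau>" "\<not> conv \<Delta> (t \<cdot> u) (Con c) \<tau>"
proof -
  show *: "\<not> conv \<Delta> (Con c) (t \<cdot> u) \<tau>"
  proof
    assume *: "conv \<Delta> (Con c) (t \<cdot> u) \<tau>"
    from conv_has_type[OF *] obtain \<sigma> where ty: "has_type \<Delta> t (\<sigma> \<rightarrow> \<tau>)" "has_type \<Delta> u \<sigma>"
      unfolding has_type_App by blast
    from conv_joinable[OF *] obtain w where w: "(tpar \<Delta> \<tau>)\<^sup>*\<^sup>* (Con c) w" "(tpar \<Delta> \<tau>)\<^sup>*\<^sup>* (t \<cdot> u) w"
      by blast
    from tpars_rigid_App[OF w(2) assms ty] tpars_Con[OF w(1)] show False by blast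
  qed
  show "\<not> conv \<Delta> (t \<cdot> u) (Con c) \<tau>"
  proof
    assume "conv \<Delta> (t \<cdot> u) (Con c) \<tau>"
    then have "conv \<Delta> (Con c) (t \<cdot> u) \<tau>" by (rule conv_sym)
    with * show False by contradiction
  qed
qed

lemmas conv_rigid = conv_rigid_App conv_Con not_conv_Con_App

section \<open>Substitution\<close>

lemma sub_has_type: "is_subst \<theta> \<Longrightarrow> has_type \<Delta> t \<tau> \<Longrightarrow> has_type \<Delta> (sub \<theta> t) \<tau>"
proof (induction t arbitrary: \<Delta> \<tau>)
  case (Var x \<sigma>)
  then show ?case by (auto simp: is_subst_def intro: has_type_weaken split: if_splits)
next
  case (App t u)
  then show ?case unfolding sub.simps has_type_App by blast
next
  case (Lam \<sigma> t)
  then show ?case unfolding sub.simps has_type_Lam by blast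
qed auto

lemma sub_lift:
  "is_subst \<theta> \<Longrightarrow> has_type \<Delta> t \<tau> \<Longrightarrow> sub \<theta> (lift k t) = lift k (sub \<theta> t)"
proof (induction t arbitrary: \<Delta> \<tau> k)
  case (Var x \<sigma>)
  then have "has_type [] (\<theta> x \<sigma>) \<sigma>" by (auto simp: is_subst_def split: if_splits)
  then show ?case using lift_has_type[of "[]"] by simp
next
  case (App t u)
  from App.prems(2) App.IH[OF App.prems(1)] show ?case unfolding has_type_App by auto
next
  case (Lam \<sigma> t)
  from Lam.prems(2) Lam.IH[OF Lam.prems(1)] show ?case unfolding has_type_Lam by auto
qed auto

lemma sub_inst:
  "is_subst \<theta> \<Longrightarrow> has_type \<Delta> t \<tau> \<Longrightarrow> has_type \<Delta>' u \<sigma> \<Longrightarrow>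
   sub \<theta> (inst k u t) = inst k (sub \<theta> u) (sub \<theta> t)"
proof (induction t arbitrary: \<Delta> \<tau> \<Delta>' k u)
  case (Var x \<rho>)
  then have "has_type [] (\<theta> x \<rho>) \<rho>" by (auto simp: is_subst_def split: if_splits)
  then show ?case using inst_has_type[of "[]"] by simp
next
  case (App t1 t2)
  from App.prems(2) App.IH[OF App.prems(1) _ App.prems(3)] show ?case
    unfolding has_type_App by auto
next
  case (Lam \<rho> t)
  have "has_type (\<rho> # \<Delta>') (lift 0 u) \<sigma>" using Lam.prems(3) by simp
  from Lam.prems(2) Lam.IH[OF Lam.prems(1) _ this] show ?case
    using sub_lift[OF Lam.prems(1,3)] unfolding has_type_Lam by auto
qed auto

lemma sub_Var [simp]: "sub Var t = t"
  by (induction t) auto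

lemma sub_sub: "sub \<theta> (sub \<rho> t) = sub (\<lambda>x \<tau>. sub \<theta> (\<rho> x \<tau>)) t"
  by (induction t) auto

lemma sub_atom: "sub \<theta> (atom p ts) = atom p (map (sub \<theta>) ts)"
  unfolding atom_def by (induction ts rule: rev_induct) auto

lemma inst_atom: "inst k u (atom p ts) = atom p (map (inst k u) ts)"
  unfolding atom_def by (induction ts rule: rev_induct) auto

lemma finite_fv [simp, intro]: "finite (fv t)"
  by (induction t) auto

lemma ex_fresh: "finite V \<Longrightarrow> \<exists>y. (y :: string, \<tau> :: ty) \<notin> V"
proof -
  assume "finite V"
  then have "finite (fst ` V)" by simp
  then obtain y where "y \<notin> fst ` V"
    using ex_new_if_finite infinite_UNIV_listI by blast
  then show ?thesis by force
qed

section \<open>Identity, weakening and natural deduction\<close>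

text \<open>Identity is derived by recursion on the formula, for which a formula has to exhibit its
  outermost connective; this class avoids normalization. The list types the bound variables.\<close>

inductive gd :: "ty list \<Rightarrow> tm \<Rightarrow> bool" where
  gd_atom: "has_type \<Delta> (atom p ts) To \<Longrightarrow> gd \<Delta> (atom p ts)"
| gd_bot: "gd \<Delta> \<^bold>\<bottom>"
| gd_top: "gd \<Delta> \<^bold>\<top>"
| gd_and: "gd \<Delta> A \<Longrightarrow> gd \<Delta> B \<Longrightarrow> gd \<Delta> (A \<^bold>\<and> B)"
| gd_or: "gd \<Delta> A \<Longrightarrow> gd \<Delta> B \<Longrightarrow> gd \<Delta> (A \<^bold>\<or> B)"
| gd_imp: "gd \<Delta> A \<Longrightarrow> gd \<Delta> B \<Longrightarrow> gd \<Delta> (A \<^bold>\<supset> B)"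
| gd_all: "ofree \<tau> \<Longrightarrow> gd (\<tau> # \<Delta>) A \<Longrightarrow> gd \<Delta> (All \<tau> (Lam \<tau> A))"
| gd_ex: "ofree \<tau> \<Longrightarrow> gd (\<tau> # \<Delta>) A \<Longrightarrow> gd \<Delta> (Ex \<tau> (Lam \<tau> A))"

lemma gd_pred:
  "has_type \<Delta> (Con (Pred p) \<cdot> a) To \<Longrightarrow> gd \<Delta> (Con (Pred p) \<cdot> a)"
  "has_type \<Delta> (Con (Pred p) \<cdot> a \<cdot> b) To \<Longrightarrow> gd \<Delta> (Con (Pred p) \<cdot> a \<cdot> b)"
  "has_type \<Delta> (Con (Pred p) \<cdot> a \<cdot> b \<cdot> c) To \<Longrightarrow> gd \<Delta> (Con (Pred p) \<cdot> a \<cdot> b \<cdot> c)"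
  using gd_atom[of \<Delta> p "[a]"] gd_atom[of \<Delta> p "[a, b]"] gd_atom[of \<Delta> p "[a, b, c]"]
  by (simp_all add: atom_def del: type_of.simps)

lemma gd_has_type: "gd \<Delta> A \<Longrightarrow> has_type \<Delta> A To"
  by (induction rule: gd.induct) auto

lemma gd_formula: "gd [] A \<Longrightarrow> formula A"
  by (simp add: formula_def gd_has_type)

lemma gd_inst: "gd (\<Delta> @ [\<sigma>]) A \<Longrightarrow> has_type [] t \<sigma> \<Longrightarrow> gd \<Delta> (inst (length \<Delta>) t A)"
proof (induction "\<Delta> @ [\<sigma>]" A arbitrary: \<Delta> rule: gd.induct)
  case (gd_atom p ts)
  have "has_type (\<Delta> @ []) t \<sigma>" using gd_atom.prems by (rule has_type_weaken)
  from type_of_inst[OF this] gd_atom.hyps have "has_type \<Delta> (inst (length \<Delta>) t (atom p ts)) To"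
    by simp
  then show ?case by (simp add: inst_atom gd.gd_atom)
next
  case (gd_all \<tau> A)
  have "lift 0 t = t" using gd_all.prems by (rule lift_has_type) simp
  with gd_all.hyps(3)[of "\<tau> # \<Delta>"] gd_all.hyps(1) gd_all.prems show ?case by (simp add: gd.gd_all)
next
  case (gd_ex \<tau> A)
  have "lift 0 t = t" using gd_ex.prems by (rule lift_has_type) simp
  with gd_ex.hyps(3)[of "\<tau> # \<Delta>"] gd_ex.hyps(1) gd_ex.prems show ?case by (simp add: gd.gd_ex)
qed (simp_all add: gd.intros)

lemma gd_inst_0: "gd [\<sigma>] A \<Longrightarrow> has_type [] t \<sigma> \<Longrightarrow> gd [] (inst 0 t A)"
  using gd_inst[of "[]"] by simp

lemma gd_sub: "gd \<Delta> A \<Longrightarrow> is_subst \<theta> \<Longrightarrow> gd \<Delta> (sub \<theta> A)"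
proof (induction rule: gd.induct)
  case (gd_atom \<Delta> p ts)
  then show ?case using sub_has_type[of \<theta> \<Delta> "atom p ts" To] by (simp add: sub_atom gd.gd_atom)
qed (simp_all add: gd.intros)

inductive_cases gd_allE: "gd \<Delta> (All \<tau> B)"
inductive_cases gd_exE: "gd \<Delta> (Ex \<tau> B)"

lemma atom_neq_quant: "atom p ts \<noteq> All \<tau> B" "atom p ts \<noteq> Ex \<tau> B"
proof -
  \<comment> \<open>The recursor walks down the spine of applications to the head and returns the
    constant there, which for an atom is a predicate.\<close>
  have *: "\<exists>c. hd (rec_tm (\<lambda>c. [c]) (\<lambda>_ _. []) (\<lambda>_. []) (\<lambda>_ _ a _. a) (\<lambda>_ _ _. []) (atom p ts)) = Pred p"
    unfolding atom_def by (induction ts rule: rev_induct) auto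
  show "atom p ts \<noteq> All \<tau> B" "atom p ts \<noteq> Ex \<tau> B" using * by auto
qed

lemma gd_quant:
  "gd \<Delta> (All \<tau> (Lam \<tau> A)) \<longleftrightarrow> ofree \<tau> \<and> gd (\<tau> # \<Delta>) A"
  "gd \<Delta> (Ex \<tau> (Lam \<tau> A)) \<longleftrightarrow> ofree \<tau> \<and> gd (\<tau> # \<Delta>) A"
  by (auto simp: atom_neq_quant atom_neq_quant[symmetric] intro: gd.intros elim: gd_allE gd_exE)

lemma size_inst_Var: "size (inst k (Var y \<tau>) A) = size A"
  by (induction A arbitrary: k) auto

section \<open>Identity and the structural rules\<close>

lemma formulas_simps [simp]:
  "formulas {#}" "formulas (add_mset A \<Gamma>) \<longleftrightarrow> formula A \<and> formulas \<Gamma>"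
  "formulas (\<Gamma> + \<Gamma>') \<longleftrightarrow> formulas \<Gamma> \<and> formulas \<Gamma>'"
  by (auto simp: formulas_def)

lemma rel_mset_conv_refl: "formulas \<Gamma> \<Longrightarrow> rel_mset (\<lambda>A B. conv [] A B To) \<Gamma> \<Gamma>"
  by (rule multiset.rel_refl_strong) (auto simp: formulas_def formula_def intro: conv_refl)

lemma derives_convL:
  "derives D (add_mset A \<Gamma>) C \<Longrightarrow> formulas \<Gamma> \<Longrightarrow> formula C \<Longrightarrow> conv [] A B To \<Longrightarrow>
   derives D (add_mset B \<Gamma>) C"
  by (erule derives.conv) (auto intro: rel_mset_Plus rel_mset_conv_refl conv_refl simp: formula_def)

lemma derives_convR:
  "derives D \<Gamma> C \<Longrightarrow> formulas \<Gamma> \<Longrightarrow> conv [] C C' To \<Longrightarrow> derives D \<Gamma> C'"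
  by (erule derives.conv) (auto intro: rel_mset_conv_refl)

lemma finite_fvs [simp, intro]: "finite (fvs \<Gamma>)"
  by (simp add: fvs_def)

text \<open>Initial sequents are atomic, so compound formulas are decomposed on both sides. The
  measure is the size because a quantifier is opened with a variable, which leaves the size of the
  body unchanged.\<close>

lemma derives_id: "gd [] A \<Longrightarrow> formulas \<Gamma> \<Longrightarrow> derives D (add_mset A \<Gamma>) A"
proof (induction A arbitrary: \<Gamma> rule: measure_induct_rule[of size])
  case (less A)
  from less.prems(1) show ?case
  proof (cases rule: gd.cases)
    case (gd_atom p ts)
    then show ?thesis using less.prems(2) by (auto intro: derives.init simp: formula_def)
  next
    case gd_bot
    then show ?thesis using less.prems(2) by (auto intro: derives.botL simp: formula_def)
  next
    case gd_top
    then show ?thesis using less.prems(2) by (auto intro: derives.topR simp: formula_def)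
  next
    case (gd_and A1 A2)
    then show ?thesis using less.IH[of A1 \<Gamma>] less.IH[of A2 \<Gamma>] less.prems(2)
      by (auto intro!: derives.andR intro: derives.andL1 derives.andL2 gd_formula)
  next
    case (gd_or A1 A2)
    then show ?thesis using less.IH[of A1 \<Gamma>] less.IH[of A2 \<Gamma>] less.prems(2)
      by (auto intro!: derives.orL intro: derives.orR1 derives.orR2 gd_formula)
  next
    case (gd_imp A1 A2)
    have "derives D (add_mset (A1 \<^bold>\<supset> A2) (add_mset A1 \<Gamma>)) A2"
      using gd_imp less.IH[of A1 \<Gamma>] less.IH[of A2 "add_mset A1 \<Gamma>"] less.prems(2)
      by (auto intro!: derives.impL intro: gd_formula)
    then show ?thesis unfolding gd_imp(1) by (auto intro!: derives.impR simp: add_mset_commute)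
  next
    case (gd_all \<tau> B)
    obtain y where y: "(y, \<tau>) \<notin> fvs (add_mset A \<Gamma>) \<union> fv (Lam \<tau> B)"
      using ex_fresh[of "fvs (add_mset A \<Gamma>) \<union> fv (Lam \<tau> B)"] by auto
    have ty: "has_type [] (Var y \<tau>) \<tau>" using gd_all by simp
    have c: "conv [] (inst 0 (Var y \<tau>) B) (Lam \<tau> B \<cdot> Var y \<tau>) To"
      using gd_all ty by (intro conv_sym[OF conv_beta] gd_has_type)
    have B: "gd [] (inst 0 (Var y \<tau>) B)" using gd_all ty by (intro gd_inst_0)
    then have "derives D (add_mset (inst 0 (Var y \<tau>) B) \<Gamma>) (inst 0 (Var y \<tau>) B)"
      using gd_all less.prems(2) by (intro less.IH) (simp_all add: size_inst_Var)
    from derives_convL[OF this less.prems(2) gd_formula[OF B] c]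
    have "derives D (add_mset (Lam \<tau> B \<cdot> Var y \<tau>) \<Gamma>) (Lam \<tau> B \<cdot> Var y \<tau>)"
      using c conv_has_type[OF c] less.prems(2)
      by (intro derives_convR[OF _ _ c]) (auto simp: formula_def)
    then have "derives D (add_mset A \<Gamma>) (Lam \<tau> B \<cdot> Var y \<tau>)"
      unfolding gd_all(1) using less.prems(1) ty gd_all(1)
      by (intro derives.allL) (auto intro: gd_formula)
    then show ?thesis using y gd_formula[OF less.prems(1)] unfolding gd_all(1)
      by (intro derives.allR) auto
  next
    case (gd_ex \<tau> B)
    obtain y where y: "(y, \<tau>) \<notin> fvs \<Gamma> \<union> fv (Lam \<tau> B) \<union> fv A"
      using ex_fresh[of "fvs \<Gamma> \<union> fv (Lam \<tau> B) \<union> fv A"] by auto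
    have ty: "has_type [] (Var y \<tau>) \<tau>" using gd_ex by simp
    have c: "conv [] (inst 0 (Var y \<tau>) B) (Lam \<tau> B \<cdot> Var y \<tau>) To"
      using gd_ex ty by (intro conv_sym[OF conv_beta] gd_has_type)
    have B: "gd [] (inst 0 (Var y \<tau>) B)" using gd_ex ty by (intro gd_inst_0)
    then have "derives D (add_mset (inst 0 (Var y \<tau>) B) \<Gamma>) (inst 0 (Var y \<tau>) B)"
      using gd_ex less.prems(2) by (intro less.IH) (simp_all add: size_inst_Var)
    from derives_convL[OF this less.prems(2) gd_formula[OF B] c]
    have "derives D (add_mset (Lam \<tau> B \<cdot> Var y \<tau>) \<Gamma>) (Lam \<tau> B \<cdot> Var y \<tau>)"
      using c conv_has_type[OF c] less.prems(2)
      by (intro derives_convR[OF _ _ c]) (auto simp: formula_def)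
    then have "derives D (add_mset (Lam \<tau> B \<cdot> Var y \<tau>) \<Gamma>) A"
      unfolding gd_ex(1) using less.prems(1) ty gd_ex(1)
      by (intro derives.exR) (auto intro: gd_formula)
    then show ?thesis using y gd_formula[OF less.prems(1)] unfolding gd_ex(1)
      by (intro derives.exL) auto
  qed
qed

lemma derives_absorb:
  "derives D (\<Gamma>' + \<Gamma>) C \<Longrightarrow> set_mset \<Gamma>' \<subseteq> set_mset \<Gamma> \<Longrightarrow> derives D \<Gamma> C"
proof (induction \<Gamma>')
  case (add x \<Gamma>')
  then have "x \<in># \<Gamma>' + \<Gamma>" by auto
  then obtain \<Delta> where \<Delta>: "\<Gamma>' + \<Gamma> = add_mset x \<Delta>" by (metis mset_add)
  with add.prems(1) have "derives D (add_mset x (add_mset x \<Delta>)) C" by simp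
  then have "derives D (\<Gamma>' + \<Gamma>) C" unfolding \<Delta> by (rule derives.contract)
  with add show ?case by auto
qed simp

text \<open>A set on the left makes contraction and weakening invisible, and it may be infinite, so
  that a whole theory can be the hypothesis.\<close>

definition ent :: "clause set \<Rightarrow> tm set \<Rightarrow> tm \<Rightarrow> bool" where
  "ent D S C \<longleftrightarrow> (\<exists>\<Gamma>. set_mset \<Gamma> \<subseteq> S \<and> formulas \<Gamma> \<and> derives D \<Gamma> C)"

lemma entI: "derives D \<Gamma> C \<Longrightarrow> set_mset \<Gamma> \<subseteq> S \<Longrightarrow> formulas \<Gamma> \<Longrightarrow> ent D S C"
  by (auto simp: ent_def)

lemma ent_mono: "ent D S C \<Longrightarrow> S \<subseteq> S' \<Longrightarrow> ent D S' C"
  by (auto simp: ent_def)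

text \<open>The calculus has no weakening rule. Cutting the given derivation against an identity
  sequent for \<open>C\<close> in the context \<Gamma> brings in the larger context, and contraction
  removes the duplicates.\<close>

lemma ent_derives:
  assumes "ent D S C" "S \<subseteq> set_mset \<Gamma>" "formulas \<Gamma>" "gd [] C"
  shows "derives D \<Gamma> C"
proof -
  from assms(1) obtain \<Gamma>' where *: "set_mset \<Gamma>' \<subseteq> S" "derives D \<Gamma>' C" by (auto simp: ent_def)
  from derives.cut[OF *(2) derives_id[OF assms(4,3)]] have "derives D (\<Gamma>' + \<Gamma>) C" .
  then show ?thesis by (rule derives_absorb) (use * assms(2) in auto)
qed

text \<open>A derivation may use \<open>A\<close> several times or not at all, while a left rule
  acts on a single occurrence; contraction and weakening leave exactly one copy outside
  \<Gamma>.\<close>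

lemma ent_insertE:
  assumes "ent D (insert A S) C" "gd [] C" "formula A"
  obtains \<Gamma> where "set_mset \<Gamma> \<subseteq> S" "formulas \<Gamma>" "derives D (add_mset A \<Gamma>) C"
proof -
  from assms(1) obtain \<Gamma>' where *: "set_mset \<Gamma>' \<subseteq> insert A S" "formulas \<Gamma>'" "derives D \<Gamma>' C"
    by (auto simp: ent_def)
  let ?\<Gamma> = "filter_mset (\<lambda>x. x \<noteq> A) \<Gamma>'"
  have "ent D (set_mset \<Gamma>') C" using * by (auto intro: entI)
  then have "derives D (add_mset A ?\<Gamma>) C"
    by (rule ent_derives) (use * assms in \<open>auto simp: formulas_def\<close>)
  then show thesis using that[of ?\<Gamma>] * by (auto simp: formulas_def)
qed

lemma ent_both:
  assumes "ent D S A" "ent D S B" "gd [] A" "gd [] B"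
  obtains \<Gamma> where "set_mset \<Gamma> \<subseteq> S" "formulas \<Gamma>" "derives D \<Gamma> A" "derives D \<Gamma> B"
proof -
  from assms obtain \<Gamma>1 \<Gamma>2 where *: "set_mset \<Gamma>1 \<subseteq> S" "formulas \<Gamma>1" "derives D \<Gamma>1 A"
    "set_mset \<Gamma>2 \<subseteq> S" "formulas \<Gamma>2" "derives D \<Gamma>2 B" by (auto simp: ent_def)
  then have "ent D (set_mset \<Gamma>1) A" "ent D (set_mset \<Gamma>2) B" by (auto intro: entI)
  then have "derives D (\<Gamma>1 + \<Gamma>2) A" "derives D (\<Gamma>1 + \<Gamma>2) B"
    using * assms by (auto elim!: ent_derives)
  then show thesis using that[of "\<Gamma>1 + \<Gamma>2"] * by auto
qed

section \<open>Natural deduction for consequence from a set of formulas\<close>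

lemma ent_id: "A \<in> S \<Longrightarrow> gd [] A \<Longrightarrow> ent D S A"
  by (rule entI[OF derives_id[where \<Gamma> = "{#}"]]) (auto intro: gd_formula)

lemma ent_cut: "ent D S A \<Longrightarrow> ent D (insert A S) C \<Longrightarrow> gd [] A \<Longrightarrow> gd [] C \<Longrightarrow> ent D S C"
proof -
  assume *: "ent D S A" "ent D (insert A S) C" "gd [] A" "gd [] C"
  from *(1) obtain \<Gamma>' where 1: "set_mset \<Gamma>' \<subseteq> S" "formulas \<Gamma>'" "derives D \<Gamma>' A"
    by (auto simp: ent_def)
  from ent_insertE[OF *(2,4) gd_formula[OF *(3)]] obtain \<Gamma> where
    2: "set_mset \<Gamma> \<subseteq> S" "formulas \<Gamma>" "derives D (add_mset A \<Gamma>) C" .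
  from derives.cut[OF 1(3) 2(3)] show ?thesis by (rule entI) (use 1 2 in auto)
qed

lemma ent_trans:
  assumes "finite S'" "ent D S' C" "\<And>A. A \<in> S' \<Longrightarrow> ent D S A" "\<And>A. A \<in> S' \<Longrightarrow> gd [] A" "gd [] C"
  shows "ent D S C"
proof -
  have "ent D (S' \<union> S) C" using assms(2) by (rule ent_mono) simp
  with assms(1,3,4) show ?thesis
  proof (induction S')
    case (insert A S')
    have "ent D (S' \<union> S) A" by (rule ent_mono[OF insert.prems(1)]) auto
    then have "ent D (S' \<union> S) C"
      by (rule ent_cut) (use insert.prems assms in auto)
    then show ?case using insert by auto
  qed simp
qed

lemma ent_conv: "ent D S A \<Longrightarrow> conv [] A B To \<Longrightarrow> ent D S B"
  by (auto simp: ent_def intro: derives_convR)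

lemma ent_botE: "ent D S \<^bold>\<bottom> \<Longrightarrow> gd [] C \<Longrightarrow> ent D S C"
proof (erule ent_cut)
  assume "gd [] C"
  then show "ent D (insert \<^bold>\<bottom> S) C"
    by (intro entI[OF derives.botL[of "{#}"]]) (auto intro: gd_formula gd_bot)
qed (auto intro: gd_bot)

lemma ent_topI: "ent D S \<^bold>\<top>"
  by (rule entI[OF derives.topR[of "{#}"]]) auto

lemma ent_andI:
  assumes "ent D S A" "ent D S B" "gd [] A" "gd [] B"
  shows "ent D S (A \<^bold>\<and> B)"
  using assms
proof (rule ent_both)
  fix \<Gamma> assume *: "set_mset \<Gamma> \<subseteq> S" "formulas \<Gamma>" "derives D \<Gamma> A" "derives D \<Gamma> B"
  from derives.andR[OF *(3,4)] show ?thesis by (rule entI) (use * in auto)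
qed

lemma ent_andE:
  assumes "ent D S (A \<^bold>\<and> B)" "gd [] A" "gd [] B"
  shows "ent D S A" "ent D S B"
proof -
  have f: "formula A" "formula B" "formula (A \<^bold>\<and> B)" using assms by (auto intro!: gd_formula gd_and)
  have "derives D {#A \<^bold>\<and> B#} A" "derives D {#A \<^bold>\<and> B#} B"
    using assms f by (auto intro!: derives.andL1[OF derives_id] derives.andL2[OF derives_id])
  then have "ent D (insert (A \<^bold>\<and> B) S) A" "ent D (insert (A \<^bold>\<and> B) S) B"
    using f by (auto elim!: entI)
  with assms show "ent D S A" "ent D S B" by (auto intro: ent_cut gd_and)
qed

lemma ent_orI1: "ent D S A \<Longrightarrow> gd [] B \<Longrightarrow> ent D S (A \<^bold>\<or> B)"
  by (auto simp: ent_def intro: derives.orR1 gd_formula)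

lemma ent_orI2: "ent D S B \<Longrightarrow> gd [] A \<Longrightarrow> ent D S (A \<^bold>\<or> B)"
  by (auto simp: ent_def intro: derives.orR2 gd_formula)

lemma ent_orE:
  assumes "ent D S (A \<^bold>\<or> B)" "ent D (insert A S) C" "ent D (insert B S) C"
    "gd [] A" "gd [] B" "gd [] C"
  shows "ent D S C"
proof -
  from ent_insertE[OF assms(2,6) gd_formula[OF assms(4)]] obtain \<Gamma>1 where
    1: "set_mset \<Gamma>1 \<subseteq> S" "formulas \<Gamma>1" "derives D (add_mset A \<Gamma>1) C" .
  from ent_insertE[OF assms(3,6) gd_formula[OF assms(5)]] obtain \<Gamma>2 where
    2: "set_mset \<Gamma>2 \<subseteq> S" "formulas \<Gamma>2" "derives D (add_mset B \<Gamma>2) C" .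
  have fA: "formula A" "formula B" "formula (A \<^bold>\<or> B)"
    using assms by (auto intro!: gd_formula gd_or)
  have "ent D (set_mset (add_mset A \<Gamma>1)) C" "ent D (set_mset (add_mset B \<Gamma>2)) C"
    using 1 2 fA by (auto intro: entI)
  then have "derives D (add_mset A (\<Gamma>1 + \<Gamma>2)) C" "derives D (add_mset B (\<Gamma>1 + \<Gamma>2)) C"
    by - (erule ent_derives; use 1 2 assms fA in auto)+
  then have "derives D (add_mset (A \<^bold>\<or> B) (\<Gamma>1 + \<Gamma>2)) C" by (rule derives.orL)
  then have "ent D (insert (A \<^bold>\<or> B) S) C" by (rule entI) (use 1 2 fA in auto)
  then show ?thesis using assms by (auto intro: ent_cut gd_or)
qed

lemma ent_impI: "ent D (insert A S) B \<Longrightarrow> gd [] A \<Longrightarrow> gd [] B \<Longrightarrow> ent D S (A \<^bold>\<supset> B)"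
  by (erule ent_insertE) (auto intro: entI derives.impR gd_formula)

lemma ent_impE:
  assumes "ent D S (A \<^bold>\<supset> B)" "ent D S A" "gd [] A" "gd [] B"
  shows "ent D S B"
proof -
  have f: "formula A" "formula (A \<^bold>\<supset> B)" using assms by (auto intro!: gd_formula gd_imp)
  have "derives D (add_mset (A \<^bold>\<supset> B) {#A#}) B"
    using assms f by (intro derives.impL) (auto intro: derives_id)
  then have "ent D {A \<^bold>\<supset> B, A} B" by (rule entI) (use f in auto)
  then show ?thesis by (rule ent_trans[rotated]) (use assms in \<open>auto intro: gd_imp\<close>)
qed

text \<open>A variable is a term like any other, so an argument covering all terms covers an
  eigenvariable; finiteness of \<open>S\<close> makes a fresh one available.\<close>

lemma ent_allI:
  assumes "finite S" "gd [] (All \<tau> (Lam \<tau> A))"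
    "\<And>t. has_type [] t \<tau> \<Longrightarrow> ent D S (inst 0 t A)"
  shows "ent D S (All \<tau> (Lam \<tau> A))"
proof -
  from assms(2) have g: "ofree \<tau>" "gd [\<tau>] A" by (auto simp: gd_quant)
  have "finite (\<Union> (fv ` S) \<union> fv A)" using assms(1) by auto
  then obtain y where y: "(y, \<tau>) \<notin> \<Union> (fv ` S) \<union> fv A" by (metis ex_fresh)
  have ty: "has_type [] (Var y \<tau>) \<tau>" using g by simp
  from assms(3)[OF ty] obtain \<Gamma> where \<Gamma>: "set_mset \<Gamma> \<subseteq> S" "formulas \<Gamma>"
    "derives D \<Gamma> (inst 0 (Var y \<tau>) A)" by (auto simp: ent_def)
  have "derives D \<Gamma> (Lam \<tau> A \<cdot> Var y \<tau>)"
    using \<Gamma>(3,2) by (rule derives_convR) (intro conv_sym[OF conv_beta] ty gd_has_type g)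
  then have "derives D \<Gamma> (All \<tau> (Lam \<tau> A))"
    by (rule derives.allR) (use y \<Gamma> assms(2) in \<open>auto simp: fvs_def intro: gd_formula\<close>)
  then show ?thesis using \<Gamma> by (auto intro: entI)
qed

lemma ent_allE:
  assumes "ent D S (All \<tau> (Lam \<tau> A))" "has_type [] t \<tau>" "gd [] (All \<tau> (Lam \<tau> A))"
  shows "ent D S (inst 0 t A)"
proof (rule ent_cut[OF assms(1) _ assms(3)])
  from assms(3) have g: "gd [\<tau>] A" by (auto simp: gd_quant)
  then show gi: "gd [] (inst 0 t A)" using assms(2) by (rule gd_inst_0)
  have c: "conv [] (inst 0 t A) (Lam \<tau> A \<cdot> t) To"
    by (intro conv_sym[OF conv_beta] assms gd_has_type g)
  have "derives D {#Lam \<tau> A \<cdot> t#} (inst 0 t A)"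
    by (rule derives_convL[OF derives_id[OF gi] _ _ c]) (use gi in \<open>auto intro: gd_formula\<close>)
  then have "derives D {#All \<tau> (Lam \<tau> A)#} (inst 0 t A)"
    by (rule derives.allL) (use assms in \<open>auto intro: gd_formula\<close>)
  then show "ent D (insert (All \<tau> (Lam \<tau> A)) S) (inst 0 t A)"
    by (rule entI) (use assms in \<open>auto intro: gd_formula\<close>)
qed

lemma ent_exI:
  assumes "ent D S (inst 0 t A)" "has_type [] t \<tau>" "gd [] (Ex \<tau> (Lam \<tau> A))"
  shows "ent D S (Ex \<tau> (Lam \<tau> A))"
proof -
  from assms(3) have g: "gd [\<tau>] A" by (auto simp: gd_quant)
  have "conv [] (inst 0 t A) (Lam \<tau> A \<cdot> t) To"
    by (intro conv_sym[OF conv_beta] assms gd_has_type g)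
  with assms show ?thesis
    by (auto simp: ent_def intro!: derives.exR dest!: gd_formula intro: derives_convR)
qed

lemma ent_exE:
  assumes "ent D (insert (inst 0 (Var y \<tau>) A) S) C" "gd [] (Ex \<tau> (Lam \<tau> A))" "gd [] C"
    "(y, \<tau>) \<notin> \<Union> (fv ` S) \<union> fv A \<union> fv C"
  shows "ent D (insert (Ex \<tau> (Lam \<tau> A)) S) C"
proof -
  from assms(2) have g: "ofree \<tau>" "gd [\<tau>] A" by (auto simp: gd_quant)
  have ty: "has_type [] (Var y \<tau>) \<tau>" using g by simp
  have c: "conv [] (inst 0 (Var y \<tau>) A) (Lam \<tau> A \<cdot> Var y \<tau>) To"
    by (intro conv_sym[OF conv_beta] ty gd_has_type g)
  have "formula (inst 0 (Var y \<tau>) A)" using g ty by (intro gd_formula gd_inst_0)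
  from ent_insertE[OF assms(1,3) this] obtain \<Gamma> where \<Gamma>: "set_mset \<Gamma> \<subseteq> S" "formulas \<Gamma>"
    "derives D (add_mset (inst 0 (Var y \<tau>) A) \<Gamma>) C" .
  have "derives D (add_mset (Lam \<tau> A \<cdot> Var y \<tau>) \<Gamma>) C"
    by (rule derives_convL[OF \<Gamma>(3,2) gd_formula[OF assms(3)] c])
  then have "derives D (add_mset (Ex \<tau> (Lam \<tau> A)) \<Gamma>) C"
    by (rule derives.exL) (use assms \<Gamma> in \<open>auto simp: fvs_def intro: gd_formula\<close>)
  then show ?thesis
    by (rule entI) (use assms \<Gamma> in \<open>auto intro: gd_formula\<close>)
qed

lemma ent_natI: "ent D S (nat' z)" "ent D S (nat' t) \<Longrightarrow> ent D S (nat' (s t))"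
  using entI[OF derives.natR_z[of "{#}"]] by (auto simp: ent_def intro: derives.natR_s)

text \<open>Base and step are derived without side formulas, as the rule demands. Hence the
  induction formulas below carry their parameters under quantifiers and their assumptions as
  antecedents.\<close>

lemma ent_nat_induct:
  assumes "gd [Tnt] P" "ent D {} (inst 0 z P)"
    "\<And>j. has_type [] j Tnt \<Longrightarrow> ent D {inst 0 j P} (inst 0 (s j) P)"
    "ent D S (nat' i)" "has_type [] i Tnt"
  shows "ent D S (inst 0 i P)"
proof -
  obtain j where j: "(j, Tnt) \<notin> fv P" using ex_fresh[of "fv P"] by auto
  have c: "conv [] (inst 0 t P) (Lam Tnt P \<cdot> t) To" if "has_type [] t Tnt" for t
    using that assms(1) by (intro conv_sym[OF conv_beta] gd_has_type)
  have gi: "gd [] (inst 0 t P)" if "has_type [] t Tnt" for t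
    using that assms(1) by (intro gd_inst_0)
  have tj: "has_type [] (Var j Tnt) Tnt" "has_type [] (s (Var j Tnt)) Tnt" "has_type [] z Tnt"
    by simp_all
  have "derives D {#} (inst 0 z P)"
    using assms(2) by (rule ent_derives) (use gi tj in auto)
  then have 1: "derives D {#} (Lam Tnt P \<cdot> z)" by (rule derives_convR) (use c tj in auto)
  have "derives D {#inst 0 (Var j Tnt) P#} (inst 0 (s (Var j Tnt)) P)"
    using assms(3)[OF tj(1)] by (rule ent_derives) (use gi tj in \<open>auto intro: gd_formula\<close>)
  then have "derives D {#inst 0 (Var j Tnt) P#} (Lam Tnt P \<cdot> s (Var j Tnt))"
    by (rule derives_convR) (use c gi tj in \<open>auto intro: gd_formula\<close>)
  then have 2: "derives D {#Lam Tnt P \<cdot> Var j Tnt#} (Lam Tnt P \<cdot> s (Var j Tnt))"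
    by (rule derives_convL) (use c[OF tj(1)] conv_has_type[OF c[OF tj(2)]] in \<open>auto simp: formula_def\<close>)
  have "derives D {#inst 0 i P#} (inst 0 i P)" using gi assms by (intro derives_id) auto
  then have 3: "derives D {#Lam Tnt P \<cdot> i#} (inst 0 i P)"
    by (rule derives_convL) (use c gi assms in \<open>auto intro: gd_formula\<close>)
  have "derives D {#nat' i#} (inst 0 i P)"
    by (rule derives.natL[OF 1 2 _ 3]) (use j in simp)
  moreover have g: "gd [] (nat' i)" using assms by (intro gd_pred) simp
  ultimately have "ent D (insert (nat' i) S) (inst 0 i P)"
    by (intro entI) (auto intro: gd_formula)
  then show ?thesis using assms g gi by (auto intro: ent_cut)
qed

lemma ent_defR: "(H \<triangleq> B) \<in> D \<Longrightarrow> is_subst \<theta> \<Longrightarrow> ent D S (sub \<theta> B) \<Longrightarrow> ent D S (sub \<theta> H)"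
  by (auto simp: ent_def intro: derives.defR)

text \<open>Since the set of all unifiers is complete, the left rule can be read as a case analysis over
  all instances; \<open>\<eta>\<close> is the restriction of the unifier to the variables of the renamed clause.\<close>

lemma ent_defL:
  assumes D: "is_definition D" and p: "p \<noteq> P_nat" "formula (atom p us)"
    and S: "finite S" "\<And>A. A \<in> S \<Longrightarrow> formula A" and C: "gd [] C"
    and *: "\<And>H B \<theta> \<eta>. (H \<triangleq> B) \<in> D \<Longrightarrow> is_subst \<theta> \<Longrightarrow> is_subst \<eta> \<Longrightarrow>
      conv [] (sub \<theta> (atom p us)) (sub \<eta> H) To \<Longrightarrow>
      ent D (insert (sub \<eta> B) (sub \<theta> ` S)) (sub \<theta> C)"
  shows "ent D (insert (atom p us) S) C"
proof -
  define V where "V = fv (atom p us) \<union> fvs (mset_set S) \<union> fv C"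
  have "finite V" by (simp add: V_def)
  \<comment> \<open>Prefixing with a word longer than all names in \<open>V\<close> renames
    injectively and away from \<open>V\<close>.\<close>
  define w where "w = replicate (Suc (Max (insert 0 ((length \<circ> fst) ` V)))) CHR ''a''"
  have w: "length x < length w" if "(x, \<tau>) \<in> V" for x \<tau>
  proof -
    have "(length \<circ> fst) (x, \<tau>) \<in> insert 0 ((length \<circ> fst) ` V)" using that by blast
    then have "length x \<le> Max (insert 0 ((length \<circ> fst) ` V))"
      using \<open>finite V\<close> by (intro Max_ge) auto
    then show ?thesis by (simp add: w_def)
  qed
  define \<rho> :: subst where "\<rho> = (\<lambda>x \<tau>. Var (w @ x) \<tau>)"
  define v where "v c = (sub \<rho> (head c) \<triangleq> sub \<rho> (body c))" for c
  have fv: "fv (sub \<rho> t) = (\<lambda>(x, \<tau>). (w @ x, \<tau>)) ` fv t" for t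
    by (induction t) (auto simp: \<rho>_def)
  have fresh: "(fv (head (v c)) \<union> fv (body (v c))) \<inter> V = {}" for c
    using w by (fastforce simp: v_def fv)
  have var: "variant (v c) c" for c
    unfolding variant_def v_def \<rho>_def by (intro exI[of _ "\<lambda>x _. w @ x"]) (simp add: inj_def)
  define U where "U c = {\<theta>. unifier \<theta> (atom p us) (head (v c))}" for c
  have U: "complete_unifiers (U c) (atom p us) (head (v c))" for c
    unfolding complete_unifiers_def
  proof (intro conjI ballI allI impI)
    fix \<sigma> assume *: "unifier \<sigma> (atom p us) (head (v c))"
    then show "\<exists>\<theta>\<in>U c. \<exists>\<rho>. is_subst \<rho> \<and>
        (\<forall>x \<tau>. ofree \<tau> \<longrightarrow> conv [] (\<sigma> x \<tau>) (sub \<rho> (\<theta> x \<tau>)) \<tau>)"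
      by (intro bexI[of _ \<sigma>] exI[of _ Var])
        (auto simp: U_def unifier_def is_subst_def intro: conv_refl)
  qed (simp add: U_def)
  have "derives D (add_mset (sub \<theta> (body (v c))) (image_mset (sub \<theta>) (mset_set S))) (sub \<theta> C)"
    if c: "c \<in> D" and \<theta>: "\<theta> \<in> U c" for c \<theta>
  proof -
    define \<eta> where "\<eta> = (\<lambda>x \<tau>. sub \<theta> (\<rho> x \<tau>))"
    have "is_subst \<theta>" using \<theta> by (auto simp: U_def unifier_def)
    then have "is_subst \<eta>" by (simp add: \<eta>_def \<rho>_def is_subst_def)
    have "(head c \<triangleq> body c) \<in> D" using c by simp
    have "conv [] (sub \<theta> (atom p us)) (sub \<eta> (head c)) To"
      using \<theta> by (simp add: U_def unifier_def v_def sub_sub \<eta>_def)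
    from *[OF \<open>(head c \<triangleq> body c) \<in> D\<close> \<open>is_subst \<theta>\<close> \<open>is_subst \<eta>\<close> this]
    have "ent D (insert (sub \<eta> (body c)) (sub \<theta> ` S)) (sub \<theta> C)" .
    then show ?thesis
    proof (rule ent_derives)
      have "formula (body c)" using D c by (auto simp: is_definition_def)
      then show "formulas (add_mset (sub \<theta> (body (v c))) (image_mset (sub \<theta>) (mset_set S)))"
        using S \<open>is_subst \<theta>\<close> \<open>is_subst \<eta>\<close>
        by (auto simp: formulas_def formula_def v_def sub_sub \<eta>_def[symmetric] intro: sub_has_type)
    qed (use S C \<open>is_subst \<theta>\<close> in \<open>auto simp: v_def sub_sub \<eta>_def[symmetric] intro: gd_sub\<close>)
  qed
  then have "derives D (add_mset (atom p us) (mset_set S)) C"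
    using p S C var U fresh
    by (intro derives.defL[of p us "mset_set S" C D v U])
      (auto simp: formulas_def gd_formula V_def Int_Un_distrib)
  then show ?thesis by (rule entI) (use S p in \<open>auto simp: formulas_def\<close>)
qed

section \<open>Prime theories\<close>

instance ty :: countable by countable_datatype
instance pred :: countable by countable_datatype
instance con :: countable by countable_datatype
instance tm :: countable by countable_datatype

definition prime_theory :: "clause set \<Rightarrow> tm set \<Rightarrow> bool" where
  "prime_theory D T \<longleftrightarrow>
     (\<forall>A\<in>T. gd [] A) \<and> (\<forall>A. gd [] A \<longrightarrow> ent D T A \<longrightarrow> A \<in> T) \<and> \<^bold>\<bottom> \<notin> T \<and>
     (\<forall>A B. gd [] A \<longrightarrow> gd [] B \<longrightarrow> A \<^bold>\<or> B \<in> T \<longrightarrow> A \<in> T \<or> B \<in> T) \<and>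
     (\<forall>\<tau> A. Ex \<tau> (Lam \<tau> A) \<in> T \<longrightarrow> (\<exists>t. has_type [] t \<tau> \<and> inst 0 t A \<in> T))"

lemma finite_subset_chain:
  assumes "finite X" "X \<subseteq> (\<Union>n. f n)" "\<And>n. f n \<subseteq> f (Suc n)"
  shows "\<exists>n :: nat. X \<subseteq> f n"
  using assms(1,2)
proof (induction X)
  case (insert x X)
  then obtain m n where "X \<subseteq> f m" "x \<in> f n" by auto
  moreover have "f m \<subseteq> f (max m n)" "f n \<subseteq> f (max m n)"
    by (rule lift_Suc_mono_le[of f], rule assms(3), simp)+
  ultimately show ?case by blast
qed simp

theorem prime_extension:
  assumes "finite S" "\<forall>A\<in>S. gd [] A" "gd [] C" "\<not> ent D S C"
  shows "\<exists>T. prime_theory D T \<and> S \<subseteq> T \<and> C \<notin> T"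
proof -
  define P :: "nat \<Rightarrow> tm set \<Rightarrow> bool" where
    "P n X \<longleftrightarrow> finite X \<and> S \<subseteq> X \<and> (\<forall>A\<in>X. gd [] A) \<and> \<not> ent D X C" for n X
  define Q where "Q n X Y \<longleftrightarrow> X \<subseteq> Y \<and> (gd [] (from_nat n) \<longrightarrow> ent D (insert (from_nat n) X) C \<or>
      from_nat n \<in> Y \<and> (\<forall>\<tau> A. from_nat n = Ex \<tau> (Lam \<tau> A) \<longrightarrow>
        (\<exists>t. has_type [] t \<tau> \<and> inst 0 t A \<in> Y)))" for n and X Y :: "tm set"
  have "\<exists>f. \<forall>n. P n (f n) \<and> Q n (f n) (f (Suc n))"
  proof (rule dependent_nat_choice)
    show "\<exists>X. P 0 X" using assms by (auto simp: P_def)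
  next
    fix X n assume X: "P n X"
    let ?A = "from_nat n :: tm"
    show "\<exists>Y. P (Suc n) Y \<and> Q n X Y"
    proof (cases "gd [] ?A \<and> \<not> ent D (insert ?A X) C")
      case False
      then show ?thesis using X by (intro exI[of _ X]) (auto simp: P_def Q_def)
    next
      case new: True
      show ?thesis
      proof (cases "\<exists>\<tau> B. ?A = Ex \<tau> (Lam \<tau> B)")
        case False
        then show ?thesis using X new
          by (intro exI[of _ "insert ?A X"]) (auto simp: P_def Q_def)
      next
        case True
        then obtain \<tau> B where A: "?A = Ex \<tau> (Lam \<tau> B)" by blast
        with new have g: "ofree \<tau>" "gd [\<tau>] B" by (auto simp: gd_quant)
        have "finite (\<Union> (fv ` insert ?A X) \<union> fv B \<union> fv C)" using X by (auto simp: P_def)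
        then obtain y where y: "(y, \<tau>) \<notin> \<Union> (fv ` insert ?A X) \<union> fv B \<union> fv C"
          by (metis ex_fresh)
        have ty: "has_type [] (Var y \<tau>) \<tau>" using g by simp
        let ?Y = "insert (inst 0 (Var y \<tau>) B) (insert ?A X)"
        have "\<not> ent D ?Y C"
        proof
          assume "ent D ?Y C"
          then have "ent D (insert (Ex \<tau> (Lam \<tau> B)) (insert ?A X)) C"
            by (rule ent_exE) (use new A assms y in auto)
          with new A show False by (simp add: insert_absorb)
        qed
        then have "P (Suc n) ?Y" using X new gd_inst_0[OF g(2) ty] by (auto simp: P_def)
        moreover have "Q n X ?Y" unfolding Q_def A using ty by blast
        ultimately show ?thesis by blast
      qed
    qed
  qed
  then obtain f where f: "\<And>n. P n (f n)" "\<And>n. Q n (f n) (f (Suc n))" by blast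
  define T where "T = (\<Union>n. f n)"
  have step: "f n \<subseteq> f (Suc n)" for n using f(2) by (auto simp: Q_def)
  have compact: "\<exists>n. ent D (f n) A" if ent: "ent D T A" for A
  proof -
    from ent obtain \<Gamma> where \<Gamma>: "set_mset \<Gamma> \<subseteq> T" "formulas \<Gamma>" "derives D \<Gamma> A"
      by (auto simp: ent_def)
    from finite_subset_chain[OF _ \<Gamma>(1)[unfolded T_def] step] obtain n where "set_mset \<Gamma> \<subseteq> f n"
      by auto
    with \<Gamma> show ?thesis by (auto intro: entI)
  qed
  have C: "\<not> ent D T C" using compact f(1) by (auto simp: P_def)
  have gT: "gd [] A" if "A \<in> T" for A using that f(1) by (auto simp: T_def P_def)
  \<comment> \<open>Maximality: a formula outside \<open>T\<close> leads to \<open>C\<close>.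
    Closure then follows by cut, the disjunction property by case distinction.\<close>
  have dec: "A \<in> T \<or> ent D (insert A T) C" if "gd [] A" for A
  proof -
    have "A \<in> f (Suc (to_nat A)) \<or> ent D (insert A (f (to_nat A))) C"
      using f(2)[of "to_nat A"] that by (auto simp: Q_def)
    moreover have "insert A (f (to_nat A)) \<subseteq> insert A T" by (auto simp: T_def)
    ultimately show ?thesis using ent_mono by (auto simp: T_def)
  qed
  have "prime_theory D T"
    unfolding prime_theory_def
  proof (intro conjI allI impI ballI)
    fix A assume A: "gd [] A" "ent D T A"
    then show "A \<in> T" using dec[OF A(1)] C ent_cut[OF A(2) _ A(1) assms(3)] by blast
  next
    show "\<^bold>\<bottom> \<notin> T" using C ent_botE[OF ent_id] assms(3) by (auto intro: gd_bot)
  next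
    fix A B assume *: "gd [] A" "gd [] B" "A \<^bold>\<or> B \<in> T"
    then have "ent D T (A \<^bold>\<or> B)" by (auto intro: ent_id gd_or)
    then show "A \<in> T \<or> B \<in> T" using dec[OF *(1)] dec[OF *(2)] ent_orE[of D T A B C] * assms C by blast
  next
    fix \<tau> A assume *: "Ex \<tau> (Lam \<tau> A) \<in> T"
    let ?E = "Ex \<tau> (Lam \<tau> A)"
    have "\<not> ent D (insert ?E (f (to_nat ?E))) C"
    proof
      assume "ent D (insert ?E (f (to_nat ?E))) C"
      then have "ent D T C" by (rule ent_mono) (use * in \<open>auto simp: T_def\<close>)
      with C show False by contradiction
    qed
    then show "\<exists>t. has_type [] t \<tau> \<and> inst 0 t A \<in> T"
      using f(2)[of "to_nat ?E"] gT[OF *] by (auto simp: Q_def T_def)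
  qed (rule gT)
  moreover have "S \<subseteq> T" using f(1)[of 0] by (auto simp: T_def P_def)
  moreover have "C \<notin> T" using C ent_id gT by blast
  ultimately show ?thesis by blast
qed

corollary ent_complete:
  "finite S \<Longrightarrow> \<forall>A\<in>S. gd [] A \<Longrightarrow> gd [] C \<Longrightarrow>
   (\<And>T. prime_theory D T \<Longrightarrow> S \<subseteq> T \<Longrightarrow> C \<in> T) \<Longrightarrow> ent D S C"
  using prime_extension by blast

section \<open>Membership in a prime theory, connective by connective\<close>

lemma prime_gd: "prime_theory D T \<Longrightarrow> A \<in> T \<Longrightarrow> gd [] A"
  by (simp add: prime_theory_def)

lemma prime_closed: "prime_theory D T \<Longrightarrow> ent D T A \<Longrightarrow> gd [] A \<Longrightarrow> A \<in> T"
  by (simp add: prime_theory_def)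

lemma prime_ent: "prime_theory D T \<Longrightarrow> A \<in> T \<Longrightarrow> ent D T A"
  by (simp add: ent_id prime_gd)

lemma prime_ent_subset: "prime_theory D T \<Longrightarrow> ent D S A \<Longrightarrow> S \<subseteq> T \<Longrightarrow> gd [] A \<Longrightarrow> A \<in> T"
  using prime_closed ent_mono by blast

lemma prime_conv: "prime_theory D T \<Longrightarrow> A \<in> T \<Longrightarrow> conv [] A B To \<Longrightarrow> gd [] B \<Longrightarrow> B \<in> T"
  using prime_closed prime_ent ent_conv by blast

lemma prime_bot: "prime_theory D T \<Longrightarrow> \<^bold>\<bottom> \<notin> T"
  by (simp add: prime_theory_def)

lemma prime_top: "prime_theory D T \<Longrightarrow> \<^bold>\<top> \<in> T"
  using prime_closed ent_topI gd_top by blast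

lemma prime_and: "prime_theory D T \<Longrightarrow> gd [] A \<Longrightarrow> gd [] B \<Longrightarrow> A \<^bold>\<and> B \<in> T \<longleftrightarrow> A \<in> T \<and> B \<in> T"
  using prime_closed prime_ent ent_andI ent_andE gd_and by metis

lemma prime_or:
  assumes "prime_theory D T" "gd [] A" "gd [] B"
  shows "A \<^bold>\<or> B \<in> T \<longleftrightarrow> A \<in> T \<or> B \<in> T"
proof
  assume "A \<in> T \<or> B \<in> T"
  then have "ent D T (A \<^bold>\<or> B)"
    using assms prime_ent ent_orI1 ent_orI2 by metis
  then show "A \<^bold>\<or> B \<in> T" using assms by (intro prime_closed) (auto intro: gd_or)
next
  assume "A \<^bold>\<or> B \<in> T"
  then show "A \<in> T \<or> B \<in> T" using assms by (simp add: prime_theory_def)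
qed

lemma prime_imp:
  "prime_theory D T \<Longrightarrow> A \<^bold>\<supset> B \<in> T \<Longrightarrow> A \<in> T \<Longrightarrow> gd [] B \<Longrightarrow> B \<in> T"
  using prime_closed prime_ent ent_impE prime_gd by metis

lemma prime_all:
  "prime_theory D T \<Longrightarrow> All \<tau> (Lam \<tau> A) \<in> T \<Longrightarrow> has_type [] t \<tau> \<Longrightarrow> inst 0 t A \<in> T"
  by (metis prime_closed prime_ent ent_allE prime_gd gd_inst_0 gd_quant(1))

lemma prime_ex:
  "prime_theory D T \<Longrightarrow> gd [] (Ex \<tau> (Lam \<tau> A)) \<Longrightarrow>
   Ex \<tau> (Lam \<tau> A) \<in> T \<longleftrightarrow> (\<exists>t. has_type [] t \<tau> \<and> inst 0 t A \<in> T)"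
  using prime_closed[of D T "Ex \<tau> (Lam \<tau> A)"] prime_ent[of D T] ent_exI[of D T _ A \<tau>]
  unfolding prime_theory_def by blast

text \<open>\<open>forces D A F\<close>: in prime theories, \<open>F\<close> is a consequence of \<open>A\<close>, and it suffices for
  deriving \<open>A\<close> from finitely many formulas.  The antecedent of an implication has to be
  interpreted by membership (\<open>decides\<close>), because a single prime theory is only closed under modus
  ponens.\<close>

definition decides :: "clause set \<Rightarrow> tm \<Rightarrow> (tm set \<Rightarrow> bool) \<Rightarrow> bool" where
  "decides D A F \<longleftrightarrow> gd [] A \<and> (\<forall>T. prime_theory D T \<longrightarrow> (A \<in> T \<longleftrightarrow> F T))"

definition forces :: "clause set \<Rightarrow> tm \<Rightarrow> (tm set \<Rightarrow> bool) \<Rightarrow> bool" where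
  "forces D A F \<longleftrightarrow> gd [] A \<and> (\<forall>T. prime_theory D T \<longrightarrow> A \<in> T \<longrightarrow> F T) \<and>
     (\<forall>S. finite S \<longrightarrow> (\<forall>A\<in>S. gd [] A) \<longrightarrow> (\<forall>T. prime_theory D T \<longrightarrow> S \<subseteq> T \<longrightarrow> F T) \<longrightarrow> ent D S A)"

lemma decides_mem: "gd [] A \<Longrightarrow> decides D A (\<lambda>T. A \<in> T)"
  by (simp add: decides_def)

lemma decides_bot: "decides D \<^bold>\<bottom> (\<lambda>T. False)"
  by (simp add: decides_def prime_bot gd_bot)

lemma decides_and: "decides D A F \<Longrightarrow> decides D B G \<Longrightarrow> decides D (A \<^bold>\<and> B) (\<lambda>T. F T \<and> G T)"
  by (simp add: decides_def prime_and gd_and)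

lemma decides_ex:
  assumes "gd [] (Ex \<tau> (Lam \<tau> A))" "\<And>t. has_type [] t \<tau> \<Longrightarrow> decides D (inst 0 t A) (F t)"
  shows "decides D (Ex \<tau> (Lam \<tau> A)) (\<lambda>T. \<exists>t. has_type [] t \<tau> \<and> F t T)"
  unfolding decides_def
proof (intro conjI allI impI)
  fix T assume T: "prime_theory D T"
  show "Ex \<tau> (Lam \<tau> A) \<in> T \<longleftrightarrow> (\<exists>t. has_type [] t \<tau> \<and> F t T)"
    unfolding prime_ex[OF T assms(1)] using assms(2) T by (auto simp: decides_def)
qed (rule assms)

lemma forces_decides: "decides D A F \<Longrightarrow> forces D A F"
  unfolding decides_def forces_def by (auto intro: ent_complete)

lemma forces_and: "forces D A F \<Longrightarrow> forces D B G \<Longrightarrow> forces D (A \<^bold>\<and> B) (\<lambda>T. F T \<and> G T)"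
  unfolding forces_def by (simp add: gd_and prime_and ent_andI)

text \<open>The prime theories above \<open>insert A S\<close> are those above \<open>S\<close> in
  which \<open>F\<close> holds. Quantifying over all of them is what validates the deduction step;
  closure of one prime theory under modus ponens would not.\<close>

lemma forces_imp:
  assumes "decides D A F" "forces D B G"
  shows "forces D (A \<^bold>\<supset> B) (\<lambda>T. F T \<longrightarrow> G T)"
  unfolding forces_def
proof (intro conjI allI impI)
  have g: "gd [] A" "gd [] B" using assms by (auto simp: decides_def forces_def)
  then show "gd [] (A \<^bold>\<supset> B)" by (rule gd_imp)
  show "G T" if "prime_theory D T" "A \<^bold>\<supset> B \<in> T" "F T" for T
    using that assms prime_imp[OF that(1,2)] g by (auto simp: decides_def forces_def)
  show "ent D S (A \<^bold>\<supset> B)"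
    if S: "finite S" "\<forall>A\<in>S. gd [] A" "\<forall>T. prime_theory D T \<longrightarrow> S \<subseteq> T \<longrightarrow> F T \<longrightarrow> G T" for S
  proof (rule ent_impI[OF _ g])
    have "\<forall>T. prime_theory D T \<longrightarrow> insert A S \<subseteq> T \<longrightarrow> G T"
      using S(3) assms(1) by (auto simp: decides_def)
    then show "ent D (insert A S) B" using assms(2) S g by (auto simp: forces_def)
  qed
qed

lemma forces_all:
  assumes "gd [] (All \<tau> (Lam \<tau> A))" "\<And>t. has_type [] t \<tau> \<Longrightarrow> forces D (inst 0 t A) (F t)"
  shows "forces D (All \<tau> (Lam \<tau> A)) (\<lambda>T. \<forall>t. has_type [] t \<tau> \<longrightarrow> F t T)"
  unfolding forces_def
proof (intro conjI allI impI)
  show "F t T" if "prime_theory D T" "All \<tau> (Lam \<tau> A) \<in> T" "has_type [] t \<tau>" for t T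
    using that assms(2)[OF that(3)] prime_all[OF that] by (auto simp: forces_def)
  show "ent D S (All \<tau> (Lam \<tau> A))"
    if "finite S" "\<forall>A\<in>S. gd [] A"
      "\<forall>T. prime_theory D T \<longrightarrow> S \<subseteq> T \<longrightarrow> (\<forall>t. has_type [] t \<tau> \<longrightarrow> F t T)" for S
    using that assms by (intro ent_allI) (auto simp: forces_def)
qed (rule assms)

lemma forces_cong:
  assumes "forces D A F" "\<And>T. prime_theory D T \<Longrightarrow> F T \<longleftrightarrow> G T"
  shows "forces D A G"
  using assms unfolding forces_def by simp

lemma forcesD: "forces D A F \<Longrightarrow> prime_theory D T \<Longrightarrow> A \<in> T \<Longrightarrow> F T"
  by (simp add: forces_def)

lemma forces_ent:
  "forces D A F \<Longrightarrow> finite S \<Longrightarrow> \<forall>A\<in>S. gd [] A \<Longrightarrow>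
   (\<And>T. prime_theory D T \<Longrightarrow> S \<subseteq> T \<Longrightarrow> F T) \<Longrightarrow> ent D S A"
  by (simp add: forces_def)

lemma forces_derives:
  "forces D A F \<Longrightarrow> (\<And>T. prime_theory D T \<Longrightarrow> F T) \<Longrightarrow> derives D {#} A"
  by (rule ent_derives[of D "{}"]) (auto simp: forces_def)

text \<open>Soundness of induction for properties expressed by a formula. Base and step are required
  in all prime theories because they must become derivations without side formulas.\<close>

lemma prime_nat_induct:
  assumes P: "gd [Tnt] P" and F: "\<And>i. has_type [] i Tnt \<Longrightarrow> forces D (inst 0 i P) (F i)"
    and base: "\<And>T. prime_theory D T \<Longrightarrow> F z T"
    and step: "\<And>T j. prime_theory D T \<Longrightarrow> has_type [] j Tnt \<Longrightarrow> nat' j \<in> T \<Longrightarrow> F j T \<Longrightarrow> F (s j) T"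
    and T: "prime_theory D T" "nat' i \<in> T" "has_type [] i Tnt"
  shows "F i T"
proof -
  \<comment> \<open>The induction rule does not tell that the predecessor is a natural number, so
    this is carried along in the formula.\<close>
  let ?P = "nat' (Bnd 0) \<^bold>\<and> P"
  have g: "gd [] (nat' i)" "gd [] (inst 0 i P)" if "has_type [] i Tnt" for i
    using that P by (auto intro!: gd_pred gd_inst_0)
  have F': "forces D (inst 0 i ?P) (\<lambda>T. nat' i \<in> T \<and> F i T)" if "has_type [] i Tnt" for i
    using that F g forces_and[OF forces_decides[OF decides_mem]] by simp
  have sj: "has_type [] z Tnt" "has_type [] j Tnt \<Longrightarrow> has_type [] (s j) Tnt" for j by simp_all
  have nz: "nat' z \<in> T" if "prime_theory D T" for T
    using that by (rule prime_closed) (intro ent_natI g sj)+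
  have ns: "nat' (s j) \<in> T" if "prime_theory D T" "nat' j \<in> T" "has_type [] j Tnt" for j T
    using that(1) by (rule prime_closed) (use that in \<open>auto intro!: ent_natI g prime_ent\<close>)
  have "gd [Tnt] ?P" using P by (auto intro!: gd_and gd_pred)
  then have "ent D T (inst 0 i ?P)"
  proof (rule ent_nat_induct)
    show "ent D {} (inst 0 z ?P)"
      by (rule forces_ent[OF F'[OF sj(1)]]) (auto intro: nz base)
  next
    fix j assume j: "has_type [] j Tnt"
    show "ent D {inst 0 j ?P} (inst 0 (s j) ?P)"
    proof (rule forces_ent[OF F'[OF sj(2)[OF j]]])
      fix T assume T: "prime_theory D T" "{inst 0 j ?P} \<subseteq> T"
      then have "nat' j \<in> T \<and> F j T" using forcesD[OF F'[OF j]] by simp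
      then show "nat' (s j) \<in> T \<and> F (s j) T" using T j ns step by simp
    qed (use F'[OF j] in \<open>auto simp: forces_def\<close>)
  qed (use T in \<open>auto intro: prime_ent\<close>)
  then have "inst 0 i ?P \<in> T" using T(1) F'[OF T(3)] by (auto intro: prime_closed simp: forces_def)
  then show ?thesis using forcesD[OF F'[OF T(3)] T(1)] by simp
qed

text \<open>Unifiers act on the whole sequent, so the cases live in other prime theories
  \<open>T'\<close> and concern instances under \<theta>. Only the facts listed in \<open>S\<close>
  are carried over, and the goal has to be a single formula \<open>C\<close> that can be taken back
  to \<open>T\<close>.\<close>

lemma prime_defL:
  assumes D: "is_definition D" "\<And>H B. (H \<triangleq> B) \<in> D \<Longrightarrow> gd [] B"
    and T: "prime_theory D T" "atom p us \<in> T" "p \<noteq> P_nat" "finite S" "S \<subseteq> T" "gd [] C"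
    and *: "\<And>H B \<theta> \<eta> T'. (H \<triangleq> B) \<in> D \<Longrightarrow> is_subst \<theta> \<Longrightarrow> is_subst \<eta> \<Longrightarrow>
      conv [] (sub \<theta> (atom p us)) (sub \<eta> H) To \<Longrightarrow> prime_theory D T' \<Longrightarrow> sub \<eta> B \<in> T' \<Longrightarrow>
      sub \<theta> ` S \<subseteq> T' \<Longrightarrow> sub \<theta> C \<in> T'"
  shows "C \<in> T"
proof (rule prime_ent_subset[OF T(1)])
  have S: "\<forall>A\<in>S. gd [] A" using T prime_gd by blast
  show "ent D (insert (atom p us) S) C"
  proof (rule ent_defL[OF D(1) T(3) _ T(4)])
    show "formula (atom p us)" using T prime_gd gd_formula by blast
    show "formula A" if "A \<in> S" for A using S that gd_formula by blast
    fix H B \<theta> \<eta>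
    assume **: "(H \<triangleq> B) \<in> D" "is_subst \<theta>" "is_subst \<eta>" "conv [] (sub \<theta> (atom p us)) (sub \<eta> H) To"
    show "ent D (insert (sub \<eta> B) (sub \<theta> ` S)) (sub \<theta> C)"
    proof (rule ent_complete)
      fix T' assume "prime_theory D T'" "insert (sub \<eta> B) (sub \<theta> ` S) \<subseteq> T'"
      then show "sub \<theta> C \<in> T'" using *[OF **] by auto
    qed (use T S D ** in \<open>auto intro: gd_sub\<close>)
  qed (rule T)
qed (use T in auto)

section \<open>The clauses of the specification logic\<close>

abbreviation prime :: "tm set \<Rightarrow> bool" where "prime \<equiv> prime_theory D_all"

lemma lift_closed [simp]: "has_type [] t \<tau> \<Longrightarrow> lift k t = t"
  by (rule lift_has_type) auto

lemma inst_closed [simp]: "has_type [] t \<tau> \<Longrightarrow> inst k u t = t"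
  by (rule inst_has_type) auto

lemma type_of_closed:
  "has_type [] t \<tau> \<Longrightarrow> type_of (\<sigma> # \<Delta>) t = Some \<tau>"
  by (rule has_type_weaken)

lemma type_of_sub_closed:
  "has_type [] t \<tau> \<Longrightarrow> is_subst \<theta> \<Longrightarrow> has_type [] (sub \<theta> t) \<tau>"
  by (rule sub_has_type)

lemmas closed_simps [simp] =
  type_of_closed[where \<tau> = Ti] type_of_closed[where \<tau> = Tnt] type_of_closed[where \<tau> = Tatm]
  type_of_closed[where \<tau> = Tprp] type_of_closed[where \<tau> = Tatmlst]
  type_of_closed[where \<tau> = "Ti \<rightarrow> Ti"] type_of_closed[where \<tau> = "Ti \<rightarrow> Tprp"]
  type_of_sub_closed[where \<tau> = Ti] type_of_sub_closed[where \<tau> = Tnt]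
  type_of_sub_closed[where \<tau> = Tatm] type_of_sub_closed[where \<tau> = Tprp]
  type_of_sub_closed[where \<tau> = Tatmlst] type_of_sub_closed[where \<tau> = "Ti \<rightarrow> Ti"]
  type_of_sub_closed[where \<tau> = "Ti \<rightarrow> Tprp"]

inductive_cases gd_AppE: "gd \<Delta> (t \<cdot> u)"

lemma atom_neq_conn: "atom p ts \<noteq> Con c \<cdot> A \<cdot> B" if "\<And>q. c \<noteq> Pred q"
proof -
  have *: "\<exists>c. hd (rec_tm (\<lambda>c. [c]) (\<lambda>_ _. []) (\<lambda>_. []) (\<lambda>_ _ a _. a) (\<lambda>_ _ _. []) (atom p ts)) = Pred p"
    unfolding atom_def by (induction ts rule: rev_induct) auto
  then show ?thesis using that[of p] by auto
qed

lemma gd_conn [simp]: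
  "gd \<Delta> (A \<^bold>\<and> B) \<longleftrightarrow> gd \<Delta> A \<and> gd \<Delta> B"
  "gd \<Delta> (A \<^bold>\<or> B) \<longleftrightarrow> gd \<Delta> A \<and> gd \<Delta> B"
  "gd \<Delta> (A \<^bold>\<supset> B) \<longleftrightarrow> gd \<Delta> A \<and> gd \<Delta> B"
  by (auto intro: gd.intros elim!: gd_AppE dest: atom_neq_conn[THEN not_sym, THEN notE, rotated]
      simp: atom_neq_conn[THEN not_sym])

lemma gd_pred_iff [simp]:
  "gd \<Delta> (Con (Pred p) \<cdot> a) \<longleftrightarrow> has_type \<Delta> (Con (Pred p) \<cdot> a) To"
  "gd \<Delta> (Con (Pred p) \<cdot> a \<cdot> b) \<longleftrightarrow> has_type \<Delta> (Con (Pred p) \<cdot> a \<cdot> b) To"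
  "gd \<Delta> (Con (Pred p) \<cdot> a \<cdot> b \<cdot> c) \<longleftrightarrow> has_type \<Delta> (Con (Pred p) \<cdot> a \<cdot> b \<cdot> c) To"
  using gd_pred gd_has_type by blast+

declare gd_quant [simp] gd_bot [simp] gd_top [simp]

lemma has_type_pred [simp]:
  "has_type \<Delta> (nat' i) To \<longleftrightarrow> has_type \<Delta> i Tnt"
  "has_type \<Delta> (seq i L b) To \<longleftrightarrow> has_type \<Delta> i Tnt \<and> has_type \<Delta> L Tatmlst \<and> has_type \<Delta> b Tprp"
  "has_type \<Delta> (element a L) To \<longleftrightarrow> has_type \<Delta> a Tatm \<and> has_type \<Delta> L Tatmlst"
  "has_type \<Delta> (prog a b) To \<longleftrightarrow> has_type \<Delta> a Tatm \<and> has_type \<Delta> b Tprp"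
  "has_type \<Delta> (x \<^bold>\<equiv> y) To \<longleftrightarrow> has_type \<Delta> x Ti \<and> has_type \<Delta> y Ti"
  "has_type \<Delta> (eq' i j) To \<longleftrightarrow> has_type \<Delta> i Tnt \<and> has_type \<Delta> j Tnt"
  by (auto split: option.splits ty.splits if_splits)

lemma gd_body_D_all: "(H \<triangleq> B) \<in> D_all \<Longrightarrow> gd [] B"
  unfolding D_all_def D_nat_def D_list_def D_intuit_def D_PCF_def D_typing_def D_natural_def
    D_transition_def D_equiv_def Let_def Un_iff
  by (elim disjE insertE emptyE; simp)

lemmas prime_case = prime_defL[OF is_definition_D_all gd_body_D_all]

lemma is_subst_has_type [simp]: "is_subst \<theta> \<Longrightarrow> ofree \<tau> \<Longrightarrow> type_of [] (\<theta> x \<tau>) = Some \<tau>"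
  by (simp add: is_subst_def)

text \<open>The list of the matching clause instance has been replaced by \<open>L\<close>, to which
  it converts. In the universal case the quantified formula itself is kept: that all its instances
  lie in \<open>T\<close> would not imply that it does.\<close>

definition seq_cases :: "tm set \<Rightarrow> tm \<Rightarrow> tm \<Rightarrow> tm \<Rightarrow> bool" where
  "seq_cases T i L b \<longleftrightarrow>
     (\<exists>a. conv [] b \<langle>a\<rangle> Tprp \<and> element a L \<in> T) \<or>
     conv [] b tt Tprp \<or>
     (\<exists>I B C. conv [] i (s I) Tnt \<and> conv [] b (B \<^bold>& C) Tprp \<and> seq I L B \<in> T \<and> seq I L C \<in> T) \<or>
     (\<exists>I a B. conv [] i (s I) Tnt \<and> conv [] b (a \<^bold>\<Rightarrow> B) Tprp \<and> seq I (a \<^bold># L) B \<in> T) \<or>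
     (\<exists>I F. conv [] i (s I) Tnt \<and> conv [] b (Bigand F) Tprp \<and> has_type [] F (Ti \<rightarrow> Tprp) \<and>
        All Ti (Lam Ti (seq I L (F \<cdot> Bnd 0))) \<in> T) \<or>
     (\<exists>I a b'. conv [] i (s I) Tnt \<and> conv [] b \<langle>a\<rangle> Tprp \<and> prog a b' \<in> T \<and> seq I L b' \<in> T)"

text \<open>Conversion preserves the head predicate, so clauses for other predicates cannot match.
  The lemmas after this one apply the same filter to further predicates.\<close>

lemma clause_seq:
  assumes "(H \<triangleq> B) \<in> D_all" "conv [] (seq i L b) (sub \<eta> H) To"
  shows "(H \<triangleq> B) \<in> D_intuit"
  using assms
  unfolding D_all_def D_nat_def D_list_def D_PCF_def D_typing_def D_natural_def
    D_transition_def D_equiv_def Let_def Un_iff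
  by (elim disjE insertE emptyE; simp add: conv_rigid)

lemma clause_element:
  assumes "(H \<triangleq> B) \<in> D_all" "conv [] (element a L) (sub \<eta> H) To"
  shows "\<exists>X L0. sub \<eta> H = element X (X \<^bold># L0) \<or>
    (\<exists>Y. sub \<eta> H = element X (Y \<^bold># L0) \<and> sub \<eta> B = element X L0)"
  using assms
  unfolding D_all_def D_nat_def D_list_def D_intuit_def D_PCF_def D_typing_def D_natural_def
    D_transition_def D_equiv_def Let_def Un_iff
  by (elim disjE insertE emptyE; simp add: conv_rigid; auto)

lemma clause_prog:
  assumes "(H \<triangleq> B) \<in> D_all" "conv [] (prog a b) (sub \<eta> H) To"
  shows "(H \<triangleq> B) \<in> D_PCF"
  using assms
  unfolding D_all_def D_nat_def D_list_def D_intuit_def D_equiv_def Let_def Un_iff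
  by (elim disjE insertE emptyE; simp add: conv_rigid)

lemma clause_equiv:
  assumes "(H \<triangleq> B) \<in> D_all" "conv [] (x \<^bold>\<equiv> y) (sub \<eta> H) To"
  shows "\<exists>t. sub \<eta> H = t \<^bold>\<equiv> t"
  using assms
  unfolding D_all_def D_nat_def D_list_def D_intuit_def D_PCF_def D_typing_def D_natural_def
    D_transition_def D_equiv_def Let_def Un_iff
  by (elim disjE insertE emptyE; simp add: conv_rigid)

lemma clause_eq:
  assumes "(H \<triangleq> B) \<in> D_all" "conv [] (eq' x y) (sub \<eta> H) To"
  shows "\<exists>t. sub \<eta> H = eq' t t"
  using assms
  unfolding D_all_def D_nat_def D_list_def D_intuit_def D_PCF_def D_typing_def D_natural_def
    D_transition_def D_equiv_def Let_def Un_iff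
  by (elim disjE insertE emptyE; simp add: conv_rigid)

section \<open>Case analysis and introduction for the specification logic\<close>

lemma prime_case_atom:
  assumes "prime T" "Con (Pred p) \<cdot> a \<cdot> b \<in> T" "p \<noteq> P_nat" "finite S" "S \<subseteq> T" "gd [] C"
    "\<And>H B \<theta> \<eta> T'. (H \<triangleq> B) \<in> D_all \<Longrightarrow> is_subst \<theta> \<Longrightarrow> is_subst \<eta> \<Longrightarrow>
      conv [] (Con (Pred p) \<cdot> sub \<theta> a \<cdot> sub \<theta> b) (sub \<eta> H) To \<Longrightarrow> prime T' \<Longrightarrow> sub \<eta> B \<in> T' \<Longrightarrow>
      sub \<theta> ` S \<subseteq> T' \<Longrightarrow> sub \<theta> C \<in> T'"
  shows "C \<in> T"
  using prime_case[where T = T and p = p and us = "[a, b]" and S = S and C = C] assms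
  by (simp add: atom_def)

lemma prime_case_atom3:
  assumes "prime T" "Con (Pred p) \<cdot> a \<cdot> b \<cdot> c \<in> T" "p \<noteq> P_nat" "finite S" "S \<subseteq> T" "gd [] C"
    "\<And>H B \<theta> \<eta> T'. (H \<triangleq> B) \<in> D_all \<Longrightarrow> is_subst \<theta> \<Longrightarrow> is_subst \<eta> \<Longrightarrow>
      conv [] (Con (Pred p) \<cdot> sub \<theta> a \<cdot> sub \<theta> b \<cdot> sub \<theta> c) (sub \<eta> H) To \<Longrightarrow> prime T' \<Longrightarrow>
      sub \<eta> B \<in> T' \<Longrightarrow> sub \<theta> ` S \<subseteq> T' \<Longrightarrow> sub \<theta> C \<in> T'"
  shows "C \<in> T"
  using prime_case[where T = T and p = p and us = "[a, b, c]" and S = S and C = C] assms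
  by (simp add: atom_def)

lemma conv_append: "conv \<Delta> t u \<tau> \<Longrightarrow> conv (\<Delta> @ \<Delta>') t u \<tau>"
proof (induction rule: conv.induct)
  case (conv_sym \<Delta> t u \<tau>)
  show ?case by (rule conv.conv_sym) fact
next
  case (conv_trans \<Delta> t u \<tau> v)
  then show ?case by (blast intro: conv.conv_trans)
next
  case (conv_lam \<sigma> \<Delta> t t' \<tau>)
  then show ?case by (auto intro: conv.conv_lam)
next
  case (conv_beta \<sigma> \<Delta> t \<tau> u)
  then show ?case using has_type_append[of "\<sigma> # \<Delta>" t \<tau> \<Delta>'] has_type_append[of \<Delta> u \<sigma> \<Delta>']
    by (simp add: conv.conv_beta)
next
  case (conv_eta \<Delta> t \<sigma> \<tau>)
  show ?case by (intro conv.conv_eta has_type_append) fact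
qed (blast intro: conv.intros has_type_append)+

lemma conv_weaken: "conv [] t u \<tau> \<Longrightarrow> conv \<Delta> t u \<tau>"
  using conv_append[of "[]" t u \<tau> \<Delta>] by (simp only: append_Nil)

lemma prime_seq_conv:
  assumes "prime T" "seq i L b \<in> T" "conv [] i i' Tnt" "conv [] L L' Tatmlst" "conv [] b b' Tprp"
  shows "seq i' L' b' \<in> T"
proof (rule prime_conv[OF assms(1,2)])
  show "conv [] (seq i L b) (seq i' L' b') To" using assms by (auto simp: conv_rigid)
  show "gd [] (seq i' L' b')" using assms by (auto dest: conv_has_type)
qed

lemma prime_element_conv:
  assumes "prime T" "element a L \<in> T" "conv [] a a' Tatm" "conv [] L L' Tatmlst"
  shows "element a' L' \<in> T"
proof (rule prime_conv[OF assms(1,2)])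
  show "conv [] (element a L) (element a' L') To" using assms by (auto simp: conv_rigid)
  show "gd [] (element a' L')" using assms by (auto dest: conv_has_type)
qed

lemma prime_prog_conv:
  assumes "prime T" "prog a b \<in> T" "conv [] a a' Tatm" "conv [] b b' Tprp"
  shows "prog a' b' \<in> T"
proof (rule prime_conv[OF assms(1,2)])
  show "conv [] (prog a b) (prog a' b') To" using assms by (auto simp: conv_rigid)
  show "gd [] (prog a' b')" using assms by (auto dest: conv_has_type)
qed

lemma prime_typed:
  "prime T \<Longrightarrow> seq i L b \<in> T \<Longrightarrow> has_type [] i Tnt \<and> has_type [] L Tatmlst \<and> has_type [] b Tprp"
  "prime T \<Longrightarrow> element a L \<in> T \<Longrightarrow> has_type [] a Tatm \<and> has_type [] L Tatmlst"
  "prime T \<Longrightarrow> prog a b \<in> T \<Longrightarrow> has_type [] a Tatm \<and> has_type [] b Tprp"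
  "prime T \<Longrightarrow> nat' i \<in> T \<Longrightarrow> has_type [] i Tnt"
  "prime T \<Longrightarrow> x \<^bold>\<equiv> y \<in> T \<Longrightarrow> has_type [] x Ti \<and> has_type [] y Ti"
  by (drule (1) prime_gd, simp del: type_of.simps)+

lemma seq_clause_cases:
  assumes T: "prime T" and \<eta>: "is_subst \<eta>"
    and "(H \<triangleq> B) \<in> D_all" "conv [] (seq i L b) (sub \<eta> H) To" "sub \<eta> B \<in> T"
  shows "seq_cases T i L b"
proof -
  have "(\<exists>a a' L0. conv [] L (a' \<^bold># L0) Tatmlst \<and> conv [] b \<langle>a\<rangle> Tprp \<and> element a (a' \<^bold># L0) \<in> T) \<or>
     conv [] b tt Tprp \<or>
     (\<exists>I L0 B C. conv [] i (s I) Tnt \<and> conv [] L L0 Tatmlst \<and> conv [] b (B \<^bold>& C) Tprp \<and>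
        seq I L0 B \<^bold>\<and> seq I L0 C \<in> T) \<or>
     (\<exists>I L0 a B. conv [] i (s I) Tnt \<and> conv [] L L0 Tatmlst \<and> conv [] b (a \<^bold>\<Rightarrow> B) Tprp \<and>
        seq I (a \<^bold># L0) B \<in> T) \<or>
     (\<exists>I L0 F. conv [] i (s I) Tnt \<and> conv [] L L0 Tatmlst \<and> conv [] b (Bigand F) Tprp \<and>
        All Ti (Lam Ti (seq I L0 (F \<cdot> Bnd 0))) \<in> T) \<or>
     (\<exists>I L0 a. conv [] i (s I) Tnt \<and> conv [] L L0 Tatmlst \<and> conv [] b \<langle>a\<rangle> Tprp \<and>
        Ex Tprp (Lam Tprp (prog a (Bnd 0) \<^bold>\<and> seq I L0 (Bnd 0))) \<in> T)"
    using clause_seq[OF assms(3,4)] assms(4,5)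
    unfolding D_intuit_def Let_def
    by (elim insertE emptyE; simp add: conv_rigid; blast)
  then show ?thesis
  proof (elim disjE exE conjE)
    fix a a' L0
    assume *: "conv [] L (a' \<^bold># L0) Tatmlst" "conv [] b \<langle>a\<rangle> Tprp" "element a (a' \<^bold># L0) \<in> T"
    have "element a L \<in> T"
      using prime_typed(2)[OF T *(3)] by (intro prime_element_conv[OF T *(3) _ conv_sym[OF *(1)]] conv_refl) simp
    then show ?thesis using * unfolding seq_cases_def by blast
  next
    fix I L0 B C
    assume *: "conv [] i (s I) Tnt" "conv [] L L0 Tatmlst" "conv [] b (B \<^bold>& C) Tprp"
      "seq I L0 B \<^bold>\<and> seq I L0 C \<in> T"
    have "gd [] (seq I L0 B \<^bold>\<and> seq I L0 C)" by (rule prime_gd[OF T *(4)])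
    then have g: "gd [] (seq I L0 B)" "gd [] (seq I L0 C)" by simp_all
    have "seq I L0 B \<in> T" "seq I L0 C \<in> T" using *(4) prime_and[OF T g] by auto
    moreover have "seq I L b \<in> T" if "seq I L0 b \<in> T" for b
      using prime_typed(1)[OF T that] by (intro prime_seq_conv[OF T that _ conv_sym[OF *(2)]] conv_refl) auto
    ultimately show ?thesis using * unfolding seq_cases_def by blast
  next
    fix I L0 a B
    assume *: "conv [] i (s I) Tnt" "conv [] L L0 Tatmlst" "conv [] b (a \<^bold>\<Rightarrow> B) Tprp"
      "seq I (a \<^bold># L0) B \<in> T"
    have "conv [] a a Tatm" using conv_has_type[OF *(3)] by (auto intro: conv_refl split: option.splits ty.splits if_splits)
    then have "conv [] (a \<^bold># L0) (a \<^bold># L) Tatmlst" using conv_sym[OF *(2)] by (simp add: conv_rigid)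
    then have "seq I (a \<^bold># L) B \<in> T"
      using prime_typed(1)[OF T *(4)] by (intro prime_seq_conv[OF T *(4)] conv_refl) auto
    then show ?thesis using * unfolding seq_cases_def by blast
  next
    fix I L0 F
    assume *: "conv [] i (s I) Tnt" "conv [] L L0 Tatmlst" "conv [] b (Bigand F) Tprp"
      "All Ti (Lam Ti (seq I L0 (F \<cdot> Bnd 0))) \<in> T"
    have ty: "has_type [] I Tnt" "has_type [] F (Ti \<rightarrow> Tprp)" "has_type [] L Tatmlst"
      using conv_has_type[OF *(1)] conv_has_type[OF *(2)] conv_has_type[OF *(3)]
      by (auto split: option.splits ty.splits if_splits)
    have "All Ti (Lam Ti (seq I L (F \<cdot> Bnd 0))) \<in> T"
    proof (rule prime_conv[OF T *(4)])
      have "conv [Ti] (seq I L0 (F \<cdot> Bnd 0)) (seq I L (F \<cdot> Bnd 0)) To"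
        using ty conv_weaken[OF conv_sym[OF *(2)]] by (auto simp: conv_rigid intro!: conv_refl)
      then show "conv [] (All Ti (Lam Ti (seq I L0 (F \<cdot> Bnd 0)))) (All Ti (Lam Ti (seq I L (F \<cdot> Bnd 0)))) To"
        by (simp add: conv_rigid conv_lam)
    qed (use ty in simp)
    then show ?thesis using * ty unfolding seq_cases_def by blast
  next
    fix I L0 a
    assume *: "conv [] i (s I) Tnt" "conv [] L L0 Tatmlst" "conv [] b \<langle>a\<rangle> Tprp"
      "Ex Tprp (Lam Tprp (prog a (Bnd 0) \<^bold>\<and> seq I L0 (Bnd 0))) \<in> T"
    have ty: "has_type [] I Tnt" "has_type [] a Tatm" "has_type [] L0 Tatmlst"
      using conv_has_type[OF *(1)] conv_has_type[OF *(2)] conv_has_type[OF *(3)]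
      by (auto split: option.splits ty.splits if_splits)
    from *(4) prime_ex[OF T prime_gd[OF T *(4)]] obtain c where
      c: "has_type [] c Tprp" "prog a c \<^bold>\<and> seq I L0 c \<in> T" using ty by auto
    then have "prog a c \<in> T" "seq I L0 c \<in> T" using prime_and[OF T] ty by auto
    moreover from this(2) have "seq I L c \<in> T"
      using ty c by (intro prime_seq_conv[OF T _ _ conv_sym[OF *(2)]]) (auto intro: conv_refl)
    ultimately show ?thesis using * unfolding seq_cases_def by blast
  qed (auto simp: seq_cases_def)
qed

lemma seq_elim:
  assumes "prime T" "seq i L b \<in> T" "finite S" "S \<subseteq> T" "gd [] C"
    "\<And>\<theta> T'. is_subst \<theta> \<Longrightarrow> prime T' \<Longrightarrow> sub \<theta> ` S \<subseteq> T' \<Longrightarrow>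
      seq_cases T' (sub \<theta> i) (sub \<theta> L) (sub \<theta> b) \<Longrightarrow> sub \<theta> C \<in> T'"
  shows "C \<in> T"
  using assms(1,2) _ assms(3,4,5)
  by (rule prime_case_atom3) (auto intro: assms seq_clause_cases)

lemma element_elim:
  assumes "prime T" "element a L \<in> T" "finite S" "S \<subseteq> T" "gd [] C"
    "\<And>\<theta> T' L0. is_subst \<theta> \<Longrightarrow> prime T' \<Longrightarrow> sub \<theta> ` S \<subseteq> T' \<Longrightarrow>
      conv [] (sub \<theta> L) (sub \<theta> a \<^bold># L0) Tatmlst \<Longrightarrow> sub \<theta> C \<in> T'"
    "\<And>\<theta> T' Y L0. is_subst \<theta> \<Longrightarrow> prime T' \<Longrightarrow> sub \<theta> ` S \<subseteq> T' \<Longrightarrow>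
      conv [] (sub \<theta> L) (Y \<^bold># L0) Tatmlst \<Longrightarrow> element (sub \<theta> a) L0 \<in> T' \<Longrightarrow> sub \<theta> C \<in> T'"
  shows "C \<in> T"
  using assms(1,2) _ assms(3,4,5)
proof (rule prime_case_atom)
  fix H B \<theta> \<eta> T'
  assume *: "(H \<triangleq> B) \<in> D_all" "is_subst \<theta>" "is_subst \<eta>" "prime T'" "sub \<eta> B \<in> T'" "sub \<theta> ` S \<subseteq> T'"
    and c: "conv [] (element (sub \<theta> a) (sub \<theta> L)) (sub \<eta> H) To"
  from clause_element[OF *(1) c] show "sub \<theta> C \<in> T'"
  proof (elim exE disjE conjE)
    fix X L0 assume "sub \<eta> H = element X (X \<^bold># L0)"
    with c have c': "conv [] (sub \<theta> a) X Tatm" "conv [] (sub \<theta> L) (X \<^bold># L0) Tatmlst"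
      by (auto simp: conv_rigid)
    then have "conv [] L0 L0 Tatmlst"
      by (auto dest!: conv_has_type intro: conv_refl split: option.splits ty.splits if_splits)
    with c'(1) have "conv [] (X \<^bold># L0) (sub \<theta> a \<^bold># L0) Tatmlst"
      by (auto simp: conv_rigid intro: conv_sym)
    with c'(2) have "conv [] (sub \<theta> L) (sub \<theta> a \<^bold># L0) Tatmlst" by (rule conv_trans)
    with * assms(6) show ?thesis by blast
  next
    fix X Y L0 assume "sub \<eta> H = element X (Y \<^bold># L0)" and B: "sub \<eta> B = element X L0"
    with c have c': "conv [] (sub \<theta> a) X Tatm" "conv [] (sub \<theta> L) (Y \<^bold># L0) Tatmlst"
      by (auto simp: conv_rigid)
    have "element X L0 \<in> T'" using * B by simp
    from prime_element_conv[OF *(4) this conv_sym[OF c'(1)]] have "element (sub \<theta> a) L0 \<in> T'"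
      using prime_typed(2)[OF *(4) \<open>element X L0 \<in> T'\<close>] by (auto intro: conv_refl)
    with * c' assms(7) show ?thesis by blast
  qed
qed simp

text \<open>Unlisted variables stay fixed, as \<open>is_subst\<close> asks for a well-typed value of
  every variable.\<close>

definition vals :: "(string \<times> ty \<times> tm) list \<Rightarrow> subst" where
  "vals vs = (\<lambda>x \<tau>. case map_of (map (\<lambda>(x, \<tau>, t). ((x, \<tau>), t)) vs) (x, \<tau>) of
     Some t \<Rightarrow> t | None \<Rightarrow> Var x \<tau>)"

lemma is_subst_vals:
  "(\<And>x \<tau> t. (x, \<tau>, t) \<in> set vs \<Longrightarrow> has_type [] t \<tau>) \<Longrightarrow> is_subst (vals vs)"
  unfolding is_subst_def vals_def by (auto split: option.splits dest!: map_of_SomeD)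

section \<open>Right rules: introduction of list membership and of object-level sequents\<close>

lemma prime_defR:
  "prime T \<Longrightarrow> (H \<triangleq> B) \<in> D_all \<Longrightarrow> is_subst \<theta> \<Longrightarrow> sub \<theta> B \<in> T \<Longrightarrow> gd [] (sub \<theta> H) \<Longrightarrow> sub \<theta> H \<in> T"
  by (rule prime_closed) (auto intro: ent_defR prime_ent)

lemma D_intuit_subset: "c \<in> D_intuit \<Longrightarrow> c \<in> D_all"
  by (simp add: D_all_def)

lemma D_list_subset: "c \<in> D_list \<Longrightarrow> c \<in> D_all"
  by (simp add: D_all_def)

lemma element_head:
  assumes "prime T" "has_type [] a Tatm" "has_type [] L Tatmlst"
  shows "element a (a \<^bold># L) \<in> T"
  using prime_defR[OF assms(1) D_list_subset is_subst_vals,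
      of "element (Var ''X'' Tatm) (Var ''X'' Tatm \<^bold># Var ''L'' Tatmlst)" "\<^bold>\<top>"
        "[(''X'', Tatm, a), (''L'', Tatmlst, L)]"] assms prime_top[OF assms(1)]
  by (auto simp: D_list_def Let_def vals_def)

lemma element_tail:
  assumes "prime T" "element a L \<in> T" "has_type [] b Tatm"
  shows "element a (b \<^bold># L) \<in> T"
  using prime_defR[OF assms(1) D_list_subset is_subst_vals,
      of "element (Var ''X'' Tatm) (Var ''Y'' Tatm \<^bold># Var ''L'' Tatmlst)"
        "element (Var ''X'' Tatm) (Var ''L'' Tatmlst)"
        "[(''X'', Tatm, a), (''Y'', Tatm, b), (''L'', Tatmlst, L)]"]
    assms prime_typed(2)[OF assms(1,2)]
  by (auto simp: D_list_def Let_def vals_def)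

lemma seq_init:
  assumes "prime T" "element a (b \<^bold># L) \<in> T" "has_type [] i Tnt" "has_type [] b Tatm" "has_type [] L Tatmlst"
  shows "seq i (b \<^bold># L) \<langle>a\<rangle> \<in> T"
  using prime_defR[OF assms(1) D_intuit_subset is_subst_vals,
      of "seq (Var ''I'' Tnt) (Var ''A1'' Tatm \<^bold># Var ''L'' Tatmlst) \<langle>Var ''A'' Tatm\<rangle>"
        "element (Var ''A'' Tatm) (Var ''A1'' Tatm \<^bold># Var ''L'' Tatmlst)"
        "[(''I'', Tnt, i), (''A'', Tatm, a), (''A1'', Tatm, b), (''L'', Tatmlst, L)]"]
    assms prime_typed(2)[OF assms(1,2)]
  by (auto simp: D_intuit_def Let_def vals_def)

lemma seq_tt:
  assumes "prime T" "has_type [] i Tnt" "has_type [] L Tatmlst"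
  shows "seq i L tt \<in> T"
  using prime_defR[OF assms(1) D_intuit_subset is_subst_vals,
      of "seq (Var ''I'' Tnt) (Var ''L'' Tatmlst) tt" "\<^bold>\<top>"
        "[(''I'', Tnt, i), (''L'', Tatmlst, L)]"] assms prime_top[OF assms(1)]
  by (auto simp: D_intuit_def Let_def vals_def)

lemma seq_amp:
  assumes "prime T" "seq i L b \<in> T" "seq i L c \<in> T"
  shows "seq (s i) L (b \<^bold>& c) \<in> T"
  using prime_defR[OF assms(1) D_intuit_subset is_subst_vals,
      of "seq (s (Var ''I'' Tnt)) (Var ''L'' Tatmlst) (Var ''B'' Tprp \<^bold>& Var ''C'' Tprp)"
        "seq (Var ''I'' Tnt) (Var ''L'' Tatmlst) (Var ''B'' Tprp) \<^bold>\<and>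
         seq (Var ''I'' Tnt) (Var ''L'' Tatmlst) (Var ''C'' Tprp)"
        "[(''I'', Tnt, i), (''B'', Tprp, b), (''C'', Tprp, c), (''L'', Tatmlst, L)]"]
    assms prime_typed(1)[OF assms(1,2)] prime_typed(1)[OF assms(1,3)]
  by (auto simp: D_intuit_def Let_def vals_def prime_and)

lemma seq_arrow:
  assumes "prime T" "seq i (a \<^bold># L) b \<in> T" "has_type [] a Tatm" "has_type [] L Tatmlst"
  shows "seq (s i) L (a \<^bold>\<Rightarrow> b) \<in> T"
  using prime_defR[OF assms(1) D_intuit_subset is_subst_vals,
      of "seq (s (Var ''I'' Tnt)) (Var ''L'' Tatmlst) (Var ''A'' Tatm \<^bold>\<Rightarrow> Var ''B'' Tprp)"
        "seq (Var ''I'' Tnt) (Var ''A'' Tatm \<^bold># Var ''L'' Tatmlst) (Var ''B'' Tprp)"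
        "[(''I'', Tnt, i), (''A'', Tatm, a), (''B'', Tprp, b), (''L'', Tatmlst, L)]"]
    assms prime_typed(1)[OF assms(1,2)]
  by (auto simp: D_intuit_def Let_def vals_def)

lemma seq_bigand:
  assumes "prime T" "All Ti (Lam Ti (seq i L (F \<cdot> Bnd 0))) \<in> T"
    "has_type [] i Tnt" "has_type [] L Tatmlst" "has_type [] F (Ti \<rightarrow> Tprp)"
  shows "seq (s i) L (Bigand F) \<in> T"
  using prime_defR[OF assms(1) D_intuit_subset is_subst_vals,
      of "seq (s (Var ''I'' Tnt)) (Var ''L'' Tatmlst) (Bigand (Var ''F'' (Ti \<rightarrow> Tprp)))"
        "all ''x'' Ti (seq (Var ''I'' Tnt) (Var ''L'' Tatmlst) (Var ''F'' (Ti \<rightarrow> Tprp) \<cdot> Var ''x'' Ti))"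
        "[(''I'', Tnt, i), (''F'', Ti \<rightarrow> Tprp, F), (''L'', Tatmlst, L)]"]
    assms
  by (auto simp: D_intuit_def Let_def vals_def)

lemma seq_prog:
  assumes "prime T" "prog a b \<in> T" "seq i L b \<in> T"
  shows "seq (s i) L \<langle>a\<rangle> \<in> T"
proof -
  have ty: "has_type [] a Tatm" "has_type [] b Tprp" "has_type [] i Tnt" "has_type [] L Tatmlst"
    using prime_typed assms by blast+
  have "Ex Tprp (Lam Tprp (prog a (Bnd 0) \<^bold>\<and> seq i L (Bnd 0))) \<in> T"
    using ty assms by (auto simp: prime_ex prime_and intro!: exI[of _ b])
  then show ?thesis
    using prime_defR[OF assms(1) D_intuit_subset is_subst_vals,
        of "seq (s (Var ''I'' Tnt)) (Var ''L'' Tatmlst) \<langle>Var ''A'' Tatm\<rangle>"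
        "ex ''b'' Tprp (prog (Var ''A'' Tatm) (Var ''b'' Tprp) \<^bold>\<and>
           seq (Var ''I'' Tnt) (Var ''L'' Tatmlst) (Var ''b'' Tprp))"
        "[(''I'', Tnt, i), (''A'', Tatm, a), (''L'', Tatmlst, L)]"] ty
    by (auto simp: D_intuit_def Let_def vals_def)
qed

section \<open>Monotonicity, weakening and cut for the specification logic\<close>

text \<open>The way to put an implication or a universal formula into \<open>T\<close>: what is
  known of \<open>T\<close> is collected in a finite \<open>S\<close>, and the argument is carried
  out in every prime theory above \<open>S\<close>.\<close>

lemma forces_mem:
  assumes "forces D A F" "prime_theory D T" "finite S" "S \<subseteq> T"
    "\<And>T'. prime_theory D T' \<Longrightarrow> S \<subseteq> T' \<Longrightarrow> F T'"
  shows "A \<in> T"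
proof (rule prime_ent_subset[OF assms(2) _ assms(4)])
  show "ent D S A" using assms prime_gd by (intro forces_ent) blast+
  show "gd [] A" using assms(1) by (simp add: forces_def)
qed

lemma forces_self: "gd [] A \<Longrightarrow> forces D A (\<lambda>T. A \<in> T)"
  by (rule forces_decides[OF decides_mem])

text \<open>The initial clause demands a list of the form \<open>b :: L0\<close>. Case analysis on
  the membership exposes that form.\<close>

lemma element_seq:
  assumes "prime T" "element a L \<in> T" "has_type [] i Tnt"
  shows "seq i L \<langle>a\<rangle> \<in> T"
proof (rule element_elim[OF assms(1,2), where S = "{}"])
  have ty: "has_type [] a Tatm" "has_type [] L Tatmlst" using prime_typed assms by blast+
  then show "gd [] (seq i L \<langle>a\<rangle>)" using assms by simp
  have *: "sub \<theta> (seq i L \<langle>a\<rangle>) \<in> T'"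
    if "is_subst \<theta>" "prime T'" "conv [] (sub \<theta> L) (b \<^bold># L0) Tatmlst" "element (sub \<theta> a) (b \<^bold># L0) \<in> T'"
    for \<theta> T' b L0
  proof -
    have "has_type [] b Tatm" "has_type [] L0 Tatmlst"
      using conv_has_type[OF that(3)] by (auto split: option.splits ty.splits if_splits)
    then have "seq (sub \<theta> i) (b \<^bold># L0) \<langle>sub \<theta> a\<rangle> \<in> T'"
      using seq_init[OF that(2,4)] assms(3) that(1) by simp
    from prime_seq_conv[OF that(2) this _ conv_sym[OF that(3)]] show ?thesis
      using that(1) assms(3) ty by (simp add: conv_refl)
  qed
  fix \<theta> T' L0 assume **: "is_subst \<theta>" "prime T'"
  {
    assume c: "conv [] (sub \<theta> L) (sub \<theta> a \<^bold># L0) Tatmlst"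
    then have "has_type [] L0 Tatmlst"
      using conv_has_type[OF c] by (auto split: option.splits ty.splits if_splits)
    with * ** c ty show "sub \<theta> (seq i L \<langle>a\<rangle>) \<in> T'" by (blast intro: element_head sub_has_type)
  next
    fix Y assume c: "conv [] (sub \<theta> L) (Y \<^bold># L0) Tatmlst" "element (sub \<theta> a) L0 \<in> T'"
    then have "has_type [] Y Tatm"
      using conv_has_type[OF c(1)] by (auto split: option.splits ty.splits if_splits)
    with * ** c show "sub \<theta> (seq i L \<langle>a\<rangle>) \<in> T'" by (blast intro: element_tail)
  }
qed auto

lemma element_nil: "prime T \<Longrightarrow> element a nil \<notin> T"
proof
  assume *: "prime T" "element a nil \<in> T"
  have "\<^bold>\<bottom> \<in> T"
    by (rule element_elim[OF *, where S = "{}"]) (auto simp: conv_rigid)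
  with * show False by (simp add: prime_bot)
qed

text \<open>Backchaining needs a height \<open>s I\<close>, which does not unify with
  \<open>z\<close>, so only the initial clause remains for an atomic goal.\<close>

lemma seq_z:
  assumes "prime T" "seq z L \<langle>a\<rangle> \<in> T"
  shows "element a L \<in> T"
proof (rule seq_elim[OF assms, where S = "{}"])
  have ty: "has_type [] a Tatm" "has_type [] L Tatmlst"
    using prime_typed(1)[OF assms] by (auto split: option.splits ty.splits if_splits)
  then show "gd [] (element a L)" by simp
  fix \<theta> T' assume \<theta>: "is_subst \<theta>" "prime T'" "seq_cases T' (sub \<theta> z) (sub \<theta> L) (sub \<theta> \<langle>a\<rangle>)"
  then obtain a' where a': "conv [] (sub \<theta> a) a' Tatm" "element a' (sub \<theta> L) \<in> T'"
    by (auto simp: seq_cases_def conv_rigid)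
  have "element (sub \<theta> a) (sub \<theta> L) \<in> T'"
    by (rule prime_element_conv[OF \<theta>(2) a'(2) conv_sym[OF a'(1)] conv_refl]) (use \<theta> ty in simp)
  then show "sub \<theta> (element a L) \<in> T'" by simp
qed auto

text \<open>A simultaneous substitution of derivations for hypotheses, written as a formula so that
  it may be an antecedent in an induction formula.\<close>

definition SubF :: "tm \<Rightarrow> tm \<Rightarrow> tm \<Rightarrow> tm" where
  "SubF L L' j = All Tatm (Lam Tatm
     (element (Bnd 0) (lift 0 L) \<^bold>\<supset> seq (lift 0 j) (lift 0 L') \<langle>Bnd 0\<rangle>))"

text \<open>Cut for several formulas at once: the height of derivations of \<open>L'\<close> from the members of \<open>L\<close>
  is bounded by \<open>j\<close>, uniformly in the bound \<open>k\<close> of the result. For \<open>j = z\<close>, this is weakening and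
  monotonicity in the height.\<close>

definition CutF :: "tm \<Rightarrow> tm \<Rightarrow> tm \<Rightarrow> tm" where
  "CutF i j k = All Tatmlst (Lam Tatmlst (All Tatmlst (Lam Tatmlst (All Tprp (Lam Tprp
     (seq (lift 0 (lift 0 (lift 0 i))) (Bnd 2) (Bnd 0) \<^bold>\<supset>
      SubF (Bnd 2) (Bnd 1) (lift 0 (lift 0 (lift 0 j))) \<^bold>\<supset>
      seq (lift 0 (lift 0 (lift 0 k))) (Bnd 1) (Bnd 0)))))))"

text \<open>Together with \<open>WeakF\<close>, the special cases of cut that its own induction
  consumes. Goals are atomic since only the derivations supplied by \<open>SubF\<close> have to be
  adjusted.\<close>

definition MonoF :: "tm \<Rightarrow> tm \<Rightarrow> tm" where
  "MonoF j k = All Tatmlst (Lam Tatmlst (All Tatm (Lam Tatm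
     (seq j (Bnd 1) \<langle>Bnd 0\<rangle> \<^bold>\<supset> seq k (Bnd 1) \<langle>Bnd 0\<rangle>))))"

definition WeakF :: "tm \<Rightarrow> tm" where
  "WeakF j = All Tatm (Lam Tatm (All Tatmlst (Lam Tatmlst (All Tatm (Lam Tatm
     (seq j (Bnd 1) \<langle>Bnd 0\<rangle> \<^bold>\<supset> seq j (Bnd 2 \<^bold># Bnd 1) \<langle>Bnd 0\<rangle>))))))"

lemma sub_SubF:
  "has_type [] L Tatmlst \<Longrightarrow> has_type [] L' Tatmlst \<Longrightarrow> has_type [] j Tnt \<Longrightarrow> is_subst \<theta> \<Longrightarrow>
   sub \<theta> (SubF L L' j) = SubF (sub \<theta> L) (sub \<theta> L') (sub \<theta> j)"
  by (simp add: SubF_def)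

lemma sub_CutF:
  "has_type [] i Tnt \<Longrightarrow> has_type [] j Tnt \<Longrightarrow> has_type [] k Tnt \<Longrightarrow> is_subst \<theta> \<Longrightarrow>
   sub \<theta> (CutF i j k) = CutF (sub \<theta> i) (sub \<theta> j) (sub \<theta> k)"
  by (simp add: CutF_def SubF_def)

lemma sub_MonoF:
  "sub \<theta> (MonoF j k) = MonoF (sub \<theta> j) (sub \<theta> k)"
  by (simp add: MonoF_def)

lemma sub_WeakF:
  "sub \<theta> (WeakF j) = WeakF (sub \<theta> j)"
  by (simp add: WeakF_def)

lemma forces_SubF:
  "has_type [] L Tatmlst \<Longrightarrow> has_type [] L' Tatmlst \<Longrightarrow> has_type [] j Tnt \<Longrightarrow>
   forces D (SubF L L' j) (\<lambda>T. \<forall>a. has_type [] a Tatm \<longrightarrow> element a L \<in> T \<longrightarrow> seq j L' \<langle>a\<rangle> \<in> T)"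
  unfolding SubF_def
  by (rule forces_all) (auto intro!: forces_imp decides_mem forces_self)

lemma forces_CutF:
  "has_type [] i Tnt \<Longrightarrow> has_type [] j Tnt \<Longrightarrow> has_type [] k Tnt \<Longrightarrow>
   forces D (CutF i j k) (\<lambda>T. \<forall>L. has_type [] L Tatmlst \<longrightarrow> (\<forall>L'. has_type [] L' Tatmlst \<longrightarrow>
     (\<forall>b. has_type [] b Tprp \<longrightarrow> seq i L b \<in> T \<longrightarrow> SubF L L' j \<in> T \<longrightarrow> seq k L' b \<in> T)))"
  unfolding CutF_def SubF_def
  by (rule forces_all) (auto intro!: forces_all forces_imp decides_mem forces_self)

lemma forces_MonoF:
  "has_type [] j Tnt \<Longrightarrow> has_type [] k Tnt \<Longrightarrow>
   forces D (MonoF j k) (\<lambda>T. \<forall>L. has_type [] L Tatmlst \<longrightarrow> (\<forall>a. has_type [] a Tatm \<longrightarrow>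
     seq j L \<langle>a\<rangle> \<in> T \<longrightarrow> seq k L \<langle>a\<rangle> \<in> T))"
  unfolding MonoF_def
  by (rule forces_all) (auto intro!: forces_all forces_imp decides_mem forces_self)

lemma forces_WeakF:
  "has_type [] j Tnt \<Longrightarrow>
   forces D (WeakF j) (\<lambda>T. \<forall>b. has_type [] b Tatm \<longrightarrow> (\<forall>L. has_type [] L Tatmlst \<longrightarrow>
     (\<forall>a. has_type [] a Tatm \<longrightarrow> seq j L \<langle>a\<rangle> \<in> T \<longrightarrow> seq j (b \<^bold># L) \<langle>a\<rangle> \<in> T)))"
  unfolding WeakF_def
  by (rule forces_all) (auto intro!: forces_all forces_imp decides_mem forces_self)

lemma CutF_use:
  assumes "prime T" "CutF i j k \<in> T" "SubF L L' j \<in> T" "seq i L b \<in> T"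
    "has_type [] j Tnt" "has_type [] k Tnt" "has_type [] L' Tatmlst"
  shows "seq k L' b \<in> T"
  using forcesD[OF forces_CutF assms(1,2)] assms prime_typed(1)[OF assms(1,4)] by blast

lemma SubF_use:
  assumes "prime T" "SubF L L' j \<in> T" "element a L \<in> T" "has_type [] j Tnt" "has_type [] L' Tatmlst"
  shows "seq j L' \<langle>a\<rangle> \<in> T"
  using forcesD[OF forces_SubF assms(1,2)] assms prime_typed(2)[OF assms(1,3)] by blast

lemma MonoF_use:
  assumes "prime T" "MonoF j k \<in> T" "seq j L \<langle>a\<rangle> \<in> T" "has_type [] k Tnt"
  shows "seq k L \<langle>a\<rangle> \<in> T"
proof -
  have "has_type [] j Tnt \<and> has_type [] L Tatmlst \<and> has_type [] a Tatm"
    using prime_typed(1)[OF assms(1,3)] by (auto split: option.splits ty.splits if_splits)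
  then show ?thesis using forcesD[OF forces_MonoF assms(1,2)] assms by blast
qed

lemma WeakF_use:
  assumes "prime T" "WeakF j \<in> T" "seq j L \<langle>a\<rangle> \<in> T" "has_type [] b Tatm"
  shows "seq j (b \<^bold># L) \<langle>a\<rangle> \<in> T"
proof -
  have "has_type [] j Tnt \<and> has_type [] L Tatmlst \<and> has_type [] a Tatm"
    using prime_typed(1)[OF assms(1,3)] by (auto split: option.splits ty.splits if_splits)
  then show ?thesis using forcesD[OF forces_WeakF assms(1,2)] assms by blast
qed

text \<open>Moving an antecedent \<open>b\<close> into the context extends both lists by it:
  \<open>b\<close> is available as a hypothesis, and the derivations of the old entries are weakened
  by \<open>WeakF\<close>.\<close>

lemma SubF_cons:
  assumes T: "prime T" "SubF L L' j \<in> T" "WeakF j \<in> T" and ty: "has_type [] b Tatm"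
    "has_type [] j Tnt" "has_type [] L Tatmlst" "has_type [] L' Tatmlst"
  shows "SubF (b \<^bold># L) (b \<^bold># L') j \<in> T"
proof (rule forces_mem[OF forces_SubF T(1), where S = "{SubF L L' j, WeakF j}"])
  fix T' assume T': "prime T'" "{SubF L L' j, WeakF j} \<subseteq> T'"
  show "\<forall>a. has_type [] a Tatm \<longrightarrow> element a (b \<^bold># L) \<in> T' \<longrightarrow> seq j (b \<^bold># L') \<langle>a\<rangle> \<in> T'"
  proof (intro allI impI)
    fix a assume a: "has_type [] a Tatm" "element a (b \<^bold># L) \<in> T'"
    show "seq j (b \<^bold># L') \<langle>a\<rangle> \<in> T'"
    proof (rule element_elim[OF T'(1) a(2), where S = "{SubF L L' j, WeakF j}"])
      fix \<theta> T'' L0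
      assume \<theta>: "is_subst \<theta>" "prime T''" "sub \<theta> ` {SubF L L' j, WeakF j} \<subseteq> T''"
      then have S: "SubF (sub \<theta> L) (sub \<theta> L') (sub \<theta> j) \<in> T''" "WeakF (sub \<theta> j) \<in> T''"
        using ty by (auto simp: sub_SubF sub_WeakF)
      {
        assume "conv [] (sub \<theta> (b \<^bold># L)) (sub \<theta> a \<^bold># L0) Tatmlst"
        then have c: "conv [] (sub \<theta> b) (sub \<theta> a) Tatm" by (auto simp: conv_rigid)
        have "element (sub \<theta> b) (sub \<theta> b \<^bold># sub \<theta> L') \<in> T''"
          using \<theta> ty by (intro element_head) auto
        then have "element (sub \<theta> a) (sub \<theta> b \<^bold># sub \<theta> L') \<in> T''"
          by (rule prime_element_conv[OF \<theta>(2)]) (use c \<theta> ty in \<open>auto intro: conv_refl\<close>)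
        then show "sub \<theta> (seq j (b \<^bold># L') \<langle>a\<rangle>) \<in> T''"
          using \<theta> ty by (auto intro: element_seq)
      next
        fix Y assume *: "conv [] (sub \<theta> (b \<^bold># L)) (Y \<^bold># L0) Tatmlst" "element (sub \<theta> a) L0 \<in> T''"
        then have "conv [] L0 (sub \<theta> L) Tatmlst" by (auto simp: conv_rigid intro: conv_sym)
        from prime_element_conv[OF \<theta>(2) *(2) conv_refl this]
        have "element (sub \<theta> a) (sub \<theta> L) \<in> T''" using \<theta> a by simp
        from SubF_use[OF \<theta>(2) S(1) this] have "seq (sub \<theta> j) (sub \<theta> L') \<langle>sub \<theta> a\<rangle> \<in> T''"
          using \<theta> ty by simp
        from WeakF_use[OF \<theta>(2) S(2) this, of "sub \<theta> b"]
        show "sub \<theta> (seq j (b \<^bold># L') \<langle>a\<rangle>) \<in> T''" using \<theta> ty by simp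
      }
    qed (use T' ty a in auto)
  qed
qed (use T ty in auto)

text \<open>A derivation of height \<open>z\<close> ends in a hypothesis or in \<open>tt\<close>. A
  hypothesis is replaced by its given derivation of height \<open>j\<close>, raised to
  \<open>k\<close>.\<close>

lemma CutF_z:
  assumes T: "prime T" "MonoF j k \<in> T" and ty: "has_type [] j Tnt" "has_type [] k Tnt"
  shows "CutF z j k \<in> T"
proof (rule forces_mem[OF forces_CutF T(1), where S = "{MonoF j k}"])
  fix T' assume T': "prime T'" "{MonoF j k} \<subseteq> T'"
  show "\<forall>L. has_type [] L Tatmlst \<longrightarrow> (\<forall>L'. has_type [] L' Tatmlst \<longrightarrow>
    (\<forall>b. has_type [] b Tprp \<longrightarrow> seq z L b \<in> T' \<longrightarrow> SubF L L' j \<in> T' \<longrightarrow> seq k L' b \<in> T'))"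
  proof (intro allI impI)
    fix L L' b assume L: "has_type [] L Tatmlst" "has_type [] L' Tatmlst" "has_type [] b Tprp"
      and *: "seq z L b \<in> T'" "SubF L L' j \<in> T'"
    show "seq k L' b \<in> T'"
    proof (rule seq_elim[OF T'(1) *(1), where S = "{MonoF j k, SubF L L' j}"])
      fix \<theta> T''
      assume \<theta>: "is_subst \<theta>" "prime T''" "sub \<theta> ` {MonoF j k, SubF L L' j} \<subseteq> T''"
        and c: "seq_cases T'' (sub \<theta> z) (sub \<theta> L) (sub \<theta> b)"
      then have S: "SubF (sub \<theta> L) (sub \<theta> L') (sub \<theta> j) \<in> T''" "MonoF (sub \<theta> j) (sub \<theta> k) \<in> T''"
        using ty L by (auto simp: sub_SubF sub_MonoF)
      have cv: "seq (sub \<theta> k) (sub \<theta> L') (sub \<theta> b) \<in> T''"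
        if "conv [] (sub \<theta> b) b' Tprp" "seq (sub \<theta> k) (sub \<theta> L') b' \<in> T''" for b'
        using prime_seq_conv[OF \<theta>(2) that(2) _ _ conv_sym[OF that(1)]] \<theta> ty L
        by (simp add: conv_refl)
      from c have "seq (sub \<theta> k) (sub \<theta> L') (sub \<theta> b) \<in> T''"
        unfolding seq_cases_def
      proof (elim disjE exE conjE)
        fix a assume a: "conv [] (sub \<theta> b) \<langle>a\<rangle> Tprp" "element a (sub \<theta> L) \<in> T''"
        have "seq (sub \<theta> j) (sub \<theta> L') \<langle>a\<rangle> \<in> T''"
          using SubF_use[OF \<theta>(2) S(1) a(2)] \<theta> ty L by simp
        from MonoF_use[OF \<theta>(2) S(2) this] a cv show ?thesis using \<theta> ty by simp
      next
        assume "conv [] (sub \<theta> b) tt Tprp"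
        then show ?thesis using cv seq_tt[OF \<theta>(2)] \<theta> ty L by simp
      qed (simp_all add: conv_rigid)
      then show "sub \<theta> (seq k L' b) \<in> T''" by simp
    qed (use T' * ty L in auto)
  qed
qed (use T ty in auto)

text \<open>The last inference is repeated over \<open>L'\<close>, which costs one successor.
  Derivations that replace hypotheses have height \<open>j\<close> and are raised to
  \<open>s k\<close> by \<open>MonoF\<close>; object-level implications need \<open>WeakF\<close>
  for the extended lists.\<close>

lemma CutF_s:
  assumes T: "prime T" "CutF i j k \<in> T" "WeakF j \<in> T" "MonoF j (s k) \<in> T"
    and ty: "has_type [] i Tnt" "has_type [] j Tnt" "has_type [] k Tnt"
  shows "CutF (s i) j (s k) \<in> T"
proof (rule forces_mem[OF forces_CutF T(1), where S = "{CutF i j k, WeakF j, MonoF j (s k)}"])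
  fix T' assume T': "prime T'" "{CutF i j k, WeakF j, MonoF j (s k)} \<subseteq> T'"
  show "\<forall>L. has_type [] L Tatmlst \<longrightarrow> (\<forall>L'. has_type [] L' Tatmlst \<longrightarrow>
    (\<forall>b. has_type [] b Tprp \<longrightarrow> seq (s i) L b \<in> T' \<longrightarrow> SubF L L' j \<in> T' \<longrightarrow> seq (s k) L' b \<in> T'))"
  proof (intro allI impI)
    fix L L' b assume L: "has_type [] L Tatmlst" "has_type [] L' Tatmlst" "has_type [] b Tprp"
      and *: "seq (s i) L b \<in> T'" "SubF L L' j \<in> T'"
    show "seq (s k) L' b \<in> T'"
    proof (rule seq_elim[OF T'(1) *(1), where S = "{CutF i j k, WeakF j, MonoF j (s k), SubF L L' j}"])
      fix \<theta> T''
      assume \<theta>: "is_subst \<theta>" "prime T''"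
        "sub \<theta> ` {CutF i j k, WeakF j, MonoF j (s k), SubF L L' j} \<subseteq> T''"
        and c: "seq_cases T'' (sub \<theta> (s i)) (sub \<theta> L) (sub \<theta> b)"
      define i' j' k' M M' where "i' = sub \<theta> i" "j' = sub \<theta> j" "k' = sub \<theta> k" "M = sub \<theta> L"
        "M' = sub \<theta> L'"
      note defs = this
      have ty': "has_type [] i' Tnt" "has_type [] j' Tnt" "has_type [] k' Tnt"
        "has_type [] M Tatmlst" "has_type [] M' Tatmlst" "has_type [] (sub \<theta> b) Tprp"
        using \<theta> ty L by (auto simp: defs)
      have S: "SubF M M' j' \<in> T''" "MonoF j' (s k') \<in> T''" "CutF i' j' k' \<in> T''" "WeakF j' \<in> T''"
        using \<theta> ty L by (auto simp: sub_SubF sub_MonoF sub_CutF sub_WeakF defs)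
      have cv: "seq (s k') M' (sub \<theta> b) \<in> T''"
        if "conv [] (sub \<theta> b) b' Tprp" "seq (s k') M' b' \<in> T''" for b'
        using prime_seq_conv[OF \<theta>(2) that(2) _ _ conv_sym[OF that(1)]] ty'
        by (simp add: conv_refl)
      have cvi: "seq i' N b \<in> T''" if "conv [] (sub \<theta> (s i)) (s I) Tnt" "seq I N b \<in> T''" for I N b
        using prime_seq_conv[OF \<theta>(2) that(2), of i' N b] that(1) prime_typed(1)[OF \<theta>(2) that(2)]
        by (auto simp: conv_rigid defs intro: conv_sym conv_refl)
      from c[folded defs] have "seq (s k') M' (sub \<theta> b) \<in> T''"
        unfolding seq_cases_def
      proof (elim disjE exE conjE)
        fix a assume a: "conv [] (sub \<theta> b) \<langle>a\<rangle> Tprp" "element a M \<in> T''"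
        have "seq j' M' \<langle>a\<rangle> \<in> T''" using SubF_use[OF \<theta>(2) S(1) a(2)] ty' by simp
        from MonoF_use[OF \<theta>(2) S(2) this] a cv show ?thesis using ty' by simp
      next
        assume "conv [] (sub \<theta> b) tt Tprp"
        then show ?thesis using cv seq_tt[OF \<theta>(2)] ty' by simp
      next
        fix I B C
        assume a: "conv [] (sub \<theta> (s i)) (s I) Tnt" "conv [] (sub \<theta> b) (B \<^bold>& C) Tprp"
          "seq I M B \<in> T''" "seq I M C \<in> T''"
        have "seq k' M' B \<in> T''" "seq k' M' C \<in> T''"
          using CutF_use[OF \<theta>(2) S(3,1) cvi[OF a(1,3)]] CutF_use[OF \<theta>(2) S(3,1) cvi[OF a(1,4)]] ty'
          by simp_all
        then show ?thesis using cv[OF a(2)] seq_amp[OF \<theta>(2)] by simp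
      next
        fix I a B
        assume a: "conv [] (sub \<theta> (s i)) (s I) Tnt" "conv [] (sub \<theta> b) (a \<^bold>\<Rightarrow> B) Tprp"
          "seq I (a \<^bold># M) B \<in> T''"
        have ta: "has_type [] a Tatm"
          using conv_has_type[OF a(2)] by (auto split: option.splits ty.splits if_splits)
        have "SubF (a \<^bold># M) (a \<^bold># M') j' \<in> T''"
          using SubF_cons[OF \<theta>(2) S(1,4)] ta ty' by simp
        from CutF_use[OF \<theta>(2) S(3) this cvi[OF a(1,3)]] have "seq k' (a \<^bold># M') B \<in> T''"
          using ty' ta by simp
        then show ?thesis using cv[OF a(2)] seq_arrow[OF \<theta>(2)] ty' ta by simp
      next
        fix I F
        assume a: "conv [] (sub \<theta> (s i)) (s I) Tnt" "conv [] (sub \<theta> b) (Bigand F) Tprp"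
          "has_type [] F (Ti \<rightarrow> Tprp)" "All Ti (Lam Ti (seq I M (F \<cdot> Bnd 0))) \<in> T''"
        have I: "has_type [] I Tnt"
          using conv_has_type[OF a(1)] by (auto split: option.splits ty.splits if_splits)
        have fA: "forces D_all (All Ti (Lam Ti (seq I M (F \<cdot> Bnd 0))))
            (\<lambda>T. \<forall>x. has_type [] x Ti \<longrightarrow> seq I M (F \<cdot> x) \<in> T)"
          if "has_type [] I Tnt" "has_type [] M Tatmlst" for I M
          using that a(3) by (intro forces_all) (auto intro!: forces_self)
        \<comment> \<open>The universal formula does not follow from its instances in
          \<open>T''\<close>. It is obtained from three formulas of \<open>T''\<close>, with the
          instances treated in every prime theory \<open>U\<close> above them.\<close>
        have "All Ti (Lam Ti (seq k' M' (F \<cdot> Bnd 0))) \<in> T''"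
        proof (rule forces_mem[OF fA \<theta>(2),
              where S = "{All Ti (Lam Ti (seq i' M (F \<cdot> Bnd 0))), CutF i' j' k', SubF M M' j'}"])
          have "conv [] I i' Tnt" using a(1) by (auto simp: conv_rigid defs intro: conv_sym)
          then have "conv [Ti] (seq I M (F \<cdot> Bnd 0)) (seq i' M (F \<cdot> Bnd 0)) To"
            using ty' a(3) conv_weaken[of I i' Tnt "[Ti]"] by (auto simp: conv_rigid intro!: conv_refl)
          then have "conv [] (All Ti (Lam Ti (seq I M (F \<cdot> Bnd 0)))) (All Ti (Lam Ti (seq i' M (F \<cdot> Bnd 0)))) To"
            by (simp add: conv_rigid conv_lam)
          from prime_conv[OF \<theta>(2) a(4) this] S ty' a(3)
          show "{All Ti (Lam Ti (seq i' M (F \<cdot> Bnd 0))), CutF i' j' k', SubF M M' j'} \<subseteq> T''" by simp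
          fix U assume U: "prime U"
            "{All Ti (Lam Ti (seq i' M (F \<cdot> Bnd 0))), CutF i' j' k', SubF M M' j'} \<subseteq> U"
          show "\<forall>x. has_type [] x Ti \<longrightarrow> seq k' M' (F \<cdot> x) \<in> U"
            using forcesD[OF fA U(1), of i' M] CutF_use[OF U(1), of i' j' k' M M'] U(2) ty' by simp
        qed (use ty' in auto)
        then show ?thesis using cv[OF a(2)] seq_bigand[OF \<theta>(2)] ty' a(3) by simp
      next
        fix I a b'
        assume a: "conv [] (sub \<theta> (s i)) (s I) Tnt" "conv [] (sub \<theta> b) \<langle>a\<rangle> Tprp"
          "prog a b' \<in> T''" "seq I M b' \<in> T''"
        have "seq k' M' b' \<in> T''"
          using CutF_use[OF \<theta>(2) S(3,1) cvi[OF a(1,4)]] ty' by simp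
        then show ?thesis using cv[OF a(2)] seq_prog[OF \<theta>(2) a(3)] by simp
      qed
      then show "sub \<theta> (seq (s k) L' b) \<in> T''" by (simp add: defs)
    qed (use T' * ty L in auto)
  qed
qed (use T ty in auto)

section \<open>Bootstrapping of monotonicity, weakening and cut\<close>

lemma MonoF_z:
  assumes "prime T" "has_type [] k Tnt"
  shows "MonoF z k \<in> T"
proof (rule forces_mem[OF forces_MonoF assms(1), where S = "{}"])
  fix T' assume T': "prime T'"
  show "\<forall>L. has_type [] L Tatmlst \<longrightarrow> (\<forall>a. has_type [] a Tatm \<longrightarrow>
      seq z L \<langle>a\<rangle> \<in> T' \<longrightarrow> seq k L \<langle>a\<rangle> \<in> T')"
    using element_seq[OF T' seq_z[OF T']] assms by blast
qed (use assms in auto)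

lemma WeakF_z:
  assumes "prime T"
  shows "WeakF z \<in> T"
proof (rule forces_mem[OF forces_WeakF assms(1), where S = "{}"])
  fix T' assume T': "prime T'"
  have "has_type [] z Tnt" by simp
  then show "\<forall>b. has_type [] b Tatm \<longrightarrow> (\<forall>L. has_type [] L Tatmlst \<longrightarrow>
      (\<forall>a. has_type [] a Tatm \<longrightarrow> seq z L \<langle>a\<rangle> \<in> T' \<longrightarrow> seq z (b \<^bold># L) \<langle>a\<rangle> \<in> T'))"
    using element_seq[OF T' element_tail[OF T' seq_z[OF T']]] by blast
qed auto

lemma SubF_refl:
  assumes "prime T" "has_type [] L Tatmlst" "has_type [] j Tnt"
  shows "SubF L L j \<in> T"
  by (rule forces_mem[OF forces_SubF assms(1), where S = "{}"]) (auto intro!: element_seq simp: assms)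

lemma CutF_mono:
  assumes "prime T" "CutF i z k \<in> T" "seq i L b \<in> T" "has_type [] k Tnt"
  shows "seq k L b \<in> T"
  using CutF_use[OF assms(1,2) SubF_refl assms(3)] prime_typed(1)[OF assms(1,3)] assms by auto

lemma CutF_trans:
  assumes T: "prime T" "CutF i j k \<in> T" "CutF k z m \<in> T"
    and ty: "has_type [] i Tnt" "has_type [] j Tnt" "has_type [] k Tnt" "has_type [] m Tnt"
  shows "CutF i j m \<in> T"
  by (rule forces_mem[OF forces_CutF T(1), where S = "{CutF i j k, CutF k z m}"])
    (use T ty in \<open>auto intro: CutF_mono CutF_use\<close>)

lemma CutF_MonoF:
  assumes T: "prime T" "CutF i z k \<in> T" and ty: "has_type [] i Tnt" "has_type [] k Tnt"
  shows "MonoF i k \<in> T"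
  by (rule forces_mem[OF forces_MonoF T(1), where S = "{CutF i z k}"])
    (use T ty in \<open>auto intro: CutF_mono\<close>)

text \<open>Weakening is cut along the inclusion of \<open>L\<close> in \<open>b :: L\<close>, since
  members of \<open>L\<close> are derivable from the longer list at height \<open>z\<close>.\<close>

lemma CutF_WeakF:
  assumes T: "prime T" "CutF i z i \<in> T" and ty: "has_type [] i Tnt"
  shows "WeakF i \<in> T"
proof (rule forces_mem[OF forces_WeakF T(1), where S = "{CutF i z i}"])
  fix T' assume T': "prime T'" "{CutF i z i} \<subseteq> T'"
  have "SubF L (b \<^bold># L) z \<in> T'" if "has_type [] L Tatmlst" "has_type [] b Tatm" for L b
    by (rule forces_mem[OF forces_SubF T'(1), where S = "{}"])
      (use that in \<open>auto intro!: element_seq element_tail\<close>)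
  then show "\<forall>b. has_type [] b Tatm \<longrightarrow> (\<forall>L. has_type [] L Tatmlst \<longrightarrow>
      (\<forall>a. has_type [] a Tatm \<longrightarrow> seq i L \<langle>a\<rangle> \<in> T' \<longrightarrow> seq i (b \<^bold># L) \<langle>a\<rangle> \<in> T'))"
    using T'(2) ty by (auto intro!: CutF_use[OF T'(1), of i z i _ "_ \<^bold># _"])
qed (use T ty in auto)

lemma CutF_gd [simp]:
  "has_type \<Delta> i Tnt \<Longrightarrow> has_type \<Delta> j Tnt \<Longrightarrow> has_type \<Delta> k Tnt \<Longrightarrow> gd \<Delta> (CutF i j k)"
  by (simp add: CutF_def SubF_def numeral_2_eq_2)

lemma inst_CutF [simp]:
  "inst m t (CutF i j k) = CutF (inst m t i) (inst m t j) (inst m t k)"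
  by (simp add: CutF_def SubF_def lift_inst_le)

lemma prime_nat_z: "prime T \<Longrightarrow> nat' z \<in> T"
  by (rule prime_closed) (auto intro: ent_natI)

lemma prime_nat_s: "prime T \<Longrightarrow> nat' i \<in> T \<Longrightarrow> nat' (s i) \<in> T"
  using prime_typed(4) by (intro prime_closed) (auto intro: ent_natI prime_ent)

text \<open>For middle argument \<open>z\<close> the side conditions \<open>MonoF\<close> and
  \<open>WeakF\<close> hold outright, so this induction is self-contained. Monotonicity and
  weakening at every natural height come out of it, and with them the general cut.\<close>

lemma CutF_refl:
  assumes "prime T" "nat' i \<in> T"
  shows "CutF i z i \<in> T"
proof (rule prime_nat_induct[of "CutF (Bnd 0) z (Bnd 0)" D_all "\<lambda>i T. CutF i z i \<in> T"])
  show "forces D_all (inst 0 i (CutF (Bnd 0) z (Bnd 0))) (\<lambda>T. CutF i z i \<in> T)"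
    if "has_type [] i Tnt" for i using that by (auto intro!: forces_self)
qed (use assms prime_typed(4)[OF assms] in \<open>auto intro!: CutF_z CutF_s MonoF_z WeakF_z\<close>)

lemma CutF_Suc:
  assumes "prime T" "nat' i \<in> T"
  shows "CutF i z (s i) \<in> T"
proof (rule prime_nat_induct[of "CutF (Bnd 0) z (s (Bnd 0))" D_all "\<lambda>i T. CutF i z (s i) \<in> T"])
  show "forces D_all (inst 0 i (CutF (Bnd 0) z (s (Bnd 0)))) (\<lambda>T. CutF i z (s i) \<in> T)"
    if "has_type [] i Tnt" for i using that by (auto intro!: forces_self)
qed (use assms prime_typed(4)[OF assms] in \<open>auto intro!: CutF_z CutF_s MonoF_z WeakF_z\<close>)

text \<open>\<open>CutF i z k\<close> stands in for \<open>i \<le> k\<close>. By induction on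
  \<open>i\<close>, the bound starts at \<open>j\<close> and grows by one successor in each
  step.\<close>

lemma nat_upper_bound:
  assumes "prime T" "nat' i \<in> T" "nat' j \<in> T"
  shows "\<exists>k. nat' k \<in> T \<and> CutF i z k \<in> T \<and> CutF j z k \<in> T"
proof -
  let ?P = "All Tnt (Lam Tnt (nat' (Bnd 0) \<^bold>\<supset> Ex Tnt (Lam Tnt
    (nat' (Bnd 0) \<^bold>\<and> CutF (Bnd 2) z (Bnd 0) \<^bold>\<and> CutF (Bnd 1) z (Bnd 0)))))"
  let ?F = "\<lambda>i T. \<forall>j. has_type [] j Tnt \<longrightarrow> nat' j \<in> T \<longrightarrow>
    (\<exists>k. has_type [] k Tnt \<and> nat' k \<in> T \<and> CutF i z k \<in> T \<and> CutF j z k \<in> T)"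
  have "?F i T"
  proof (rule prime_nat_induct[of ?P D_all ?F])
    show gP: "gd [Tnt] ?P" by (simp add: numeral_2_eq_2)
    show "forces D_all (inst 0 i ?P) (?F i)" if "has_type [] i Tnt" for i
      using that
      by (simp add: numeral_2_eq_2)
        (rule forces_all, simp, simp, rule forces_imp, rule decides_mem, simp, rule forces_decides,
          auto intro!: decides_mem decides_ex decides_and)
    show "?F z T" if T: "prime T" for T
      using that CutF_refl CutF_z MonoF_z by auto
    show "?F (s i) T" if "prime T" "has_type [] i Tnt" "nat' i \<in> T" "?F i T" for i T
    proof (intro allI impI)
      fix j assume j: "has_type [] j Tnt" "nat' j \<in> T"
      with that(4) obtain k where k: "has_type [] k Tnt" "nat' k \<in> T" "CutF i z k \<in> T" "CutF j z k \<in> T"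
        by blast
      have "CutF (s i) z (s k) \<in> T"
        by (rule CutF_s) (use that k in \<open>auto intro: MonoF_z WeakF_z\<close>)
      moreover have "CutF j z (s k) \<in> T"
        by (rule CutF_trans[OF that(1) k(4) CutF_Suc]) (use that k j in auto)
      ultimately show "\<exists>k. has_type [] k Tnt \<and> nat' k \<in> T \<and> CutF (s i) z k \<in> T \<and> CutF j z k \<in> T"
        using prime_nat_s[OF that(1) k(2)] k(1) by (intro exI[of _ "s k"]) simp
    qed
  qed (use assms prime_typed(4) in auto)
  then show ?thesis using prime_typed(4) assms by blast
qed

text \<open>The induction formula also records \<open>CutF j z k\<close>: the bound \<open>k\<close>
  must stay above \<open>j\<close>, since in the step the derivations of height \<open>j\<close> are
  raised to \<open>s k\<close>.\<close>

lemma CutF_ex: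
  assumes "prime T" "nat' i \<in> T" "nat' j \<in> T"
  shows "\<exists>k. nat' k \<in> T \<and> CutF i j k \<in> T"
proof -
  have j: "has_type [] j Tnt" using prime_typed(4) assms by blast
  let ?P = "nat' j \<^bold>\<supset> Ex Tnt (Lam Tnt (nat' (Bnd 0) \<^bold>\<and> CutF (Bnd 1) j (Bnd 0) \<^bold>\<and> CutF j z (Bnd 0)))"
  let ?F = "\<lambda>i T. nat' j \<in> T \<longrightarrow>
    (\<exists>k. has_type [] k Tnt \<and> nat' k \<in> T \<and> CutF i j k \<in> T \<and> CutF j z k \<in> T)"
  have "?F i T"
  proof (rule prime_nat_induct[of ?P D_all ?F])
    show gP: "gd [Tnt] ?P" using j by simp
    show "forces D_all (inst 0 i ?P) (?F i)" if "has_type [] i Tnt" for i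
      using that j
      by simp
        (rule forces_imp, rule decides_mem, simp, rule forces_decides,
          auto intro!: decides_mem decides_ex decides_and)
    show "?F z T" if T: "prime T" for T
      using that CutF_refl CutF_z CutF_MonoF j by blast
    show "?F (s i) T" if "prime T" "has_type [] i Tnt" "nat' i \<in> T" "?F i T" for i T
    proof
      assume nj: "nat' j \<in> T"
      with that(4) obtain k where k: "has_type [] k Tnt" "nat' k \<in> T" "CutF i j k \<in> T" "CutF j z k \<in> T"
        by blast
      have jk: "CutF j z (s k) \<in> T"
        by (rule CutF_trans[OF that(1) k(4) CutF_Suc]) (use that k j in auto)
      have "CutF (s i) j (s k) \<in> T"
        by (rule CutF_s)
          (use that k j in \<open>auto intro: CutF_MonoF[OF that(1) jk] CutF_WeakF CutF_refl[OF that(1) nj]\<close>)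
      with jk show "\<exists>k. has_type [] k Tnt \<and> nat' k \<in> T \<and> CutF (s i) j k \<in> T \<and> CutF j z k \<in> T"
        using prime_nat_s[OF that(1) k(2)] k(1) by (intro exI[of _ "s k"]) simp
    qed
  qed (use assms prime_typed(4) in auto)
  then show ?thesis using assms by blast
qed

lemma seq_cut:
  assumes T: "prime T" and i: "nat' i \<in> T" "seq i (a \<^bold># nil) b \<in> T"
    and j: "nat' j \<in> T" "seq j nil \<langle>a\<rangle> \<in> T"
  shows "\<exists>k. nat' k \<in> T \<and> seq k nil b \<in> T"
proof -
  have ty: "has_type [] a Tatm" "has_type [] j Tnt"
    using prime_typed(1)[OF T j(2)] by (auto split: option.splits ty.splits if_splits)
  have "SubF (a \<^bold># nil) nil j \<in> T"
  proof (rule forces_mem[OF forces_SubF T, where S = "{seq j nil \<langle>a\<rangle>}"])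
    fix T' assume T': "prime T'" "{seq j nil \<langle>a\<rangle>} \<subseteq> T'"
    show "\<forall>c. has_type [] c Tatm \<longrightarrow> element c (a \<^bold># nil) \<in> T' \<longrightarrow> seq j nil \<langle>c\<rangle> \<in> T'"
    proof (intro allI impI)
      fix c assume c: "has_type [] c Tatm" "element c (a \<^bold># nil) \<in> T'"
      show "seq j nil \<langle>c\<rangle> \<in> T'"
      proof (rule element_elim[OF T'(1) c(2) _ T'(2)])
        fix \<theta> T'' L0
        assume \<theta>: "is_subst \<theta>" "prime T''" "sub \<theta> ` {seq j nil \<langle>a\<rangle>} \<subseteq> T''"
        {
          assume "conv [] (sub \<theta> (a \<^bold># nil)) (sub \<theta> c \<^bold># L0) Tatmlst"
          then have "conv [] \<langle>sub \<theta> a\<rangle> \<langle>sub \<theta> c\<rangle> Tprp" by (auto simp: conv_rigid)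
          moreover have "seq (sub \<theta> j) nil \<langle>sub \<theta> a\<rangle> \<in> T''" using \<theta> by simp
          ultimately show "sub \<theta> (seq j nil \<langle>c\<rangle>) \<in> T''"
            using prime_seq_conv[OF \<theta>(2), of "sub \<theta> j" nil] \<theta> ty by (simp add: conv_refl)
        next
          fix Y assume *: "conv [] (sub \<theta> (a \<^bold># nil)) (Y \<^bold># L0) Tatmlst" "element (sub \<theta> c) L0 \<in> T''"
          then have "conv [] L0 nil Tatmlst" by (auto simp: conv_rigid intro: conv_sym)
          from prime_element_conv[OF \<theta>(2) *(2) conv_refl this] element_nil[OF \<theta>(2)]
          show "sub \<theta> (seq j nil \<langle>c\<rangle>) \<in> T''" using \<theta> c by simp
        }
      qed (use ty c in auto)
    qed
  qed (use j ty in auto)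
  then show ?thesis using CutF_ex[OF T i(1) j(1)] CutF_use[OF T _ _ i(2)] prime_typed(4)[OF T] ty(2)
    by fastforce
qed

section \<open>Equality\<close>

lemma equiv_elim:
  assumes "prime T" "x \<^bold>\<equiv> y \<in> T" "finite S" "S \<subseteq> T" "gd [] C"
    "\<And>\<theta> T'. is_subst \<theta> \<Longrightarrow> prime T' \<Longrightarrow> sub \<theta> ` S \<subseteq> T' \<Longrightarrow>
      conv [] (sub \<theta> x) (sub \<theta> y) Ti \<Longrightarrow> sub \<theta> C \<in> T'"
  shows "C \<in> T"
  using assms(1,2) _ assms(3,4,5)
proof (rule prime_case_atom)
  fix H B \<theta> \<eta> T'
  assume *: "(H \<triangleq> B) \<in> D_all" "is_subst \<theta>" "prime T'" "sub \<theta> ` S \<subseteq> T'"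
    and c: "conv [] (sub \<theta> x \<^bold>\<equiv> sub \<theta> y) (sub \<eta> H) To"
  from clause_equiv[OF *(1) c] obtain t where "sub \<eta> H = t \<^bold>\<equiv> t" by blast
  with c have "conv [] (sub \<theta> x) t Ti" "conv [] (sub \<theta> y) t Ti" by (auto simp: conv_rigid)
  from conv_trans[OF this(1) conv_sym[OF this(2)]] * assms(6) show "sub \<theta> C \<in> T'" by blast
qed simp

lemma eq_elim:
  assumes "prime T" "eq' x y \<in> T" "finite S" "S \<subseteq> T" "gd [] C"
    "\<And>\<theta> T'. is_subst \<theta> \<Longrightarrow> prime T' \<Longrightarrow> sub \<theta> ` S \<subseteq> T' \<Longrightarrow>
      conv [] (sub \<theta> x) (sub \<theta> y) Tnt \<Longrightarrow> sub \<theta> C \<in> T'"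
  shows "C \<in> T"
  using assms(1,2) _ assms(3,4,5)
proof (rule prime_case_atom)
  fix H B \<theta> \<eta> T'
  assume *: "(H \<triangleq> B) \<in> D_all" "is_subst \<theta>" "prime T'" "sub \<theta> ` S \<subseteq> T'"
    and c: "conv [] (eq' (sub \<theta> x) (sub \<theta> y)) (sub \<eta> H) To"
  from clause_eq[OF *(1) c] obtain t where "sub \<eta> H = eq' t t" by blast
  with c have "conv [] (sub \<theta> x) t Tnt" "conv [] (sub \<theta> y) t Tnt" by (auto simp: conv_rigid)
  from conv_trans[OF this(1) conv_sym[OF this(2)]] * assms(6) show "sub \<theta> C \<in> T'" by blast
qed simp

lemma eq_refl:
  assumes "prime T" "has_type [] t Tnt"
  shows "eq' t t \<in> T"
  using prime_defR[OF assms(1) _ is_subst_vals,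
      of "eq' (Var ''I'' Tnt) (Var ''I'' Tnt)" "\<^bold>\<top>" "[(''I'', Tnt, t)]"]
    assms prime_top[OF assms(1)]
  by (auto simp: D_all_def D_nat_def Let_def vals_def)

lemma equiv_refl:
  assumes "prime T" "has_type [] t Ti"
  shows "t \<^bold>\<equiv> t \<in> T"
  using prime_defR[OF assms(1) _ is_subst_vals,
      of "Var ''X'' Ti \<^bold>\<equiv> Var ''X'' Ti" "\<^bold>\<top>" "[(''X'', Ti, t)]"]
    assms prime_top[OF assms(1)]
  by (auto simp: D_all_def D_equiv_def Let_def vals_def)

lemma equiv_conv:
  assumes "prime T" "conv [] x y Ti"
  shows "x \<^bold>\<equiv> y \<in> T"
proof (rule prime_conv[OF assms(1) equiv_refl[OF assms(1), of x]])
  have ty: "has_type [] x Ti" "has_type [] y Ti" using conv_has_type[OF assms(2)] by auto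
  then show "has_type [] x Ti" "gd [] (x \<^bold>\<equiv> y)" by simp_all
  show "conv [] (x \<^bold>\<equiv> x) (x \<^bold>\<equiv> y) To" using assms(2) ty by (simp add: conv_rigid conv_refl)
qed

text \<open>A unifier of \<open>x\<close> and \<open>y\<close> makes the two instances convertible,
  so the left rule yields Leibniz's law.\<close>

lemma equiv_subst:
  assumes T: "prime T" "x \<^bold>\<equiv> y \<in> T" "inst 0 x P \<in> T" and P: "gd [Ti] P"
  shows "inst 0 y P \<in> T"
proof (rule equiv_elim[OF T(1,2), where S = "{inst 0 x P}"])
  have ty: "has_type [] x Ti" "has_type [] y Ti" using prime_typed(5)[OF T(1,2)] by auto
  then show "gd [] (inst 0 y P)" using P by (intro gd_inst_0)
  fix \<theta> T' assume \<theta>: "is_subst \<theta>" "prime T'" "sub \<theta> ` {inst 0 x P} \<subseteq> T'"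
    "conv [] (sub \<theta> x) (sub \<theta> y) Ti"
  have s: "sub \<theta> (inst 0 t P) = inst 0 (sub \<theta> t) (sub \<theta> P)" if "has_type [] t Ti" for t
    using sub_inst[OF \<theta>(1) gd_has_type[OF P] that] .
  have P': "has_type [Ti] (sub \<theta> P) To" using sub_has_type[OF \<theta>(1) gd_has_type[OF P]] .
  have c: "conv [] (Lam Ti (sub \<theta> P) \<cdot> sub \<theta> t) (inst 0 (sub \<theta> t) (sub \<theta> P)) To"
    if "has_type [] t Ti" for t using P' that \<theta>(1) by (intro conv_beta) auto
  \<comment> \<open>Conversion is a congruence for application, so the instances are compared as
    values of one abstraction.\<close>
  have "conv [] (Lam Ti (sub \<theta> P) \<cdot> sub \<theta> x) (Lam Ti (sub \<theta> P) \<cdot> sub \<theta> y) To"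
    using P' by (intro conv_app[OF conv_refl \<theta>(4)]) simp
  then have "conv [] (inst 0 (sub \<theta> x) (sub \<theta> P)) (inst 0 (sub \<theta> y) (sub \<theta> P)) To"
    using c[OF ty(1)] c[OF ty(2)] by (blast intro: conv_trans dest: conv_sym)
  moreover have "gd [] (sub \<theta> (inst 0 y P))" using P ty \<theta>(1) by (intro gd_sub gd_inst_0)
  ultimately show "sub \<theta> (inst 0 y P) \<in> T'"
    using prime_conv[OF \<theta>(2)] \<theta>(3) s ty by simp
qed (use T in auto)

text \<open>Every unifier of the premise also unifies the conclusion, which is all the left rule
  asks for; between constructor terms this is injectivity.\<close>

lemma equiv_derive:
  assumes T: "prime T" "x \<^bold>\<equiv> y \<in> T" and ty: "has_type [] a Ti" "has_type [] b Ti"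
    and *: "\<And>\<theta>. is_subst \<theta> \<Longrightarrow> conv [] (sub \<theta> x) (sub \<theta> y) Ti \<Longrightarrow> conv [] (sub \<theta> a) (sub \<theta> b) Ti"
  shows "a \<^bold>\<equiv> b \<in> T"
  by (rule equiv_elim[OF T, where S = "{}"]) (use ty * in \<open>auto intro: equiv_conv\<close>)

text \<open>With no unifier the left rule leaves no case, so the equation proves absurdity.\<close>

lemma equiv_clash:
  assumes T: "prime T" "x \<^bold>\<equiv> y \<in> T"
    and *: "\<And>\<theta>. is_subst \<theta> \<Longrightarrow> \<not> conv [] (sub \<theta> x) (sub \<theta> y) Ti"
  shows False
proof -
  have "\<^bold>\<bottom> \<in> T" by (rule equiv_elim[OF T, where S = "{}"]) (use * in auto)
  with T show False by (simp add: prime_bot)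
qed

lemma equiv_sym: "prime T \<Longrightarrow> x \<^bold>\<equiv> y \<in> T \<Longrightarrow> y \<^bold>\<equiv> x \<in> T"
  using prime_typed(5) by (auto intro: equiv_derive conv_sym)

lemma equiv_trans:
  assumes "prime T" "x \<^bold>\<equiv> y \<in> T" "y \<^bold>\<equiv> w \<in> T"
  shows "x \<^bold>\<equiv> w \<in> T"
  using equiv_subst[OF assms(1,3), of "x \<^bold>\<equiv> Bnd 0"] assms
    prime_typed(5)[OF assms(1,2)] by simp

lemma decidesD: "decides D A F \<Longrightarrow> prime_theory D T \<Longrightarrow> A \<in> T \<longleftrightarrow> F T"
  by (simp add: decides_def)

section \<open>Inversion for the specification logic\<close>

text \<open>\<open>nat\<close> has no clauses and hence no case rule, so inversion is an induction
  generalised by an equation with \<open>s j\<close>, which unification then solves.\<close>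

lemma prime_nat_pred:
  assumes "prime T" "nat' (s i) \<in> T"
  shows "nat' i \<in> T"
proof -
  let ?P = "All Tnt (Lam Tnt (eq' (Bnd 1) (s (Bnd 0)) \<^bold>\<supset> nat' (Bnd 0)))"
  let ?F = "\<lambda>i T. \<forall>j. has_type [] j Tnt \<longrightarrow> eq' i (s j) \<in> T \<longrightarrow> nat' j \<in> T"
  have i: "has_type [] i Tnt"
    using prime_typed(4)[OF assms] by (auto split: option.splits ty.splits if_splits)
  have "?F (s i) T"
  proof (rule prime_nat_induct[of ?P D_all ?F])
    show "forces D_all (inst 0 i ?P) (?F i)" if "has_type [] i Tnt" for i
      using that by simp (rule forces_all; auto intro!: forces_imp decides_mem forces_self)
    show "?F z T" if "prime T" for T
    proof (intro allI impI)
      fix j assume "has_type [] j Tnt" "eq' z (s j) \<in> T"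
      then show "nat' j \<in> T"
        using eq_elim[OF that, of z "s j" "{}" "nat' j"] by (simp add: conv_rigid)
    qed
    show "?F (s i) T" if T: "prime T" "nat' i \<in> T" and i: "has_type [] i Tnt" for i T
    proof (intro allI impI)
      fix j assume j: "has_type [] j Tnt" "eq' (s i) (s j) \<in> T"
      show "nat' j \<in> T"
      proof (rule eq_elim[OF T(1) j(2), where S = "{nat' i}"])
        fix \<theta> T' assume \<theta>: "prime T'" "sub \<theta> ` {nat' i} \<subseteq> T'"
          "conv [] (sub \<theta> (s i)) (sub \<theta> (s j)) Tnt"
        then have c: "conv [] (nat' (sub \<theta> i)) (nat' (sub \<theta> j)) To" by (simp add: conv_rigid)
        then have "gd [] (nat' (sub \<theta> j))" using conv_has_type[OF c] by simp
        with prime_conv[OF \<theta>(1) _ c] \<theta>(2) show "sub \<theta> (nat' j) \<in> T'" by simp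
      qed (use T j in auto)
    qed
  qed (use assms i in auto)
  then show ?thesis using eq_refl[OF assms(1), of "s i"] i by simp
qed

lemma prime_nat_conv:
  assumes "prime T" "nat' i \<in> T" "conv [] i (s j) Tnt"
  shows "nat' j \<in> T"
proof -
  have c: "conv [] (nat' i) (nat' (s j)) To" using assms(3) by (simp add: conv_rigid)
  then have "gd [] (nat' (s j))" using conv_has_type[OF c] by simp
  with prime_conv[OF assms(1,2) c] prime_nat_pred[OF assms(1)] show ?thesis by simp
qed

text \<open>Monotonicity in the height allows us to forget that the premises have smaller height.\<close>

lemma seq_mono:
  assumes T: "prime T" "nat' i \<in> T" "conv [] i (s I) Tnt" "seq I L b \<in> T"
  shows "seq i L b \<in> T"
proof -
  have I: "has_type [] I Tnt" "has_type [] L Tatmlst" "has_type [] b Tprp"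
    using prime_typed(1)[OF T(1,4)] by auto
  have "seq (s I) L b \<in> T"
    by (rule CutF_mono[OF T(1) CutF_Suc[OF T(1) prime_nat_conv[OF T(1-3)]] T(4)]) (simp add: I)
  from prime_seq_conv[OF T(1) this conv_sym[OF T(3)] conv_refl conv_refl] I show ?thesis by simp
qed

lemma seq_amp_inv:
  assumes T: "prime T" "nat' i \<in> T" "seq i L (b \<^bold>& c) \<in> T"
  shows "seq i L b \<in> T \<and> seq i L c \<in> T"
proof -
  have ty: "has_type [] i Tnt" "has_type [] L Tatmlst" "has_type [] b Tprp" "has_type [] c Tprp"
    using prime_typed(1)[OF T(1,3)] by (auto split: option.splits ty.splits if_splits)
  have "seq i L b \<^bold>\<and> seq i L c \<in> T"
  proof (rule seq_elim[OF T(1,3), where S = "{nat' i}"])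
    fix \<theta> T' assume \<theta>: "is_subst \<theta>" "prime T'" "sub \<theta> ` {nat' i} \<subseteq> T'"
      and "seq_cases T' (sub \<theta> i) (sub \<theta> L) (sub \<theta> (b \<^bold>& c))"
    then obtain I B C where I: "conv [] (sub \<theta> i) (s I) Tnt"
      and B: "conv [] (sub \<theta> b) B Tprp" "seq I (sub \<theta> L) B \<in> T'"
      and C: "conv [] (sub \<theta> c) C Tprp" "seq I (sub \<theta> L) C \<in> T'"
      by (auto simp: seq_cases_def conv_rigid)
    have "nat' (sub \<theta> i) \<in> T'" using \<theta> by simp
    from seq_mono[OF \<theta>(2) this I B(2)] seq_mono[OF \<theta>(2) this I C(2)]
    have "seq (sub \<theta> i) (sub \<theta> L) (sub \<theta> b) \<in> T'" "seq (sub \<theta> i) (sub \<theta> L) (sub \<theta> c) \<in> T'"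
      using prime_seq_conv[OF \<theta>(2) _ conv_refl conv_refl conv_sym[OF B(1)]]
        prime_seq_conv[OF \<theta>(2) _ conv_refl conv_refl conv_sym[OF C(1)]] \<theta>(1) ty by auto
    then show "sub \<theta> (seq i L b \<^bold>\<and> seq i L c) \<in> T'" using \<theta> ty by (simp add: prime_and)
  qed (use T ty in auto)
  then show ?thesis using T(1) ty by (simp add: prime_and)
qed

lemma seq_arrow_inv:
  assumes T: "prime T" "nat' i \<in> T" "seq i L (a \<^bold>\<Rightarrow> b) \<in> T"
  shows "seq i (a \<^bold># L) b \<in> T"
proof (rule seq_elim[OF T(1,3), where S = "{nat' i}"])
  have ty: "has_type [] i Tnt" "has_type [] L Tatmlst" "has_type [] a Tatm" "has_type [] b Tprp"
    using prime_typed(1)[OF T(1,3)] by (auto split: option.splits ty.splits if_splits)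
  then show "gd [] (seq i (a \<^bold># L) b)" by simp
  fix \<theta> T' assume \<theta>: "is_subst \<theta>" "prime T'" "sub \<theta> ` {nat' i} \<subseteq> T'"
    and "seq_cases T' (sub \<theta> i) (sub \<theta> L) (sub \<theta> (a \<^bold>\<Rightarrow> b))"
  then obtain I A B where I: "conv [] (sub \<theta> i) (s I) Tnt"
    and A: "conv [] (sub \<theta> a) A Tatm" and B: "conv [] (sub \<theta> b) B Tprp" "seq I (A \<^bold># sub \<theta> L) B \<in> T'"
    by (auto simp: seq_cases_def conv_rigid)
  have n: "nat' (sub \<theta> i) \<in> T'" using \<theta> by simp
  have "conv [] (A \<^bold># sub \<theta> L) (sub \<theta> a \<^bold># sub \<theta> L) Tatmlst"
    using conv_sym[OF A] \<theta>(1) ty by (simp add: conv_rigid conv_refl)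
  from prime_seq_conv[OF \<theta>(2) seq_mono[OF \<theta>(2) n I B(2)] conv_refl this conv_sym[OF B(1)]]
  show "sub \<theta> (seq i (a \<^bold># L) b) \<in> T'" using \<theta> ty by simp
qed (use T in auto)

lemma seq_bigand_inv:
  assumes T: "prime T" "nat' i \<in> T" "seq i L (Bigand F) \<in> T" and x: "has_type [] x Ti"
  shows "seq i L (F \<cdot> x) \<in> T"
proof (rule seq_elim[OF T(1,3), where S = "{nat' i}"])
  have ty: "has_type [] i Tnt" "has_type [] L Tatmlst" "has_type [] F (Ti \<rightarrow> Tprp)"
    using prime_typed(1)[OF T(1,3)] by (auto split: option.splits ty.splits if_splits)
  then show "gd [] (seq i L (F \<cdot> x))" using x by simp
  fix \<theta> T' assume \<theta>: "is_subst \<theta>" "prime T'" "sub \<theta> ` {nat' i} \<subseteq> T'"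
    and "seq_cases T' (sub \<theta> i) (sub \<theta> L) (sub \<theta> (Bigand F))"
  then obtain I G where I: "conv [] (sub \<theta> i) (s I) Tnt"
    and G: "conv [] (sub \<theta> F) G (Ti \<rightarrow> Tprp)" "has_type [] G (Ti \<rightarrow> Tprp)"
      "All Ti (Lam Ti (seq I (sub \<theta> L) (G \<cdot> Bnd 0))) \<in> T'"
    by (auto simp: seq_cases_def conv_rigid)
  have tI: "has_type [] I Tnt"
    using conv_has_type[OF I] by (auto split: option.splits ty.splits if_splits)
  have n: "nat' (sub \<theta> i) \<in> T'" using \<theta> by simp
  have "seq I (sub \<theta> L) (G \<cdot> sub \<theta> x) \<in> T'"
    using prime_all[OF \<theta>(2) G(3), of "sub \<theta> x"] \<theta>(1) x tI ty G(2) by simp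
  from prime_seq_conv[OF \<theta>(2) seq_mono[OF \<theta>(2) n I this] conv_refl conv_refl
      conv_app[OF conv_sym[OF G(1)] conv_refl]]
  show "sub \<theta> (seq i L (F \<cdot> x)) \<in> T'" using \<theta> ty x by simp
qed (use T in auto)

text \<open>Case analysis only proves membership of formulas, so the alternatives are first written
  as one disjunction with existential quantifiers and then read off in \<open>T\<close> by primeness
  and the existence property.\<close>

lemma seq_obj_inv:
  assumes T: "prime T" "nat' i \<in> T" "seq i L \<langle>a\<rangle> \<in> T"
  shows "element a L \<in> T \<or> (\<exists>I b. nat' I \<in> T \<and> prog a b \<in> T \<and> seq I L b \<in> T)"
proof -
  have ty: "has_type [] i Tnt" "has_type [] L Tatmlst" "has_type [] a Tatm"
    using prime_typed(1)[OF T(1,3)] by (auto split: option.splits ty.splits if_splits)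
  let ?E = "Ex Tnt (Lam Tnt (Ex Tprp (Lam Tprp
    (nat' (Bnd 1) \<^bold>\<and> prog a (Bnd 0) \<^bold>\<and> seq (Bnd 1) L (Bnd 0)))))"
  have E: "decides D_all (Ex Tnt (Lam Tnt (Ex Tprp (Lam Tprp
      (nat' (Bnd 1) \<^bold>\<and> prog a (Bnd 0) \<^bold>\<and> seq (Bnd 1) L (Bnd 0)))))) (\<lambda>T. \<exists>I. has_type [] I Tnt \<and> (\<exists>b. has_type [] b Tprp \<and>
      nat' I \<in> T \<and> prog a b \<in> T \<and> seq I L b \<in> T))"
    if "has_type [] a Tatm" "has_type [] L Tatmlst" for a L
    using that by (auto intro!: decides_ex decides_and decides_mem)
  have g: "gd [] (element a L)" "gd [] ?E" using ty by simp_all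
  have "element a L \<^bold>\<or> ?E \<in> T"
  proof (rule seq_elim[OF T(1,3), where S = "{nat' i}"])
    fix \<theta> T' assume \<theta>: "is_subst \<theta>" "prime T'" "sub \<theta> ` {nat' i} \<subseteq> T'"
      and "seq_cases T' (sub \<theta> i) (sub \<theta> L) (sub \<theta> \<langle>a\<rangle>)"
    then consider (el) A where "conv [] (sub \<theta> a) A Tatm" "element A (sub \<theta> L) \<in> T'"
      | (pr) I A b where "conv [] (sub \<theta> i) (s I) Tnt" "conv [] (sub \<theta> a) A Tatm"
        "prog A b \<in> T'" "seq I (sub \<theta> L) b \<in> T'"
      by (auto simp: seq_cases_def conv_rigid)
    then have "element (sub \<theta> a) (sub \<theta> L) \<in> T' \<or>
        (\<exists>I b. nat' I \<in> T' \<and> prog (sub \<theta> a) b \<in> T' \<and> seq I (sub \<theta> L) b \<in> T')"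
    proof cases
      case el
      then show ?thesis
        using prime_element_conv[OF \<theta>(2) el(2) conv_sym[OF el(1)] conv_refl] \<theta>(1) ty by simp
    next
      case pr
      have "nat' I \<in> T'" using prime_nat_conv[OF \<theta>(2) _ pr(1)] \<theta>(3) by simp
      moreover have "prog (sub \<theta> a) b \<in> T'"
        using prime_prog_conv[OF \<theta>(2) pr(3) conv_sym[OF pr(2)] conv_refl]
          prime_typed(3)[OF \<theta>(2) pr(3)] by simp
      ultimately show ?thesis using pr(4) by blast
    qed
    moreover have "sub \<theta> ?E \<in> T' \<longleftrightarrow> (\<exists>I. has_type [] I Tnt \<and> (\<exists>b. has_type [] b Tprp \<and>
        nat' I \<in> T' \<and> prog (sub \<theta> a) b \<in> T' \<and> seq I (sub \<theta> L) b \<in> T'))"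
      using decidesD[OF E[of "sub \<theta> a" "sub \<theta> L"] \<theta>(2)] \<theta>(1) ty by simp
    then have "sub \<theta> ?E \<in> T' \<longleftrightarrow>
        (\<exists>I b. nat' I \<in> T' \<and> prog (sub \<theta> a) b \<in> T' \<and> seq I (sub \<theta> L) b \<in> T')"
      using prime_typed(1)[OF \<theta>(2)] by metis
    moreover have "gd [] (sub \<theta> (element a L))" "gd [] (sub \<theta> ?E)" using g \<theta>(1) gd_sub by blast+
    ultimately show "sub \<theta> (element a L \<^bold>\<or> ?E) \<in> T'" using prime_or[OF \<theta>(2)] by simp
  qed (use T g in auto)
  then show ?thesis using decidesD[OF E[OF ty(3,2)] T(1)] prime_or[OF T(1) g] by metis
qed

lemma seq_obj_inv_s:
  assumes T: "prime T" "seq (s i) L \<langle>a\<rangle> \<in> T"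
  shows "element a L \<in> T \<or> (\<exists>b. prog a b \<in> T \<and> seq i L b \<in> T)"
proof -
  have ty: "has_type [] i Tnt" "has_type [] L Tatmlst" "has_type [] a Tatm"
    using prime_typed(1)[OF T] by (auto split: option.splits ty.splits if_splits)
  let ?E = "Ex Tprp (Lam Tprp (prog a (Bnd 0) \<^bold>\<and> seq i L (Bnd 0)))"
  have E: "decides D_all (Ex Tprp (Lam Tprp (prog a (Bnd 0) \<^bold>\<and> seq i L (Bnd 0))))
      (\<lambda>T. \<exists>b. has_type [] b Tprp \<and> prog a b \<in> T \<and> seq i L b \<in> T)"
    if "has_type [] a Tatm" "has_type [] L Tatmlst" "has_type [] i Tnt" for a L i
    using that by (auto intro!: decides_ex decides_and decides_mem)
  have g: "gd [] (element a L)" "gd [] ?E" using ty by simp_all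
  have "element a L \<^bold>\<or> ?E \<in> T"
  proof (rule seq_elim[OF T, where S = "{}"])
    fix \<theta> T' assume \<theta>: "is_subst \<theta>" "prime T'"
      and "seq_cases T' (sub \<theta> (s i)) (sub \<theta> L) (sub \<theta> \<langle>a\<rangle>)"
    then consider (el) A where "conv [] (sub \<theta> a) A Tatm" "element A (sub \<theta> L) \<in> T'"
      | (pr) I A b where "conv [] (sub \<theta> i) I Tnt" "conv [] (sub \<theta> a) A Tatm"
        "prog A b \<in> T'" "seq I (sub \<theta> L) b \<in> T'"
      by (auto simp: seq_cases_def conv_rigid)
    then have "element (sub \<theta> a) (sub \<theta> L) \<in> T' \<or>
        (\<exists>b. prog (sub \<theta> a) b \<in> T' \<and> seq (sub \<theta> i) (sub \<theta> L) b \<in> T')"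
    proof cases
      case el
      then show ?thesis
        using prime_element_conv[OF \<theta>(2) el(2) conv_sym[OF el(1)] conv_refl] \<theta>(1) ty by simp
    next
      case pr
      have b: "has_type [] b Tprp" using prime_typed(3)[OF \<theta>(2) pr(3)] by simp
      have "prog (sub \<theta> a) b \<in> T'"
        using prime_prog_conv[OF \<theta>(2) pr(3) conv_sym[OF pr(2)] conv_refl[OF b]] .
      moreover have "seq (sub \<theta> i) (sub \<theta> L) b \<in> T'"
        using prime_seq_conv[OF \<theta>(2) pr(4) conv_sym[OF pr(1)] conv_refl conv_refl[OF b]] \<theta>(1) ty
        by simp
      ultimately show ?thesis by blast
    qed
    moreover have "sub \<theta> ?E \<in> T' \<longleftrightarrow> (\<exists>b. has_type [] b Tprp \<and>
        prog (sub \<theta> a) b \<in> T' \<and> seq (sub \<theta> i) (sub \<theta> L) b \<in> T')"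
      using decidesD[OF E[of "sub \<theta> a" "sub \<theta> L" "sub \<theta> i"] \<theta>(2)] \<theta>(1) ty by simp
    then have "sub \<theta> ?E \<in> T' \<longleftrightarrow>
        (\<exists>b. prog (sub \<theta> a) b \<in> T' \<and> seq (sub \<theta> i) (sub \<theta> L) b \<in> T')"
      using prime_typed(3)[OF \<theta>(2)] by metis
    moreover have "gd [] (sub \<theta> (element a L))" "gd [] (sub \<theta> ?E)" using g \<theta>(1) gd_sub by blast+
    ultimately show "sub \<theta> (element a L \<^bold>\<or> ?E) \<in> T'" using prime_or[OF \<theta>(2)] by simp
  qed (use T g in auto)
  then show ?thesis using decidesD[OF E[OF ty(3,2,1)] T(1)] prime_or[OF T(1) g] by metis
qed

definition provb :: "tm set \<Rightarrow> tm \<Rightarrow> bool" where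
  "provb T b \<longleftrightarrow> (\<exists>i. nat' i \<in> T \<and> seq i nil b \<in> T)"

lemma decides_provable:
  assumes "has_type [] b Tprp"
  shows "decides D_all (\<turnstile> b) (\<lambda>T. provb T b)"
proof -
  have "decides D_all (\<turnstile> b) (\<lambda>T. \<exists>i. has_type [] i Tnt \<and> nat' i \<in> T \<and> seq i nil b \<in> T)"
    unfolding provable_def using assms by (auto intro!: decides_ex decides_and decides_mem)
  then show ?thesis using prime_typed(4) unfolding decides_def provb_def by blast
qed

lemma provb_tt: "prime T \<Longrightarrow> provb T tt"
  unfolding provb_def using prime_nat_z seq_tt by fastforce

text \<open>Both conjuncts must be derived at the same height, so the two derivations are raised to
  a common bound.\<close>

lemma provb_amp:
  assumes T: "prime T" "provb T b" "provb T c"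
  shows "provb T (b \<^bold>& c)"
proof -
  from T obtain i j where i: "nat' i \<in> T" "seq i nil b \<in> T" and j: "nat' j \<in> T" "seq j nil c \<in> T"
    by (auto simp: provb_def)
  from nat_upper_bound[OF T(1) i(1) j(1)] obtain k where
    k: "nat' k \<in> T" "CutF i z k \<in> T" "CutF j z k \<in> T" by blast
  then have "seq k nil b \<in> T" "seq k nil c \<in> T"
    using CutF_mono[OF T(1)] i j prime_typed(4)[OF T(1)] by blast+
  from seq_amp[OF T(1) this] prime_nat_s[OF T(1) k(1)] show ?thesis by (auto simp: provb_def)
qed

lemma provb_prog:
  assumes T: "prime T" "prog a b \<in> T" "provb T b"
  shows "provb T \<langle>a\<rangle>"
  using T seq_prog prime_nat_s unfolding provb_def by blast

section \<open>Inversion for the clauses of PCF\<close>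

lemma type_of_bind:
  "ofree \<tau> \<Longrightarrow> type_of (\<Delta>1 @ \<tau> # \<Delta>2) (bind (length \<Delta>1) x \<tau> t) = type_of (\<Delta>1 @ \<Delta>2) t"
proof (induction t arbitrary: \<Delta>1)
  case (Lam \<sigma> t)
  show ?case using Lam.IH[of "\<sigma> # \<Delta>1"] Lam.prems by simp
qed (auto simp: nth_append Suc_diff_le split: ty.split option.split)

lemma bind_atom: "bind k x \<tau> (atom p ts) = atom p (map (bind k x \<tau>) ts)"
  unfolding atom_def by (induction ts rule: rev_induct) auto

lemma gd_bind: "gd (\<Delta>1 @ \<Delta>2) A \<Longrightarrow> ofree \<tau> \<Longrightarrow> gd (\<Delta>1 @ \<tau> # \<Delta>2) (bind (length \<Delta>1) x \<tau> A)"
proof (induction "\<Delta>1 @ \<Delta>2" A arbitrary: \<Delta>1 rule: gd.induct)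
  case (gd_atom p ts)
  then show ?case using type_of_bind[of \<tau> \<Delta>1 \<Delta>2 x "atom p ts"] by (simp add: bind_atom gd.gd_atom)
next
  case (gd_all \<sigma> A)
  then show ?case using gd_all.hyps(3)[of "\<sigma> # \<Delta>1"] by simp
next
  case (gd_ex \<sigma> A)
  then show ?case using gd_ex.hyps(3)[of "\<sigma> # \<Delta>1"] by simp
qed simp_all

definition upd :: "subst \<Rightarrow> string \<Rightarrow> ty \<Rightarrow> tm \<Rightarrow> subst" where
  "upd \<sigma> x \<tau> t = (\<lambda>y \<rho>. if y = x \<and> \<rho> = \<tau> then t else \<sigma> y \<rho>)"

lemma inst_sub_bind:
  "is_subst \<sigma> \<Longrightarrow> has_type \<Delta> A \<rho> \<Longrightarrow> has_type [] t \<tau> \<Longrightarrow>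
   inst (length \<Delta>) t (sub \<sigma> (bind (length \<Delta>) x \<tau> A)) = sub (upd \<sigma> x \<tau> t) A"
proof (induction A arbitrary: \<Delta> \<rho>)
  case (Var y \<rho>')
  then have "has_type [] (\<sigma> y \<rho>') \<rho>'" by (auto split: if_splits)
  then show ?case by (auto simp: upd_def)
next
  case (App A1 A2)
  from App.prems(2) App.IH[OF App.prems(1) _ App.prems(3)] show ?case
    unfolding has_type_App by auto
next
  case (Lam \<rho>' A)
  from Lam.prems(2) obtain \<rho>'' where "has_type (\<rho>' # \<Delta>) A \<rho>''" unfolding has_type_Lam by blast
  from Lam.IH[OF Lam.prems(1) this Lam.prems(3)] Lam.prems(3) show ?case by simp
qed (auto split: if_splits)

definition exs :: "(string \<times> ty) list \<Rightarrow> tm \<Rightarrow> tm" where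
  "exs vs A = foldr (\<lambda>(x, \<tau>) A. ex x \<tau> A) vs A"

lemma exs_simps [simp]: "exs [] A = A" "exs ((x, \<tau>) # vs) A = ex x \<tau> (exs vs A)"
  by (simp_all add: exs_def)

lemma gd_exs: "\<forall>(x, \<tau>)\<in>set vs. ofree \<tau> \<Longrightarrow> gd [] A \<Longrightarrow> gd [] (exs vs A)"
  by (induction vs) (use gd_bind[of "[]" "[]"] in auto)

lemma is_subst_upd: "is_subst \<sigma> \<Longrightarrow> has_type [] t \<tau> \<Longrightarrow> is_subst (upd \<sigma> x \<tau> t)"
  by (auto simp: is_subst_def upd_def)

text \<open>Iterating the existence property, the witnesses chosen one by one assemble into a single
  substitution \<eta>.\<close>

lemma prime_exs:
  assumes T: "prime T" and g: "gd [] A" "\<forall>(x, \<tau>)\<in>set vs. ofree \<tau>"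
  shows "is_subst \<sigma> \<Longrightarrow> sub \<sigma> (exs vs A) \<in> T \<longleftrightarrow>
    (\<exists>\<eta>. is_subst \<eta> \<and> (\<forall>x \<tau>. (x, \<tau>) \<notin> set vs \<longrightarrow> \<eta> x \<tau> = \<sigma> x \<tau>) \<and> sub \<eta> A \<in> T)"
  using g(2)
proof (induction vs arbitrary: \<sigma>)
  case Nil
  then show ?case by (auto simp: fun_eq_iff[symmetric] cong: conj_cong)
next
  case (Cons v vs)
  obtain x \<tau> where v: "v = (x, \<tau>)" by force
  have o: "ofree \<tau>" and vs: "\<forall>(x, \<tau>)\<in>set vs. ofree \<tau>" using Cons.prems v by auto
  have ge: "gd [] (exs vs A)" using g(1) vs by (intro gd_exs)
  have gb: "gd [] (sub \<sigma> (ex x \<tau> (exs vs A)))"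
    using gd_bind[of "[]" "[]" "exs vs A" \<tau> x] ge o Cons.prems(1) by (intro gd_sub) auto
  have i: "inst 0 t (sub \<sigma> (bind 0 x \<tau> (exs vs A))) = sub (upd \<sigma> x \<tau> t) (exs vs A)"
    if "has_type [] t \<tau>" for t
    using inst_sub_bind[OF Cons.prems(1) gd_has_type[OF ge] that, of x] by simp
  have "sub \<sigma> (exs (v # vs) A) \<in> T \<longleftrightarrow>
      (\<exists>t. has_type [] t \<tau> \<and> sub (upd \<sigma> x \<tau> t) (exs vs A) \<in> T)"
    using prime_ex[OF T, of \<tau> "sub \<sigma> (bind 0 x \<tau> (exs vs A))"] gb i by (auto simp: v)
  also have "\<dots> \<longleftrightarrow> (\<exists>t. has_type [] t \<tau> \<and> (\<exists>\<eta>. is_subst \<eta> \<and>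
      (\<forall>y \<rho>. (y, \<rho>) \<notin> set vs \<longrightarrow> \<eta> y \<rho> = upd \<sigma> x \<tau> t y \<rho>) \<and> sub \<eta> A \<in> T))"
    using Cons.IH[OF is_subst_upd[OF Cons.prems(1)] vs] by blast
  also have "\<dots> \<longleftrightarrow>
      (\<exists>\<eta>. is_subst \<eta> \<and> (\<forall>y \<rho>. (y, \<rho>) \<notin> set (v # vs) \<longrightarrow> \<eta> y \<rho> = \<sigma> y \<rho>) \<and> sub \<eta> A \<in> T)"
  proof
    assume "\<exists>t. has_type [] t \<tau> \<and> (\<exists>\<eta>. is_subst \<eta> \<and>
      (\<forall>y \<rho>. (y, \<rho>) \<notin> set vs \<longrightarrow> \<eta> y \<rho> = upd \<sigma> x \<tau> t y \<rho>) \<and> sub \<eta> A \<in> T)"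
    then show "\<exists>\<eta>. is_subst \<eta> \<and> (\<forall>y \<rho>. (y, \<rho>) \<notin> set (v # vs) \<longrightarrow> \<eta> y \<rho> = \<sigma> y \<rho>) \<and> sub \<eta> A \<in> T"
      by (auto simp: v upd_def)
  next
    assume "\<exists>\<eta>. is_subst \<eta> \<and> (\<forall>y \<rho>. (y, \<rho>) \<notin> set (v # vs) \<longrightarrow> \<eta> y \<rho> = \<sigma> y \<rho>) \<and> sub \<eta> A \<in> T"
    then obtain \<eta> where "is_subst \<eta>" "\<forall>y \<rho>. (y, \<rho>) \<notin> set (v # vs) \<longrightarrow> \<eta> y \<rho> = \<sigma> y \<rho>" "sub \<eta> A \<in> T"
      by blast
    then show "\<exists>t. has_type [] t \<tau> \<and> (\<exists>\<eta>. is_subst \<eta> \<and>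
      (\<forall>y \<rho>. (y, \<rho>) \<notin> set vs \<longrightarrow> \<eta> y \<rho> = upd \<sigma> x \<tau> t y \<rho>) \<and> sub \<eta> A \<in> T)"
      using o by (intro exI[of _ "\<eta> x \<tau>"] conjI exI[of _ \<eta>]) (auto simp: v upd_def)
  qed
  finally show ?case .
qed

lemma sub_cong: "(\<And>x \<tau>. (x, \<tau>) \<in> fv t \<Longrightarrow> \<theta> x \<tau> = \<rho> x \<tau>) \<Longrightarrow> sub \<theta> t = sub \<rho> t"
  by (induction t) auto

definition disj :: "tm list \<Rightarrow> tm" where
  "disj As = foldr (\<lambda>A B. A \<^bold>\<or> B) As \<^bold>\<bottom>"

lemma gd_disj: "\<forall>A\<in>set As. gd [] A \<Longrightarrow> gd [] (disj As)"
  unfolding disj_def by (induction As) auto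

lemma sub_disj: "sub \<theta> (disj As) = disj (map (sub \<theta>) As)"
  unfolding disj_def by (induction As) auto

lemma prime_disj:
  "prime_theory D T \<Longrightarrow> \<forall>A\<in>set As. gd [] A \<Longrightarrow> disj As \<in> T \<longleftrightarrow> (\<exists>A\<in>set As. A \<in> T)"
proof (induction As)
  case (Cons A As)
  then show ?case using gd_disj[of As] by (simp add: disj_def prime_or)
qed (simp add: disj_def prime_bot)

lemma D_PCF_shape:
  "c \<in> D_PCF \<Longrightarrow> \<exists>h g. c = (prog h g \<triangleq> \<^bold>\<top>) \<and> has_type [] h Tatm \<and> has_type [] g Tprp \<and>
     fv h \<union> fv g \<subseteq> UNIV \<times> {Ti, Ti \<rightarrow> Ti}"
  unfolding D_PCF_def D_typing_def D_natural_def D_transition_def Let_def Un_iff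
  by (elim disjE insertE emptyE; simp)

lemma finite_D_PCF: "finite D_PCF"
  by (simp add: D_PCF_def D_typing_def D_natural_def D_transition_def Let_def)

theorem prog_inv:
  assumes T: "prime T" "prog a b \<in> T" "seq i L b \<in> T"
  shows "\<exists>h g \<eta>. (prog h g \<triangleq> \<^bold>\<top>) \<in> D_PCF \<and> is_subst \<eta> \<and>
    element a (sub \<eta> h \<^bold># nil) \<in> T \<and> seq i L (sub \<eta> g) \<in> T"
proof -
  have ty: "has_type [] a Tatm" "has_type [] i Tnt" "has_type [] L Tatmlst" "has_type [] b Tprp"
    using prime_typed(1,3) T by blast+
  define hd bd where "hd c = (case head c of _ \<cdot> h \<cdot> g \<Rightarrow> h)" and
    "bd c = (case head c of _ \<cdot> h \<cdot> g \<Rightarrow> g)" for c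
  have shape: "c = (prog (hd c) (bd c) \<triangleq> \<^bold>\<top>)" "has_type [] (hd c) Tatm" "has_type [] (bd c) Tprp"
    "fv (hd c) \<union> fv (bd c) \<subseteq> UNIV \<times> {Ti, Ti \<rightarrow> Ti}" if "c \<in> D_PCF" for c
    using D_PCF_shape[OF that] by (auto simp: hd_def bd_def)
  \<comment> \<open>The parameters enter as variables, so that one formula serves all instances.
    Their types differ from those of the clause variables, hence the existential closure never
    captures them.\<close>
  define F where "F c = element (Var ''a'' Tatm) (hd c \<^bold># nil) \<^bold>\<and>
    seq (Var ''i'' Tnt) (Var ''L'' Tatmlst) (bd c)" for c
  define vs where "vs c = (SOME vs. set vs = fv (hd c) \<union> fv (bd c))" for c
  have vs: "set (vs c) = fv (hd c) \<union> fv (bd c)" for c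
    unfolding vs_def by (rule someI_ex) (simp add: finite_list)
  obtain cs where cs: "set cs = D_PCF" using finite_list[OF finite_D_PCF] by blast
  define A where "A = disj (map (\<lambda>c. exs (vs c) (F c)) cs)"
  define \<sigma> where "\<sigma> = vals [(''a'', Tatm, a), (''i'', Tnt, i), (''L'', Tatmlst, L)]"
  have \<sigma>: "is_subst \<sigma>" unfolding \<sigma>_def by (rule is_subst_vals) (use ty in auto)
  have gF: "gd [] (F c)" if "c \<in> D_PCF" for c using shape[OF that] by (simp add: F_def)
  have o: "\<forall>(x, \<tau>)\<in>set (vs c). ofree \<tau>" if "c \<in> D_PCF" for c
    using shape(4)[OF that] by (auto simp: vs)
  \<comment> \<open>The formula is decoded for arbitrary parameters and an arbitrary prime theory:
    it is established in \<open>T'\<close> under a unifier and used in \<open>T\<close>.\<close>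
  have main: "sub \<sigma>' A \<in> T' \<longleftrightarrow> (\<exists>h g \<eta>. (prog h g \<triangleq> \<^bold>\<top>) \<in> D_PCF \<and> is_subst \<eta> \<and>
      element a' (sub \<eta> h \<^bold># nil) \<in> T' \<and> seq i' L' (sub \<eta> g) \<in> T')"
    if T': "prime T'" and \<sigma>': "is_subst \<sigma>'" and eqs: "\<sigma>' ''a'' Tatm = a'" "\<sigma>' ''i'' Tnt = i'"
      "\<sigma>' ''L'' Tatmlst = L'" for T' \<sigma>' a' i' L'
  proof -
    have ty': "has_type [] a' Tatm" "has_type [] i' Tnt" "has_type [] L' Tatmlst"
      using \<sigma>' by (simp_all add: eqs[symmetric])
    have g: "gd [] (sub \<sigma>' (exs (vs c) (F c)))" if "c \<in> set cs" for c
      using that cs gF o \<sigma>' by (intro gd_sub gd_exs) auto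
    have "sub \<sigma>' A \<in> T' \<longleftrightarrow> (\<exists>c\<in>D_PCF. sub \<sigma>' (exs (vs c) (F c)) \<in> T')"
      unfolding A_def sub_disj using prime_disj[OF T', of "map (sub \<sigma>') (map (\<lambda>c. exs (vs c) (F c)) cs)"] g cs
      by auto
    also have "\<dots> \<longleftrightarrow> (\<exists>c\<in>D_PCF. \<exists>\<eta>. is_subst \<eta> \<and> (\<forall>x \<tau>. (x, \<tau>) \<notin> set (vs c) \<longrightarrow> \<eta> x \<tau> = \<sigma>' x \<tau>) \<and>
        sub \<eta> (F c) \<in> T')"
      using prime_exs[OF T' gF o \<sigma>'] by blast
    also have "\<dots> \<longleftrightarrow> (\<exists>c\<in>D_PCF. \<exists>\<eta>. is_subst \<eta> \<and>
        element a' (sub \<eta> (hd c) \<^bold># nil) \<in> T' \<and> seq i' L' (sub \<eta> (bd c)) \<in> T')"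
    proof (intro bex_cong refl)
      fix c assume c: "c \<in> D_PCF"
      have free: "(''a'', Tatm) \<notin> set (vs c)" "(''i'', Tnt) \<notin> set (vs c)" "(''L'', Tatmlst) \<notin> set (vs c)"
        using shape(4)[OF c] by (auto simp: vs)
      have conj: "element a' (sub \<eta> (hd c) \<^bold># nil) \<^bold>\<and> seq i' L' (sub \<eta> (bd c)) \<in> T' \<longleftrightarrow>
          element a' (sub \<eta> (hd c) \<^bold># nil) \<in> T' \<and> seq i' L' (sub \<eta> (bd c)) \<in> T'" if "is_subst \<eta>" for \<eta>
        using that ty' shape(2,3)[OF c] by (intro prime_and[OF T']) auto
      show "(\<exists>\<eta>. is_subst \<eta> \<and> (\<forall>x \<tau>. (x, \<tau>) \<notin> set (vs c) \<longrightarrow> \<eta> x \<tau> = \<sigma>' x \<tau>) \<and> sub \<eta> (F c) \<in> T') \<longleftrightarrow>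
        (\<exists>\<eta>. is_subst \<eta> \<and> element a' (sub \<eta> (hd c) \<^bold># nil) \<in> T' \<and> seq i' L' (sub \<eta> (bd c)) \<in> T')"
      proof
        assume "\<exists>\<eta>. is_subst \<eta> \<and> (\<forall>x \<tau>. (x, \<tau>) \<notin> set (vs c) \<longrightarrow> \<eta> x \<tau> = \<sigma>' x \<tau>) \<and> sub \<eta> (F c) \<in> T'"
        then show "\<exists>\<eta>. is_subst \<eta> \<and> element a' (sub \<eta> (hd c) \<^bold># nil) \<in> T' \<and> seq i' L' (sub \<eta> (bd c)) \<in> T'"
          using free conj by (auto simp: F_def eqs)
      next
        assume "\<exists>\<eta>. is_subst \<eta> \<and> element a' (sub \<eta> (hd c) \<^bold># nil) \<in> T' \<and> seq i' L' (sub \<eta> (bd c)) \<in> T'"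
        then obtain \<eta> where \<eta>: "is_subst \<eta>" "element a' (sub \<eta> (hd c) \<^bold># nil) \<in> T'"
          "seq i' L' (sub \<eta> (bd c)) \<in> T'" by blast
        define \<eta>' where "\<eta>' = (\<lambda>x \<tau>. if (x, \<tau>) \<in> set (vs c) then \<eta> x \<tau> else \<sigma>' x \<tau>)"
        have "is_subst \<eta>'" using \<eta>(1) \<sigma>' by (auto simp: \<eta>'_def is_subst_def)
        moreover have "sub \<eta>' (hd c) = sub \<eta> (hd c)" "sub \<eta>' (bd c) = sub \<eta> (bd c)"
          by (auto intro!: sub_cong simp: \<eta>'_def vs)
        then have "sub \<eta>' (F c) = element a' (sub \<eta> (hd c) \<^bold># nil) \<^bold>\<and> seq i' L' (sub \<eta> (bd c))"
          using free by (simp add: F_def \<eta>'_def eqs)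
        ultimately show "\<exists>\<eta>. is_subst \<eta> \<and> (\<forall>x \<tau>. (x, \<tau>) \<notin> set (vs c) \<longrightarrow> \<eta> x \<tau> = \<sigma>' x \<tau>) \<and> sub \<eta> (F c) \<in> T'"
          using \<eta> conj[OF \<eta>(1)] by (intro exI[of _ \<eta>']) (auto simp: \<eta>'_def)
      qed
    qed
    also have "\<dots> \<longleftrightarrow> (\<exists>h g \<eta>. (prog h g \<triangleq> \<^bold>\<top>) \<in> D_PCF \<and> is_subst \<eta> \<and>
        element a' (sub \<eta> h \<^bold># nil) \<in> T' \<and> seq i' L' (sub \<eta> g) \<in> T')"
    proof (intro iffI; elim bexE exE conjE)
      fix c \<eta> assume "c \<in> D_PCF" "is_subst \<eta>" "element a' (sub \<eta> (hd c) \<^bold># nil) \<in> T'"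
        "seq i' L' (sub \<eta> (bd c)) \<in> T'"
      then show "\<exists>h g \<eta>. (prog h g \<triangleq> \<^bold>\<top>) \<in> D_PCF \<and> is_subst \<eta> \<and>
          element a' (sub \<eta> h \<^bold># nil) \<in> T' \<and> seq i' L' (sub \<eta> g) \<in> T'"
        using shape(1) by metis
    next
      fix h g \<eta> assume *: "(prog h g \<triangleq> \<^bold>\<top>) \<in> D_PCF" "is_subst \<eta>" "element a' (sub \<eta> h \<^bold># nil) \<in> T'"
        "seq i' L' (sub \<eta> g) \<in> T'"
      have "hd (prog h g \<triangleq> \<^bold>\<top>) = h" "bd (prog h g \<triangleq> \<^bold>\<top>) = g" by (simp_all add: hd_def bd_def)
      with * show "\<exists>c\<in>D_PCF. \<exists>\<eta>. is_subst \<eta> \<and> element a' (sub \<eta> (hd c) \<^bold># nil) \<in> T' \<and>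
          seq i' L' (sub \<eta> (bd c)) \<in> T'" by metis
    qed
    finally show ?thesis .
  qed
  have "sub \<sigma> A \<in> T"
  proof (rule prime_case_atom[OF T(1,2), where S = "{seq i L b}"])
    show "gd [] (sub \<sigma> A)"
      unfolding A_def using cs \<sigma> by (intro gd_sub gd_disj) (auto intro: gd_exs[OF o gF])
    fix H B \<theta> \<eta> T'
    assume *: "(H \<triangleq> B) \<in> D_all" "is_subst \<theta>" "is_subst \<eta>" "prime T'" "sub \<theta> ` {seq i L b} \<subseteq> T'"
      and c: "conv [] (prog (sub \<theta> a) (sub \<theta> b)) (sub \<eta> H) To"
    from clause_prog[OF *(1) c] have PCF: "(H \<triangleq> B) \<in> D_PCF" .
    with D_PCF_shape[OF PCF] obtain h g where h: "H = prog h g" "B = \<^bold>\<top>" by auto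
    with c have cv: "conv [] (sub \<theta> a) (sub \<eta> h) Tatm" "conv [] (sub \<theta> b) (sub \<eta> g) Tprp"
      by (auto simp: conv_rigid)
    have "element (sub \<theta> a) (sub \<eta> h \<^bold># nil) \<in> T'"
    proof (rule prime_element_conv[OF *(4) element_head[OF *(4), of "sub \<theta> a" nil] conv_refl])
      show "conv [] (sub \<theta> a \<^bold># nil) (sub \<eta> h \<^bold># nil) Tatmlst" using cv by (simp add: conv_rigid)
    qed (use * ty in auto)
    moreover have "seq (sub \<theta> i) (sub \<theta> L) (sub \<eta> g) \<in> T'"
      using prime_seq_conv[OF *(4) _ conv_refl conv_refl cv(2)] * ty by simp
    ultimately have ex: "\<exists>h g \<eta>. (prog h g \<triangleq> \<^bold>\<top>) \<in> D_PCF \<and> is_subst \<eta> \<and>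
        element (sub \<theta> a) (sub \<eta> h \<^bold># nil) \<in> T' \<and> seq (sub \<theta> i) (sub \<theta> L) (sub \<eta> g) \<in> T'"
      using PCF *(3) h by blast
    have "is_subst (\<lambda>x \<tau>. sub \<theta> (\<sigma> x \<tau>))"
      using \<sigma> *(2) by (auto simp: is_subst_def intro: sub_has_type)
    from main[OF *(4) this, of "sub \<theta> a" "sub \<theta> i" "sub \<theta> L"] ex
    show "sub \<theta> (sub \<sigma> A) \<in> T'" unfolding sub_sub by (simp add: \<sigma>_def vals_def)
  qed (use T in auto)
  then show ?thesis using main[OF T(1) \<sigma>, of a i L] by (simp add: \<sigma>_def vals_def)
qed

section \<open>The structure of a prime theory\<close>

text \<open>The terms of type \<open>i\<close> modulo provable equality form a countably infinite set, which is
  identified with the type of natural numbers.\<close>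

definition eqcls :: "tm set \<Rightarrow> tm \<Rightarrow> tm set" where
  "eqcls T t = {u. t \<^bold>\<equiv> u \<in> T}"

definition den :: "tm set \<Rightarrow> tm \<Rightarrow> nat" where
  "den T t = to_nat_on (eqcls T ` {t. has_type [] t Ti}) (eqcls T t)"

lemma eqcls_eq:
  assumes "prime T" "has_type [] b Ti"
  shows "eqcls T a = eqcls T b \<longleftrightarrow> a \<^bold>\<equiv> b \<in> T"
  using equiv_refl[OF assms] equiv_sym[OF assms(1)] equiv_trans[OF assms(1)]
  unfolding eqcls_def by blast

lemma den_eq:
  assumes "prime T" "has_type [] a Ti" "has_type [] b Ti"
  shows "den T a = den T b \<longleftrightarrow> a \<^bold>\<equiv> b \<in> T"
proof -
  have "countable (eqcls T ` {t. has_type [] t Ti})" by (intro countable_image countableI_type)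
  then show ?thesis
    unfolding den_def using eqcls_eq[OF assms(1,3)] assms by (subst to_nat_on_inj) auto
qed

primrec numeral_tm :: "nat \<Rightarrow> tm" where
  "numeral_tm 0 = zero'"
| "numeral_tm (Suc n) = succ' (numeral_tm n)"

lemma numeral_tm:
  "has_type [] (numeral_tm n) Ti" "rigid (numeral_tm n)" "sub \<theta> (numeral_tm n) = numeral_tm n"
  by (induction n) auto

lemma numeral_tm_inj:
  assumes "prime T"
  shows "numeral_tm m \<^bold>\<equiv> numeral_tm n \<in> T \<Longrightarrow> m = n"
proof (induction m arbitrary: n)
  case 0
  show ?case
  proof (cases n)
    case (Suc k)
    then show ?thesis using equiv_clash[OF assms 0] by (simp add: conv_rigid numeral_tm)
  qed simp
next
  case (Suc m)
  show ?case
  proof (cases n)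
    case 0
    then show ?thesis using equiv_clash[OF assms Suc.prems] by (simp add: conv_rigid numeral_tm)
  next
    case (Suc k)
    have "numeral_tm m \<^bold>\<equiv> numeral_tm k \<in> T"
      by (rule equiv_derive[OF assms Suc.prems]) (auto simp: conv_rigid numeral_tm Suc)
    then show ?thesis using Suc.IH Suc by simp
  qed
qed

text \<open>The numerals are pairwise unequal, so there are infinitely many classes and their
  enumeration reaches every number. Hence quantifiers over terms become quantifiers over one fixed
  type, whatever the prime theory.\<close>

lemma den_surj:
  assumes "prime T"
  shows "\<exists>t. has_type [] t Ti \<and> den T t = n"
proof -
  let ?Q = "eqcls T ` {t. has_type [] t Ti}"
  have "inj (\<lambda>n. eqcls T (numeral_tm n))"
    using eqcls_eq[OF assms numeral_tm(1)] numeral_tm_inj[OF assms] by (auto intro!: injI)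
  then have "infinite (range (\<lambda>n. eqcls T (numeral_tm n)))" by (simp add: finite_image_iff)
  moreover have "range (\<lambda>n. eqcls T (numeral_tm n)) \<subseteq> ?Q" using numeral_tm(1) by auto
  ultimately have "infinite ?Q" using finite_subset by blast
  then have "bij_betw (to_nat_on ?Q) ?Q UNIV"
    by (intro to_nat_on_infinite countable_image countableI_type)
  then have "n \<in> to_nat_on ?Q ` ?Q" by (simp add: bij_betw_def)
  then show ?thesis by (auto simp: den_def)
qed

definition rep :: "tm set \<Rightarrow> nat \<Rightarrow> tm" where
  "rep T n = (SOME t. has_type [] t Ti \<and> den T t = n)"

lemma rep:
  assumes "prime T"
  shows "has_type [] (rep T n) Ti" "den T (rep T n) = n"
  using someI_ex[OF den_surj[OF assms, of n]] by (simp_all add: rep_def)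

lemma den_subst:
  assumes T: "prime T" "den T a = den T b" and ty: "has_type [] a Ti" "has_type [] b Ti"
    and P: "gd [Ti] P"
  shows "inst 0 a P \<in> T \<longleftrightarrow> inst 0 b P \<in> T"
  using T ty equiv_subst[OF T(1) _ _ P] equiv_sym[OF T(1)] den_eq[OF T(1) ty] by blast

lemma den_cong:
  assumes T: "prime T" "den T a = den T b" and ty: "has_type [] a Ti" "has_type [] b Ti"
    and t: "has_type [Ti] t Ti"
  shows "den T (inst 0 a t) = den T (inst 0 b t)"
proof -
  have i: "has_type [] (inst 0 a t) Ti" "has_type [] (inst 0 b t) Ti"
    using ty t type_of_inst_0 by auto
  have "inst 0 a t \<^bold>\<equiv> inst 0 a t \<in> T" using T(1) i by (intro equiv_refl)
  moreover have "gd [Ti] (inst 0 a t \<^bold>\<equiv> t)" using i t by simp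
  ultimately have "inst 0 a t \<^bold>\<equiv> inst 0 b t \<in> T"
    using den_subst[OF T ty, of "inst 0 a t \<^bold>\<equiv> t"] i by simp
  then show ?thesis using den_eq[OF T(1) i] by simp
qed

text \<open>There is no equality predicate at type \<open>i \<rightarrow> i\<close>, so function
  arguments stay terms and are compared by their values through \<open>ap\<close>.\<close>

typedef fn = "{t. has_type [] t (Ti \<rightarrow> Ti)}" morphisms fn_tm Fn
  by (rule exI[of _ "Lam Ti (Bnd 0)"]) simp

lemma fn_tm [simp]: "has_type [] (fn_tm f) (Ti \<rightarrow> Ti)"
  using fn_tm by simp

lemma fn_tm_Fn [simp]: "has_type [] t (Ti \<rightarrow> Ti) \<Longrightarrow> fn_tm (Fn t) = t"
  by (simp add: Fn_inverse)

text \<open>One layer of syntax over arbitrary subterms: over terms it is read by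
  \<open>raw\<close>, over denotations by \<open>K\<close>.\<close>

datatype ('i, 'f) sh = SNum | SBool | SArr 'i 'i | SZero | STrue | SFalse | SSucc 'i | SPred 'i
  | SIsZero 'i | SIf 'i 'i 'i | SAbs 'i 'f | SApp 'i 'i | SRec 'i 'f

primrec raw :: "(tm, fn) sh \<Rightarrow> tm" where
  "raw SNum = num'"
| "raw SBool = bool'"
| "raw (SArr a b) = arr' a b"
| "raw SZero = zero'"
| "raw STrue = true'"
| "raw SFalse = false'"
| "raw (SSucc a) = succ' a"
| "raw (SPred a) = pred' a"
| "raw (SIsZero a) = is_zero' a"
| "raw (SIf a b c) = if' a b c"
| "raw (SAbs a f) = abs' a (fn_tm f)"
| "raw (SApp a b) = app' a b"
| "raw (SRec a f) = rec' a (fn_tm f)"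

definition K :: "tm set \<Rightarrow> (nat, fn) sh \<Rightarrow> nat" where
  "K T x = den T (raw (map_sh (rep T) id x))"

definition ap :: "tm set \<Rightarrow> fn \<Rightarrow> nat \<Rightarrow> nat" where
  "ap T f n = den T (fn_tm f \<cdot> rep T n)"

text \<open>Arguments are exchanged for their representatives one at a time, each by Leibniz's law
  with the others held fixed.\<close>

lemma den_raw:
  assumes T: "prime T" and "\<forall>a\<in>set1_sh x. has_type [] a Ti"
  shows "den T (raw x) = K T (map_sh (den T) id x)"
proof -
  note r = rep[OF T]
  have 1: "den T (f \<cdot> a) = den T (f \<cdot> rep T (den T a))"
    if "has_type [] f (Ti \<rightarrow> Ti)" "has_type [] a Ti" for f a
    using den_cong[OF T, of a "rep T (den T a)" "f \<cdot> Bnd 0"] r that by simp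
  have 2: "den T (f \<cdot> a \<cdot> b) = den T (f \<cdot> rep T (den T a) \<cdot> rep T (den T b))"
    if "f \<in> {Con C_app, Con C_arr}" "has_type [] a Ti" "has_type [] b Ti" for f a b
    using den_cong[OF T, of a "rep T (den T a)" "f \<cdot> Bnd 0 \<cdot> b"]
      den_cong[OF T, of b "rep T (den T b)" "f \<cdot> rep T (den T a) \<cdot> Bnd 0"] r that by auto
  have 4: "den T (f \<cdot> a \<cdot> b) = den T (f \<cdot> rep T (den T a) \<cdot> b)"
    if "f \<in> {Con C_abs, Con C_rec}" "has_type [] a Ti" "has_type [] b (Ti \<rightarrow> Ti)" for f a b
    using den_cong[OF T, of a "rep T (den T a)" "f \<cdot> Bnd 0 \<cdot> b"] r that by auto
  have 3: "den T (if' a b c) = den T (if' (rep T (den T a)) (rep T (den T b)) (rep T (den T c)))"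
    if "has_type [] a Ti" "has_type [] b Ti" "has_type [] c Ti" for a b c
    using den_cong[OF T, of a "rep T (den T a)" "if' (Bnd 0) b c"]
      den_cong[OF T, of b "rep T (den T b)" "if' (rep T (den T a)) (Bnd 0) c"]
      den_cong[OF T, of c "rep T (den T c)" "if' (rep T (den T a)) (rep T (den T b)) (Bnd 0)"]
      r that by simp
  show ?thesis
    using assms(2) r
    unfolding K_def by (cases x) (simp; rule 1 2 4 3; simp)+
qed

lemma den_simps:
  assumes "prime T"
  shows "den T num' = K T SNum" "den T bool' = K T SBool" "den T zero' = K T SZero"
    "den T true' = K T STrue" "den T false' = K T SFalse"
    "has_type [] a Ti \<Longrightarrow> den T (succ' a) = K T (SSucc (den T a))"
    "has_type [] a Ti \<Longrightarrow> den T (pred' a) = K T (SPred (den T a))"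
    "has_type [] a Ti \<Longrightarrow> den T (is_zero' a) = K T (SIsZero (den T a))"
    "has_type [] a Ti \<Longrightarrow> has_type [] b Ti \<Longrightarrow> den T (arr' a b) = K T (SArr (den T a) (den T b))"
    "has_type [] a Ti \<Longrightarrow> has_type [] b Ti \<Longrightarrow> den T (app' a b) = K T (SApp (den T a) (den T b))"
    "has_type [] a Ti \<Longrightarrow> has_type [] b Ti \<Longrightarrow> has_type [] c Ti \<Longrightarrow>
      den T (if' a b c) = K T (SIf (den T a) (den T b) (den T c))"
    "has_type [] a Ti \<Longrightarrow> has_type [] f (Ti \<rightarrow> Ti) \<Longrightarrow> den T (abs' a f) = K T (SAbs (den T a) (Fn f))"
    "has_type [] a Ti \<Longrightarrow> has_type [] f (Ti \<rightarrow> Ti) \<Longrightarrow> den T (rec' a f) = K T (SRec (den T a) (Fn f))"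
  using den_raw[OF assms, of SNum] den_raw[OF assms, of SBool] den_raw[OF assms, of SZero]
    den_raw[OF assms, of STrue] den_raw[OF assms, of SFalse] den_raw[OF assms, of "SSucc a"]
    den_raw[OF assms, of "SPred a"] den_raw[OF assms, of "SIsZero a"]
    den_raw[OF assms, of "SArr a b"] den_raw[OF assms, of "SApp a b"]
    den_raw[OF assms, of "SIf a b c"] den_raw[OF assms, of "SAbs a (Fn f)"]
    den_raw[OF assms, of "SRec a (Fn f)"]
  by simp_all

lemma den_app_fn:
  assumes "prime T" "has_type [] f (Ti \<rightarrow> Ti)" "has_type [] a Ti"
  shows "den T (f \<cdot> a) = ap T (Fn f) (den T a)"
  using den_cong[OF assms(1), of a "rep T (den T a)" "f \<cdot> Bnd 0"] rep[OF assms(1)] assms(2,3)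
  by (simp add: ap_def)

text \<open>Without a unifier the left rule would prove absurdity. A single unifier already forces
  equal head constants; then every unifier of the whole terms unifies the arguments, which gives
  their equality in \<open>T\<close>.\<close>

lemma raw_inj:
  assumes T: "prime T" "raw x \<^bold>\<equiv> raw y \<in> T"
    and ty: "\<forall>a\<in>set1_sh x. has_type [] a Ti" "\<forall>a\<in>set1_sh y. has_type [] a Ti"
  shows "rel_sh (\<lambda>a b. a \<^bold>\<equiv> b \<in> T)
    (\<lambda>f g. \<forall>t. has_type [] t Ti \<longrightarrow> fn_tm f \<cdot> t \<^bold>\<equiv> fn_tm g \<cdot> t \<in> T) x y"
proof (cases "(\<exists>\<theta>. is_subst \<theta> \<and> conv [] (sub \<theta> (raw x)) (sub \<theta> (raw y)) Ti)")
  case False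
  then show ?thesis using equiv_clash[OF T] by blast
next
  case True
  note d = equiv_derive[OF T]
  from True show ?thesis
    by (cases x; cases y)
      (use ty in \<open>auto simp: conv_rigid intro!: d conv_app conv_refl\<close>)
qed

text \<open>Function components are recovered only up to pointwise equality. This suffices where a
  rule applies the function to an argument, as in beta-reduction and the unfolding of
  recursion.\<close>

lemma K_inj:
  assumes T: "prime T" and eq: "K T x = K T y"
  shows "rel_sh (=) (\<lambda>f g. \<forall>n. ap T f n = ap T g n) x y"
proof -
  let ?r = "map_sh (rep T) id"
  have ty: "\<forall>a\<in>set1_sh (?r x). has_type [] a Ti" for x
    using rep[OF T] by (auto simp: sh.set_map)
  have tr: "has_type [] (raw x) Ti" if "\<forall>a\<in>set1_sh x. has_type [] a Ti" for x
    using that by (cases x) auto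
  have "raw (?r x) \<^bold>\<equiv> raw (?r y) \<in> T"
    using eq den_eq[OF T tr[OF ty] tr[OF ty]] by (simp add: K_def)
  from raw_inj[OF T this ty ty]
  have *: "rel_sh (\<lambda>a b. rep T a \<^bold>\<equiv> rep T b \<in> T)
      (\<lambda>f g. \<forall>t. has_type [] t Ti \<longrightarrow> fn_tm f \<cdot> t \<^bold>\<equiv> fn_tm g \<cdot> t \<in> T) x y"
    by (simp add: sh.rel_map id_def)
  then show ?thesis
  proof (rule sh.rel_mono_strong)
    fix a b assume "rep T a \<^bold>\<equiv> rep T b \<in> T"
    then have "den T (rep T a) = den T (rep T b)" using den_eq[OF T rep(1)[OF T] rep(1)[OF T]] by simp
    then show "a = b" using rep[OF T] by simp
  next
    fix f g assume *: "\<forall>t. has_type [] t Ti \<longrightarrow> fn_tm f \<cdot> t \<^bold>\<equiv> fn_tm g \<cdot> t \<in> T"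
    have ty: "has_type [] (fn_tm h \<cdot> rep T n) Ti" for h n using rep[OF T] by simp
    have "ap T f n = ap T g n" for n
      unfolding ap_def den_eq[OF T ty ty] using * rep[OF T] by blast
    then show "\<forall>n. ap T f n = ap T g n" ..
  qed
qed

section \<open>Judgments of the object logic as relations on denotations\<close>

abbreviation binary :: "con \<Rightarrow> bool" where
  "binary C \<equiv> C \<in> {C_typeof, C_eval, C_step, C_steps}"

definition At :: "tm set \<Rightarrow> tm \<Rightarrow> tm \<Rightarrow> con \<Rightarrow> nat \<Rightarrow> nat \<Rightarrow> bool" where
  "At T i L C x y \<longleftrightarrow> seq i L \<langle>Con C \<cdot> rep T x \<cdot> rep T y\<rangle> \<in> T"

definition AtV :: "tm set \<Rightarrow> tm \<Rightarrow> tm \<Rightarrow> nat \<Rightarrow> bool" where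
  "AtV T i L x \<longleftrightarrow> seq i L \<langle>value' (rep T x)\<rangle> \<in> T"

definition Pr :: "tm set \<Rightarrow> con \<Rightarrow> nat \<Rightarrow> nat \<Rightarrow> bool" where
  "Pr T C x y \<longleftrightarrow> provb T \<langle>Con C \<cdot> rep T x \<cdot> rep T y\<rangle>"

definition PrV :: "tm set \<Rightarrow> nat \<Rightarrow> bool" where
  "PrV T x \<longleftrightarrow> provb T \<langle>value' (rep T x)\<rangle>"

lemma At_iff:
  assumes T: "prime T" and C: "binary C" and ty: "has_type [] a Ti" "has_type [] b Ti"
  shows "seq i L \<langle>Con C \<cdot> a \<cdot> b\<rangle> \<in> T \<longleftrightarrow> At T i L C (den T a) (den T b)"
proof (cases "has_type [] i Tnt \<and> has_type [] L Tatmlst")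
  case True
  have "seq i L \<langle>Con C \<cdot> a \<cdot> b\<rangle> \<in> T \<longleftrightarrow> seq i L \<langle>Con C \<cdot> rep T (den T a) \<cdot> b\<rangle> \<in> T"
    using den_subst[OF T, of a "rep T (den T a)" "seq i L \<langle>Con C \<cdot> Bnd 0 \<cdot> b\<rangle>"] rep[OF T] ty C True
    by auto
  also have "\<dots> \<longleftrightarrow> seq i L \<langle>Con C \<cdot> rep T (den T a) \<cdot> rep T (den T b)\<rangle> \<in> T"
    using den_subst[OF T, of b "rep T (den T b)" "seq i L \<langle>Con C \<cdot> rep T (den T a) \<cdot> Bnd 0\<rangle>"]
      rep[OF T] ty C True
    by auto
  finally show ?thesis by (simp add: At_def)
next
  case False
  then show ?thesis using prime_typed(1)[OF T] unfolding At_def by blast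
qed

lemma AtV_iff:
  assumes T: "prime T" and ty: "has_type [] a Ti"
  shows "seq i L \<langle>value' a\<rangle> \<in> T \<longleftrightarrow> AtV T i L (den T a)"
proof (cases "has_type [] i Tnt \<and> has_type [] L Tatmlst")
  case True
  then show ?thesis
    using den_subst[OF T, of a "rep T (den T a)" "seq i L \<langle>value' (Bnd 0)\<rangle>"] rep[OF T] ty
    by (simp add: AtV_def)
next
  case False
  then show ?thesis using prime_typed(1)[OF T] unfolding AtV_def by blast
qed

lemma Pr_iff:
  "prime T \<Longrightarrow> binary C \<Longrightarrow> has_type [] a Ti \<Longrightarrow> has_type [] b Ti \<Longrightarrow>
   provb T \<langle>Con C \<cdot> a \<cdot> b\<rangle> \<longleftrightarrow> Pr T C (den T a) (den T b)"
  by (simp add: provb_def Pr_def At_iff rep del: insert_iff)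

lemma PrV_iff:
  "prime T \<Longrightarrow> has_type [] a Ti \<Longrightarrow> provb T \<langle>value' a\<rangle> \<longleftrightarrow> PrV T (den T a)"
  by (simp add: provb_def PrV_def AtV_iff rep)

lemma Pr_At: "Pr T C x y \<longleftrightarrow> (\<exists>i. nat' i \<in> T \<and> At T i nil C x y)"
  by (simp add: Pr_def At_def provb_def)

lemma PrV_AtV: "PrV T x \<longleftrightarrow> (\<exists>i. nat' i \<in> T \<and> AtV T i nil x)"
  by (simp add: PrV_def AtV_def provb_def)

text \<open>The tail of the list is \<open>nil\<close>, which has no members, so membership can only
  come from the head and acts as equality at type \<open>atm\<close>.\<close>

lemma element_singleton_elim:
  assumes T: "prime T" "element a (b \<^bold># nil) \<in> T" "gd [] C" and ty: "has_type [] a Tatm" "has_type [] b Tatm"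
    and *: "\<And>\<theta> T'. is_subst \<theta> \<Longrightarrow> prime T' \<Longrightarrow> conv [] (sub \<theta> a) (sub \<theta> b) Tatm \<Longrightarrow> sub \<theta> C \<in> T'"
  shows "C \<in> T"
proof (rule element_elim[OF T(1,2), where S = "{}"])
  fix \<theta> T' L0 assume \<theta>: "is_subst \<theta>" "prime T'"
  {
    assume "conv [] (sub \<theta> (b \<^bold># nil)) (sub \<theta> a \<^bold># L0) Tatmlst"
    then have "conv [] (sub \<theta> a) (sub \<theta> b) Tatm" by (auto simp: conv_rigid intro: conv_sym)
    then show "sub \<theta> C \<in> T'" using * \<theta> by blast
  next
    fix Y assume c: "conv [] (sub \<theta> (b \<^bold># nil)) (Y \<^bold># L0) Tatmlst" "element (sub \<theta> a) L0 \<in> T'"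
    then have "conv [] L0 nil Tatmlst" by (auto simp: conv_rigid intro: conv_sym)
    from prime_element_conv[OF \<theta>(2) c(2) conv_refl this] element_nil[OF \<theta>(2)] \<theta> ty
    show "sub \<theta> C \<in> T'" by simp
  }
qed (use T in auto)

lemma element_binary:
  assumes T: "prime T" "element (Con C \<cdot> a \<cdot> b) (Con C' \<cdot> a' \<cdot> b' \<^bold># nil) \<in> T"
    and ty: "binary C" "binary C'" "has_type [] a Ti" "has_type [] b Ti" "has_type [] a' Ti" "has_type [] b' Ti"
  shows "C = C' \<and> den T a = den T a' \<and> den T b = den T b'"
proof (cases "C = C'")
  case True
  have "a \<^bold>\<equiv> a' \<in> T" "b \<^bold>\<equiv> b' \<in> T"
    by (rule element_singleton_elim[OF T]; use ty True in \<open>auto simp: conv_rigid intro: equiv_conv\<close>)+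
  then show ?thesis using True den_eq[OF T(1)] ty by simp
next
  case False
  have "\<^bold>\<bottom> \<in> T"
    by (rule element_singleton_elim[OF T]) (use ty False in \<open>auto simp: conv_rigid\<close>)
  with T show ?thesis by (simp add: prime_bot)
qed

lemma element_unary:
  assumes T: "prime T" "element (value' a) (value' a' \<^bold># nil) \<in> T"
    and ty: "has_type [] a Ti" "has_type [] a' Ti"
  shows "den T a = den T a'"
proof -
  have "a \<^bold>\<equiv> a' \<in> T"
    by (rule element_singleton_elim[OF T]) (use ty in \<open>auto simp: conv_rigid intro: equiv_conv\<close>)
  then show ?thesis using den_eq[OF T(1)] ty by simp
qed

lemma element_unary_binary:
  assumes T: "prime T" and ty: "binary C" "has_type [] a Ti" "has_type [] b Ti" "has_type [] c Ti"
  shows "element (value' c) (Con C \<cdot> a \<cdot> b \<^bold># nil) \<notin> T" "element (Con C \<cdot> a \<cdot> b) (value' c \<^bold># nil) \<notin> T"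
proof -
  have 1: "\<^bold>\<bottom> \<in> T" if "element (value' c) (Con C \<cdot> a \<cdot> b \<^bold># nil) \<in> T"
    by (rule element_singleton_elim[OF T that]) (use ty in \<open>auto simp: conv_rigid\<close>)
  have 2: "\<^bold>\<bottom> \<in> T" if "element (Con C \<cdot> a \<cdot> b) (value' c \<^bold># nil) \<in> T"
    by (rule element_singleton_elim[OF T that]) (use ty in \<open>auto simp: conv_rigid\<close>)
  show "element (value' c) (Con C \<cdot> a \<cdot> b \<^bold># nil) \<notin> T" "element (Con C \<cdot> a \<cdot> b) (value' c \<^bold># nil) \<notin> T"
    using 1 2 prime_bot[OF T] by blast+
qed

section \<open>The relations of PCF in a prime theory\<close>

text \<open>This definition and the next ones unfold a judgment once, with its premises as
  parameters. With \<open>At\<close> in the premises they express inversion at a smaller height, for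
  induction; with \<open>Pr\<close>, inversion and closure under the rules at unspecified
  heights.\<close>

inductive stepF for T st vl where
  step_succ: "st a b \<Longrightarrow> stepF T st vl (K T (SSucc a)) (K T (SSucc b))"
| step_pred_zero: "stepF T st vl (K T (SPred (K T SZero))) (K T SZero)"
| step_pred_succ: "vl v \<Longrightarrow> stepF T st vl (K T (SPred (K T (SSucc v)))) v"
| step_pred: "st a b \<Longrightarrow> stepF T st vl (K T (SPred a)) (K T (SPred b))"
| step_is_zero_zero: "stepF T st vl (K T (SIsZero (K T SZero))) (K T STrue)"
| step_is_zero_succ: "vl v \<Longrightarrow> stepF T st vl (K T (SIsZero (K T (SSucc v)))) (K T SFalse)"
| step_is_zero: "st a b \<Longrightarrow> stepF T st vl (K T (SIsZero a)) (K T (SIsZero b))"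
| step_if_true: "stepF T st vl (K T (SIf (K T STrue) c d)) c"
| step_if_false: "stepF T st vl (K T (SIf (K T SFalse) c d)) d"
| step_if: "st a b \<Longrightarrow> stepF T st vl (K T (SIf a c d)) (K T (SIf b c d))"
| step_beta: "stepF T st vl (K T (SApp (K T (SAbs t r)) n)) (ap T r n)"
| step_app: "st a b \<Longrightarrow> stepF T st vl (K T (SApp a n)) (K T (SApp b n))"
| step_rec: "stepF T st vl (K T (SRec t r)) (ap T r (K T (SRec t r)))"

inductive stepsF for st sts where
  steps_refl: "stepsF st sts x x"
| steps_step: "st x y \<Longrightarrow> sts y w \<Longrightarrow> stepsF st sts x w"

inductive valF for T vl where
  val_zero: "valF T vl (K T SZero)"
| val_true: "valF T vl (K T STrue)"
| val_false: "valF T vl (K T SFalse)"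
| val_succ: "vl v \<Longrightarrow> valF T vl (K T (SSucc v))"
| val_abs: "valF T vl (K T (SAbs t r))"

inductive evalF for T ev where
  eval_zero: "evalF T ev (K T SZero) (K T SZero)"
| eval_true: "evalF T ev (K T STrue) (K T STrue)"
| eval_false: "evalF T ev (K T SFalse) (K T SFalse)"
| eval_succ: "ev a v \<Longrightarrow> evalF T ev (K T (SSucc a)) (K T (SSucc v))"
| eval_pred_zero: "ev a (K T SZero) \<Longrightarrow> evalF T ev (K T (SPred a)) (K T SZero)"
| eval_pred_succ: "ev a (K T (SSucc v)) \<Longrightarrow> evalF T ev (K T (SPred a)) v"
| eval_is_zero_zero: "ev a (K T SZero) \<Longrightarrow> evalF T ev (K T (SIsZero a)) (K T STrue)"
| eval_is_zero_succ: "ev a (K T (SSucc v)) \<Longrightarrow> evalF T ev (K T (SIsZero a)) (K T SFalse)"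
| eval_if_true: "ev a (K T STrue) \<Longrightarrow> ev b v \<Longrightarrow> evalF T ev (K T (SIf a b c)) v"
| eval_if_false: "ev a (K T SFalse) \<Longrightarrow> ev c v \<Longrightarrow> evalF T ev (K T (SIf a b c)) v"
| eval_abs: "evalF T ev (K T (SAbs t r)) (K T (SAbs t r))"
| eval_app: "ev a (K T (SAbs t r)) \<Longrightarrow> ev (ap T r n) v \<Longrightarrow> evalF T ev (K T (SApp a n)) v"
| eval_rec: "ev (ap T r (K T (SRec t r))) v \<Longrightarrow> evalF T ev (K T (SRec t r)) v"

text \<open>The parameter \<open>bd\<close> abstracts from the hypothetical premise of the binder
  rules, which appears in several readings: under an extended list, as closure under typed
  arguments, or excluded.\<close>

inductive typF for T ty bd where
  typ_zero: "typF T ty bd (K T SZero) (K T SNum)"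
| typ_true: "typF T ty bd (K T STrue) (K T SBool)"
| typ_false: "typF T ty bd (K T SFalse) (K T SBool)"
| typ_succ: "ty a (K T SNum) \<Longrightarrow> typF T ty bd (K T (SSucc a)) (K T SNum)"
| typ_pred: "ty a (K T SNum) \<Longrightarrow> typF T ty bd (K T (SPred a)) (K T SNum)"
| typ_is_zero: "ty a (K T SNum) \<Longrightarrow> typF T ty bd (K T (SIsZero a)) (K T SBool)"
| typ_if: "ty a (K T SBool) \<Longrightarrow> ty b t \<Longrightarrow> ty c t \<Longrightarrow> typF T ty bd (K T (SIf a b c)) t"
| typ_abs: "bd t r u \<Longrightarrow> typF T ty bd (K T (SAbs t r)) (K T (SArr t u))"
| typ_app: "ty a (K T (SArr u t)) \<Longrightarrow> ty n u \<Longrightarrow> typF T ty bd (K T (SApp a n)) t"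
| typ_rec: "bd t r t \<Longrightarrow> typF T ty bd (K T (SRec t r)) t"

lemma stepF_mono:
  "stepF T st vl x y \<Longrightarrow> (\<And>a b. st a b \<Longrightarrow> st' a b) \<Longrightarrow> (\<And>a. vl a \<Longrightarrow> vl' a) \<Longrightarrow> stepF T st' vl' x y"
  by (erule stepF.cases; simp add: stepF.intros)

lemma stepsF_mono:
  "stepsF st sts x y \<Longrightarrow> (\<And>a b. st a b \<Longrightarrow> st' a b) \<Longrightarrow> (\<And>a b. sts a b \<Longrightarrow> sts' a b) \<Longrightarrow>
   stepsF st' sts' x y"
  by (erule stepsF.cases) (simp add: steps_refl, metis steps_step)

lemma valF_mono: "valF T vl x \<Longrightarrow> (\<And>a. vl a \<Longrightarrow> vl' a) \<Longrightarrow> valF T vl' x"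
  by (erule valF.cases; simp add: valF.intros)

lemma evalF_mono: "evalF T ev x y \<Longrightarrow> (\<And>a b. ev a b \<Longrightarrow> ev' a b) \<Longrightarrow> evalF T ev' x y"
  by (erule evalF.cases; simp; rule evalF.intros; blast)

lemma typF_mono:
  "typF T ty bd x t \<Longrightarrow> (\<And>a b. ty a b \<Longrightarrow> ty' a b) \<Longrightarrow> (\<And>a b c. bd a b c \<Longrightarrow> bd' a b c) \<Longrightarrow>
   typF T ty' bd' x t"
  by (erule typF.cases; simp; rule typF.intros; blast)

lemma element_binary_iff:
  assumes T: "prime T"
    and ty: "binary C" "binary C'" "has_type [] a Ti" "has_type [] b Ti" "has_type [] a' Ti" "has_type [] b' Ti"
  shows "element (Con C \<cdot> a \<cdot> b) (Con C' \<cdot> a' \<cdot> b' \<^bold># nil) \<in> T \<longleftrightarrow>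
    C = C' \<and> den T a = den T a' \<and> den T b = den T b'"
proof
  assume *: "C = C' \<and> den T a = den T a' \<and> den T b = den T b'"
  have g: "gd [Ti] (element (Con C \<cdot> a \<cdot> b) (Con C \<cdot> Bnd 0 \<cdot> b \<^bold># nil))"
    "gd [Ti] (element (Con C \<cdot> a \<cdot> b) (Con C \<cdot> a' \<cdot> Bnd 0 \<^bold># nil))" using ty by auto
  have "has_type [] (Con C \<cdot> a \<cdot> b) Tatm" using ty by auto
  from element_head[OF T this, of nil]
  have "element (Con C \<cdot> a \<cdot> b) (Con C \<cdot> a \<cdot> b \<^bold># nil) \<in> T" by simp
  then have "element (Con C \<cdot> a \<cdot> b) (Con C \<cdot> a' \<cdot> b \<^bold># nil) \<in> T"
    using den_subst[OF T _ ty(3,5) g(1)] * ty by simp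
  then show "element (Con C \<cdot> a \<cdot> b) (Con C' \<cdot> a' \<cdot> b' \<^bold># nil) \<in> T"
    using den_subst[OF T _ ty(4,6) g(2)] * ty by simp
qed (use element_binary[OF T _ ty] in blast)

lemma element_unary_iff:
  assumes T: "prime T" and ty: "has_type [] a Ti" "has_type [] a' Ti"
  shows "element (value' a) (value' a' \<^bold># nil) \<in> T \<longleftrightarrow> den T a = den T a'"
proof
  assume *: "den T a = den T a'"
  have "element (value' a) (value' a \<^bold># nil) \<in> T" using ty by (intro element_head[OF T]) auto
  then show "element (value' a) (value' a' \<^bold># nil) \<in> T"
    using den_subst[OF T * ty, of "element (value' a) (value' (Bnd 0) \<^bold># nil)"] ty by simp
qed (use element_unary[OF T _ ty] in blast)

text \<open>What is left of a binder premise after inverting its object-level quantifier and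
  implication, still at height \<open>i\<close>.\<close>

definition tyB :: "tm set \<Rightarrow> tm \<Rightarrow> tm \<Rightarrow> nat \<Rightarrow> fn \<Rightarrow> nat \<Rightarrow> bool" where
  "tyB T i L t r u \<longleftrightarrow> (\<forall>x. has_type [] x Ti \<longrightarrow>
     seq i (typeof x (rep T t) \<^bold># L) \<langle>typeof (fn_tm r \<cdot> x) (rep T u)\<rangle> \<in> T)"

lemma seq_typeof_body:
  assumes T: "prime T" "nat' i \<in> T"
    "seq i L (Bigand (Lam Ti (typeof (Bnd 0) t \<^bold>\<Rightarrow> \<langle>typeof (f \<cdot> Bnd 0) u\<rangle>))) \<in> T"
    and ty: "has_type [] t Ti" "has_type [] u Ti" "has_type [] f (Ti \<rightarrow> Ti)"
  shows "tyB T i L (den T t) (Fn f) (den T u)"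
  unfolding tyB_def
proof (intro allI impI)
  fix x assume x: "has_type [] x Ti"
  have iL: "has_type [] i Tnt" "has_type [] L Tatmlst" using prime_typed(1)[OF T(1,3)] by auto
  have "conv [] (Lam Ti (typeof (Bnd 0) t \<^bold>\<Rightarrow> \<langle>typeof (f \<cdot> Bnd 0) u\<rangle>) \<cdot> x)
      (typeof x t \<^bold>\<Rightarrow> \<langle>typeof (f \<cdot> x) u\<rangle>) Tprp"
    using conv_beta[of Ti "[]" "typeof (Bnd 0) t \<^bold>\<Rightarrow> \<langle>typeof (f \<cdot> Bnd 0) u\<rangle>" Tprp x] ty x by simp
  from prime_seq_conv[OF T(1) seq_bigand_inv[OF T x] conv_refl conv_refl this]
  have "seq i L (typeof x t \<^bold>\<Rightarrow> \<langle>typeof (f \<cdot> x) u\<rangle>) \<in> T" using iL by simp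
  from seq_arrow_inv[OF T(1,2) this]
  have "seq i (typeof x t \<^bold># L) \<langle>typeof (f \<cdot> x) u\<rangle> \<in> T" .
  then have "seq i (typeof x (rep T (den T t)) \<^bold># L) \<langle>typeof (f \<cdot> x) u\<rangle> \<in> T"
    using den_subst[OF T(1), of t "rep T (den T t)" "seq i (typeof x (Bnd 0) \<^bold># L) \<langle>typeof (f \<cdot> x) u\<rangle>"]
      rep[OF T(1)] ty x iL by simp
  then show "seq i (typeof x (rep T (den T t)) \<^bold># L) \<langle>typeof (fn_tm (Fn f) \<cdot> x) (rep T (den T u))\<rangle> \<in> T"
    using den_subst[OF T(1), of u "rep T (den T u)"
        "seq i (typeof x (rep T (den T t)) \<^bold># L) \<langle>typeof (f \<cdot> x) (Bnd 0)\<rangle>"]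
      rep[OF T(1)] ty x iL by simp
qed

lemma den_app_subst:
  "prime T \<Longrightarrow> is_subst \<eta> \<Longrightarrow> has_type [] a Ti \<Longrightarrow>
   den T (\<eta> x (Ti \<rightarrow> Ti) \<cdot> a) = ap T (Fn (\<eta> x (Ti \<rightarrow> Ti))) (den T a)"
  by (simp add: den_app_fn)

lemmas prime_simps = element_binary_iff element_unary_iff element_unary_binary den_simps
  den_app_subst At_iff AtV_iff

context
  fixes T i L b
  assumes T: "prime T" and i: "nat' i \<in> T" and b: "seq i L b \<in> T"
begin

lemma step_inv:
  assumes "prog (x \<leadsto> y) b \<in> T"
  shows "stepF T (At T i L C_step) (AtV T i L) (den T x) (den T y)"
proof -
  have ty: "has_type [] x Ti" "has_type [] y Ti"
    using prime_typed(3)[OF T assms] by (auto split: option.splits ty.splits if_splits)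
  from prog_inv[OF T assms b] obtain h g \<eta> where "(prog h g \<triangleq> \<^bold>\<top>) \<in> D_PCF" "is_subst \<eta>"
    "element (x \<leadsto> y) (sub \<eta> h \<^bold># nil) \<in> T" "seq i L (sub \<eta> g) \<in> T" by blast
  then show ?thesis
    unfolding D_PCF_def D_typing_def D_natural_def D_transition_def Let_def Un_iff
    by (elim disjE insertE emptyE; simp add: ty prime_simps[OF T] stepF.intros)
qed

lemma steps_inv:
  assumes "prog (x \<leadsto>\<^sup>* y) b \<in> T"
  shows "stepsF (At T i L C_step) (At T i L C_steps) (den T x) (den T y)"
proof -
  have ty: "has_type [] x Ti" "has_type [] y Ti"
    using prime_typed(3)[OF T assms] by (auto split: option.splits ty.splits if_splits)
  from prog_inv[OF T assms b] obtain h g \<eta> where "(prog h g \<triangleq> \<^bold>\<top>) \<in> D_PCF" "is_subst \<eta>"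
    "element (x \<leadsto>\<^sup>* y) (sub \<eta> h \<^bold># nil) \<in> T" "seq i L (sub \<eta> g) \<in> T" by blast
  then show ?thesis
    unfolding D_PCF_def D_typing_def D_natural_def D_transition_def Let_def Un_iff
    by (elim disjE insertE emptyE; simp add: ty prime_simps[OF T] steps_refl)
      (drule seq_amp_inv[OF T i], simp add: prime_simps[OF T], blast intro: steps_step)
qed

lemma val_inv:
  assumes "prog (value' x) b \<in> T"
  shows "valF T (AtV T i L) (den T x)"
proof -
  have ty: "has_type [] x Ti"
    using prime_typed(3)[OF T assms] by (auto split: option.splits ty.splits if_splits)
  from prog_inv[OF T assms b] obtain h g \<eta> where "(prog h g \<triangleq> \<^bold>\<top>) \<in> D_PCF" "is_subst \<eta>"
    "element (value' x) (sub \<eta> h \<^bold># nil) \<in> T" "seq i L (sub \<eta> g) \<in> T" by blast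
  then show ?thesis
    unfolding D_PCF_def D_typing_def D_natural_def D_transition_def Let_def Un_iff
    by (elim disjE insertE emptyE; simp add: ty prime_simps[OF T] valF.intros)
qed

lemma eval_inv:
  assumes "prog (x \<Down> y) b \<in> T"
  shows "evalF T (At T i L C_eval) (den T x) (den T y)"
proof -
  have ty: "has_type [] x Ti" "has_type [] y Ti"
    using prime_typed(3)[OF T assms] by (auto split: option.splits ty.splits if_splits)
  from prog_inv[OF T assms b] obtain h g \<eta> where "(prog h g \<triangleq> \<^bold>\<top>) \<in> D_PCF" "is_subst \<eta>"
    "element (x \<Down> y) (sub \<eta> h \<^bold># nil) \<in> T" "seq i L (sub \<eta> g) \<in> T" by blast
  then show ?thesis
    unfolding D_PCF_def D_typing_def D_natural_def D_transition_def Let_def Un_iff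
    by (elim disjE insertE emptyE; simp add: ty prime_simps[OF T] evalF.intros)
      ((drule seq_amp_inv[OF T i])?, simp add: prime_simps[OF T], blast intro: evalF.intros)+
qed

lemma typ_inv:
  assumes "prog (typeof x y) b \<in> T"
  shows "typF T (At T i L C_typeof) (tyB T i L) (den T x) (den T y)"
proof -
  have ty: "has_type [] x Ti" "has_type [] y Ti"
    using prime_typed(3)[OF T assms] by (auto split: option.splits ty.splits if_splits)
  from prog_inv[OF T assms b] obtain h g \<eta> where "(prog h g \<triangleq> \<^bold>\<top>) \<in> D_PCF" "is_subst \<eta>"
    "element (typeof x y) (sub \<eta> h \<^bold># nil) \<in> T" "seq i L (sub \<eta> g) \<in> T" by blast
  then show ?thesis
    unfolding D_PCF_def D_typing_def D_natural_def D_transition_def Let_def Un_iff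
    by (elim disjE insertE emptyE; simp add: ty prime_simps[OF T] typF.intros)
      ((drule seq_typeof_body[OF T i], simp, simp, simp, simp add: typF.intros)
       | (drule seq_amp_inv[OF T i], (elim conjE, drule seq_amp_inv[OF T i])?,
          simp add: prime_simps[OF T], blast intro: typF.intros))+
qed

end

section \<open>Inversion at a smaller height and at some height\<close>

lemma At_obj_inv:
  assumes T: "prime T" "nat' i \<in> T" "seq i nil \<langle>a\<rangle> \<in> T"
  obtains I b where "nat' I \<in> T" "prog a b \<in> T" "seq I nil b \<in> T"
  using seq_obj_inv[OF T] element_nil[OF T(1)] by blast

lemma At_Pr: "nat' i \<in> T \<Longrightarrow> At T i nil C x y \<Longrightarrow> Pr T C x y"
  by (auto simp: Pr_At)

lemma AtV_PrV: "nat' i \<in> T \<Longrightarrow> AtV T i nil x \<Longrightarrow> PrV T x"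
  by (auto simp: PrV_AtV)

text \<open>Without hypotheses an atom has no derivation of height \<open>z\<close>, so the base
  case of the height inductions over the empty list is void.\<close>

lemma not_At_z:
  assumes "prime T"
  shows "\<not> At T z nil C x y" "\<not> AtV T z nil x"
  unfolding At_def AtV_def using seq_z[OF assms] element_nil[OF assms] by blast+

lemma At_s_prog:
  assumes "prime T" "At T (s i) nil C x y"
  obtains b where "prog (Con C \<cdot> rep T x \<cdot> rep T y) b \<in> T" "seq i nil b \<in> T"
  using seq_obj_inv_s[OF assms(1)] assms(2) element_nil[OF assms(1)] unfolding At_def by blast

lemma AtV_s_prog:
  assumes "prime T" "AtV T (s i) nil x"
  obtains b where "prog (value' (rep T x)) b \<in> T" "seq i nil b \<in> T"
  using seq_obj_inv_s[OF assms(1)] assms(2) element_nil[OF assms(1)] unfolding AtV_def by blast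

lemma Pr_prog:
  assumes "prime T" "Pr T C x y"
  obtains i b where "nat' i \<in> T" "prog (Con C \<cdot> rep T x \<cdot> rep T y) b \<in> T" "seq i nil b \<in> T"
  using assms At_obj_inv[OF assms(1)] unfolding Pr_At At_def by blast

lemma PrV_prog:
  assumes "prime T" "PrV T x"
  obtains i b where "nat' i \<in> T" "prog (value' (rep T x)) b \<in> T" "seq i nil b \<in> T"
  using assms At_obj_inv[OF assms(1)] unfolding PrV_AtV AtV_def by blast

text \<open>Only premises with the judgment under induction keep their height; auxiliary premises
  are weakened to \<open>Pr\<close> and \<open>PrV\<close>, where facts already established
  apply.\<close>

lemma At_s_inv:
  assumes T: "prime T" and i: "nat' i \<in> T"
  shows "At T (s i) nil C_step x y \<Longrightarrow> stepF T (At T i nil C_step) (PrV T) x y"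
    "At T (s i) nil C_steps x y \<Longrightarrow> stepsF (Pr T C_step) (At T i nil C_steps) x y"
    "At T (s i) nil C_eval x y \<Longrightarrow> evalF T (At T i nil C_eval) x y"
    "AtV T (s i) nil x \<Longrightarrow> valF T (AtV T i nil) x"
proof -
  note r = rep(2)[OF T]
  show "stepF T (At T i nil C_step) (PrV T) x y" if "At T (s i) nil C_step x y"
    using that by (rule At_s_prog[OF T])
      (drule step_inv[OF T i, rotated], assumption, auto simp: r intro: AtV_PrV[OF i] elim!: stepF_mono)
  show "stepsF (Pr T C_step) (At T i nil C_steps) x y" if "At T (s i) nil C_steps x y"
    using that by (rule At_s_prog[OF T])
      (drule steps_inv[OF T i, rotated], assumption, auto simp: r intro: At_Pr[OF i] elim!: stepsF_mono)
  show "evalF T (At T i nil C_eval) x y" if "At T (s i) nil C_eval x y"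
    using that by (rule At_s_prog[OF T])
      (drule eval_inv[OF T i, rotated], assumption, auto simp: r)
  show "valF T (AtV T i nil) x" if "AtV T (s i) nil x"
    using that by (rule AtV_s_prog[OF T])
      (drule val_inv[OF T i, rotated], assumption, auto simp: r)
qed

lemma Pr_inv:
  assumes T: "prime T"
  shows "Pr T C_step x y \<Longrightarrow> stepF T (Pr T C_step) (PrV T) x y"
    "Pr T C_steps x y \<Longrightarrow> stepsF (Pr T C_step) (Pr T C_steps) x y"
    "Pr T C_eval x y \<Longrightarrow> evalF T (Pr T C_eval) x y"
    "PrV T x \<Longrightarrow> valF T (PrV T) x"
proof -
  note r = rep(2)[OF T]
  show "stepF T (Pr T C_step) (PrV T) x y" if "Pr T C_step x y"
    using that by (rule Pr_prog[OF T])
      (drule step_inv[OF T, rotated 2], assumption+, auto simp: r intro: AtV_PrV At_Pr elim!: stepF_mono)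
  show "stepsF (Pr T C_step) (Pr T C_steps) x y" if "Pr T C_steps x y"
    using that by (rule Pr_prog[OF T])
      (drule steps_inv[OF T, rotated 2], assumption+, auto simp: r intro: At_Pr elim!: stepsF_mono)
  show "evalF T (Pr T C_eval) x y" if "Pr T C_eval x y"
    using that by (rule Pr_prog[OF T])
      (drule eval_inv[OF T, rotated 2], assumption+, auto simp: r intro: At_Pr elim!: evalF_mono)
  show "valF T (PrV T) x" if "PrV T x"
    using that by (rule PrV_prog[OF T])
      (drule val_inv[OF T, rotated 2], assumption+, auto simp: r intro: AtV_PrV elim!: valF_mono)
qed

text \<open>The hypothetical judgment in the typing rules for binders is eliminated by cut.\<close>

lemma typ_Pr_inv:
  assumes T: "prime T" and "Pr T C_typeof x t"
  shows "typF T (Pr T C_typeof) (\<lambda>t r u. \<forall>n. Pr T C_typeof n t \<longrightarrow> Pr T C_typeof (ap T r n) u) x t"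
proof -
  note r = rep[OF T]
  from Pr_prog[OF T assms(2)] obtain i b where i: "nat' i \<in> T"
    and *: "prog (typeof (rep T x) (rep T t)) b \<in> T" "seq i nil b \<in> T" .
  from typ_inv[OF T i *(2,1)] have "typF T (At T i nil C_typeof) (tyB T i nil) x t" by (simp add: r)
  then show ?thesis
  proof (rule typF_mono)
    fix u f v assume tyB: "tyB T i nil u f v"
    show "\<forall>n. Pr T C_typeof n u \<longrightarrow> Pr T C_typeof (ap T f n) v"
    proof (intro allI impI)
      fix n assume "Pr T C_typeof n u"
      then obtain j where j: "nat' j \<in> T" "seq j nil \<langle>typeof (rep T n) (rep T u)\<rangle> \<in> T"
        by (auto simp: Pr_At At_def)
      have "seq i (typeof (rep T n) (rep T u) \<^bold># nil) \<langle>typeof (fn_tm f \<cdot> rep T n) (rep T v)\<rangle> \<in> T"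
        using tyB r unfolding tyB_def by blast
      from seq_cut[OF T i this j] have "provb T \<langle>typeof (fn_tm f \<cdot> rep T n) (rep T v)\<rangle>"
        by (simp add: provb_def)
      then have "Pr T C_typeof (den T (fn_tm f \<cdot> rep T n)) (den T (rep T v))"
        using Pr_iff[OF T, of C_typeof "fn_tm f \<cdot> rep T n" "rep T v"] r by simp
      then show "Pr T C_typeof (ap T f n) v" by (simp only: ap_def r)
    qed
  qed (rule At_Pr[OF i])
qed

section \<open>Introduction: closure under the clauses of PCF\<close>

lemma provb_clause:
  assumes T: "prime T" and c: "(prog h g \<triangleq> \<^bold>\<top>) \<in> D_PCF" and \<eta>: "is_subst \<eta>"
    and g: "provb T (sub \<eta> g)"
  shows "provb T \<langle>sub \<eta> h\<rangle>"
proof (rule provb_prog[OF T _ g])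
  have "has_type [] h Tatm" "has_type [] g Tprp" using D_PCF_shape[OF c] by auto
  then have "gd [] (sub \<eta> (prog h g))" using \<eta> by simp
  with prime_defR[OF T _ \<eta>, of "prog h g" "\<^bold>\<top>"] c prime_top[OF T]
  show "prog (sub \<eta> h) (sub \<eta> g) \<in> T" by (simp add: D_all_def)
qed

lemma provb_amp_iff:
  assumes "prime T"
  shows "provb T (b \<^bold>& c) \<longleftrightarrow> provb T b \<and> provb T c"
  using provb_amp[OF assms] seq_amp_inv[OF assms] unfolding provb_def by blast

lemma den_fn_tm:
  "prime T \<Longrightarrow> has_type [] a Ti \<Longrightarrow> den T (fn_tm f \<cdot> a) = ap T f (den T a)"
  by (simp add: den_app_fn fn_tm_inverse)

text \<open>The clauses share one stock of variable names, so a single valuation by representatives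
  can instantiate each of them.\<close>

definition env :: "tm set \<Rightarrow> nat \<Rightarrow> nat \<Rightarrow> nat \<Rightarrow> nat \<Rightarrow> nat \<Rightarrow> nat \<Rightarrow> nat \<Rightarrow> nat \<Rightarrow> fn \<Rightarrow> subst" where
  "env T a b c d e v t u r = vals [(''M'', Ti, rep T a), (''M1'', Ti, rep T b), (''N'', Ti, rep T c),
     (''N1'', Ti, rep T d), (''N2'', Ti, rep T e), (''V'', Ti, rep T v), (''T'', Ti, rep T t),
     (''U'', Ti, rep T u), (''R'', Ti \<rightarrow> Ti, fn_tm r)]"

lemma env_simps:
  "env T a b c d e v t u r ''M'' Ti = rep T a" "env T a b c d e v t u r ''M1'' Ti = rep T b"
  "env T a b c d e v t u r ''N'' Ti = rep T c" "env T a b c d e v t u r ''N1'' Ti = rep T d"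
  "env T a b c d e v t u r ''N2'' Ti = rep T e" "env T a b c d e v t u r ''V'' Ti = rep T v"
  "env T a b c d e v t u r ''T'' Ti = rep T t" "env T a b c d e v t u r ''U'' Ti = rep T u"
  "env T a b c d e v t u r ''R'' (Ti \<rightarrow> Ti) = fn_tm r"
  by (simp_all add: env_def vals_def)

lemma is_subst_env: "prime T \<Longrightarrow> is_subst (env T a b c d e v t u r)"
  unfolding env_def by (rule is_subst_vals) (auto simp: rep)

lemmas provb_simps = Pr_iff PrV_iff provb_amp_iff provb_tt rep den_simps den_fn_tm

declare fn_tm_inverse [simp]

text \<open>Of the typing rules only those without binders are needed: subject reduction removes binders
  but does not retype them, hence the body judgment \<open>False\<close>.\<close>

lemma Pr_intro:
  assumes T: "prime T"
  shows "stepF T (Pr T C_step) (PrV T) x y \<Longrightarrow> Pr T C_step x y"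
    "stepsF (Pr T C_step) (Pr T C_steps) x y \<Longrightarrow> Pr T C_steps x y"
    "evalF T (Pr T C_eval) x y \<Longrightarrow> Pr T C_eval x y"
    "valF T (PrV T) x \<Longrightarrow> PrV T x"
    "typF T (Pr T C_typeof) (\<lambda>_ _ _. False) x y \<Longrightarrow> Pr T C_typeof x y"
proof -
  have C: "(prog h g \<triangleq> \<^bold>\<top>) \<in> D_transition \<union> D_natural \<union> D_typing \<Longrightarrow>
      provb T (sub (env T a b c d e v t u r) g) \<Longrightarrow> provb T \<langle>sub (env T a b c d e v t u r) h\<rangle>"
    for h g a b c d e v t u r
    using provb_clause[OF T _ is_subst_env[OF T]] unfolding D_PCF_def by blast
  let ?M = "Var ''M'' Ti" and ?M1 = "Var ''M1'' Ti" and ?N = "Var ''N'' Ti"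
    and ?N1 = "Var ''N1'' Ti" and ?N2 = "Var ''N2'' Ti" and ?V = "Var ''V'' Ti"
    and ?T = "Var ''T'' Ti" and ?U = "Var ''U'' Ti" and ?R = "Var ''R'' (Ti \<rightarrow> Ti)"
  show "Pr T C_step x y" if "stepF T (Pr T C_step) (PrV T) x y"
    using that
  proof cases
    case (step_succ a b)
    then show ?thesis
      using C[of "succ' ?M \<leadsto> succ' ?M1" "\<langle>?M \<leadsto> ?M1\<rangle>" a b]
      by (simp add: D_transition_def Let_def provb_simps[OF T] env_simps)
  next
    case step_pred_zero
    then show ?thesis
      using C[of "pred' zero' \<leadsto> zero'" "tt" _]
      by (simp add: D_transition_def Let_def provb_simps[OF T] env_simps)
  next
    case step_pred_succ
    then show ?thesis
      using C[of "pred' (succ' ?V) \<leadsto> ?V" "\<langle>value' ?V\<rangle>" _ _ _ _ _ y]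
      by (simp add: D_transition_def Let_def provb_simps[OF T] env_simps)
  next
    case (step_pred a b)
    then show ?thesis
      using C[of "pred' ?M \<leadsto> pred' ?M1" "\<langle>?M \<leadsto> ?M1\<rangle>" a b]
      by (simp add: D_transition_def Let_def provb_simps[OF T] env_simps)
  next
    case step_is_zero_zero
    then show ?thesis
      using C[of "is_zero' zero' \<leadsto> true'" "tt" _]
      by (simp add: D_transition_def Let_def provb_simps[OF T] env_simps)
  next
    case (step_is_zero_succ v)
    then show ?thesis
      using C[of "is_zero' (succ' ?V) \<leadsto> false'" "\<langle>value' ?V\<rangle>" _ _ _ _ _ v]
      by (simp add: D_transition_def Let_def provb_simps[OF T] env_simps)
  next
    case (step_is_zero a b)
    then show ?thesis
      using C[of "is_zero' ?M \<leadsto> is_zero' ?M1" "\<langle>?M \<leadsto> ?M1\<rangle>" a b]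
      by (simp add: D_transition_def Let_def provb_simps[OF T] env_simps)
  next
    case (step_if_true d)
    then show ?thesis
      using C[of "if' true' ?M ?N \<leadsto> ?M" "tt" y _ d]
      by (simp add: D_transition_def Let_def provb_simps[OF T] env_simps)
  next
    case (step_if_false c)
    then show ?thesis
      using C[of "if' false' ?M ?N \<leadsto> ?N" "tt" c _ y]
      by (simp add: D_transition_def Let_def provb_simps[OF T] env_simps)
  next
    case (step_if a b c d)
    then show ?thesis
      using C[of "if' ?M ?N1 ?N2 \<leadsto> if' ?M1 ?N1 ?N2" "\<langle>?M \<leadsto> ?M1\<rangle>" a b _ c d]
      by (simp add: D_transition_def Let_def provb_simps[OF T] env_simps)
  next
    case (step_beta t r n)
    then show ?thesis
      using C[of "app' (abs' ?T ?R) ?N \<leadsto> (?R \<cdot> ?N)" "tt" _ _ n _ _ _ t _ r]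
      by (simp add: D_transition_def Let_def provb_simps[OF T] env_simps)
  next
    case (step_app a b n)
    then show ?thesis
      using C[of "app' ?M ?N \<leadsto> app' ?M1 ?N" "\<langle>?M \<leadsto> ?M1\<rangle>" a b n]
      by (simp add: D_transition_def Let_def provb_simps[OF T] env_simps)
  next
    case (step_rec t r)
    then show ?thesis
      using C[of "rec' ?T ?R \<leadsto> (?R \<cdot> rec' ?T ?R)" "tt" _ _ _ _ _ _ t _ r]
      by (simp add: D_transition_def Let_def provb_simps[OF T] env_simps)
  qed
  show "Pr T C_steps x y" if "stepsF (Pr T C_step) (Pr T C_steps) x y"
    using that
  proof cases
    case steps_refl
    then show ?thesis
      using C[of "?M \<leadsto>\<^sup>* ?M" "tt" x]
      by (simp add: D_transition_def Let_def provb_simps[OF T] env_simps)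
  next
    case (steps_step w)
    then show ?thesis
      using C[of "?M \<leadsto>\<^sup>* ?N" "\<langle>?M \<leadsto> ?M1\<rangle> \<^bold>& \<langle>?M1 \<leadsto>\<^sup>* ?N\<rangle>" x w y]
      by (simp add: D_transition_def Let_def provb_simps[OF T] env_simps)
  qed
  show "Pr T C_eval x y" if "evalF T (Pr T C_eval) x y"
    using that
  proof cases
    case eval_zero
    then show ?thesis
      using C[of "zero' \<Down> zero'" "tt" _]
      by (simp add: D_natural_def Let_def provb_simps[OF T] env_simps)
  next
    case eval_true
    then show ?thesis
      using C[of "true' \<Down> true'" "tt" _]
      by (simp add: D_natural_def Let_def provb_simps[OF T] env_simps)
  next
    case eval_false
    then show ?thesis
      using C[of "false' \<Down> false'" "tt" _]
      by (simp add: D_natural_def Let_def provb_simps[OF T] env_simps)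
  next
    case (eval_succ a v)
    then show ?thesis
      using C[of "succ' ?M \<Down> succ' ?V" "\<langle>?M \<Down> ?V\<rangle>" a _ _ _ _ v]
      by (simp add: D_natural_def Let_def provb_simps[OF T] env_simps)
  next
    case (eval_pred_zero a)
    then show ?thesis
      using C[of "pred' ?M \<Down> zero'" "\<langle>?M \<Down> zero'\<rangle>" a]
      by (simp add: D_natural_def Let_def provb_simps[OF T] env_simps)
  next
    case (eval_pred_succ a)
    then show ?thesis
      using C[of "pred' ?M \<Down> ?V" "\<langle>?M \<Down> succ' ?V\<rangle>" a _ _ _ _ y]
      by (simp add: D_natural_def Let_def provb_simps[OF T] env_simps)
  next
    case (eval_is_zero_zero a)
    then show ?thesis
      using C[of "is_zero' ?M \<Down> true'" "\<langle>?M \<Down> zero'\<rangle>" a]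
      by (simp add: D_natural_def Let_def provb_simps[OF T] env_simps)
  next
    case (eval_is_zero_succ a v)
    then show ?thesis
      using C[of "is_zero' ?M \<Down> false'" "\<langle>?M \<Down> succ' ?V\<rangle>" a _ _ _ _ v]
      by (simp add: D_natural_def Let_def provb_simps[OF T] env_simps)
  next
    case (eval_if_true a b c)
    then show ?thesis
      using C[of "if' ?M ?N1 ?N2 \<Down> ?V" "\<langle>?M \<Down> true'\<rangle> \<^bold>& \<langle>?N1 \<Down> ?V\<rangle>" a _ _ b c y]
      by (simp add: D_natural_def Let_def provb_simps[OF T] env_simps)
  next
    case (eval_if_false a c b)
    then show ?thesis
      using C[of "if' ?M ?N1 ?N2 \<Down> ?V" "\<langle>?M \<Down> false'\<rangle> \<^bold>& \<langle>?N2 \<Down> ?V\<rangle>" a _ _ b c y]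
      by (simp add: D_natural_def Let_def provb_simps[OF T] env_simps)
  next
    case (eval_abs t r)
    then show ?thesis
      using C[of "abs' ?T ?R \<Down> abs' ?T ?R" "tt" _ _ _ _ _ _ t _ r]
      by (simp add: D_natural_def Let_def provb_simps[OF T] env_simps)
  next
    case (eval_app a t r n)
    then show ?thesis
      using C[of "app' ?M ?N \<Down> ?V" "\<langle>?M \<Down> abs' ?T ?R\<rangle> \<^bold>& \<langle>(?R \<cdot> ?N) \<Down> ?V\<rangle>" a _ n _ _ y t _ r]
      by (simp add: D_natural_def Let_def provb_simps[OF T] env_simps)
  next
    case (eval_rec r t)
    then show ?thesis
      using C[of "rec' ?T ?R \<Down> ?V" "\<langle>(?R \<cdot> rec' ?T ?R) \<Down> ?V\<rangle>" _ _ _ _ _ y t _ r]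
      by (simp add: D_natural_def Let_def provb_simps[OF T] env_simps)
  qed
  show "PrV T x" if "valF T (PrV T) x"
    using that
  proof cases
    case val_zero
    then show ?thesis
      using C[of "value' zero'" "tt" _]
      by (simp add: D_transition_def Let_def provb_simps[OF T] env_simps)
  next
    case val_true
    then show ?thesis
      using C[of "value' true'" "tt" _]
      by (simp add: D_transition_def Let_def provb_simps[OF T] env_simps)
  next
    case val_false
    then show ?thesis
      using C[of "value' false'" "tt" _]
      by (simp add: D_transition_def Let_def provb_simps[OF T] env_simps)
  next
    case (val_succ v)
    then show ?thesis
      using C[of "value' (succ' ?V)" "\<langle>value' ?V\<rangle>" _ _ _ _ _ v]
      by (simp add: D_transition_def Let_def provb_simps[OF T] env_simps)
  next
    case (val_abs t r)
    then show ?thesis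
      using C[of "value' (abs' ?T ?R)" "tt" _ _ _ _ _ _ t _ r]
      by (simp add: D_transition_def Let_def provb_simps[OF T] env_simps)
  qed
  show "Pr T C_typeof x y" if "typF T (Pr T C_typeof) (\<lambda>_ _ _. False) x y"
    using that
  proof cases
    case typ_zero
    then show ?thesis
      using C[of "typeof zero' num'" "tt" _]
      by (simp add: D_typing_def Let_def provb_simps[OF T] env_simps)
  next
    case typ_true
    then show ?thesis
      using C[of "typeof true' bool'" "tt" _]
      by (simp add: D_typing_def Let_def provb_simps[OF T] env_simps)
  next
    case typ_false
    then show ?thesis
      using C[of "typeof false' bool'" "tt" _]
      by (simp add: D_typing_def Let_def provb_simps[OF T] env_simps)
  next
    case (typ_succ a)
    then show ?thesis
      using C[of "typeof (succ' ?M) num'" "\<langle>typeof ?M num'\<rangle>" a]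
      by (simp add: D_typing_def Let_def provb_simps[OF T] env_simps)
  next
    case (typ_pred a)
    then show ?thesis
      using C[of "typeof (pred' ?M) num'" "\<langle>typeof ?M num'\<rangle>" a]
      by (simp add: D_typing_def Let_def provb_simps[OF T] env_simps)
  next
    case (typ_is_zero a)
    then show ?thesis
      using C[of "typeof (is_zero' ?M) bool'" "\<langle>typeof ?M num'\<rangle>" a]
      by (simp add: D_typing_def Let_def provb_simps[OF T] env_simps)
  next
    case (typ_if a b c)
    then show ?thesis
      using C[of "typeof (if' ?M ?N1 ?N2) ?T" "\<langle>typeof ?M bool'\<rangle> \<^bold>& \<langle>typeof ?N1 ?T\<rangle> \<^bold>& \<langle>typeof ?N2 ?T\<rangle>" a _ _ b c _ y]
      by (simp add: D_typing_def Let_def provb_simps[OF T] env_simps)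
  next
    case (typ_app a u n)
    then show ?thesis
      using C[of "typeof (app' ?M ?N) ?T" "\<langle>typeof ?M (arr' ?U ?T)\<rangle> \<^bold>& \<langle>typeof ?N ?U\<rangle>" a _ n _ _ _ y u]
      by (simp add: D_typing_def Let_def provb_simps[OF T] env_simps)
  qed simp_all
qed

section \<open>Induction on object-level derivations\<close>

lemma inst_provable [simp]: "inst k u (\<turnstile> b) = \<turnstile> (inst k u b)"
  by (simp add: provable_def lift_inst_le)

lemma gd_provable [simp]: "gd \<Delta> (\<turnstile> b) \<longleftrightarrow> has_type \<Delta> b Tprp"
  by (auto simp: provable_def)

lemma gd_append: "gd \<Delta> A \<Longrightarrow> gd (\<Delta> @ \<Delta>') A"
proof (induction rule: gd.induct)
  case (gd_atom \<Delta> p ts)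
  show ?case by (intro gd.gd_atom has_type_append) fact
qed simp_all

lemma decides_Pr:
  "binary C \<Longrightarrow> has_type [] a Ti \<Longrightarrow> has_type [] b Ti \<Longrightarrow>
   decides D_all (\<turnstile> \<langle>Con C \<cdot> a \<cdot> b\<rangle>) (\<lambda>T. Pr T C (den T a) (den T b))"
  using decides_provable[of "\<langle>Con C \<cdot> a \<cdot> b\<rangle>"] Pr_iff unfolding decides_def by auto

lemma decides_PrV:
  "has_type [] a Ti \<Longrightarrow> decides D_all (\<turnstile> \<langle>value' a\<rangle>) (\<lambda>T. PrV T (den T a))"
  using decides_provable[of "\<langle>value' a\<rangle>"] PrV_iff unfolding decides_def by auto

lemma decides_equiv:
  "has_type [] a Ti \<Longrightarrow> has_type [] b Ti \<Longrightarrow> decides D_all (a \<^bold>\<equiv> b) (\<lambda>T. den T a = den T b)"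
  using den_eq unfolding decides_def by auto

lemma den_all: "prime T \<Longrightarrow> (\<forall>t. has_type [] t Ti \<longrightarrow> P (den T t)) \<longleftrightarrow> (\<forall>n. P n)"
  using rep by metis

text \<open>Every number is denoted by a term, so an object quantifier over \<open>i\<close> may be
  read as a quantifier over numbers, uniformly in the prime theory.\<close>

lemma forces_all_i:
  assumes "gd [Ti] A" "\<And>t. has_type [] t Ti \<Longrightarrow> forces D_all (inst 0 t A) (\<lambda>T. F T (den T t))"
  shows "forces D_all (All Ti (Lam Ti A)) (\<lambda>T. \<forall>n. F T n)"
proof (rule forces_cong[OF forces_all])
  show "gd [] (All Ti (Lam Ti A))" using assms(1) by simp
qed (use assms den_all in auto)

lemma forces_not: "decides D A F \<Longrightarrow> forces D (A \<^bold>\<supset> \<^bold>\<bottom>) (\<lambda>T. \<not> F T)"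
  using forces_imp[OF _ forces_decides[OF decides_bot]] by fastforce

lemmas forces_rules = forces_not forces_all_i forces_imp forces_and decides_Pr decides_PrV decides_equiv
  decides_bot forces_decides[OF decides_Pr] forces_decides[OF decides_PrV]
  forces_decides[OF decides_equiv] forces_decides[OF decides_bot]

text \<open>The property is proved for all pairs derivable at height \<open>i\<close>, by induction
  on \<open>i\<close>. This needs a formula \<open>A\<close> expressing it, whose indices 1 and 0
  stand for the two arguments, and a step valid in every prime theory; parameters that vary in the
  step are quantified inside \<open>A\<close>.\<close>

lemma At_induct:
  assumes C: "binary C" and A: "gd [Ti, Ti] A"
    and F: "\<And>x y. has_type [] x Ti \<Longrightarrow> has_type [] y Ti \<Longrightarrow>
      forces D_all (inst 0 y (inst (Suc 0) x A)) (\<lambda>T. F T (den T x) (den T y))"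
    and step: "\<And>T i x y. prime T \<Longrightarrow> nat' i \<in> T \<Longrightarrow> (\<And>x y. At T i nil C x y \<Longrightarrow> F T x y) \<Longrightarrow>
      At T (s i) nil C x y \<Longrightarrow> F T x y"
    and T: "prime T" "Pr T C x y"
  shows "F T x y"
proof -
  let ?P = "All Ti (Lam Ti (All Ti (Lam Ti (seq (Bnd 2) nil \<langle>Con C \<cdot> Bnd 1 \<cdot> Bnd 0\<rangle> \<^bold>\<supset> A))))"
  let ?F = "\<lambda>i T. \<forall>x y. At T i nil C x y \<longrightarrow> F T x y"
  from T(2) obtain i where i: "nat' i \<in> T" "At T i nil C x y" by (auto simp: Pr_At)
  have At: "decides D_all (seq i nil \<langle>Con C \<cdot> a \<cdot> b\<rangle>) (\<lambda>T. At T i nil C (den T a) (den T b))"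
    if "has_type [] i Tnt" "has_type [] a Ti" "has_type [] b Ti" for i a b
    using that C At_iff[OF _ C] unfolding decides_def by auto
  have gA: "gd [Ti, Ti, Tnt] A" using gd_append[OF A, of "[Tnt]"] by simp
  have i2: "inst 2 i A = A" for i using inst_has_type[OF gd_has_type[OF A]] by simp
  have "?F i T"
  proof (rule prime_nat_induct[of ?P D_all ?F])
    show "gd [Tnt] ?P" using C gA by (auto simp: numeral_2_eq_2)
    show "forces D_all (inst 0 i ?P) (?F i)" if i: "has_type [] i Tnt" for i
    proof -
      have "gd [Ti] (inst 1 x A)" if "has_type [] x Ti" for x
        using gd_inst[of "[Ti]" Ti A x] A that by simp
      moreover have "con_ok C" "cty C = (Ti \<rightarrow> Ti \<rightarrow> Tatm)" using C by auto
      ultimately show ?thesis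
        using i A i2
        by (auto intro!: forces_all_i forces_imp At F simp: numeral_2_eq_2)
    qed
    show "?F z T" if "prime T" for T using not_At_z[OF that] by blast
    show "?F (s i) T" if "prime T" "nat' i \<in> T" "?F i T" for i T
      using step[OF that(1,2)] that(3) by blast
  qed (use T i prime_typed(4) in auto)
  with i show ?thesis by blast
qed

lemma AtV_induct:
  assumes A: "gd [Ti] A"
    and F: "\<And>x. has_type [] x Ti \<Longrightarrow> forces D_all (inst 0 x A) (\<lambda>T. F T (den T x))"
    and step: "\<And>T i x. prime T \<Longrightarrow> nat' i \<in> T \<Longrightarrow> (\<And>x. AtV T i nil x \<Longrightarrow> F T x) \<Longrightarrow>
      AtV T (s i) nil x \<Longrightarrow> F T x"
    and T: "prime T" "PrV T x"
  shows "F T x"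
proof -
  let ?P = "All Ti (Lam Ti (seq (Bnd 1) nil \<langle>value' (Bnd 0)\<rangle> \<^bold>\<supset> A))"
  let ?F = "\<lambda>i T. \<forall>x. AtV T i nil x \<longrightarrow> F T x"
  from T(2) obtain i where i: "nat' i \<in> T" "AtV T i nil x" by (auto simp: PrV_AtV)
  have At: "decides D_all (seq i nil \<langle>value' a\<rangle>) (\<lambda>T. AtV T i nil (den T a))"
    if "has_type [] i Tnt" "has_type [] a Ti" for i a
    using that AtV_iff unfolding decides_def by auto
  have gA: "gd [Ti, Tnt] A" using gd_append[OF A, of "[Tnt]"] by simp
  have i1: "inst 1 i A = A" for i using inst_has_type[OF gd_has_type[OF A]] by simp
  have "?F i T"
  proof (rule prime_nat_induct[of ?P D_all ?F])
    show "gd [Tnt] ?P" using gA by auto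
    show "forces D_all (inst 0 i ?P) (?F i)" if i: "has_type [] i Tnt" for i
      using i A i1 by (auto intro!: forces_all_i forces_imp At F)
    show "?F z T" if "prime T" for T using not_At_z[OF that] by blast
    show "?F (s i) T" if "prime T" "nat' i \<in> T" "?F i T" for i T
      using step[OF that(1,2)] that(3) by blast
  qed (use T i prime_typed(4) in auto)
  with i show ?thesis by blast
qed

section \<open>Determinacy\<close>

lemma val_intros:
  assumes "prime T"
  shows "PrV T (K T SZero)" "PrV T (K T STrue)" "PrV T (K T SFalse)" "PrV T (K T (SAbs t r))"
    "PrV T v \<Longrightarrow> PrV T (K T (SSucc v))"
  by (auto intro!: Pr_intro(4)[OF assms] valF.intros)

text \<open>Only \<open>succ\<close> has both a value rule and a reduction rule, and there the
  induction hypothesis applies to the argument.\<close>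

theorem val_no_step:
  assumes "prime T" "PrV T x"
  shows "\<not> Pr T C_step x y"
proof -
  have "\<forall>y. Pr T C_step x y \<longrightarrow> False"
    using _ _ _ assms
  proof (rule AtV_induct[where A = "All Ti (Lam Ti (\<turnstile> \<langle>Bnd 1 \<leadsto> Bnd 0\<rangle> \<^bold>\<supset> \<^bold>\<bottom>))"])
    fix T i x assume T: "prime T" "nat' i \<in> T" and IH: "\<And>x. AtV T i nil x \<Longrightarrow> \<forall>y. Pr T C_step x y \<longrightarrow> False"
      and x: "AtV T (s i) nil x"
    show "\<forall>y. Pr T C_step x y \<longrightarrow> False"
    proof (intro allI impI)
      fix y assume "Pr T C_step x y"
      from Pr_inv(1)[OF T(1) this] At_s_inv(4)[OF T x] show False
        by (elim stepF.cases valF.cases; use IH in \<open>auto dest!: K_inj[OF T(1)]\<close>)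
    qed
  qed (auto intro!: forces_rules)
  then show ?thesis by blast
qed

text \<open>Rules overlap only where a computation rule meets a congruence rule; the argument to be
  reduced is then a value and cannot reduce.\<close>

theorem step_determinate:
  assumes "prime T" "Pr T C_step x y" "Pr T C_step x y'"
  shows "y = y'"
proof -
  have "\<forall>y'. Pr T C_step x y' \<longrightarrow> y = y'"
    using _ _ _ _ assms(1,2)
  proof (rule At_induct[where A = "All Ti (Lam Ti (\<turnstile> \<langle>Bnd 2 \<leadsto> Bnd 0\<rangle> \<^bold>\<supset> Bnd 1 \<^bold>\<equiv> Bnd 0))"])
    fix T i x y assume T: "prime T" "nat' i \<in> T"
      and IH: "\<And>x y. At T i nil C_step x y \<Longrightarrow> \<forall>y'. Pr T C_step x y' \<longrightarrow> y = y'"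
      and xy: "At T (s i) nil C_step x y"
    note K = K_inj[OF T(1)]
    note v = val_intros[OF T(1)]
    have n: "\<not> Pr T C_step (K T SZero) w" "\<not> Pr T C_step (K T STrue) w" "\<not> Pr T C_step (K T SFalse) w"
      "\<not> Pr T C_step (K T (SAbs t r)) w" "PrV T v \<Longrightarrow> \<not> Pr T C_step (K T (SSucc v)) w"
      for t r v w by (auto intro!: val_no_step[OF T(1)] v)
    have m: "\<not> At T i nil C_step (K T SZero) w" "\<not> At T i nil C_step (K T STrue) w" "\<not> At T i nil C_step (K T SFalse) w"
      "\<not> At T i nil C_step (K T (SAbs t r)) w" "PrV T v \<Longrightarrow> \<not> At T i nil C_step (K T (SSucc v)) w"
      for t r v w using n At_Pr[OF T(2)] by blast+
    have IH': "At T i nil C_step a b \<Longrightarrow> Pr T C_step a b' \<Longrightarrow> b = b'" for a b b' using IH by blast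
    show "\<forall>y'. Pr T C_step x y' \<longrightarrow> y = y'"
    proof (intro allI impI)
      fix y' assume "Pr T C_step x y'"
      then have y': "stepF T (Pr T C_step) (PrV T) x y'" by (rule Pr_inv(1)[OF T(1)])
      from At_s_inv(1)[OF T xy] show "y = y'"
      proof cases
        \<comment> \<open>The bodies \<open>r\<close> and \<open>r'\<close> agree only pointwise;
          this is enough because the reduct applies the body to the redex, which is the same on both
          sides.\<close>
        case x: (step_rec t r)
        from y' show ?thesis
        proof cases
          case (step_rec t' r')
          with x have "K T (SRec t r) = K T (SRec t' r')" by simp
          with K[OF this] x step_rec show ?thesis by simp
        qed (use x in \<open>auto dest!: K\<close>)
      qed (insert y', auto elim!: stepF.cases dest!: K simp: n m dest: IH')
    qed
  qed (auto intro!: forces_rules simp: numeral_2_eq_2)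
  with assms show ?thesis by blast
qed

lemmas steps_intros = Pr_intro(2)[OF _ steps_refl] Pr_intro(2)[OF _ steps_step]

text \<open>A value does not reduce, so neither sequence can stop before the other, and their single
  steps coincide by \<open>step_determinate\<close>.\<close>

theorem steps_determinate:
  assumes "prime T" "PrV T v1" "Pr T C_steps m v1" "PrV T v2" "Pr T C_steps m v2"
  shows "v1 = v2"
proof -
  have "\<forall>w. PrV T w \<longrightarrow> Pr T C_steps m w \<longrightarrow> PrV T v1 \<longrightarrow> v1 = w"
    using _ _ _ _ assms(1,3)
  proof (rule At_induct[where A = "All Ti (Lam Ti (\<turnstile> \<langle>value' (Bnd 0)\<rangle> \<^bold>\<supset> \<turnstile> \<langle>Bnd 2 \<leadsto>\<^sup>* Bnd 0\<rangle> \<^bold>\<supset> \<turnstile> \<langle>value' (Bnd 1)\<rangle> \<^bold>\<supset> Bnd 1 \<^bold>\<equiv> Bnd 0))"])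
    fix T i x y assume T: "prime T" "nat' i \<in> T"
      and IH: "\<And>x y. At T i nil C_steps x y \<Longrightarrow> \<forall>w. PrV T w \<longrightarrow> Pr T C_steps x w \<longrightarrow> PrV T y \<longrightarrow> y = w"
      and xy: "At T (s i) nil C_steps x y"
    show "\<forall>w. PrV T w \<longrightarrow> Pr T C_steps x w \<longrightarrow> PrV T y \<longrightarrow> y = w"
    proof (intro allI impI)
      fix w assume v: "PrV T y" "PrV T w" and w: "Pr T C_steps x w"
      from At_s_inv(2)[OF T xy] Pr_inv(2)[OF T(1) w] show "y = w"
        by (elim stepsF.cases)
          (use v val_no_step[OF T(1)] step_determinate[OF T(1)] IH in blast)+
    qed
  qed (auto intro!: forces_rules simp: numeral_2_eq_2)
  with assms show ?thesis by blast
qed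

section \<open>Equivalence of the two semantics\<close>

lemma steps_trans:
  assumes "prime T" "Pr T C_steps x y" "Pr T C_steps y w"
  shows "Pr T C_steps x w"
proof -
  have "\<forall>w. Pr T C_steps y w \<longrightarrow> Pr T C_steps x w"
    using _ _ _ _ assms(1,2)
  proof (rule At_induct[where A = "All Ti (Lam Ti (\<turnstile> \<langle>Bnd 1 \<leadsto>\<^sup>* Bnd 0\<rangle> \<^bold>\<supset> \<turnstile> \<langle>Bnd 2 \<leadsto>\<^sup>* Bnd 0\<rangle>))"])
    fix T i x y assume T: "prime T" "nat' i \<in> T"
      and IH: "\<And>x y. At T i nil C_steps x y \<Longrightarrow> \<forall>w. Pr T C_steps y w \<longrightarrow> Pr T C_steps x w"
      and xy: "At T (s i) nil C_steps x y"
    from At_s_inv(2)[OF T xy] show "\<forall>w. Pr T C_steps y w \<longrightarrow> Pr T C_steps x w"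
      by cases (use IH steps_intros(2)[OF T(1)] in blast)+
  qed (auto intro!: forces_rules simp: numeral_2_eq_2)
  with assms show ?thesis by blast
qed

text \<open>An evaluation context is represented by a term of type \<open>i \<rightarrow> i\<close>,
  so one induction serves all congruence rules. Preservation of single steps is assumed in every
  prime theory because the induction ranges over all of them.\<close>

lemma steps_cong:
  assumes f: "\<And>T x y. prime T \<Longrightarrow> Pr T C_step x y \<Longrightarrow> Pr T C_step (ap T f x) (ap T f y)"
    and "prime T" "Pr T C_steps x y"
  shows "Pr T C_steps (ap T f x) (ap T f y)"
  using _ _ _ _ assms(2,3)
proof (rule At_induct[where A = "\<turnstile> \<langle>fn_tm f \<cdot> Bnd 1 \<leadsto>\<^sup>* fn_tm f \<cdot> Bnd 0\<rangle>" and F = "\<lambda>T x y. Pr T C_steps (ap T f x) (ap T f y)"])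
  fix T i x y assume T: "prime T" "nat' i \<in> T"
    and IH: "\<And>x y. At T i nil C_steps x y \<Longrightarrow> Pr T C_steps (ap T f x) (ap T f y)"
    and xy: "At T (s i) nil C_steps x y"
  from At_s_inv(2)[OF T xy] show "Pr T C_steps (ap T f x) (ap T f y)"
    by cases (use IH steps_intros[OF T(1)] f[OF T(1)] in blast)+
next
  fix x y assume ty: "has_type [] x Ti" "has_type [] y Ti"
  let ?C = "\<lambda>T. Pr T C_steps (den T (fn_tm f \<cdot> x)) (den T (fn_tm f \<cdot> y))"
  have "forces D_all (\<turnstile> \<langle>fn_tm f \<cdot> x \<leadsto>\<^sup>* fn_tm f \<cdot> y\<rangle>) ?C"
    using ty by (intro forces_rules) auto
  then show "forces D_all (inst 0 y (inst (Suc 0) x (\<turnstile> \<langle>fn_tm f \<cdot> Bnd 1 \<leadsto>\<^sup>* fn_tm f \<cdot> Bnd 0\<rangle>)))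
     (\<lambda>T. Pr T C_steps (ap T f (den T x)) (ap T f (den T y)))"
    using ty by (auto simp: den_fn_tm elim!: forces_cong)
next
  show "gd [Ti, Ti] (\<turnstile> \<langle>fn_tm f \<cdot> Bnd 1 \<leadsto>\<^sup>* fn_tm f \<cdot> Bnd 0\<rangle>)"
    using has_type_weaken[OF fn_tm, of "[Ti, Ti]"] by simp
qed simp

lemma ap_Lam:
  assumes T: "prime T" and t: "has_type [Ti] t Ti"
  shows "ap T (Fn (Lam Ti t)) n = den T (inst 0 (rep T n) t)"
proof -
  note r = rep[OF T, of n]
  have c: "conv [] (Lam Ti t \<cdot> rep T n) (inst 0 (rep T n) t) Ti" using t r by (intro conv_beta)
  have "Lam Ti t \<cdot> rep T n \<^bold>\<equiv> inst 0 (rep T n) t \<in> T" using equiv_conv[OF T c] .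
  then show ?thesis using t r den_eq[OF T conv_has_type[OF c, THEN conjunct1] conv_has_type[OF c, THEN conjunct2]]
    by (simp add: ap_def)
qed

lemma steps_congs:
  assumes T: "prime T" and *: "Pr T C_steps x y"
  shows "Pr T C_steps (K T (SSucc x)) (K T (SSucc y))"
    "Pr T C_steps (K T (SPred x)) (K T (SPred y))"
    "Pr T C_steps (K T (SIsZero x)) (K T (SIsZero y))"
    "Pr T C_steps (K T (SIf x c d)) (K T (SIf y c d))"
    "Pr T C_steps (K T (SApp x n)) (K T (SApp y n))"
proof -
  note i = Pr_intro(1)
  have "Pr T C_steps (ap T (Fn (Lam Ti (succ' (Bnd 0)))) x) (ap T (Fn (Lam Ti (succ' (Bnd 0)))) y)"
    using _ assms by (rule steps_cong) (simp add: ap_Lam rep den_simps i stepF.intros)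
  then show "Pr T C_steps (K T (SSucc x)) (K T (SSucc y))"
    by (simp add: ap_Lam rep[OF T] den_simps T)
  have "Pr T C_steps (ap T (Fn (Lam Ti (pred' (Bnd 0)))) x) (ap T (Fn (Lam Ti (pred' (Bnd 0)))) y)"
    using _ assms by (rule steps_cong) (simp add: ap_Lam rep den_simps i stepF.intros)
  then show "Pr T C_steps (K T (SPred x)) (K T (SPred y))"
    by (simp add: ap_Lam rep[OF T] den_simps T)
  have "Pr T C_steps (ap T (Fn (Lam Ti (is_zero' (Bnd 0)))) x) (ap T (Fn (Lam Ti (is_zero' (Bnd 0)))) y)"
    using _ assms by (rule steps_cong) (simp add: ap_Lam rep den_simps i stepF.intros)
  then show "Pr T C_steps (K T (SIsZero x)) (K T (SIsZero y))"
    by (simp add: ap_Lam rep[OF T] den_simps T)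
  have c: "has_type \<Delta> (rep T n) Ti" "inst 0 a (rep T n) = rep T n" for n \<Delta> a
    using has_type_weaken[OF rep(1)[OF T]] inst_has_type[OF rep(1)[OF T]] by auto
  \<comment> \<open>The fixed subterms are representatives taken in \<open>T\<close>. They are plain
    terms, so the context makes sense in every other prime theory as well, with the denotation it
    has there.\<close>
  let ?f = "Fn (Lam Ti (if' (Bnd 0) (rep T c) (rep T d)))"
  have "Pr T C_steps (ap T ?f x) (ap T ?f y)"
    using _ assms by (rule steps_cong) (simp add: ap_Lam rep c den_simps i stepF.intros)
  then show "Pr T C_steps (K T (SIf x c d)) (K T (SIf y c d))"
    by (simp add: ap_Lam rep[OF T] c den_simps T)
  let ?f = "Fn (Lam Ti (app' (Bnd 0) (rep T n)))"
  have "Pr T C_steps (ap T ?f x) (ap T ?f y)"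
    using _ assms by (rule steps_cong) (simp add: ap_Lam rep c den_simps i stepF.intros)
  then show "Pr T C_steps (K T (SApp x n)) (K T (SApp y n))"
    by (simp add: ap_Lam rep[OF T] c den_simps T)
qed

text \<open>The two conclusions are proved together: reducing \<open>pred\<close> or
  \<open>is_zero\<close> of \<open>succ v\<close> requires \<open>v\<close> to be a value, which
  comes from the induction hypothesis for the evaluation to \<open>succ v\<close>.\<close>

lemma eval_value_steps:
  assumes "prime T" "Pr T C_eval x y"
  shows "PrV T y \<and> Pr T C_steps x y"
  using _ _ _ _ assms
proof (rule At_induct[where A = "\<turnstile> \<langle>value' (Bnd 0)\<rangle> \<^bold>\<and> \<turnstile> \<langle>Bnd 1 \<leadsto>\<^sup>* Bnd 0\<rangle>"])
  fix T i x y assume T: "prime T" "nat' i \<in> T"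
    and IH: "\<And>x y. At T i nil C_eval x y \<Longrightarrow> PrV T y \<and> Pr T C_steps x y"
    and xy: "At T (s i) nil C_eval x y"
  note step = Pr_intro(1)[OF T(1)] and tr = steps_trans[OF T(1)] and cg = steps_congs[OF T(1)]
    and st = steps_intros[OF T(1)] and v = val_intros[OF T(1)]
  have succ_inv: "PrV T v" if "PrV T (K T (SSucc v))" for v
    using Pr_inv(4)[OF T(1) that] by cases (auto dest!: K_inj[OF T(1)])
  have one: "Pr T C_steps a b" if "stepF T (Pr T C_step) (PrV T) a b" for a b
    using st(2)[OF step[OF that] st(1)] .
  have then_one: "Pr T C_steps a c" if "Pr T C_steps a b" "stepF T (Pr T C_step) (PrV T) b c" for a b c
    using tr[OF that(1) one[OF that(2)]] .
  note IHv = IH[THEN conjunct1] and IHs = IH[THEN conjunct2]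
  from At_s_inv(3)[OF T xy] show "PrV T y \<and> Pr T C_steps x y"
  proof cases
    case (eval_succ a v)
    then show ?thesis using IHv[THEN v(5)] IHs[THEN cg(1)] by simp
  next
    case (eval_pred_zero a)
    then show ?thesis using then_one[OF cg(2)[OF IHs] step_pred_zero] v by simp
  next
    case (eval_pred_succ a)
    then show ?thesis using then_one[OF cg(2)[OF IHs] step_pred_succ] succ_inv[OF IHv] by simp
  next
    case (eval_is_zero_zero a)
    then show ?thesis using then_one[OF cg(3)[OF IHs] step_is_zero_zero] v by simp
  next
    case (eval_is_zero_succ a w)
    then show ?thesis
      using then_one[OF cg(3)[OF IHs] step_is_zero_succ] succ_inv[OF IHv] v by simp
  next
    case (eval_if_true a b c)
    then show ?thesis using IHv tr[OF then_one[OF cg(4)[OF IHs] step_if_true] IHs] by simp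
  next
    case (eval_if_false a c b)
    then show ?thesis using IHv tr[OF then_one[OF cg(4)[OF IHs] step_if_false] IHs] by simp
  next
    case (eval_app a t r n)
    then show ?thesis using IHv tr[OF then_one[OF cg(5)[OF IHs] step_beta] IHs] by simp
  next
    case (eval_rec r t)
    then show ?thesis using IHv tr[OF one[OF step_rec] IHs] by simp
  qed (use st v in auto)
qed (auto intro!: forces_rules simp: numeral_2_eq_2)

lemma value_eval:
  assumes "prime T" "PrV T x"
  shows "Pr T C_eval x x"
  using _ _ _ assms
proof (rule AtV_induct[where A = "\<turnstile> \<langle>Bnd 0 \<Down> Bnd 0\<rangle>"])
  fix T i x assume T: "prime T" "nat' i \<in> T"
    and IH: "\<And>x. AtV T i nil x \<Longrightarrow> Pr T C_eval x x" and x: "AtV T (s i) nil x"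
  from At_s_inv(4)[OF T x] show "Pr T C_eval x x"
    by cases (use IH in \<open>auto intro!: Pr_intro(3)[OF T(1)] intro: evalF.intros\<close>)
qed (auto intro!: forces_rules)

text \<open>The evaluation of the reduct is inverted and rebuilt around the redex; under a
  congruence rule the induction hypothesis transfers the evaluation of the reduced argument.\<close>

lemma step_eval:
  assumes "prime T" "Pr T C_step x y" "Pr T C_eval y v"
  shows "Pr T C_eval x v"
proof -
  have "\<forall>v. Pr T C_eval y v \<longrightarrow> Pr T C_eval x v"
    using _ _ _ _ assms(1,2)
  proof (rule At_induct[where A = "All Ti (Lam Ti (\<turnstile> \<langle>Bnd 1 \<Down> Bnd 0\<rangle> \<^bold>\<supset> \<turnstile> \<langle>Bnd 2 \<Down> Bnd 0\<rangle>))"])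
    fix T i x y assume T: "prime T" "nat' i \<in> T"
      and IH: "\<And>x y. At T i nil C_step x y \<Longrightarrow> \<forall>v. Pr T C_eval y v \<longrightarrow> Pr T C_eval x v"
      and xy: "At T (s i) nil C_step x y"
    note K = K_inj[OF T(1)] and ev = Pr_intro(3)[OF T(1)]
    have IH': "At T i nil C_step a b \<Longrightarrow> Pr T C_eval b w \<Longrightarrow> Pr T C_eval a w" for a b w using IH by blast
    have ee: "Pr T C_eval (K T SZero) (K T SZero)" "Pr T C_eval (K T STrue) (K T STrue)" "Pr T C_eval (K T SFalse) (K T SFalse)"
      "Pr T C_eval (K T (SAbs t r)) (K T (SAbs t r))"
      "Pr T C_eval a b \<Longrightarrow> Pr T C_eval (K T (SSucc a)) (K T (SSucc b))" for a b t r
      by (auto intro!: ev evalF.intros)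
    note ve = value_eval[OF T(1)]
    show "\<forall>v. Pr T C_eval y v \<longrightarrow> Pr T C_eval x v"
    proof (intro allI impI)
      fix v assume "Pr T C_eval y v"
      then have v: "evalF T (Pr T C_eval) y v" "Pr T C_eval y v" using Pr_inv(3)[OF T(1)] by blast+
      from At_s_inv(1)[OF T xy] show "Pr T C_eval x v"
      proof cases
        case (step_succ a b)
        from v(1) show ?thesis unfolding step_succ(2)
          by cases (auto dest!: K simp: step_succ(1) intro: evalF.intros[THEN ev] dest!: IH'[OF step_succ(3)])
      next
        case step_pred_zero
        from v(1) show ?thesis unfolding step_pred_zero(2)
          by cases (auto dest!: K simp: step_pred_zero intro: evalF.intros[THEN ev] ee)
      next
        case step_pred_succ
        then show ?thesis using ee(5)[OF v(2)] by (auto intro: ev evalF.intros)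
      next
        case (step_pred a b)
        from v(1) show ?thesis unfolding step_pred(2)
          by cases (auto dest!: K simp: step_pred(1) intro: evalF.intros[THEN ev] dest!: IH'[OF step_pred(3)])
      next
        case step_is_zero_zero
        from v(1) show ?thesis unfolding step_is_zero_zero(2)
          by cases (auto dest!: K simp: step_is_zero_zero intro: evalF.intros[THEN ev] ee)
      next
        \<comment> \<open>The evaluation rule needs an evaluation of \<open>succ w\<close>; as
          \<open>w\<close> is a value, it evaluates to itself.\<close>
        case (step_is_zero_succ w)
        from v(1) show ?thesis unfolding step_is_zero_succ(2)
          by cases (auto dest!: K simp: step_is_zero_succ(1) intro: evalF.intros[THEN ev] ee(5)[OF ve[OF step_is_zero_succ(3)]])
      next
        case (step_is_zero a b)
        from v(1) show ?thesis unfolding step_is_zero(2)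
          by cases (auto dest!: K simp: step_is_zero(1) intro: evalF.intros[THEN ev] dest!: IH'[OF step_is_zero(3)])
      next
        case (step_if a b c d)
        from v(1) show ?thesis unfolding step_if(2)
          by cases (auto dest!: K simp: step_if(1) intro: evalF.intros[THEN ev] dest!: IH'[OF step_if(3)])
      next
        case (step_app a b n)
        from v(1) show ?thesis unfolding step_app(2)
          by cases (auto dest!: K simp: step_app(1) intro: evalF.intros[THEN ev] dest!: IH'[OF step_app(3)])
      qed (use v(2) ee in \<open>auto intro!: ev intro: evalF.intros\<close>)
    qed
  qed (auto intro!: forces_rules simp: numeral_2_eq_2)
  with assms show ?thesis by blast
qed

lemma steps_eval:
  assumes "prime T" "Pr T C_steps x v" "PrV T v"
  shows "Pr T C_eval x v"
proof -
  have "PrV T v \<longrightarrow> Pr T C_eval x v"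
    using _ _ _ _ assms(1,2)
  proof (rule At_induct[where A = "\<turnstile> \<langle>value' (Bnd 0)\<rangle> \<^bold>\<supset> \<turnstile> \<langle>Bnd 1 \<Down> Bnd 0\<rangle>"])
    fix T i x v assume T: "prime T" "nat' i \<in> T"
      and IH: "\<And>x v. At T i nil C_steps x v \<Longrightarrow> PrV T v \<longrightarrow> Pr T C_eval x v"
      and xv: "At T (s i) nil C_steps x v"
    from At_s_inv(2)[OF T xv] show "PrV T v \<longrightarrow> Pr T C_eval x v"
      by cases (use value_eval[OF T(1)] step_eval[OF T(1)] IH in blast)+
  qed (auto intro!: forces_rules)
  with assms show ?thesis by blast
qed

text \<open>Evaluation leads by reduction to a value, so uniqueness of reachable values decides the
  matter.\<close>

lemma eval_determinate:
  "prime T \<Longrightarrow> Pr T C_eval m v \<Longrightarrow> Pr T C_eval m w \<Longrightarrow> v = w"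
  using eval_value_steps steps_determinate by blast

section \<open>Subject reduction\<close>

text \<open>The substitution property is supplied by \<open>typ_Pr_inv\<close>, which reads a binder
  premise as closure under typed arguments, exactly what beta-reduction and unfolding need.\<close>

lemma step_typ:
  assumes "prime T" "Pr T C_step x y" "Pr T C_typeof x t"
  shows "Pr T C_typeof y t"
proof -
  have "\<forall>t. Pr T C_typeof x t \<longrightarrow> Pr T C_typeof y t"
    using _ _ _ _ assms(1,2)
  proof (rule At_induct[where A = "All Ti (Lam Ti (\<turnstile> \<langle>typeof (Bnd 2) (Bnd 0)\<rangle> \<^bold>\<supset> \<turnstile> \<langle>typeof (Bnd 1) (Bnd 0)\<rangle>))"])
    fix T i x y assume T: "prime T" "nat' i \<in> T"
      and IH: "\<And>x y. At T i nil C_step x y \<Longrightarrow> \<forall>t. Pr T C_typeof x t \<longrightarrow> Pr T C_typeof y t"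
      and xy: "At T (s i) nil C_step x y"
    note K = K_inj[OF T(1)] and ty = Pr_intro(5)[OF T(1)] and inv = typ_Pr_inv[OF T(1)]
    have IH': "At T i nil C_step a b \<Longrightarrow> Pr T C_typeof a t \<Longrightarrow> Pr T C_typeof b t" for a b t using IH by blast
    show "\<forall>t. Pr T C_typeof x t \<longrightarrow> Pr T C_typeof y t"
    proof (intro allI impI)
      fix t assume "Pr T C_typeof x t"
      from inv[OF this] have t: "typF T (Pr T C_typeof) (\<lambda>t r u. \<forall>n. Pr T C_typeof n t \<longrightarrow> Pr T C_typeof (ap T r n) u) x t" .
      have succ_inv: "Pr T C_typeof a (K T SNum) \<and> u = K T SNum" if "Pr T C_typeof (K T (SSucc a)) u" for a u
        using inv[OF that] by cases (auto dest!: K)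
      have abs_inv: "\<forall>n. Pr T C_typeof n u \<longrightarrow> Pr T C_typeof (ap T r n) v" if "Pr T C_typeof (K T (SAbs w r)) (K T (SArr u v))" for w r u v
        using inv[OF that] by cases (auto dest!: K)
      have c: "Pr T C_typeof (K T SZero) (K T SNum)" "Pr T C_typeof (K T STrue) (K T SBool)" "Pr T C_typeof (K T SFalse) (K T SBool)"
        by (auto intro!: ty typF.intros)
      from At_s_inv(1)[OF T xy] show "Pr T C_typeof y t"
      proof cases
        case (step_rec u r)
        \<comment> \<open>Unfolding puts the recursive term in place of its bound variable, so its
          own typing is the argument for the body premise.\<close>
        have "Pr T C_typeof (K T (SRec u r)) t" using \<open>Pr T C_typeof x t\<close> step_rec by simp
        with t show ?thesis unfolding step_rec
          by cases (auto dest!: K)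
      next
        case (step_beta w r n)
        from t show ?thesis unfolding step_beta
          by cases (auto dest!: K abs_inv)
      next
        case (step_if a b c d)
        from t show ?thesis unfolding step_if
          by cases (auto dest!: K intro: typF.intros[THEN ty] dest!: IH'[OF step_if(3)])
      next
        case (step_app a b n)
        from t show ?thesis unfolding step_app
          by cases (auto dest!: K intro: typF.intros[THEN ty] dest!: IH'[OF step_app(3)])
      qed (insert t, auto elim!: typF.cases dest!: K dest: succ_inv IH' intro!: c intro: typF.intros[THEN ty])
    qed
  qed (auto intro!: forces_rules simp: numeral_2_eq_2)
  with assms show ?thesis by blast
qed

lemma steps_typ:
  assumes "prime T" "Pr T C_steps x y" "Pr T C_typeof x t"
  shows "Pr T C_typeof y t"
proof -
  have "\<forall>t. Pr T C_typeof x t \<longrightarrow> Pr T C_typeof y t"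
    using _ _ _ _ assms(1,2)
  proof (rule At_induct[where A = "All Ti (Lam Ti (\<turnstile> \<langle>typeof (Bnd 2) (Bnd 0)\<rangle> \<^bold>\<supset> \<turnstile> \<langle>typeof (Bnd 1) (Bnd 0)\<rangle>))"])
    fix T i x y assume T: "prime T" "nat' i \<in> T"
      and IH: "\<And>x y. At T i nil C_steps x y \<Longrightarrow> \<forall>t. Pr T C_typeof x t \<longrightarrow> Pr T C_typeof y t"
      and xy: "At T (s i) nil C_steps x y"
    from At_s_inv(2)[OF T xy] show "\<forall>t. Pr T C_typeof x t \<longrightarrow> Pr T C_typeof y t"
      by cases (use step_typ[OF T(1)] IH in blast)+
  qed (auto intro!: forces_rules simp: numeral_2_eq_2)
  with assms show ?thesis by blast
qed

lemma eval_typ: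
  "prime T \<Longrightarrow> Pr T C_eval x y \<Longrightarrow> Pr T C_typeof x t \<Longrightarrow> Pr T C_typeof y t"
  using eval_value_steps steps_typ by blast

section \<open>Unicity of typing\<close>

lemma decides_At:
  "binary C \<Longrightarrow> has_type [] i Tnt \<Longrightarrow> has_type [] L Tatmlst \<Longrightarrow> has_type [] a Ti \<Longrightarrow> has_type [] b Ti \<Longrightarrow>
   decides D_all (seq i L \<langle>Con C \<cdot> a \<cdot> b\<rangle>) (\<lambda>T. At T i L C (den T a) (den T b))"
  using At_iff unfolding decides_def by auto

text \<open>To compare two typings of an abstraction, its bound variable is replaced by a closed term with
  a unique type: \<open>rec T (\<lambda>x. x)\<close> has only the type \<open>T\<close>.\<close>

abbreviation loop :: "tm \<Rightarrow> tm" where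
  "loop t \<equiv> rec' t (Lam Ti (Bnd 0))"

text \<open>The invariant of the hypothesis lists met in the proof of unicity. It is a formula,
  since it occurs as an antecedent in the induction.\<close>

abbreviation good :: "tm \<Rightarrow> tm" where
  "good L \<equiv> All Ti (Lam Ti (All Ti (Lam Ti
     (element (typeof (Bnd 1) (Bnd 0)) L \<^bold>\<supset> Bnd 1 \<^bold>\<equiv> loop (Bnd 0)))))"

lemma den_loop: "prime T \<Longrightarrow> has_type [] t Ti \<Longrightarrow> den T (loop t) = K T (SRec (den T t) (Fn (Lam Ti (Bnd 0))))"
  by (simp add: den_simps)

lemma forces_good:
  assumes "has_type [] L Tatmlst"
  shows "forces D_all (good L) (\<lambda>T. \<forall>x. has_type [] x Ti \<longrightarrow> (\<forall>t. has_type [] t Ti \<longrightarrow>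
    element (typeof x t) L \<in> T \<longrightarrow> x \<^bold>\<equiv> loop t \<in> T))"
  using assms has_type_weaken[OF assms]
  by (auto intro!: forces_all forces_imp decides_mem forces_self)

text \<open>Typing the body of a binder annotated with \<open>a\<close> adds a hypothesis on its
  variable; instantiating the variable by \<open>loop a\<close> gives the hypothesis exactly the
  allowed form.\<close>

lemma good_Cons:
  assumes T: "prime T" "good L \<in> T" and ty: "has_type [] a Ti" "has_type [] L Tatmlst"
  shows "good (typeof (loop a) a \<^bold># L) \<in> T"
proof (rule forces_mem[OF forces_good T(1), where S = "{good L}"])
  fix T' assume T': "prime T'" "{good L} \<subseteq> T'"
  show "\<forall>x. has_type [] x Ti \<longrightarrow> (\<forall>t. has_type [] t Ti \<longrightarrow>
    element (typeof x t) (typeof (loop a) a \<^bold># L) \<in> T' \<longrightarrow> x \<^bold>\<equiv> loop t \<in> T')"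
  proof (intro allI impI)
    fix x t assume xt: "has_type [] x Ti" "has_type [] t Ti"
      and e: "element (typeof x t) (typeof (loop a) a \<^bold># L) \<in> T'"
    show "x \<^bold>\<equiv> loop t \<in> T'"
    proof (rule element_elim[OF T'(1) e, where S = "{good L}"])
      fix \<theta> T2 L0 assume \<theta>: "is_subst \<theta>" "prime T2" "sub \<theta> ` {good L} \<subseteq> T2"
      note st = sub_has_type[OF \<theta>(1), of "[]"]
      {
        assume c: "conv [] (sub \<theta> (typeof (loop a) a \<^bold># L)) (sub \<theta> (typeof x t) \<^bold># L0) Tatmlst"
        then have c: "conv [] (loop (sub \<theta> a)) (sub \<theta> x) Ti" "conv [] (sub \<theta> a) (sub \<theta> t) Ti"
          by (auto simp: conv_rigid)
        have "conv [] (loop (sub \<theta> a)) (loop (sub \<theta> t)) Ti"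
          using c(2) by (auto simp: conv_rigid intro: conv_refl)
        with conv_sym[OF c(1)] have "conv [] (sub \<theta> x) (loop (sub \<theta> t)) Ti" by (rule conv_trans)
        then show "sub \<theta> (x \<^bold>\<equiv> loop t) \<in> T2" using \<theta> by (simp add: equiv_conv)
      next
        fix Y assume c: "conv [] (sub \<theta> (typeof (loop a) a \<^bold># L)) (Y \<^bold># L0) Tatmlst"
          and e: "element (sub \<theta> (typeof x t)) L0 \<in> T2"
        from c have "conv [] L0 (sub \<theta> L) Tatmlst" by (auto simp: conv_rigid intro: conv_sym)
        from prime_element_conv[OF \<theta>(2) e conv_refl this]
        have "element (typeof (sub \<theta> x) (sub \<theta> t)) (sub \<theta> L) \<in> T2" using st xt by simp
        moreover have "good (sub \<theta> L) \<in> T2" using \<theta> by simp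
        ultimately show "sub \<theta> (x \<^bold>\<equiv> loop t) \<in> T2"
          using forcesD[OF forces_good \<theta>(2), of "sub \<theta> L"] st xt ty by simp
      }
    qed (use T' xt in auto)
  qed
qed (use T ty in auto)

lemma good_At:
  assumes T: "prime T" and g: "good L \<in> T" "has_type [] L Tatmlst"
    and e: "element (typeof (rep T x) (rep T t)) L \<in> T"
  shows "x = K T (SRec t (Fn (Lam Ti (Bnd 0))))"
proof -
  note r = rep[OF T]
  have "rep T x \<^bold>\<equiv> loop (rep T t) \<in> T"
    using forcesD[OF forces_good[OF g(2)] T g(1)] e r by blast
  then have "den T (rep T x) = den T (loop (rep T t))" using den_eq[OF T, of "rep T x" "loop (rep T t)"] r by simp
  then show ?thesis using r den_loop[OF T] by simp
qed

lemma At_typ_inv: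
  assumes T: "prime T" "nat' k \<in> T" "good L \<in> T" "has_type [] L Tatmlst" "At T k L C_typeof x t"
  shows "x = K T (SRec t (Fn (Lam Ti (Bnd 0)))) \<or>
    (\<exists>j. nat' j \<in> T \<and> typF T (At T j L C_typeof) (tyB T j L) x t)"
  using seq_obj_inv[OF T(1,2)] T(5) good_At[OF T(1,3,4)] typ_inv[OF T(1)] rep[OF T(1)]
  unfolding At_def by metis

lemma At_typ_s_inv:
  assumes T: "prime T" "nat' i \<in> T" "good L \<in> T" "has_type [] L Tatmlst" "At T (s i) L C_typeof x t"
  shows "x = K T (SRec t (Fn (Lam Ti (Bnd 0)))) \<or> typF T (At T i L C_typeof) (tyB T i L) x t"
  using seq_obj_inv_s[OF T(1)] T(5) good_At[OF T(1,3,4)] typ_inv[OF T(1,2)] rep[OF T(1)]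
  unfolding At_def by metis

text \<open>A typing of a recursion comes from its clause or, by \<open>good\<close>, from a
  hypothesis about a \<open>loop\<close>; both assign the annotation as the type.\<close>

lemma At_typ_rec:
  assumes T: "prime T" "nat' k \<in> T" "good L \<in> T" "has_type [] L Tatmlst"
    "At T k L C_typeof (K T (SRec t f)) u"
  shows "u = t"
  using At_typ_inv[OF T] by (auto elim!: typF.cases dest!: K_inj[OF T(1)])

lemma tyB_loop:
  assumes T: "prime T" and "tyB T i L t r u" and ty: "has_type [] i Tnt" "has_type [] L Tatmlst"
  shows "At T i (typeof (loop (rep T t)) (rep T t) \<^bold># L) C_typeof (ap T r (den T (loop (rep T t)))) u"
proof -
  note r = rep[OF T]
  have "seq i (typeof (loop (rep T t)) (rep T t) \<^bold># L) \<langle>typeof (fn_tm r \<cdot> loop (rep T t)) (rep T u)\<rangle> \<in> T"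
    using assms(2) r unfolding tyB_def by simp
  then show ?thesis
    using At_iff[OF T, of C_typeof "fn_tm r \<cdot> loop (rep T t)" "rep T u"] den_fn_tm[OF T, of "loop (rep T t)" r] r
    by simp
qed

text \<open>Induction on the height of the first typing, with the second at an arbitrary height. The
  list varies because bodies of abstractions are typed under a new hypothesis; hence
  \<open>At_induct\<close>, with its empty list, does not apply.\<close>

lemma At_typ_unique:
  assumes "prime T" "nat' i \<in> T" "good L \<in> T" "has_type [] L Tatmlst" "At T i L C_typeof x t"
    "nat' k \<in> T" "At T k L C_typeof x u"
  shows "t = u"
proof -
  let ?P = "All Tatmlst (Lam Tatmlst (good (Bnd 2) \<^bold>\<supset>
    All Tnt (Lam Tnt (nat' (Bnd 0) \<^bold>\<supset>
    All Ti (Lam Ti (All Ti (Lam Ti (seq (Bnd 4) (Bnd 3) \<langle>typeof (Bnd 1) (Bnd 0)\<rangle> \<^bold>\<supset>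
    All Ti (Lam Ti (seq (Bnd 3) (Bnd 4) \<langle>typeof (Bnd 2) (Bnd 0)\<rangle> \<^bold>\<supset> Bnd 1 \<^bold>\<equiv> Bnd 0))))))))))"
  let ?F = "\<lambda>i T. \<forall>L. has_type [] L Tatmlst \<longrightarrow> good L \<in> T \<longrightarrow>
    (\<forall>k. has_type [] k Tnt \<longrightarrow> nat' k \<in> T \<longrightarrow>
    (\<forall>x t. At T i L C_typeof x t \<longrightarrow> (\<forall>u. At T k L C_typeof x u \<longrightarrow> t = u)))"
  have "?F i T"
  proof (rule prime_nat_induct[of ?P D_all ?F])
    show "gd [Tnt] ?P" by simp
    show "forces D_all (inst 0 i ?P) (?F i)" if i: "has_type [] i Tnt" for i
      using i
      by (auto intro!: forces_all forces_all_i forces_imp decides_mem decides_At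
          forces_decides[OF decides_equiv] simp: numeral_2_eq_2 numeral_3_eq_3)
    show "?F z T" if T: "prime T" for T
    proof (intro allI impI)
      fix L k x t u assume L: "has_type [] L Tatmlst" "good L \<in> T" and k: "nat' k \<in> T"
        and xt: "At T z L C_typeof x t" and xu: "At T k L C_typeof x u"
      from seq_z[OF T xt[unfolded At_def]] have "x = K T (SRec t (Fn (Lam Ti (Bnd 0))))"
        by (rule good_At[OF T L(2,1)])
      with At_typ_rec[OF T k L(2,1)] xu show "t = u" by blast
    qed
    show "?F (s i) T" if T: "prime T" and ti: "has_type [] i Tnt" and i: "nat' i \<in> T" and "?F i T" for i T
    proof (intro allI impI)
      fix L k x t u assume L: "has_type [] L Tatmlst" "good L \<in> T" and k: "nat' k \<in> T"
        and xt: "At T (s i) L C_typeof x t" and xu: "At T k L C_typeof x u"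
      note K = K_inj[OF T] and r = rep[OF T]
      have IH: "t = u" if "has_type [] L Tatmlst" "good L \<in> T" "nat' k \<in> T" "At T i L C_typeof x t"
        "At T k L C_typeof x u" for L k x t u
        using \<open>?F i T\<close> that prime_typed(4)[OF T that(3)] by blast
      from At_typ_inv[OF T k L(2,1) xu] show "t = u"
      proof (elim disjE exE conjE)
        assume x: "x = K T (SRec u (Fn (Lam Ti (Bnd 0))))"
        have "nat' (s i) \<in> T" using prime_nat_s[OF T i] .
        with At_typ_rec[OF T this L(2,1)] xt x show ?thesis by blast
      next
        fix j assume j: "nat' j \<in> T" and xu': "typF T (At T j L C_typeof) (tyB T j L) x u"
        note tj = prime_typed(4)[OF T j]
        from At_typ_s_inv[OF T i L(2,1) xt] show ?thesis
        proof (elim disjE)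
          assume x: "x = K T (SRec t (Fn (Lam Ti (Bnd 0))))"
          with At_typ_rec[OF T k L(2,1)] xu show ?thesis by blast
        next
          assume "typF T (At T i L C_typeof) (tyB T i L) x t"
          then show ?thesis
          proof cases
            case abs: (typ_abs a f b)
            from xu' show ?thesis unfolding abs(1)
            proof cases
              case (typ_abs a' f' b')
              from K[OF this(1)] have *: "a' = a" "\<And>n. ap T f' n = ap T f n" by auto
              \<comment> \<open>Both typings annotate the bound variable with \<open>a\<close>, so
                the same term instantiates both bodies and both receive the same new
                hypothesis.\<close>
              let ?L = "typeof (loop (rep T a)) (rep T a) \<^bold># L"
              have "At T i ?L C_typeof (ap T f (den T (loop (rep T a)))) b"
                using tyB_loop[OF T abs(3) ti L(1)] .
              moreover have "At T j ?L C_typeof (ap T f (den T (loop (rep T a)))) b'"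
                using tyB_loop[OF T typ_abs(3) tj L(1)] * by simp
              moreover have "good ?L \<in> T" using good_Cons[OF T L(2) r(1) L(1)] .
              ultimately have "b = b'" using IH[of ?L j] L j r by simp
              then show ?thesis using typ_abs abs * by simp
            qed (auto dest!: K)
          next
            case (typ_if a b c)
            from xu' show ?thesis unfolding typ_if(1)
              by cases (auto dest!: K IH[OF L j typ_if(3)])
          next
            case (typ_app a v n)
            from xu' show ?thesis unfolding typ_app(1)
              by cases (auto dest!: K IH[OF L j typ_app(2)])
          qed (use xu' in \<open>auto elim!: typF.cases dest!: K\<close>)
        qed
      qed
    qed
  qed (use assms prime_typed(4) in auto)
  with assms prime_typed(4) show ?thesis by blast
qed

theorem typ_unique:
  assumes T: "prime T" "Pr T C_typeof x t" "Pr T C_typeof x u"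
  shows "t = u"
proof -
  have "good nil \<in> T"
    by (rule forces_mem[OF forces_good T(1), where S = "{}"]) (auto simp: element_nil)
  then show ?thesis using T At_typ_unique[OF T(1)] unfolding Pr_At by fastforce
qed

section \<open>The theorem\<close>

lemma bind_lift_0: "bind (Suc k) x \<tau> (lift j b) = lift j (bind k x \<tau> b)" if "j \<le> k"
  using that by (induction b arbitrary: j k) auto

lemma bind_provable [simp]: "bind k x \<tau> (\<turnstile> b) = \<turnstile> (bind k x \<tau> b)"
  by (simp add: provable_def bind_lift_0)

lemma derivable_D_all:
  assumes "forces D_all A F" "\<And>T. prime T \<Longrightarrow> F T"
  shows "derivable D_all A"
  using forces_derives[OF assms] gd_formula assms(1) is_definition_D_all
  unfolding derivable_def forces_def by blast

theorem theorem8p2: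
  shows
  "let m = Var ''m'' Ti; m1 = Var ''m1'' Ti; m2 = Var ''m2'' Ti; n = Var ''n'' Ti;
       v = Var ''v'' Ti; v1 = Var ''v1'' Ti; v2 = Var ''v2'' Ti;
       t = Var ''t'' Ti; t1 = Var ''t1'' Ti; t2 = Var ''t2'' Ti in
   \<comment> \<open>determinacy\<close>
   derivable D_all
     (all ''m'' Ti (all ''m1'' Ti (all ''m2'' Ti
       (\<turnstile> \<langle>m \<Down> m1\<rangle> \<^bold>\<supset> \<turnstile> \<langle>m \<Down> m2\<rangle> \<^bold>\<supset> m1 \<^bold>\<equiv> m2)))) \<and>
   derivable D_all
     (all ''m'' Ti (all ''m1'' Ti (all ''m2'' Ti
       (\<turnstile> \<langle>m \<leadsto> m1\<rangle> \<^bold>\<supset> \<turnstile> \<langle>m \<leadsto> m2\<rangle> \<^bold>\<supset> m1 \<^bold>\<equiv> m2)))) \<and>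
   derivable D_all
     (all ''m'' Ti (all ''v1'' Ti (all ''v2'' Ti
       (\<turnstile> \<langle>value' v1\<rangle> \<^bold>\<supset> \<turnstile> \<langle>m \<leadsto>\<^sup>* v1\<rangle> \<^bold>\<supset>
        \<turnstile> \<langle>value' v2\<rangle> \<^bold>\<supset> \<turnstile> \<langle>m \<leadsto>\<^sup>* v2\<rangle> \<^bold>\<supset> v1 \<^bold>\<equiv> v2)))) \<and>
   \<comment> \<open>equivalence\<close>
   derivable D_all
     (all ''m'' Ti (all ''v'' Ti
       (\<turnstile> \<langle>m \<Down> v\<rangle> \<^bold>\<supset> (\<turnstile> \<langle>value' v\<rangle> \<^bold>\<and> \<turnstile> \<langle>m \<leadsto>\<^sup>* v\<rangle>)))) \<and>
   derivable D_all
     (all ''m'' Ti (all ''v'' Ti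
       ((\<turnstile> \<langle>value' v\<rangle> \<^bold>\<and> \<turnstile> \<langle>m \<leadsto>\<^sup>* v\<rangle>) \<^bold>\<supset> \<turnstile> \<langle>m \<Down> v\<rangle>))) \<and>
   \<comment> \<open>subject reduction\<close>
   (\<forall>R \<in> {C_eval, C_step, C_steps}.
     derivable D_all
       (all ''m'' Ti (all ''n'' Ti
         (\<turnstile> \<langle>Con R \<cdot> m \<cdot> n\<rangle> \<^bold>\<supset>
          all ''t'' Ti (\<turnstile> \<langle>typeof m t\<rangle> \<^bold>\<supset> \<turnstile> \<langle>typeof n t\<rangle>))))) \<and>
   \<comment> \<open>unicity of typing\<close>
   derivable D_all
     (all ''m'' Ti (all ''t1'' Ti (all ''t2'' Ti
       (\<turnstile> \<langle>typeof m t1\<rangle> \<^bold>\<supset> \<turnstile> \<langle>typeof m t2\<rangle> \<^bold>\<supset> t1 \<^bold>\<equiv> t2))))"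
proof -
  \<comment> \<open>The bound names of the statement turn into indices; the schematic
    \<open>C\<close> covers evaluation, transition and typing, whose uniqueness statements have the
    same form.\<close>
  have det: "derivable D_all (All Ti (Lam Ti (All Ti (Lam Ti (All Ti (Lam Ti
      (\<turnstile> \<langle>Con C \<cdot> Bnd 2 \<cdot> Bnd 1\<rangle> \<^bold>\<supset> \<turnstile> \<langle>Con C \<cdot> Bnd 2 \<cdot> Bnd 0\<rangle> \<^bold>\<supset> Bnd 1 \<^bold>\<equiv> Bnd 0)))))))"
    if "binary C" "\<And>T m a b. prime T \<Longrightarrow> Pr T C m a \<Longrightarrow> Pr T C m b \<Longrightarrow> a = b" for C
    by (rule derivable_D_all[where F = "\<lambda>T. \<forall>m a b. Pr T C m a \<longrightarrow> Pr T C m b \<longrightarrow> a = b"])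
      (use that in \<open>auto intro!: forces_rules simp: numeral_2_eq_2 simp del: all_simps\<close>)
  have steps: "derivable D_all (All Ti (Lam Ti (All Ti (Lam Ti (All Ti (Lam Ti
      (\<turnstile> \<langle>value' (Bnd 1)\<rangle> \<^bold>\<supset> \<turnstile> \<langle>Bnd 2 \<leadsto>\<^sup>* Bnd 1\<rangle> \<^bold>\<supset>
       \<turnstile> \<langle>value' (Bnd 0)\<rangle> \<^bold>\<supset> \<turnstile> \<langle>Bnd 2 \<leadsto>\<^sup>* Bnd 0\<rangle> \<^bold>\<supset> Bnd 1 \<^bold>\<equiv> Bnd 0)))))))"
    by (rule derivable_D_all[where F = "\<lambda>T. \<forall>m. \<forall>v w. PrV T v \<longrightarrow> Pr T C_steps m v \<longrightarrow> PrV T w \<longrightarrow> Pr T C_steps m w \<longrightarrow> v = w"])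
      (auto intro!: forces_rules dest: steps_determinate simp: numeral_2_eq_2 simp del: all_simps)
  have ev: "derivable D_all (All Ti (Lam Ti (All Ti (Lam Ti
      (\<turnstile> \<langle>Bnd 1 \<Down> Bnd 0\<rangle> \<^bold>\<supset> \<turnstile> \<langle>value' (Bnd 0)\<rangle> \<^bold>\<and> \<turnstile> \<langle>Bnd 1 \<leadsto>\<^sup>* Bnd 0\<rangle>)))))"
    by (rule derivable_D_all[where F = "\<lambda>T. \<forall>m v. Pr T C_eval m v \<longrightarrow> PrV T v \<and> Pr T C_steps m v"])
      (auto intro!: forces_rules dest: eval_value_steps)
  have ve: "derivable D_all (All Ti (Lam Ti (All Ti (Lam Ti
      (\<turnstile> \<langle>value' (Bnd 0)\<rangle> \<^bold>\<and> \<turnstile> \<langle>Bnd 1 \<leadsto>\<^sup>* Bnd 0\<rangle> \<^bold>\<supset> \<turnstile> \<langle>Bnd 1 \<Down> Bnd 0\<rangle>)))))"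
    by (rule derivable_D_all[where F = "\<lambda>T. \<forall>m v. PrV T v \<and> Pr T C_steps m v \<longrightarrow> Pr T C_eval m v"])
      (auto intro!: forces_all_i forces_imp decides_and forces_rules dest: steps_eval simp del: imp_conjL)
  have sr: "derivable D_all (All Ti (Lam Ti (All Ti (Lam Ti (\<turnstile> \<langle>Con C \<cdot> Bnd 1 \<cdot> Bnd 0\<rangle> \<^bold>\<supset>
      All Ti (Lam Ti (\<turnstile> \<langle>typeof (Bnd 2) (Bnd 0)\<rangle> \<^bold>\<supset> \<turnstile> \<langle>typeof (Bnd 1) (Bnd 0)\<rangle>)))))))"
    if "binary C" "\<And>T m n t. prime T \<Longrightarrow> Pr T C m n \<Longrightarrow> Pr T C_typeof m t \<Longrightarrow> Pr T C_typeof n t" for C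
    by (rule derivable_D_all[where F = "\<lambda>T. \<forall>m n. Pr T C m n \<longrightarrow> (\<forall>t. Pr T C_typeof m t \<longrightarrow> Pr T C_typeof n t)"])
      (use that in \<open>auto intro!: forces_rules simp: numeral_2_eq_2\<close>)
  show ?thesis
    using det[of C_eval] det[of C_step] steps ev ve sr[of C_eval] sr[of C_step] sr[of C_steps] det[of C_typeof]
    by (simp add: Let_def numeral_2_eq_2 eval_determinate step_determinate typ_unique eval_typ step_typ steps_typ)
qed

end
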